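(* Let $S_\varepsilon$ be a generic $1$-parameter family of smooth surfaces in $\mathbb{RP}^3$ (or $\mathbb{R}^3$). If $S_0$ has a point $q$ at which the parabolic curve $P$ has a Morse singularity, with a unique asymptotic direction which is in general position (transverse to the branches of $P$), then the flecnodal curve has an $A_3$ transition at $q$. There are four cases: (a) $q$ is an isolated parabolic point inside a hyperbolic region. An elliptic island is born or disappears. (b) and (c) $q$ is a crossing of two branches of $P$ at which the asymptotic line is pointing, respectively, to the hyperbolic sectors and to the elliptic sectors. Two locally disjoint hyperbolic (resp. elliptic) regions merge, while an elliptic (resp. hyperbolic) region is separated into two locally disjoint regions. (d) $q$ is an isolated parabolic point inside an elliptic region. A hyperbolic island is born or disappears. In the four cases, two godrons are born or die, and in the "surface-time" $3$-space $\{S_\varepsilon\times\{\varepsilon\}\}$ the flecnodal curves of the surfaces $S_\varepsilon$ form a Whitney umbrella whose self-intersection line consists of hyperbonodes and whose handle consists of ellipnodes. The section $\varepsilon=0$ is tangent to the umbrella at its pinch-point, giving an $A_3$ curve singularity.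
   Context: All maps are smooth and the family depends smoothly on $\varepsilon$; "generic" has its usual meaning in singularity theory. The elliptic (hyperbolic) domain of a surface is the open set where the Gaussian curvature is positive (negative) in an affine chart; the parabolic curve $P$ is where it vanishes; in Monge form $z=f(x,y)$, $P$ is $f_{xx}f_{yy}-f_{xy}^2=0$, and a Morse singularity of $P$ is a Morse critical point, with value $0$, of this function. Asymptotic lines are tangent lines having at least 3-point contact with the surface. The flecnodal curve $F$ consists of the points at which some asymptotic line has at least 4-point contact with the surface. A godron is a parabolic point at which the unique asymptotic direction is tangent to $P$. At hyperbolic points one asymptotic line is left and the other right (the tangent plane of the surface along the corresponding asymptotic curve twists negatively or positively for a fixed orientation of the space), and the left (right) flecnodal curve consists of the points where the left (right) asymptotic line has at least 4-point contact. A hyperbonode is a point of transverse intersection of the left and right branches of $F$. An ellipnode is a real point of the elliptic domain which is a simple intersection point of the two complex conjugate flecnodal curves associated to the two complex conjugate asymptotic lines. In Monge form $z=f_2+f_3+\cdots$ (with $f_j$ homogeneous of degree $j$), a hyperbonode or ellipnode is a point where $f_2$ divides $f_3$. A Whitney umbrella is a germ of surface in 3-space diffeomorphic to $x^2=zy^2$ at the origin (the pinch-point); its self-intersection line is $\{x=y=0,z>0\}$ and its handle is $\{x=y=0,z<0\}$. At the pinch-point, the single tangent line is the image of the differential of the parametrisation $(u,v)\mapsto(uv,v,u^2)$ (the $y$-axis); a plane is tangent to the umbrella at the pinch-point if it contains the single tangent line. An $A_3$ transition is one equivalent to the isochronal sections $\varepsilon=\mathrm{const}$ of $y^2=\varepsilon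 x^2+\alpha x^4$ with $\alpha\neq0$ (elliptic if $\alpha>0$, hyperbolic if $\alpha<0$), up to the sign of $\varepsilon$. Two families of plane curves with a local transition at $q$ for parameter $0$ are equivalent if there is a local diffeomorphism (or homeomorphism) of $\mathbb{R}^2\times\mathbb{R}$ near $(q,0)$ sending isochronal sections diffeomorphically to isochronal sections. An $A_3$ curve singularity is one diffeomorphic to $y^2=\pm x^4$. *)

theory Defs
  imports "HOL-Analysis.Analysis"
begin

section \<open>Smooth maps\<close>

primrec partials :: "'a::real_normed_vector list \<Rightarrow> ('a \<Rightarrow> 'b::real_normed_vector) \<Rightarrow> 'a \<Rightarrow> 'b" where
  "partials [] f = f"
| "partials (v # vs) f = (\<lambda>x. frechet_derivative (partials vs f) (at x) v)"

text \<open>To be used on open sets only: all iterated partial derivatives exist and are differentiable.\<close>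

definition smooth_on :: "'a::euclidean_space set \<Rightarrow> ('a \<Rightarrow> 'b::real_normed_vector) \<Rightarrow> bool" where
  "smooth_on U f \<longleftrightarrow> (\<forall>vs. set vs \<subseteq> Basis \<longrightarrow> partials vs f differentiable_on U)"

definition diffeo_on :: "'a::euclidean_space set \<Rightarrow> ('a \<Rightarrow> 'b::euclidean_space) \<Rightarrow> bool" where
  "diffeo_on V \<Theta> \<longleftrightarrow> open V \<and> open (\<Theta> ` V) \<and> inj_on \<Theta> V \<and>
     smooth_on V \<Theta> \<and> smooth_on (\<Theta> ` V) (inv_into V \<Theta>)"


section \<open>Families of surfaces in projective 3-space, and genericity\<close>

type_synonym plane = "real \<times> real"

text \<open>The point of projective space with homogeneous coordinates v is represented by the matrix
  of the orthogonal projection onto the line spanned by v.  This is the standard smooth embedding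
  of projective 3-space into the space of 4 by 4 matrices; smoothness of maps into projective
  space, and the C-infinity topology on such maps, are those of matrix-valued maps.\<close>

definition proj_point :: "real^4 \<Rightarrow> real^4^4" where
  "proj_point v = (\<chi> i j. v $ i * v $ j / (v \<bullet> v))"

definition projective_space :: "(real^4^4) set" where
  "projective_space = proj_point ` {v. v \<noteq> 0}"

definition affine_space :: "(real^4^4) set" where
  "affine_space = proj_point ` {v. v $ 4 \<noteq> 0}"

definition local_param :: "'a::euclidean_space set \<Rightarrow> plane set \<Rightarrow> (plane \<Rightarrow> 'a) \<Rightarrow> bool" where
  "local_param M U \<psi> \<longleftrightarrow> open U \<and> smooth_on U \<psi> \<and>
     (\<forall>u\<in>U. inj (frechet_derivative \<psi> (at u))) \<and>
     openin (top_of_set M) (\<psi> ` U) \<and> (\<exists>\<psi>'. homeomorphism U (\<psi> ` U) \<psi> \<psi>')"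

text \<open>An abstract smooth surface (without boundary), realised as a submanifold of some Euclidean
  space; it is the source of the parametrised families below.\<close>

definition smooth_surface :: "'a::euclidean_space set \<Rightarrow> bool" where
  "smooth_surface M \<longleftrightarrow> (\<forall>m\<in>M. \<exists>U \<psi>. local_param M U \<psi> \<and> m \<in> \<psi> ` U)"

definition in_chart :: "('a \<Rightarrow> real \<Rightarrow> real^4^4) \<Rightarrow> (plane \<Rightarrow> 'a) \<Rightarrow> plane \<times> real \<Rightarrow> real^4^4" where
  "in_chart S \<psi> = (\<lambda>(u, \<epsilon>). S (\<psi> u) \<epsilon>)"

text \<open>Smooth 1-parameter families of immersions of M into the ambient space A; the surface of
  parameter \<open>\<epsilon>\<close> is the image of \<open>\<lambda>m. S m \<epsilon>\<close>.  Values of S outside M are irrelevant.\<close>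

definition surface_families ::
    "'a::euclidean_space set \<Rightarrow> (real^4^4) set \<Rightarrow> ('a \<Rightarrow> real \<Rightarrow> real^4^4) set" where
  "surface_families M A = {S. (\<forall>m\<in>M. \<forall>\<epsilon>. S m \<epsilon> \<in> A) \<and>
     (\<forall>U \<psi>. local_param M U \<psi> \<longrightarrow> smooth_on (U \<times> UNIV) (in_chart S \<psi>) \<and>
        (\<forall>u\<in>U. \<forall>\<epsilon>. inj (frechet_derivative (\<lambda>x. S (\<psi> x) \<epsilon>) (at u))))}"

text \<open>The C-infinity (weak Whitney) topology: uniform convergence of all partial derivatives
  on compact sets.\<close>

definition C_infinity_topology ::
    "'a::euclidean_space set \<Rightarrow> (real^4^4) set \<Rightarrow> ('a \<Rightarrow> real \<Rightarrow> real^4^4) topology" where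
  "C_infinity_topology M A = topology_generated_by
     {N. \<exists>S\<in>surface_families M A. \<exists>U \<psi> K. \<exists>k::nat. \<exists>\<delta>>0.
        local_param M U \<psi> \<and> compact K \<and> K \<subseteq> U \<times> UNIV \<and>
        N = {S' \<in> surface_families M A. \<forall>vs. set vs \<subseteq> Basis \<and> length vs \<le> k \<longrightarrow>
               (\<forall>x\<in>K. norm (partials vs (in_chart S' \<psi>) x - partials vs (in_chart S \<psi>) x) < \<delta>)}}"

definition generically :: "'s topology \<Rightarrow> ('s \<Rightarrow> bool) \<Rightarrow> bool" where
  "generically X Q \<longleftrightarrow> (\<exists>G :: nat \<Rightarrow> 's set.
     (\<forall>n. openin X (G n) \<and> X closure_of (G n) = topspace X) \<and>
     (\<forall>s \<in> (\<Inter>n. G n). Q s))"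

text \<open>In suitable projective coordinates (given by T), the family is locally the family of graphs
  \<open>z = f \<epsilon> (x, y)\<close>.  As each surface is immersed, \<open>(p, \<epsilon>) \<mapsto> (\<mu> (p, \<epsilon>), \<epsilon>)\<close> is
  automatically a diffeomorphism from W onto an open part of surface-time.\<close>

definition monge_chart :: "'a::euclidean_space set \<Rightarrow> ('a \<Rightarrow> real \<Rightarrow> real^4^4) \<Rightarrow>
    (plane \<times> real) set \<Rightarrow> (real \<Rightarrow> plane \<Rightarrow> real) \<Rightarrow> bool" where
  "monge_chart M S W f \<longleftrightarrow> open W \<and> smooth_on W (\<lambda>(p, \<epsilon>). f \<epsilon> p) \<and>
     (\<exists>(T :: real^4^4) \<mu>. invertible T \<and> smooth_on W \<mu> \<and> \<mu> ` W \<subseteq> M \<and>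
        (\<forall>(p, \<epsilon>) \<in> W. S (\<mu> (p, \<epsilon>)) \<epsilon> =
            proj_point (T *v vector [fst p, snd p, f \<epsilon> p, 1])))"


section \<open>Geometry of a surface in Monge form\<close>

definition hess_det :: "(plane \<Rightarrow> real) \<Rightarrow> plane \<Rightarrow> real" where
  "hess_det g p = partials [(1,0),(1,0)] g p * partials [(0,1),(0,1)] g p
                  - (partials [(1,0),(0,1)] g p)\<^sup>2"

definition gaussian_curvature :: "(plane \<Rightarrow> real) \<Rightarrow> plane \<Rightarrow> real" where
  "gaussian_curvature g p =
     hess_det g p / (1 + (partials [(1,0)] g p)\<^sup>2 + (partials [(0,1)] g p)\<^sup>2)\<^sup>2"

definition elliptic_domain :: "(plane \<Rightarrow> real) \<Rightarrow> plane set" where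
  "elliptic_domain g = {p. gaussian_curvature g p > 0}"

definition hyperbolic_domain :: "(plane \<Rightarrow> real) \<Rightarrow> plane set" where
  "hyperbolic_domain g = {p. gaussian_curvature g p < 0}"

definition parabolic_curve :: "(plane \<Rightarrow> real) \<Rightarrow> plane set" where
  "parabolic_curve g = {p. hess_det g p = 0}"

definition parabolic_morse :: "(plane \<Rightarrow> real) \<Rightarrow> plane \<Rightarrow> bool" where
  "parabolic_morse g p \<longleftrightarrow> hess_det g p = 0 \<and>
     (\<forall>v. frechet_derivative (hess_det g) (at p) v = 0) \<and> hess_det (hess_det g) p \<noteq> 0"

text \<open>At least k-point contact (\<open>k \<ge> 2\<close>) of the surface with its tangent line
  \<open>t \<mapsto> (p + t v, g p + t dg(v))\<close>: the height of the surface above that line vanishes to order k.\<close>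

definition line_contact :: "nat \<Rightarrow> (plane \<Rightarrow> real) \<Rightarrow> plane \<Rightarrow> plane \<Rightarrow> bool" where
  "line_contact k g p v \<longleftrightarrow> (\<forall>j<k.
     (deriv ^^ j) (\<lambda>t. g (p + t *\<^sub>R v) - (g p + t * frechet_derivative g (at p) v)) 0 = 0)"

definition asymptotic :: "(plane \<Rightarrow> real) \<Rightarrow> plane \<Rightarrow> plane \<Rightarrow> bool" where
  "asymptotic g p v \<longleftrightarrow> v \<noteq> 0 \<and> line_contact 3 g p v"

definition unique_asymptotic :: "(plane \<Rightarrow> real) \<Rightarrow> plane \<Rightarrow> bool" where
  "unique_asymptotic g p \<longleftrightarrow>
     (\<exists>v. asymptotic g p v \<and> (\<forall>w. asymptotic g p w \<longrightarrow> (\<exists>c. w = c *\<^sub>R v)))"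

definition tangent_to_parabolic :: "(plane \<Rightarrow> real) \<Rightarrow> plane \<Rightarrow> plane \<Rightarrow> bool" where
  "tangent_to_parabolic g p v \<longleftrightarrow> (\<exists>\<gamma> \<delta>. \<delta> > 0 \<and> smooth_on {-\<delta><..<\<delta>} \<gamma> \<and> \<gamma> 0 = p \<and>
     (\<forall>t\<in>{-\<delta><..<\<delta>}. \<gamma> t \<in> parabolic_curve g) \<and> v \<noteq> 0 \<and> (\<gamma> has_vector_derivative v) (at 0))"

definition general_position :: "(plane \<Rightarrow> real) \<Rightarrow> plane \<Rightarrow> bool" where
  "general_position g p \<longleftrightarrow> (\<forall>v. asymptotic g p v \<longrightarrow> \<not> tangent_to_parabolic g p v)"

definition godron :: "(plane \<Rightarrow> real) \<Rightarrow> plane \<Rightarrow> bool" where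
  "godron g p \<longleftrightarrow> p \<in> parabolic_curve g \<and> unique_asymptotic g p \<and>
     (\<exists>v. asymptotic g p v \<and> tangent_to_parabolic g p v)"


subsection \<open>The flecnodal curve, hyperbonodes and ellipnodes\<close>

text \<open>\<open>j!\<close> times the homogeneous part of degree j of the Taylor expansion of g at p, evaluated at a
  complex vector.  The complex line of direction w is asymptotic if this vanishes for \<open>j = 2\<close>,
  and has at least 4-point contact if it also vanishes for \<open>j = 3\<close>.\<close>

definition jet_form :: "nat \<Rightarrow> (plane \<Rightarrow> real) \<Rightarrow> plane \<Rightarrow> complex \<times> complex \<Rightarrow> complex" where
  "jet_form j g p w = (\<Sum>i\<le>j. of_nat (j choose i) *
     of_real (partials (replicate (j - i) (1,0) @ replicate i (0,1)) g p) *
     fst w ^ (j - i) * snd w ^ i)"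

definition real_flecnodal_curve :: "(plane \<Rightarrow> real) \<Rightarrow> plane set" where
  "real_flecnodal_curve g = {p. \<exists>v. asymptotic g p v \<and> line_contact 4 g p v}"

text \<open>All real points of the flecnodal curve: the asymptotic line may be complex.  This adds
  only points of the elliptic domain, where the two asymptotic lines are complex conjugate.\<close>

definition flecnodal_curve :: "(plane \<Rightarrow> real) \<Rightarrow> plane set" where
  "flecnodal_curve g = {p. \<exists>w. w \<noteq> 0 \<and> jet_form 2 g p w = 0 \<and> jet_form 3 g p w = 0}"

definition normal_vec :: "(plane \<Rightarrow> real) \<Rightarrow> plane \<Rightarrow> real^3" where
  "normal_vec g p = vector [- partials [(1,0)] g p, - partials [(0,1)] g p, 1]"

text \<open>Along a curve on the surface with velocity c and unnormalised normal n, the tangent plane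
  rotates about the tangent line with the sign of \<open>det (c, n, n')\<close>.\<close>

definition twist :: "(plane \<Rightarrow> real) \<Rightarrow> plane \<Rightarrow> plane \<Rightarrow> real" where
  "twist g p v = det (vector [vector [fst v, snd v, frechet_derivative g (at p) v],
       normal_vec g p, frechet_derivative (normal_vec g) (at p) v] :: real^3^3)"

definition left_flecnodal :: "(plane \<Rightarrow> real) \<Rightarrow> plane set" where
  "left_flecnodal g = {p \<in> hyperbolic_domain g.
     \<exists>v. asymptotic g p v \<and> twist g p v < 0 \<and> line_contact 4 g p v}"

definition right_flecnodal :: "(plane \<Rightarrow> real) \<Rightarrow> plane set" where
  "right_flecnodal g = {p \<in> hyperbolic_domain g.
     \<exists>v. asymptotic g p v \<and> twist g p v > 0 \<and> line_contact 4 g p v}"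

definition transverse_curves :: "plane set \<Rightarrow> plane set \<Rightarrow> plane \<Rightarrow> bool" where
  "transverse_curves A B p \<longleftrightarrow> (\<exists>U a b. open U \<and> p \<in> U \<and>
     smooth_on U (a :: plane \<Rightarrow> real) \<and> smooth_on U (b :: plane \<Rightarrow> real) \<and>
     A \<inter> U = {x\<in>U. a x = 0} \<and> B \<inter> U = {x\<in>U. b x = 0} \<and> a p = 0 \<and> b p = 0 \<and>
     partials [(1,0)] a p * partials [(0,1)] b p - partials [(0,1)] a p * partials [(1,0)] b p \<noteq> 0)"

definition hyperbonode :: "(plane \<Rightarrow> real) \<Rightarrow> plane \<Rightarrow> bool" where
  "hyperbonode g p \<longleftrightarrow> p \<in> hyperbolic_domain g \<and>
     transverse_curves (left_flecnodal g) (right_flecnodal g) p"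

text \<open>Here w is a smooth field of complex asymptotic directions.  The conjugate flecnodal curves
  have equations \<open>\<Phi> = 0\<close> and \<open>cnj \<Phi> = 0\<close>, and simplicity of their intersection means that the
  Jacobian determinant of \<open>(\<Phi>, cnj \<Phi>)\<close> does not vanish; rescaling w, or replacing it by
  its conjugate, does not affect this.\<close>

definition ellipnode :: "(plane \<Rightarrow> real) \<Rightarrow> plane \<Rightarrow> bool" where
  "ellipnode g p \<longleftrightarrow> p \<in> elliptic_domain g \<and>
     (\<exists>U w. open U \<and> p \<in> U \<and> smooth_on U w \<and> (\<forall>x\<in>U. w x \<noteq> 0 \<and> jet_form 2 g x (w x) = 0) \<and>
       (let \<Phi> = (\<lambda>x. jet_form 3 g x (w x)) in \<Phi> p = 0 \<and>
          partials [(1,0)] \<Phi> p * cnj (partials [(0,1)] \<Phi> p)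
            - partials [(0,1)] \<Phi> p * cnj (partials [(1,0)] \<Phi> p) \<noteq> 0))"


section \<open>The A3 transition and the Whitney umbrella\<close>

definition equivalent_families ::
    "(real \<Rightarrow> plane set) \<Rightarrow> plane \<times> real \<Rightarrow> (real \<Rightarrow> plane set) \<Rightarrow> plane \<times> real \<Rightarrow> bool" where
  "equivalent_families C z C' z' \<longleftrightarrow> (\<exists>V \<Theta> \<tau>. diffeo_on V \<Theta> \<and> z \<in> V \<and> \<Theta> z = z' \<and>
     (\<forall>(p, \<epsilon>) \<in> V. snd (\<Theta> (p, \<epsilon>)) = \<tau> \<epsilon> \<and>
        (p \<in> C \<epsilon> \<longleftrightarrow> fst (\<Theta> (p, \<epsilon>)) \<in> C' (\<tau> \<epsilon>))))"

text \<open>The sign of the parameter is immaterial here, as \<open>\<tau>\<close> above may reverse it.\<close>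

definition A3_transition :: "(real \<Rightarrow> plane set) \<Rightarrow> plane \<Rightarrow> real \<Rightarrow> bool" where
  "A3_transition C q \<epsilon>0 \<longleftrightarrow> (\<exists>\<alpha>. \<alpha> \<noteq> 0 \<and>
     equivalent_families C (q, \<epsilon>0) (\<lambda>\<epsilon>. {(x, y). y^2 = \<epsilon> * x^2 + \<alpha> * x^4}) (0, 0))"

definition A3_singularity :: "plane set \<Rightarrow> plane \<Rightarrow> bool" where
  "A3_singularity C q \<longleftrightarrow> (\<exists>V (\<theta> :: plane \<Rightarrow> plane). \<exists>s\<in>{1, -1}. diffeo_on V \<theta> \<and> q \<in> V \<and> \<theta> q = 0 \<and>
     (\<forall>p\<in>V. p \<in> C \<longleftrightarrow> \<theta> p \<in> {(x, y). y^2 = s * x^4}))"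

definition umbrella :: "(plane \<times> real) set" where
  "umbrella = {((x, y), z). x^2 = z * y^2}"

definition umbrella_param :: "plane \<Rightarrow> plane \<times> real" where
  "umbrella_param = (\<lambda>(u, v). ((u * v, v), u^2))"

definition self_intersection_line :: "(plane \<times> real) set" where
  "self_intersection_line = {((x, y), z). x = 0 \<and> y = 0 \<and> z > 0}"

definition handle :: "(plane \<times> real) set" where
  "handle = {((x, y), z). x = 0 \<and> y = 0 \<and> z < 0}"

definition umbrella_chart ::
    "(plane \<times> real) set \<Rightarrow> plane \<times> real \<Rightarrow> (plane \<times> real) set \<Rightarrow> (plane \<times> real \<Rightarrow> plane \<times> real) \<Rightarrow> bool" where
  "umbrella_chart X z V \<Theta> \<longleftrightarrow> diffeo_on V \<Theta> \<and> z \<in> V \<and> \<Theta> z = 0 \<and>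
     (\<forall>w\<in>V. w \<in> X \<longleftrightarrow> \<Theta> w \<in> umbrella)"

text \<open>The single tangent line of the umbrella X at its pinch-point is the image of the differential
  at 0 of the parametrisation of X; it lies in the plane of constant parameter.\<close>

definition isochronal_section_tangent ::
    "(plane \<times> real) set \<Rightarrow> (plane \<times> real \<Rightarrow> plane \<times> real) \<Rightarrow> bool" where
  "isochronal_section_tangent V \<Theta> \<longleftrightarrow>
     (\<forall>h. snd (frechet_derivative (\<lambda>x. inv_into V \<Theta> (umbrella_param x)) (at 0) h) = 0)"


section \<open>Local transitions of the elliptic and hyperbolic domains\<close>

text \<open>In arbitrarily small disc neighbourhoods U of q, property B holds just before \<open>\<epsilon>0\<close> and
  A just after it; time runs forwards if \<open>\<sigma> = 1\<close>, backwards if \<open>\<sigma> = -1\<close>.\<close>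

definition local_transition ::
    "real \<Rightarrow> plane \<Rightarrow> real \<Rightarrow> (real \<Rightarrow> plane set \<Rightarrow> bool) \<Rightarrow> (real \<Rightarrow> plane set \<Rightarrow> bool) \<Rightarrow> bool" where
  "local_transition \<sigma> q \<epsilon>0 B A \<longleftrightarrow> (\<forall>N. open N \<and> q \<in> N \<longrightarrow>
     (\<exists>U \<delta>. open U \<and> q \<in> U \<and> U \<subseteq> N \<and> U homeomorphic (ball 0 1 :: plane set) \<and> \<delta> > 0 \<and>
        (\<forall>\<epsilon>. 0 < \<sigma> * (\<epsilon> - \<epsilon>0) \<and> \<sigma> * (\<epsilon> - \<epsilon>0) < \<delta> \<longrightarrow> A \<epsilon> U) \<and>
        (\<forall>\<epsilon>. - \<delta> < \<sigma> * (\<epsilon> - \<epsilon>0) \<and> \<sigma> * (\<epsilon> - \<epsilon>0) < 0 \<longrightarrow> B \<epsilon> U)))"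

definition isolated_parabolic_in :: "(plane \<Rightarrow> real) \<Rightarrow> plane \<Rightarrow> plane set \<Rightarrow> bool" where
  "isolated_parabolic_in g q R \<longleftrightarrow> q \<in> parabolic_curve g \<and> (\<exists>U. open U \<and> q \<in> U \<and> U - {q} \<subseteq> R)"

definition parabolic_crossing :: "(plane \<Rightarrow> real) \<Rightarrow> plane \<Rightarrow> bool" where
  "parabolic_crossing g q \<longleftrightarrow> (\<exists>A B U. transverse_curves A B q \<and> open U \<and> q \<in> U \<and>
     parabolic_curve g \<inter> U = (A \<union> B) \<inter> U)"

definition asymptotic_points_to :: "(plane \<Rightarrow> real) \<Rightarrow> plane \<Rightarrow> plane set \<Rightarrow> bool" where
  "asymptotic_points_to g q R \<longleftrightarrow>
     (\<forall>v. asymptotic g q v \<longrightarrow> eventually (\<lambda>t. q + t *\<^sub>R v \<in> R) (at 0))"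

text \<open>Inside U, the region R is a disc bounded by the closed curve that the parabolic curve
  forms in U.\<close>

definition island :: "(plane \<Rightarrow> real) \<Rightarrow> plane set \<Rightarrow> plane set \<Rightarrow> bool" where
  "island g R U \<longleftrightarrow> (R \<inter> U) homeomorphic (ball 0 1 :: plane set) \<and>
     compact (closure (R \<inter> U)) \<and> closure (R \<inter> U) \<subseteq> U \<and>
     frontier (R \<inter> U) = parabolic_curve g \<inter> U \<and>
     (parabolic_curve g \<inter> U) homeomorphic (sphere 0 1 :: plane set)"

definition n_regions :: "plane set \<Rightarrow> plane set \<Rightarrow> nat" where
  "n_regions R U = card (components (R \<inter> U))"

definition case_a :: "(real \<Rightarrow> plane \<Rightarrow> real) \<Rightarrow> plane \<Rightarrow> real \<Rightarrow> real \<Rightarrow> bool" where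
  "case_a f q \<epsilon>0 \<sigma> \<longleftrightarrow> isolated_parabolic_in (f \<epsilon>0) q (hyperbolic_domain (f \<epsilon>0)) \<and>
     local_transition \<sigma> q \<epsilon>0
       (\<lambda>\<epsilon> U. U \<subseteq> hyperbolic_domain (f \<epsilon>))
       (\<lambda>\<epsilon> U. island (f \<epsilon>) (elliptic_domain (f \<epsilon>)) U)"

definition case_b :: "(real \<Rightarrow> plane \<Rightarrow> real) \<Rightarrow> plane \<Rightarrow> real \<Rightarrow> real \<Rightarrow> bool" where
  "case_b f q \<epsilon>0 \<sigma> \<longleftrightarrow> parabolic_crossing (f \<epsilon>0) q \<and>
     asymptotic_points_to (f \<epsilon>0) q (hyperbolic_domain (f \<epsilon>0)) \<and>
     local_transition \<sigma> q \<epsilon>0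
       (\<lambda>\<epsilon> U. n_regions (hyperbolic_domain (f \<epsilon>)) U = 2 \<and> n_regions (elliptic_domain (f \<epsilon>)) U = 1)
       (\<lambda>\<epsilon> U. n_regions (hyperbolic_domain (f \<epsilon>)) U = 1 \<and> n_regions (elliptic_domain (f \<epsilon>)) U = 2)"

definition case_c :: "(real \<Rightarrow> plane \<Rightarrow> real) \<Rightarrow> plane \<Rightarrow> real \<Rightarrow> real \<Rightarrow> bool" where
  "case_c f q \<epsilon>0 \<sigma> \<longleftrightarrow> parabolic_crossing (f \<epsilon>0) q \<and>
     asymptotic_points_to (f \<epsilon>0) q (elliptic_domain (f \<epsilon>0)) \<and>
     local_transition \<sigma> q \<epsilon>0
       (\<lambda>\<epsilon> U. n_regions (elliptic_domain (f \<epsilon>)) U = 2 \<and> n_regions (hyperbolic_domain (f \<epsilon>)) U = 1)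
       (\<lambda>\<epsilon> U. n_regions (elliptic_domain (f \<epsilon>)) U = 1 \<and> n_regions (hyperbolic_domain (f \<epsilon>)) U = 2)"

definition case_d :: "(real \<Rightarrow> plane \<Rightarrow> real) \<Rightarrow> plane \<Rightarrow> real \<Rightarrow> real \<Rightarrow> bool" where
  "case_d f q \<epsilon>0 \<sigma> \<longleftrightarrow> isolated_parabolic_in (f \<epsilon>0) q (elliptic_domain (f \<epsilon>0)) \<and>
     local_transition \<sigma> q \<epsilon>0
       (\<lambda>\<epsilon> U. U \<subseteq> elliptic_domain (f \<epsilon>))
       (\<lambda>\<epsilon> U. island (f \<epsilon>) (hyperbolic_domain (f \<epsilon>)) U)"

definition two_godrons_transition :: "(real \<Rightarrow> plane \<Rightarrow> real) \<Rightarrow> plane \<Rightarrow> real \<Rightarrow> real \<Rightarrow> bool" where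
  "two_godrons_transition f q \<epsilon>0 \<sigma> \<longleftrightarrow> local_transition \<sigma> q \<epsilon>0
     (\<lambda>\<epsilon> U. {p\<in>U. godron (f \<epsilon>) p} = {})
     (\<lambda>\<epsilon> U. card {p\<in>U. godron (f \<epsilon>) p} = 2)"

end

theory Submission imports Defs begin

text \<open>Genericity is used only through versality: at a parabolic point where the Hessian determinant
\<open>H(p, eps)\<close> is critical in \<open>p\<close>, its derivative in \<open>eps\<close> and its Hessian form do not vanish. Versality is an
open condition, as it is the non-vanishing of differential polynomials in the homogeneous coordinates
of the family. It is dense because an affine coordinate can be perturbed by a quadratic-cubic polynomial
with five parameters: the bad parameters form the smooth image of a four-dimensional set.

Near \<open>q\<close> the asymptotic lines have slopes \<open>m + s\<close> and \<open>m - s\<close>, where \<open>s\<^sup>2 = Z\<close> and \<open>Z\<close> is \<open>-H\<close> up to a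
positive factor. The cubic form takes the values \<open>A + s B\<close> and \<open>A - s B\<close> on these lines, so the flecnodal
curve is \<open>A\<^sup>2 = Z B\<^sup>2\<close>. Transversality of the asymptotic direction makes \<open>(A, B, Z)\<close> coordinates of
surface-time, which gives the umbrella: \<open>A = B = 0\<close> is the line of hyperbonodes (\<open>Z > 0\<close>) and ellipnodes
(\<open>Z < 0\<close>). Expanding \<open>Z\<close> to second order in the coordinates \<open>(A, B, eps)\<close> gives the normal form of the
\<open>A3\<close> transition. Godrons are the points with \<open>A = Z = 0\<close>.\<close>

text \<open>General position speaks of tangents to smooth arcs of the parabolic curve. To use it, an
  arc must be produced: if the Hessian form of \<open>H\<close> vanished on the asymptotic
  direction, the critical point would be a saddle and its blow-up would yield a branch tangent to
  that direction. Hence the form is nonzero there (\<open>hvv\<close>). The signs of the form on the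
  diagonalising basis \<open>v0\<close>, \<open>t0\<close>, and that of the time derivative of
  \<open>H\<close>, decide between the four cases and the direction of time.

  Genericity has to be handled for all charts and all times at once. Monge charts depend on the
  family, so the Hessian is replaced by a second fundamental form in homogeneous coordinates, which
  agrees with it up to nonvanishing factors. Non-vanishing side conditions are not closed;
  thresholds 1/(r+1) on compact pieces make each good set open, at the cost of countably many of
  them. A perturbation must keep the ambient space invariant and be small uniformly: it is cut off
  where its affine chart degenerates, and time enters through the bounded function arctan.\<close>

notation scaleR (infixr "*." 75)

section \<open>Calculus of smooth maps on open sets\<close>

lemma differentiable_on_openD:
 "f differentiable_on U ==> open U ==> x \<in> U ==> f differentiable (at x)" by (metis at_within_open differentiable_on_def)

lemma differentiable_on_openI:
 "(!!x. x \<in> U ==> f differentiable (at x)) ==> f differentiable_on U" by (simp add: differentiable_at_imp_differentiable_on)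

text \<open>With the direction as first argument, iterated derivatives are plain iterates, matching
  the recursion of \<open>partials\<close>.\<close>

definition pd :: "'a::real_normed_vector => ('a => 'b::real_normed_vector) => 'a => 'b" where
 "pd v f x = frechet_derivative f (at x) v"

lemma pd_eqI: "(f has_derivative f') (at x) ==> pd v f x = f' v" by (simp add: pd_def frechet_derivative_at[symmetric])

lemma has_derivative_pd: "f differentiable (at x) ==> (f has_derivative (%v. pd v f x)) (at x)"
 by (simp add: pd_def frechet_derivative_works[THEN iffD1])

lemma pd_cong_open:
 assumes "open U" "x \<in> U" "!!y. y \<in> U ==> f y = g y"
 shows "pd v f x = pd v g x"
proof -
 have "(f has_derivative f') (at x) \<longleftrightarrow> (g has_derivative f') (at x)" for f'
  using assms by (metis has_derivative_transform_within_open)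
 then show ?thesis by (simp add: pd_def frechet_derivative_def)
qed

text \<open>A finite order of smoothness, to induct on. The recursion takes the innermost derivative
  first, while \<open>partials\<close> adds the outermost one; closure properties then follow by
  induction on the order with the function arbitrary.\<close>

primrec ndiff_on :: "nat => 'a::euclidean_space set => ('a => 'b::real_normed_vector) => bool" where
 "ndiff_on 0 U f \<longleftrightarrow> True"
| "ndiff_on (Suc n) U f \<longleftrightarrow> f differentiable_on U \<and> (\<forall>b\<in>Basis. ndiff_on n U (pd b f))"

lemma partials_snoc: "partials (vs @ [b]) f = partials vs (pd b f)" by (induction vs) (auto simp: pd_def[abs_def])

lemma partials_Cons_pd: "partials (v # vs) f = pd v (partials vs f)" by (simp add: pd_def[abs_def])

text \<open>The order shifts by one: lists of length at most n record derivatives already taken, and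
  differentiability of the result is one derivative more.\<close>

lemma ndiff_on_Suc_iff_partials:
 "ndiff_on (Suc n) U f \<longleftrightarrow>
  (\<forall>vs. set vs \<subseteq> Basis \<and> length vs \<le> n --> partials vs f differentiable_on U)"
proof (induction n arbitrary: f)
 case (Suc n)
 have "(\<forall>vs. set vs \<subseteq> Basis \<and> length vs \<le> Suc n --> partials vs f differentiable_on U) \<longleftrightarrow>
  f differentiable_on U \<and>
  (\<forall>b\<in>Basis. \<forall>vs. set vs \<subseteq> Basis \<and> length vs \<le> n --> partials vs (pd b f) differentiable_on U)"
  (is "?L \<longleftrightarrow> ?R")
 proof
  assume L: ?L
  show ?R
  proof (intro conjI ballI allI impI)
   show "f differentiable_on U" using L[rule_format, of "[]"] by simp
   fix b :: 'a and vs :: "'a list" assume "b \<in> Basis" "set vs \<subseteq> Basis \<and> length vs \<le> n"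
   then show "partials vs (pd b f) differentiable_on U" using L[rule_format, of "vs @ [b]"] by (simp add: partials_snoc)
  qed
 next
  assume R: ?R
  show ?L
  proof (intro allI impI)
   fix vs :: "'a list" assume vs: "set vs \<subseteq> Basis \<and> length vs \<le> Suc n"
   show "partials vs f differentiable_on U"
   proof (cases vs rule: rev_exhaust)
    case Nil then show ?thesis using R by simp
   next
    case (snoc ys y) then show ?thesis using R vs by (simp add: partials_snoc)
   qed
  qed
 qed
 then show ?case using Suc by simp
qed auto

lemma ndiff_on_mono: "ndiff_on n U f ==> m \<le> n ==> ndiff_on m U f"
proof (induction n arbitrary: m f)
 case (Suc n) then show ?case by (cases m) auto
qed auto

lemma smooth_on_iff_ndiff: "smooth_on U f \<longleftrightarrow> (\<forall>n. ndiff_on n U f)"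
proof
 assume "smooth_on U f"
 then have "ndiff_on (Suc n) U f" for n by (simp add: smooth_on_def ndiff_on_Suc_iff_partials del: ndiff_on.simps)
 then show "\<forall>n. ndiff_on n U f" using ndiff_on_mono[OF _ le_SucI[OF order_refl]] by blast
next
 assume a: "\<forall>n. ndiff_on n U f"
 show "smooth_on U f" unfolding smooth_on_def using a[rule_format, of "Suc _", unfolded ndiff_on_Suc_iff_partials] by blast
qed

lemma smooth_onI: "(!!n. ndiff_on n U f) ==> smooth_on U f" and smooth_onD: "smooth_on U f ==> ndiff_on n U f"
 by (auto simp: smooth_on_iff_ndiff)

lemma smooth_on_imp_differentiable_on: "smooth_on U f ==> f differentiable_on U" using smooth_onD[of U f "Suc 0"] by simp

lemma smooth_on_differentiable: "smooth_on U f ==> open U ==> x \<in> U ==> f differentiable (at x)"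
 using differentiable_on_openD smooth_on_imp_differentiable_on by blast

lemma smooth_on_has_derivative:
 "smooth_on U f ==> open U ==> x \<in> U ==> (f has_derivative (%v. pd v f x)) (at x)"
 by (simp add: smooth_on_differentiable has_derivative_pd)

lemma smooth_on_imp_continuous_on: "smooth_on U f ==> continuous_on U f"
 using smooth_on_imp_differentiable_on differentiable_imp_continuous_on by blast

lemma smooth_on_pd_Basis: "smooth_on U f ==> b \<in> Basis ==> smooth_on U (pd b f)"
 by (metis smooth_on_iff_ndiff ndiff_on.simps(2))

lemma ndiff_on_subset: "ndiff_on n U f ==> V \<subseteq> U ==> ndiff_on n V f"
 by (induction n arbitrary: f) (auto intro: differentiable_on_subset)

lemma smooth_on_subset: "smooth_on U f ==> V \<subseteq> U ==> smooth_on V f" by (metis ndiff_on_subset smooth_on_iff_ndiff)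

lemma ndiff_on_cong:
 assumes "open U" "!!x. x \<in> U ==> f x = g x"
 shows "ndiff_on n U f \<longleftrightarrow> ndiff_on n U g" using assms(2)
proof (induction n arbitrary: f g)
 case (Suc n)
 have "f differentiable_on U \<longleftrightarrow> g differentiable_on U"
  using Suc.prems by (auto simp: differentiable_on_def intro: differentiable_transform_within[where d=1])
 moreover have "ndiff_on n U (pd b f) \<longleftrightarrow> ndiff_on n U (pd b g)" for b
  using Suc by (intro Suc.IH pd_cong_open[OF assms(1)]) auto
 ultimately show ?case by simp
qed simp

lemma smooth_on_cong:
 assumes "open U" "!!x. x \<in> U ==> f x = g x"
 shows "smooth_on U f \<longleftrightarrow> smooth_on U g" using ndiff_on_cong[OF assms] by (simp add: smooth_on_iff_ndiff)

lemma smooth_on_local: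
 assumes "open U" "!!x. x \<in> U ==> \<exists>V. open V \<and> x \<in> V \<and> smooth_on V f"
 shows "smooth_on U f" unfolding smooth_on_def
proof (intro allI impI differentiable_on_openI)
 fix vs :: "'a list" and x assume "set vs \<subseteq> Basis" "x \<in> U"
 moreover obtain V where "open V" "x \<in> V" "smooth_on V f" using assms(2)[OF \<open>x \<in> U\<close>] by blast
 ultimately show "partials vs f differentiable (at x)" unfolding smooth_on_def using differentiable_on_openD by blast
qed

lemma ndiff_on_const:
 fixes U :: "'a::euclidean_space set"
 shows "ndiff_on n U (%x. c)"
proof (induction n arbitrary: c)
 case (Suc n)
 have "pd b (%x. c) = (%x. 0)" for b :: 'a by (auto intro!: pd_eqI derivative_eq_intros)
 with Suc show ?case by simp
qed simp

lemma ndiff_on_add: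
 assumes "open U"
 shows "ndiff_on n U f ==> ndiff_on n U g ==> ndiff_on n U (%x. f x + g x)"
proof (induction n arbitrary: f g)
 case (Suc n)
 have "pd b (%x. f x + g x) x = pd b f x + pd b g x" if "x \<in> U" for b x using that Suc.prems assms
  by (auto intro!: pd_eqI derivative_eq_intros has_derivative_pd differentiable_on_openD)
 then have "ndiff_on n U (pd b (%x. f x + g x))" if "b \<in> Basis" for b using Suc that by (subst ndiff_on_cong[OF assms]) auto
 then show ?case using Suc.prems by (auto intro: differentiable_on_add)
qed simp

lemma ndiff_on_linear:
 assumes "open U" "bounded_linear L"
 shows "ndiff_on n U f ==> ndiff_on n U (%x. L (f x))"
proof (induction n arbitrary: f)
 case (Suc n)
 have d: "((%x. L (f x)) has_derivative (%v. L (pd v f x))) (at x)" if "x \<in> U" for x using that Suc.prems assms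
  by (intro bounded_linear.has_derivative[OF assms(2)] has_derivative_pd differentiable_on_openD[of f U]) simp_all
 have "pd b (%x. L (f x)) x = L (pd b f x)" if "x \<in> U" for b x using that by (simp add: pd_eqI[OF d])
 then have "ndiff_on n U (pd b (%x. L (f x)))" if "b \<in> Basis" for b using Suc that by (subst ndiff_on_cong[OF assms(1)]) auto
 moreover have "(%x. L (f x)) differentiable_on U" by (rule differentiable_on_openI, rule differentiableI[OF d])
 ultimately show ?case by simp
qed simp

lemma ndiff_on_bilinear:
 assumes "open U" "bounded_bilinear h"
 shows "ndiff_on n U f ==> ndiff_on n U g ==> ndiff_on n U (%x. h (f x) (g x))"
proof (induction n arbitrary: f g)
 case (Suc n)
 have d: "((%x. h (f x) (g x)) has_derivative (%v. h (f x) (pd v g x) + h (pd v f x) (g x))) (at x)" if "x \<in> U" for x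
  using that Suc.prems assms by (intro bounded_bilinear.FDERIV[OF assms(2)] has_derivative_pd differentiable_on_openD[of f U]
    differentiable_on_openD[of g U]) simp_all
 have e: "pd b (%x. h (f x) (g x)) x = h (f x) (pd b g x) + h (pd b f x) (g x)" if "x \<in> U" for b x
  using that by (simp add: pd_eqI[OF d])
 have m: "ndiff_on n U f" "ndiff_on n U g" using Suc.prems ndiff_on_mono le_SucI order_refl by blast+
 have "ndiff_on n U (pd b (%x. h (f x) (g x)))" if "b \<in> Basis" for b using Suc that m e
  by (subst ndiff_on_cong[OF assms(1) e]) (auto intro!: ndiff_on_add assms(1) Suc.IH)
 moreover have "(%x. h (f x) (g x)) differentiable_on U" by (rule differentiable_on_openI, rule differentiableI[OF d])
 ultimately show ?case by simp
qed simp

lemma ndiff_on_sum: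
 assumes "open U" "!!i. i \<in> I ==> ndiff_on n U (f i)"
 shows "ndiff_on n U (%x. \<Sum>i\<in>I. f i x)" using assms(2)
 by (induction I rule: infinite_finite_induct) (auto intro: ndiff_on_const ndiff_on_add assms(1))

lemma ndiff_on_scaleR:
 "open U ==> ndiff_on n U f ==> ndiff_on n U g ==> ndiff_on n U (%x. f x *. g x)"
 by (rule ndiff_on_bilinear[OF _ bounded_bilinear_scaleR])

lemma pd_sum_Basis:
 fixes f :: "'a::euclidean_space => 'b::real_normed_vector"
 assumes "f differentiable (at x)"
 shows "pd v f x = (\<Sum>b\<in>Basis. (v \<bullet> b) *. pd b f x)"
proof -
 have "bounded_linear (%v. pd v f x)" using has_derivative_bounded_linear[OF has_derivative_pd[OF assms]] .
 then interpret bounded_linear "%v. pd v f x" .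
 have "pd v f x = pd (\<Sum>b\<in>Basis. (v \<bullet> b) *. b) f x" by (simp add: euclidean_representation)
 then show ?thesis by (simp add: sum scale)
qed

lemma pd_compose:
 assumes "f differentiable (at x)" "g differentiable (at (f x))"
 shows "pd v (%x. g (f x)) x = pd (pd v f x) g (f x)"
 by (rule pd_eqI) (use diff_chain_at[OF has_derivative_pd[OF assms(1)] has_derivative_pd[OF assms(2)]] in
  \<open>simp add: o_def\<close>)

text \<open>The chain rule, written in components, expresses a derivative of the composite by
  products of components of the derivative of f with composites of derivatives of g, each one order
  lower.\<close>

lemma ndiff_on_compose:
 fixes f :: "'a::euclidean_space => 'b::euclidean_space"
 assumes "open U" "open V" "f ` U \<subseteq> V"
 shows "ndiff_on n V g ==> ndiff_on n U f ==> ndiff_on n U (%x. g (f x))"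
proof (induction n arbitrary: g)
 case (Suc n)
 have df: "f differentiable (at x)" "g differentiable (at (f x))" if "x \<in> U" for x
  using that Suc.prems assms by (auto intro!: differentiable_on_openD[where U=V] differentiable_on_openD[where U=U])
 have e: "pd b (%x. g (f x)) x = (\<Sum>i\<in>Basis. (pd b f x \<bullet> i) *. pd i g (f x))" if "x \<in> U" for b x
  using that by (simp add: pd_compose df pd_sum_Basis[OF df(2), symmetric])
 have m: "ndiff_on n U f" using Suc.prems ndiff_on_mono le_SucI order_refl by blast
 have "ndiff_on n U (pd b (%x. g (f x)))" if "b \<in> Basis" for b using Suc that m by (subst ndiff_on_cong[OF assms(1) e])
   (auto intro!: ndiff_on_sum ndiff_on_scaleR assms(1) Suc.IH ndiff_on_linear[OF assms(1) bounded_linear_inner_left])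
 moreover have "(%x. g (f x)) differentiable_on U"
  by (rule differentiable_on_openI) (use differentiable_chain_at[OF df] in \<open>simp add: o_def\<close>)
 ultimately show ?case by simp
qed simp

lemma smooth_on_compose:
 fixes f :: "'a::euclidean_space => 'b::euclidean_space"
 assumes "smooth_on V g" "smooth_on U f" "open U" "open V" "f ` U \<subseteq> V"
 shows "smooth_on U (%x. g (f x))" using assms by (auto simp: smooth_on_iff_ndiff intro: ndiff_on_compose)

lemma smooth_on_const: "smooth_on U (%x. c)" by (simp add: smooth_on_iff_ndiff ndiff_on_const)

lemma smooth_on_linear:
 "open U ==> smooth_on U f ==> bounded_linear L ==> smooth_on U (%x. L (f x))" by (simp add: smooth_on_iff_ndiff ndiff_on_linear)

lemma smooth_on_id: "smooth_on U (%x. x)"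
proof (rule smooth_on_subset[OF _ subset_UNIV], rule smooth_onI)
 fix n :: nat
 have "pd b (%x. x) = (%x. b)" for b :: 'a by (auto intro!: pd_eqI derivative_eq_intros)
 then show "ndiff_on n UNIV (%x::'a. x)" by (cases n) (auto simp: ndiff_on_const)
qed

lemma smooth_on_bilinear:
 "open U ==> smooth_on U f ==> smooth_on U g ==> bounded_bilinear h ==> smooth_on U (%x. h (f x) (g x))"
 by (simp add: smooth_on_iff_ndiff ndiff_on_bilinear)

lemma smooth_on_add: "open U ==> smooth_on U f ==> smooth_on U g ==> smooth_on U (%x. f x + g x)"
 by (simp add: smooth_on_iff_ndiff ndiff_on_add)

lemma smooth_on_minus: "open U ==> smooth_on U f ==> smooth_on U (%x. - f x)"
 by (rule smooth_on_linear[OF _ _ bounded_linear_minus[OF bounded_linear_ident]])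

lemma smooth_on_diff: "open U ==> smooth_on U f ==> smooth_on U g ==> smooth_on U (%x. f x - g x)"
 using smooth_on_add[OF _ _ smooth_on_minus, of U f g] by simp

lemma smooth_on_sum:
 "open U ==> (!!i. i \<in> I ==> smooth_on U (f i)) ==> smooth_on U (%x. \<Sum>i\<in>I. f i x)"
 by (simp add: smooth_on_iff_ndiff ndiff_on_sum)

lemma smooth_on_scaleR: "open U ==> smooth_on U f ==> smooth_on U g ==> smooth_on U (%x. f x *. g x)"
 by (rule smooth_on_bilinear[OF _ _ _ bounded_bilinear_scaleR])

lemma smooth_on_mult:
 fixes f g :: "'a::euclidean_space => 'b::real_normed_algebra"
 shows "open U ==> smooth_on U f ==> smooth_on U g ==> smooth_on U (%x. f x * g x)"
 by (rule smooth_on_bilinear[OF _ _ _ bounded_bilinear_mult])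

lemma smooth_on_inner: "open U ==> smooth_on U f ==> smooth_on U g ==> smooth_on U (%x. f x \<bullet> g x)"
 by (rule smooth_on_bilinear[OF _ _ _ bounded_bilinear_inner])

lemma smooth_on_power:
 fixes f :: "'a::euclidean_space => 'b::real_normed_algebra_1"
 shows "open U ==> smooth_on U f ==> smooth_on U (%x. f x ^ n)" by (induction n) (auto intro: smooth_on_const smooth_on_mult)

lemma smooth_on_prod:
 fixes f :: "'i => 'a::euclidean_space => 'b::real_normed_field"
 assumes "open U" "!!i. i \<in> I ==> smooth_on U (f i)"
 shows "smooth_on U (%x. \<Prod>i\<in>I. f i x)" using assms(2)
 by (induction I rule: infinite_finite_induct) (auto intro: smooth_on_const smooth_on_mult assms(1))

lemma smooth_on_Pair: 
 assumes "open U" "smooth_on U f" "smooth_on U g" shows "smooth_on U (%x. (f x, g x))"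
proof -
 have "bounded_linear (%y::'b. (y, 0::'c))" "bounded_linear (%y::'c. (0::'b, y))"
  by (auto intro: bounded_linear_Pair bounded_linear_ident bounded_linear_zero)
 then have "smooth_on U (%x. (f x, 0) + (0, g x))"
  using assms by (intro smooth_on_add smooth_on_linear[where L="%y. (y, 0)"] smooth_on_linear[where L="%y. (0, y)"])
 then show ?thesis by simp
qed

lemma smooth_on_fst: "open U ==> smooth_on U f ==> smooth_on U (%x. fst (f x))"
 and smooth_on_snd: "open U ==> smooth_on U f ==> smooth_on U (%x. snd (f x))"
 by (auto intro: smooth_on_linear[OF _ _ bounded_linear_fst] smooth_on_linear[OF _ _ bounded_linear_snd])

lemma smooth_on_vec_nth: "open U ==> smooth_on U f ==> smooth_on U (%x. f x $ i)"
 by (rule smooth_on_linear[OF _ _ bounded_linear_vec_nth])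

lemma smooth_on_vec_lambda:
 fixes f :: "'n::finite => 'a::euclidean_space => 'b::euclidean_space"
 assumes "open U" "!!i. smooth_on U (f i)"
 shows "smooth_on U (%x. \<chi> i. f i x)"
proof -
 have "(\<chi> i. f i x) = (\<Sum>i\<in>UNIV. axis i (f i x))" for x
  by (simp add: vec_eq_iff axis_def sum.delta if_distrib cong: if_cong)
 moreover have "bounded_linear (axis i :: 'b => 'b^'n)" for i
  by (rule linear_conv_bounded_linear[THEN iffD1]) (auto simp: linear_iff axis_def vec_eq_iff)
 ultimately show ?thesis using assms
  by (simp del: axis_in_Basis_iff) (intro smooth_on_sum smooth_on_linear[of U "f i" "axis i" for i])
qed

lemma smooth_on_of_real:
 "open U ==> smooth_on U f ==> smooth_on U (%x. complex_of_real (f x))" by (rule smooth_on_linear[OF _ _ bounded_linear_of_real])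

text \<open>For functions whose derivative is an expression in the function itself, such as inverse
  and square root: every order gained by f passes to f' and so gives f the next one.\<close>

lemma smooth_on_real_bootstrap:
 fixes f :: "real => real"
 assumes "open U" "!!x. x \<in> U ==> (f has_real_derivative f' x) (at x)" and "!!n. ndiff_on n U f ==> ndiff_on n U f'"
 shows "smooth_on U f"
proof (rule smooth_onI)
 fix n show "ndiff_on n U f"
 proof (induction n)
  case (Suc n)
  have "pd 1 f x = f' x" if "x \<in> U" for x
   using assms(2)[OF that] pd_eqI[of f _ x 1] by (auto simp: has_field_derivative_def)
  then have "ndiff_on n U (pd 1 f)" using assms(3)[OF Suc] ndiff_on_cong[OF assms(1)] by blast
  moreover have "f differentiable_on U" by (rule differentiable_on_openI) (use assms(2) real_differentiable_def in blast)
  ultimately show ?case by simp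
 qed simp
qed

lemma ndiff_on_mult:
 fixes f g :: "'a::euclidean_space => real"
 shows "open U ==> ndiff_on n U f ==> ndiff_on n U g ==> ndiff_on n U (%x. f x * g x)"
 by (rule ndiff_on_bilinear[OF _ bounded_bilinear_mult])

lemma smooth_on_inverse_real: "smooth_on (- {0::real}) inverse"
proof (rule smooth_on_real_bootstrap[where f'="%x. (-1) * (inverse x * inverse x)"])
 show "open (- {0::real})" by auto
 show "(inverse has_real_derivative - 1 * (inverse x * inverse x)) (at x)" if "x \<in> - {0}" for x :: real
  using that by (auto intro!: derivative_eq_intros simp: power2_eq_square)
 show "ndiff_on n (- {0}) (%x::real. - 1 * (inverse x * inverse x))" if "ndiff_on n (- {0::real}) inverse" for n
  by (intro ndiff_on_mult ndiff_on_const that) auto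
qed

lemma smooth_on_inverse:
 fixes f :: "'a::euclidean_space => real"
 assumes "open U" "smooth_on U f" "!!x. x \<in> U ==> f x ~= 0"
 shows "smooth_on U (%x. inverse (f x))" using assms by (intro smooth_on_compose[OF smooth_on_inverse_real]) auto

lemma smooth_on_divide:
 fixes f g :: "'a::euclidean_space => real"
 assumes "open U" "smooth_on U f" "smooth_on U g" "!!x. x \<in> U ==> g x ~= 0"
 shows "smooth_on U (%x. f x / g x)" unfolding divide_inverse using assms by (intro smooth_on_mult smooth_on_inverse)

lemma smooth_on_sqrt_real: "smooth_on {0::real<..} sqrt"
proof (rule smooth_on_real_bootstrap[where f'="%x. inverse (sqrt x) * (1 / 2)"])
 show "(sqrt has_real_derivative inverse (sqrt x) * (1 / 2)) (at x)" if "x \<in> {0<..}" for x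
  using that by (auto intro!: derivative_eq_intros)
 show "ndiff_on n {0<..} (%x. inverse (sqrt x) * (1 / 2))" if "ndiff_on n {0<..} sqrt" for n
 proof (rule ndiff_on_mult[OF _ ndiff_on_compose[where V="- {0}" and g=inverse and f=sqrt]])
  show "ndiff_on n (- {0::real}) inverse" by (rule smooth_onD[OF smooth_on_inverse_real])
 qed (auto intro: ndiff_on_const that)
qed auto

lemma smooth_on_sqrt:
 assumes "open U" "smooth_on U f" "!!x. x \<in> U ==> f x > 0"
 shows "smooth_on U (%x. sqrt (f x))" using assms by (intro smooth_on_compose[OF smooth_on_sqrt_real]) auto

lemma smooth_on_arctan: "smooth_on UNIV arctan"
proof (rule smooth_on_real_bootstrap[where f'="%x. inverse (1 + x\<^sup>2)"])
 show "(arctan has_real_derivative inverse (1 + x\<^sup>2)) (at x)" for x by (auto intro!: derivative_eq_intros)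
 show "ndiff_on n UNIV (%x::real. inverse (1 + x\<^sup>2))" for n
  by (intro smooth_onD smooth_on_inverse smooth_on_add smooth_on_const smooth_on_power smooth_on_id open_UNIV)
   (metis power_one sum_power2_eq_zero_iff zero_neq_one)
qed auto

lemmas smooth_intros = smooth_on_const smooth_on_id smooth_on_add smooth_on_minus smooth_on_diff
 smooth_on_sum smooth_on_scaleR smooth_on_mult smooth_on_inner smooth_on_power smooth_on_prod smooth_on_Pair
 smooth_on_fst smooth_on_snd smooth_on_vec_nth smooth_on_vec_lambda smooth_on_of_real

lemma smooth_on_pd:
 assumes "open U" "smooth_on U f" shows "smooth_on U (pd v f)"
proof -
 have "smooth_on U (%x. \<Sum>b\<in>Basis. (v \<bullet> b) *. pd b f x)"
  using assms by (intro smooth_intros smooth_on_pd_Basis)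
 then show ?thesis using smooth_on_cong[OF assms(1)] pd_sum_Basis smooth_on_differentiable[OF assms(2,1)]
  by (metis (mono_tags, lifting))
qed

lemma smooth_on_partials: "open U ==> smooth_on U f ==> smooth_on U (partials vs f)"
 by (induction vs) (auto simp: partials_Cons_pd simp del: partials.simps(2) intro!: smooth_on_pd)

lemma partials_cong_open:
 assumes "open U" "!!y. y \<in> U ==> f y = g y" "x \<in> U"
 shows "partials vs f x = partials vs g x" using assms(3) by (induction vs arbitrary: x)
  (auto simp: partials_Cons_pd assms(2) simp del: partials.simps(2) intro!: pd_cong_open[OF assms(1)])

section \<open>Inverses of linear families, diffeomorphisms and the inverse function theorem\<close>

text \<open>Product rule at a zero of p: the increment of c is multiplied by a quantity of first
  order, so continuity of c is enough. This breaks the circle when an inverse, so far only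
  continuous, is differentiated.\<close>

lemma has_derivative_zero_scaleR_continuous:
 fixes p :: "'a::real_normed_vector => real" and c :: "'a => 'b::real_normed_vector"
 assumes p: "(p has_derivative p') (at x)" and "p x = 0" and c: "isCont c x"
 shows "((%y. p y *. c y) has_derivative (%h. p' h *. c x)) (at x)"
proof -
 interpret p': bounded_linear p' using p by (rule has_derivative_bounded_linear)
 obtain K where K: "!!h. norm (p' h) \<le> norm h * K" using p'.bounded by blast
 have t1: "((%y. ((1 / norm (y - x)) *. (p y - p' (y - x))) *. c y) \<longlongrightarrow> 0 *. c x) (at x)"
  using p c \<open>p x = 0\<close> by (intro tendsto_scaleR) (auto simp: has_derivative_at2 isCont_def)
 have t2: "((%y. ((1 / norm (y - x)) * p' (y - x)) *. (c y - c x)) \<longlongrightarrow> 0) (at x)"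
 proof (rule Lim_null_comparison[where g="%y. K * norm (c y - c x)"])
  show "\<forall>\<^sub>F y in at x. norm (((1 / norm (y - x)) * p' (y - x)) *. (c y - c x)) \<le> K * norm (c y - c x)"
   unfolding eventually_at_filter
  proof (intro always_eventually allI impI)
   fix y assume "y ~= x"
   then have "\<bar>(1 / norm (y - x)) * p' (y - x)\<bar> \<le> K" using K[of "y - x"] by (simp add: abs_mult field_simps)
   then show "norm (((1 / norm (y - x)) * p' (y - x)) *. (c y - c x)) \<le> K * norm (c y - c x)"
    unfolding norm_scaleR by (intro mult_right_mono) auto
  qed
  have "((%y. norm (c y - c x)) \<longlongrightarrow> 0) (at x)" using c by (simp add: isCont_def tendsto_norm_zero LIM_zero)
  then show "((%y. K * norm (c y - c x)) \<longlongrightarrow> 0) (at x)" using tendsto_mult_right_zero by blast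
 qed
 have "((%y. (1 / norm (y - x)) *. (p y *. c y - (p x *. c x + p' (y - x) *. c x))) \<longlongrightarrow> 0) (at x)"
  using tendsto_add[OF t1 t2] \<open>p x = 0\<close> by (simp add: scaleR_diff_right scaleR_diff_left algebra_simps)
 moreover have "bounded_linear (%h. p' h *. c x)"
  using bounded_linear_scaleR_left bounded_linear_compose p'.bounded_linear_axioms by fastforce
 ultimately show ?thesis by (simp add: has_derivative_at2)
qed

lemma linear_sum_Basis:
 fixes L :: "'a::euclidean_space => 'b::real_normed_vector"
 assumes "linear L" shows "L v = (\<Sum>j\<in>Basis. (v \<bullet> j) *. L j)"
 using linear_sum[OF assms, of "%j. (v \<bullet> j) *. j" Basis] linear_scale[OF assms]
 by (simp add: euclidean_representation)

text \<open>From w(y) b = w(x) b - w(y) (L(y) - L(x)) w(x) b, whose difference of L vanishes at y =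
  x, the derivative of w at x is -w L' w. It contains w itself only undifferentiated, so the order
  of w catches up with that of L.\<close>

lemma ndiff_on_inverse_family:
 fixes L w :: "'a::euclidean_space => 'a => 'a"
 assumes V: "open V" and linL: "!!y. y \<in> V ==> linear (L y)" and linw: "!!y. y \<in> V ==> linear (w y)"
  and Lw: "!!y b. y \<in> V ==> L y (w y b) = b" and wL: "!!y b. y \<in> V ==> w y (L y b) = b"
  and cont: "!!b. b \<in> Basis ==> continuous_on V (%y. w y b)"
 shows "(!!j. j \<in> Basis ==> ndiff_on n V (%y. L y j)) ==> b \<in> Basis ==> ndiff_on n V (%y. w y b)"
proof (induction n arbitrary: b)
 case (Suc n)
 have Ld: "((%y. L y j) has_derivative (%v. pd v (%y. L y j) y)) (at y)" if "y \<in> V" "j \<in> Basis" for j y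
  using Suc.prems(1)[OF that(2)] that V by (auto intro!: has_derivative_pd differentiable_on_openD)
 define D where "D b y h = - (\<Sum>i\<in>Basis. ((\<Sum>j\<in>Basis. (w y b \<bullet> j) *. pd h (%y. L y j) y) \<bullet> i) *. w y i)" for b y h
 have wd: "((%y. w y b) has_derivative D b x) (at x)" if "x \<in> V" "b \<in> Basis" for b x
 proof -
  define k where "k y = (\<Sum>j\<in>Basis. (w x b \<bullet> j) *. L y j)" for y
  have kL: "k y = L y (w x b)" if "y \<in> V" for y unfolding k_def using linear_sum_Basis[OF linL[OF that]] by metis
  have kd: "(k has_derivative (%h. \<Sum>j\<in>Basis. (w x b \<bullet> j) *. pd h (%y. L y j) x)) (at x)"
   unfolding k_def by (intro has_derivative_sum has_derivative_scaleR_right Ld that)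
  have "((%y. ((k y - k x) \<bullet> i) *. w y i) has_derivative
   (%h. ((\<Sum>j\<in>Basis. (w x b \<bullet> j) *. pd h (%y. L y j) x) \<bullet> i) *. w x i)) (at x)" if "i \<in> Basis" for i
  proof (rule has_derivative_zero_scaleR_continuous)
   show "((%y. (k y - k x) \<bullet> i) has_derivative
    (%h. (\<Sum>j\<in>Basis. (w x b \<bullet> j) *. pd h (%y. L y j) x) \<bullet> i)) (at x)"
    by (rule has_derivative_inner_left) (use has_derivative_diff[OF kd has_derivative_const, of "k x"] in simp)
   show "isCont (%y. w y i) x" using cont[OF that] V \<open>x \<in> V\<close> continuous_on_eq_continuous_at by blast
  qed simp
  then have "((%y. w x b - (\<Sum>i\<in>Basis. ((k y - k x) \<bullet> i) *. w y i)) has_derivative (%h. 0 - (- D b x h))) (at x)"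
   unfolding D_def minus_minus by (intro has_derivative_diff has_derivative_const has_derivative_sum)
  moreover have "w x b - (\<Sum>i\<in>Basis. ((k y - k x) \<bullet> i) *. w y i) = w y b" if "y \<in> V" for y
  proof -
   have "(\<Sum>i\<in>Basis. ((k y - k x) \<bullet> i) *. w y i) = w y (k y - k x)"
    using linear_sum_Basis[OF linw[OF that]] by metis
   also have "\<dots> = w x b - w y b"
    using kL[OF that] kL[OF \<open>x \<in> V\<close>] Lw[OF \<open>x \<in> V\<close>] wL[OF that] linear_diff[OF linw[OF that]] by simp
   finally show ?thesis by simp
  qed
  ultimately show ?thesis
   using has_derivative_transform_within_open[OF _ V \<open>x \<in> V\<close>] by (metis (no_types, lifting) add.inverse_inverse diff_0 ext)
 qed
 have m: "ndiff_on n V (%y. L y j)" if "j \<in> Basis" for j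
  using Suc.prems(1)[OF that] ndiff_on_mono le_SucI order_refl by blast
 have "ndiff_on n V (pd h (%y. w y b))" if "h \<in> Basis" for h
 proof -
  have "ndiff_on n V (pd h (%y. L y j))" if "j \<in> Basis" for j
   using Suc.prems(1)[OF that] \<open>h \<in> Basis\<close> by simp
  then have "ndiff_on n V (%y. D b y h)" unfolding D_def
   by (intro ndiff_on_linear[OF V bounded_linear_minus[OF bounded_linear_ident]] ndiff_on_sum[OF V]
    ndiff_on_scaleR[OF V] ndiff_on_linear[OF V bounded_linear_inner_left] Suc.IH m Suc.prems(2))
  then show ?thesis using ndiff_on_cong[OF V, of "%y. D b y h"] pd_eqI[OF wd] Suc.prems(2) by metis
 qed
 moreover have "(%y. w y b) differentiable_on V"
  by (rule differentiable_on_openI, rule differentiableI[OF wd]) (use Suc.prems in auto)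
 ultimately show ?case by simp
qed simp

lemma diffeo_onI:
 assumes "open V" "open V'" "F ` V = V'" "smooth_on V F" "smooth_on V' g" "!!x. x \<in> V ==> g (F x) = x"
 shows "diffeo_on V F"
proof -
 have inj: "inj_on F V" using assms(6) by (metis inj_on_inverseI)
 have "inv_into V F y = g y" if "y \<in> V'" for y using that assms(3,6) inj by (auto simp: inv_into_f_f)
 then have "smooth_on V' (inv_into V F)" using smooth_on_cong[OF assms(2)] assms(5) by metis
 with assms inj show ?thesis by (simp add: diffeo_on_def)
qed

lemma diffeo_onD:
 assumes "diffeo_on V F"
 shows "open V" "open (F ` V)" "inj_on F V" "smooth_on V F" "smooth_on (F ` V) (inv_into V F)"
 using assms by (auto simp: diffeo_on_def)

lemma diffeo_on_open_image:
 assumes "diffeo_on V F" "open V'" "V' \<subseteq> V" shows "open (F ` V')"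
proof -
 note d = diffeo_onD[OF assms(1)]
 have "F ` V' = F ` V \<inter> inv_into V F -` V'" using assms(3) d(3) by (auto simp: inv_into_f_f subset_iff intro!: image_eqI)
 then show ?thesis using continuous_open_preimage[OF smooth_on_imp_continuous_on[OF d(5)] d(2) assms(2)] by simp
qed

lemma diffeo_on_subset:
 assumes "diffeo_on V F" "open V'" "V' \<subseteq> V" shows "diffeo_on V' F"
proof (rule diffeo_onI[OF assms(2) diffeo_on_open_image[OF assms] refl])
 note d = diffeo_onD[OF assms(1)]
 show "smooth_on V' F" "smooth_on (F ` V') (inv_into V F)" using d assms(3) by (auto intro: smooth_on_subset)
 show "inv_into V F (F x) = x" if "x \<in> V'" for x using that d(3) assms(3) by (auto simp: inv_into_f_f)
qed

lemma diffeo_on_compose: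
 assumes "diffeo_on V F" "diffeo_on V2 G" "F ` V \<subseteq> V2" shows "diffeo_on V (%x. G (F x))"
proof (rule diffeo_onI)
 note d = diffeo_onD[OF assms(1)] and e = diffeo_onD[OF assms(2)]
 show "open V" by (rule d)
 show op: "open (G ` F ` V)" by (rule diffeo_on_open_image[OF assms(2) d(2) assms(3)])
 show "(%x. G (F x)) ` V = G ` F ` V" by auto
 show "smooth_on V (%x. G (F x))" by (rule smooth_on_compose[OF e(4) d(4) d(1) e(1) assms(3)])
 show "smooth_on (G ` F ` V) (%y. inv_into V F (inv_into V2 G y))"
 proof (rule smooth_on_compose[OF d(5) _ op d(2)])
  show "smooth_on (G ` F ` V) (inv_into V2 G)" using smooth_on_subset[OF e(5)] assms(3) by blast
  show "inv_into V2 G ` G ` F ` V \<subseteq> F ` V" using e(3) assms(3) by (auto simp: inv_into_f_f subset_iff)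
 qed
 show "inv_into V F (inv_into V2 G (G (F x))) = x" if "x \<in> V" for x
  using that d(3) e(3) assms(3) by (simp add: inv_into_f_f image_subset_iff)
qed

lemma diffeo_on_inv_pd:
 assumes "diffeo_on V F" "y \<in> F ` V" shows "pd (pd v (inv_into V F) y) F (inv_into V F y) = v"
proof -
 note d = diffeo_onD[OF assms(1)]
 have i: "inv_into V F y \<in> V" using assms(2) by (simp add: inv_into_into)
 have "pd v (%y. F (inv_into V F y)) y = pd (pd v (inv_into V F) y) F (inv_into V F y)"
  by (rule pd_compose[OF smooth_on_differentiable[OF d(5,2) assms(2)] smooth_on_differentiable[OF d(4,1) i]])
 moreover have "pd v (%y. F (inv_into V F y)) y = pd v (%y. y) y"
  by (rule pd_cong_open[OF d(2) assms(2)]) (simp add: f_inv_into_f)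
 moreover have "pd v (%y. y) y = v" by (auto intro!: pd_eqI derivative_eq_intros)
 ultimately show ?thesis by simp
qed

text \<open>The C^1 theorem supplies the inverse g, with derivative inverse to F' at g(y). If g has
  order n, so has y |-> F'(g(y)), and inverting this family gives g order n + 1.\<close>

theorem smooth_inverse_function:
 fixes F :: "'a::euclidean_space => 'a"
 assumes "open U" "smooth_on U F" "x0 \<in> U" "!!v. pd v F x0 = 0 ==> v = 0"
 obtains V where "open V" "V \<subseteq> U" "x0 \<in> V" "diffeo_on V F"
proof -
 define f' where "f' x = Blinfun (%v. pd v F x)" for x
 have hd: "(F has_derivative (%v. pd v F x)) (at x)" if "x \<in> U" for x by (rule smooth_on_has_derivative[OF assms(2,1) that])
 have f': "blinfun_apply (f' x) = (%v. pd v F x)" if "x \<in> U" for x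
  unfolding f'_def by (rule bounded_linear_Blinfun_apply[OF has_derivative_bounded_linear[OF hd[OF that]]])
 have lin: "linear (%v. pd v F x)" if "x \<in> U" for x
  using has_derivative_bounded_linear[OF hd[OF that]] bounded_linear.linear by blast
 have "inj (%v. pd v F x0)" using assms(4) lin[OF assms(3)] by (simp add: linear_injective_0)
 then obtain g0 where g0: "linear g0" "g0 \<circ> (%v. pd v F x0) = id"
  using linear_injective_left_inverse[OF lin[OF assms(3)]] by blast
 have "Blinfun g0 o\<^sub>L f' x0 = id_blinfun" using g0 by (intro blinfun_eqI)
   (simp add: f'[OF assms(3)] bounded_linear_Blinfun_apply linear_conv_bounded_linear o_def fun_eq_iff)
 moreover have "continuous_on U f'"
 proof (rule continuous_on_blinfun_componentwise)
  fix i :: 'a assume "i \<in> Basis"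
  have "continuous_on U (pd i F)" by (rule smooth_on_imp_continuous_on[OF smooth_on_pd[OF assms(1,2)]])
  then show "continuous_on U (%x. blinfun_apply (f' x) i)" by (rule continuous_on_eq) (simp add: f')
 qed
 ultimately obtain U' V g g' where op: "open U'" "U' \<subseteq> U" "x0 \<in> U'" "open V" "F x0 \<in> V"
  and hom: "homeomorphism U' V F g" and gd: "!!y. y \<in> V ==> (g has_derivative (g' y)) (at y)"
  and g': "!!y. y \<in> V ==> g' y = inv (blinfun_apply (f' (g y)))"
  and bij: "!!y. y \<in> V ==> bij (blinfun_apply (f' (g y)))"
  using inverse_function_theorem[OF assms(1), of F f' x0 "Blinfun g0"] hd f' assms(3) by metis
 have gU: "g y \<in> U'" if "y \<in> V" for y using hom that by (auto simp: homeomorphism_def)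
 note gU2 = subsetD[OF op(2) gU]
 have gp: "pd b g y = inv (%v. pd v F (g y)) b" if "y \<in> V" for b y
  using pd_eqI[OF gd[OF that]] g'[OF that] f'[OF gU2[OF that]] by simp
 have bij2: "bij (%v. pd v F (g y))" if "y \<in> V" for y using bij[OF that] f'[OF gU2[OF that]] by simp
 have "ndiff_on n V g" for n
 proof (induction n)
  case (Suc n)
  have "ndiff_on n V (%y. pd b g y)" if "b \<in> Basis" for b
  proof (rule ndiff_on_inverse_family[where L="%y v. pd v F (g y)" and w="%y b. pd b g y"])
   show "open V" by fact
   show "linear (%v. pd v F (g y))" if "y \<in> V" for y by (rule lin[OF gU2[OF that]])
   show "linear (%b. pd b g y)" if "y \<in> V" for y
    using pd_eqI[OF gd[OF that]] gd[OF that] has_derivative_linear by (metis (no_types, lifting) ext)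
   show "pd (pd b g y) F (g y) = b" if "y \<in> V" for y b
    using gp[OF that] surj_f_inv_f[OF bij_is_surj[OF bij2[OF that]], of b] by simp
   show "pd (pd b F (g y)) g y = b" if "y \<in> V" for y b
    using gp[OF that] inv_f_f[OF bij_is_inj[OF bij2[OF that]], of b] by simp
   show "ndiff_on n V (%y. pd j F (g y))" if "j \<in> Basis" for j by (rule ndiff_on_compose[OF op(4) assms(1) _ _ Suc])
     (use gU2 smooth_onD[OF smooth_on_pd[OF assms(1,2)]] in auto)
   show "continuous_on V (%y. pd b g y)" if "b \<in> Basis" for b
   proof -
    have cg: "continuous_on V g" using hom by (simp add: homeomorphism_def)
    define f2 where "f2 y = f' (g y)" for y
    have c2: "continuous_on V f2" unfolding f2_def
     using \<open>continuous_on U f'\<close> cg gU2 by (auto intro: continuous_on_compose2)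
    show ?thesis
    proof (rule continuous_at_imp_continuous_on, rule ballI)
     fix y0 assume y0: "y0 \<in> V"
     let ?w = "%y. pd b g y"
     have inj0: "inj (blinfun_apply (f2 y0))" using bij[OF y0] f2_def bij_is_inj by simp
     \<comment> \<open>A lower bound for the injective map f2(y0); it controls the inverses at
       nearby points.\<close>
     obtain B where B: "B > 0" "!!v. B * norm v \<le> norm (blinfun_apply (f2 y0) v)"
      using linear_inj_bounded_below_pos[OF bounded_linear.linear[OF blinfun.bounded_linear_right] inj0] by metis
     have fw: "blinfun_apply (f2 y) (?w y) = b" if "y \<in> V" for y
      using gp[OF that] surj_f_inv_f[OF bij_is_surj[OF bij2[OF that]], of b] f'[OF gU2[OF that]] by (simp add: f2_def)
     have "isCont f2 y0" using c2 y0 continuous_on_eq_continuous_at[OF op(4)] by blast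
     then have "(f2 \<longlongrightarrow> f2 y0) (at y0)" by (simp add: isCont_def)
     then have tend: "((%y. norm (f2 y - f2 y0)) \<longlongrightarrow> 0) (at y0)" by (intro tendsto_norm_zero LIM_zero)
     have ev: "\<forall>\<^sub>F y in at y0. norm (f2 y - f2 y0) < B / 2"
      using order_tendstoD(2)[OF tend, of "B/2"] B(1) by simp
     have evV: "\<forall>\<^sub>F y in at y0. y \<in> V" using op(4) y0 eventually_at_topological by blast
     have "((%y. ?w y - ?w y0) \<longlongrightarrow> 0) (at y0)"
     proof (rule Lim_null_comparison[where g="%y. (2 / B * norm (?w y0)) * norm (f2 y - f2 y0)"])
      show "\<forall>\<^sub>F y in at y0. norm (?w y - ?w y0) \<le> (2 / B * norm (?w y0)) * norm (f2 y - f2 y0)"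
       using ev evV
      proof eventually_elim
       case (elim y)
       let ?d = "?w y - ?w y0"
       \<comment> \<open>Both w(y) and w(y0) are mapped to b, by f2(y) and f2(y0) respectively. Once
         f2(y) is within B/2 of f2(y0), the term containing ?d on the right is absorbed by half of
         the lower bound B.\<close>
       have "blinfun_apply (f2 y0) ?d = - blinfun_apply (f2 y - f2 y0) ?d - blinfun_apply (f2 y - f2 y0) (?w y0)"
        using fw[OF elim(2)] fw[OF y0] by (simp add: blinfun.diff_left blinfun.diff_right)
       then have "norm (blinfun_apply (f2 y0) ?d) \<le>
         norm (blinfun_apply (f2 y - f2 y0) ?d) + norm (blinfun_apply (f2 y - f2 y0) (?w y0))"
        by (metis norm_minus_cancel norm_triangle_ineq4)
       also have "\<dots> \<le> norm (f2 y - f2 y0) * norm ?d + norm (f2 y - f2 y0) * norm (?w y0)"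
        by (intro add_mono norm_blinfun)
       also have "\<dots> \<le> B / 2 * norm ?d + norm (f2 y - f2 y0) * norm (?w y0)"
        using elim(1) by (intro add_mono mult_right_mono) auto
       finally have "B * norm ?d \<le> B / 2 * norm ?d + norm (f2 y - f2 y0) * norm (?w y0)" using B(2)[of ?d] by linarith
       then show ?case using B(1) by (simp add: field_simps)
      qed
      show "((%y. (2 / B * norm (?w y0)) * norm (f2 y - f2 y0)) \<longlongrightarrow> 0) (at y0)"
       using tendsto_mult_right_zero[OF tend] by blast
     qed
     then show "isCont ?w y0" by (simp add: isCont_def LIM_zero_iff)
    qed
   qed
  qed (use that in auto)
  moreover have "g differentiable_on V" by (rule differentiable_on_openI, rule differentiableI[OF gd])
  ultimately show ?case by simp
 qed simp
 then have "smooth_on V g" by (rule smooth_onI)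
 then have "diffeo_on U' F" using hom op smooth_on_subset[OF assms(2) op(2)] unfolding homeomorphism_def
  by (intro diffeo_onI[where V'=V and g=g]) auto
 then show ?thesis using that op by blast
qed

section \<open>Mixed derivatives, integrals with a parameter and Taylor formulas\<close>

lemma pd_along_line:
 assumes "f differentiable (at (x + t *. v))"
 shows "((%t. f (x + t *. v)) has_vector_derivative pd v f (x + t *. v)) (at t)"
proof -
 have "((%t. x + t *. v) has_derivative (%s. s *. v)) (at t)" by (auto intro!: derivative_eq_intros)
 from diff_chain_at[OF this has_derivative_pd[OF assms]]
 have "((%t. f (x + t *. v)) has_derivative (%s. pd (s *. v) f (x + t *. v))) (at t)" by (simp add: o_def)
 moreover have "pd (s *. v) f (x + t *. v) = s *. pd v f (x + t *. v)" for s
  using linear_scale[OF bounded_linear.linear[OF has_derivative_bounded_linear[OF has_derivative_pd[OF assms]]]] .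
 ultimately show ?thesis by (simp add: has_vector_derivative_def)
qed

lemma pd_along_line_real:
 fixes f :: "'a::real_normed_vector => real"
 assumes "f differentiable (at (x + t *. v))"
 shows "((%t. f (x + t *. v)) has_real_derivative pd v f (x + t *. v)) (at t)"
 using pd_along_line[OF assms] by (simp add: has_real_derivative_iff_has_vector_derivative)

lemma pd_linear:
 assumes "f differentiable (at x)"
 shows "pd (a *. v + b *. w) f x = a *. pd v f x + b *. pd w f x"
  "pd (v + w) f x = pd v f x + pd w f x" "pd (a *. v) f x = a *. pd v f x" "pd 0 f x = 0" "pd (- v) f x = - pd v f x"
proof -
 have l: "linear (%v. pd v f x)"
  by (rule bounded_linear.linear[OF has_derivative_bounded_linear[OF has_derivative_pd[OF assms]]])
 show "pd (a *. v + b *. w) f x = a *. pd v f x + b *. pd w f x"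
  "pd (v + w) f x = pd v f x + pd w f x" "pd (a *. v) f x = a *. pd v f x" using l by (auto simp: linear_iff)
 show "pd 0 f x = 0" "pd (- v) f x = - pd v f x" using linear_0[OF l] linear_neg[OF l] by auto
qed

text \<open>The second difference of f over a small parallelogram is symmetric in v and w. Two
  applications of the mean value theorem write it as h^2 times either mixed derivative at an
  intermediate point; divide by h^2 and let h tend to 0.\<close>

theorem pd_commute:
 fixes f :: "'a::euclidean_space => real"
 assumes "open U" "smooth_on U f" "x \<in> U"
 shows "pd v (pd w f) x = pd w (pd v f) x"
proof -
 obtain e where e: "e > 0" "ball x e \<subseteq> U" using assms(1,3) open_contains_ball by blast
 have df: "g differentiable (at y)" if "y \<in> ball x e" "smooth_on U g" for g :: "'a => real" and y
  using that e smooth_on_differentiable assms(1) by blast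
 have key: "\<exists>s t. 0 < s \<and> s < h \<and> 0 < t \<and> t < h \<and>
   f (x + h *. v + h *. w) - f (x + h *. v) - f (x + h *. w) + f x = h * h * pd w (pd v f) (x + s *. v + t *. w)"
  if h: "0 < h" "h * (norm v + norm w) < e" for h v w
 proof -
  have inb: "x + s *. v + t *. w \<in> ball x e" if "0 \<le> s" "s \<le> h" "0 \<le> t" "t \<le> h" for s t
  proof -
   have "norm (s *. v + t *. w) \<le> s * norm v + t * norm w"
    using norm_triangle_ineq[of "s *. v" "t *. w"] that by simp
   also have "\<dots> \<le> h * norm v + h * norm w" using that by (intro add_mono mult_right_mono) auto
   also have "\<dots> < e" using h by (simp add: algebra_simps)
   finally have "norm (s *. v + t *. w) < e" .
   moreover have "x - (x + s *. v + t *. w) = - (s *. v + t *. w)" by simp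
   ultimately show ?thesis unfolding mem_ball dist_norm by (metis norm_minus_cancel)
  qed
  define phi where "phi s = f ((x + h *. w) + s *. v) - f (x + s *. v)" for s
  have "\<exists>s. 0 < s \<and> s < h \<and> phi h - phi 0 = (h - 0) * (pd v f ((x + h *. w) + s *. v) - pd v f (x + s *. v))"
  proof (rule MVT2)
   fix s assume "0 \<le> s" "s \<le> h"
   then have "f differentiable at ((x + h *. w) + s *. v)" "f differentiable at (x + s *. v)"
    using inb[of s h] inb[of s 0] df[OF _ assms(2)] h(1) by (auto simp: add_ac)
   then show "DERIV phi s :> pd v f ((x + h *. w) + s *. v) - pd v f (x + s *. v)"
    unfolding phi_def by (intro DERIV_diff pd_along_line_real)
  qed (use h in simp)
  then obtain s where s: "0 < s" "s < h"
   "phi h - phi 0 = h * (pd v f ((x + s *. v) + h *. w) - pd v f ((x + s *. v) + 0 *. w))" by (auto simp: add_ac)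
  have "\<exists>t. 0 < t \<and> t < h \<and> pd v f ((x + s *. v) + h *. w) - pd v f ((x + s *. v) + 0 *. w)
    = (h - 0) * pd w (pd v f) ((x + s *. v) + t *. w)"
  proof (rule MVT2)
   fix t assume "0 \<le> t" "t \<le> h"
   then show "DERIV (%t. pd v f ((x + s *. v) + t *. w)) t :> pd w (pd v f) ((x + s *. v) + t *. w)"
    using s by (intro pd_along_line_real df[OF inb smooth_on_pd[OF assms(1,2)]]) auto
  qed (use h in simp)
  then obtain t where "0 < t" "t < h" "pd v f ((x + s *. v) + h *. w) - pd v f ((x + s *. v) + 0 *. w)
    = h * pd w (pd v f) ((x + s *. v) + t *. w)" by auto
  then show ?thesis using s by (intro exI[of _ s] exI[of _ t]) (simp add: phi_def add_ac algebra_simps)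
 qed
 define c where "c = norm v + norm w + 1"
 have c: "c > 0" by (simp add: c_def add_nonneg_pos)
 \<comment> \<open>With n + 1 as denominator the bound for n = 0 would not be strict.\<close>
 define hn where "hn n = e / c / real (n + 2)" for n :: nat
 have hn: "0 < hn n" "hn n * (norm v + norm w) < e" for n
 proof -
  show "0 < hn n" using e c by (simp add: hn_def)
  have "hn n * (norm v + norm w) \<le> hn n * c" using \<open>0 < hn n\<close> by (simp add: c_def)
  also have "\<dots> = e / real (n + 2)" using c by (simp add: hn_def)
  also have "\<dots> < e / 1" using e(1) by (intro divide_strict_left_mono) auto
  finally show "hn n * (norm v + norm w) < e" by simp
 qed
 have "\<forall>n. \<exists>s t s' t'. 0 < s \<and> s < hn n \<and> 0 < t \<and> t < hn n \<and> 0 < s' \<and> s' < hn n \<and> 0 < t' \<and> t' < hn n \<and>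
  pd w (pd v f) (x + s *. v + t *. w) = pd v (pd w f) (x + s' *. w + t' *. v)"
 proof
  fix n
  obtain s t where 1: "0 < s" "s < hn n" "0 < t" "t < hn n" "f (x + hn n *. v + hn n *. w) - f (x + hn n *. v) - f (x + hn n *. w) + f x = hn n * hn n * pd w (pd v f) (x + s *. v + t *. w)"
   using key[OF hn] by blast
  obtain s' t' where 2: "0 < s'" "s' < hn n" "0 < t'" "t' < hn n" "f (x + hn n *. w + hn n *. v) - f (x + hn n *. w) - f (x + hn n *. v) + f x = hn n * hn n * pd v (pd w f) (x + s' *. w + t' *. v)"
   using key[of "hn n" w v] hn by (auto simp: add.commute)
  have "hn n * hn n * pd w (pd v f) (x + s *. v + t *. w) = hn n * hn n * pd v (pd w f) (x + s' *. w + t' *. v)"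
  proof -
   have "x + hn n *. w + hn n *. v = x + hn n *. v + hn n *. w" by simp
   with 1(5) 2(5) show ?thesis by (metis (no_types, opaque_lifting) add.commute add_diff_eq diff_diff_eq)
  qed
  then have "pd w (pd v f) (x + s *. v + t *. w) = pd v (pd w f) (x + s' *. w + t' *. v)"
   using hn(1)[of n] by simp
  with 1 2 show "\<exists>s t s' t'. 0 < s \<and> s < hn n \<and> 0 < t \<and> t < hn n \<and> 0 < s' \<and> s' < hn n \<and> 0 < t' \<and> t' < hn n \<and>
  pd w (pd v f) (x + s *. v + t *. w) = pd v (pd w f) (x + s' *. w + t' *. v)" by blast
 qed
 then obtain s t s' t' where st: "!!n. 0 < s n \<and> s n < hn n \<and> 0 < t n \<and> t n < hn n \<and> 0 < s' n \<and> s' n < hn n \<and> 0 < t' n \<and> t' n < hn n \<and>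
  pd w (pd v f) (x + s n *. v + t n *. w) = pd v (pd w f) (x + s' n *. w + t' n *. v)" by metis
 have hn0: "hn \<longlonglongrightarrow> 0"
  using LIMSEQ_ignore_initial_segment[OF lim_const_over_n[of "e / c"], of 2] by (simp add: hn_def[abs_def])
 have z: "r \<longlonglongrightarrow> 0" if "!!n. 0 < r n \<and> r n < hn n" for r
  by (rule tendsto_sandwich[OF _ _ tendsto_const hn0]) (use that less_imp_le in \<open>auto intro!: always_eventually\<close>)
 have c2: "isCont (pd v (pd w f)) x" "isCont (pd w (pd v f)) x"
  using smooth_on_imp_continuous_on[OF smooth_on_pd[OF assms(1) smooth_on_pd[OF assms(1,2)]]]
   continuous_on_eq_continuous_at[OF assms(1)] assms(3) by auto
 have "(%n. x + s n *. v + t n *. w) \<longlonglongrightarrow> x + 0 *. v + 0 *. w"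
  using st by (intro tendsto_intros z) auto
 then have l1: "(%n. pd w (pd v f) (x + s n *. v + t n *. w)) \<longlonglongrightarrow> pd w (pd v f) x"
  using isCont_tendsto_compose[OF c2(2)] by simp
 have "(%n. x + s' n *. w + t' n *. v) \<longlonglongrightarrow> x + 0 *. w + 0 *. v"
  using st by (intro tendsto_intros z) auto
 then have l2: "(%n. pd v (pd w f) (x + s' n *. w + t' n *. v)) \<longlonglongrightarrow> pd v (pd w f) x"
  using isCont_tendsto_compose[OF c2(1)] by simp
 show ?thesis using LIMSEQ_unique[OF l1] l2 st by simp
qed

text \<open>Differentiation under the integral gives an integral of the same shape, so the induction
  keeps F arbitrary. The open set Om is there because smoothness is meaningful on open sets only,
  whereas the integration runs over a closed interval.\<close>

lemma smooth_on_integral: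
 fixes F :: "'a::euclidean_space \<times> real => real"
 assumes "open U" "open Om" "U \<times> {0..1} \<subseteq> Om" "smooth_on Om F"
 shows "smooth_on U (%x. integral {0..1} (%t. F (x, t)))"
proof (rule smooth_onI)
 fix n show "ndiff_on n U (%x. integral {0..1} (%t. F (x, t)))" using assms(4)
 proof (induction n arbitrary: F)
  case (Suc n)
  have d: "((%x. integral {0..1} (%t. F (x, t))) has_derivative
    (%h. integral {0..1} (%t. pd (h, 0) F (x0, t)))) (at x0)" if x0: "x0 \<in> U" for x0
  proof -
   obtain e where e: "e > 0" "ball x0 e \<subseteq> U" using assms(1) x0 open_contains_ball by blast
   define B where "B = ball x0 e"
   define fx where "fx x t = Blinfun (%h. pd (h, 0) F (x, t))" for x t
   have inOm: "(x, t) \<in> Om" if "x \<in> B" "t \<in> {0..1}" for x t using that e assms(3) unfolding B_def by blast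
   have hd: "((%x. F (x, t)) has_derivative (%h. pd (h, 0) F (x, t))) (at x)" if "x \<in> B" "t \<in> {0..1}" for x t
   proof -
    have "((%x. (x, t)) has_derivative (%h. (h, 0))) (at x)" by (auto intro!: derivative_eq_intros)
    from diff_chain_at[OF this smooth_on_has_derivative[OF Suc.prems assms(2) inOm[OF that]]]
    show ?thesis by (simp add: o_def)
   qed
   have fx: "blinfun_apply (fx x t) = (%h. pd (h, 0) F (x, t))" if "x \<in> B" "t \<in> {0..1}" for x t
    unfolding fx_def by (rule bounded_linear_Blinfun_apply[OF has_derivative_bounded_linear[OF hd[OF that]]])
   have cF: "continuous_on (B \<times> {0..1}) G" if "continuous_on Om G" for G :: "'a \<times> real => real"
    using that continuous_on_subset inOm by (metis SigmaE subsetI)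
   have c1: "continuous_on {0..1} (%t. F (x, t))" if "x \<in> B" for x
    by (rule continuous_on_compose2[OF cF[OF smooth_on_imp_continuous_on[OF Suc.prems]]])
     (use that in \<open>auto intro!: continuous_intros\<close>)
   have cfx: "continuous_on (B \<times> cbox 0 1) (%(x, t). fx x t)"
   proof (rule continuous_on_blinfun_componentwise)
    fix i :: 'a
    have "continuous_on (B \<times> cbox 0 1) (pd (i, 0) F)" unfolding interval_cbox[symmetric]
     by (rule cF[OF smooth_on_imp_continuous_on[OF smooth_on_pd[OF assms(2) Suc.prems]]])
    then show "continuous_on (B \<times> cbox 0 1) (%z. blinfun_apply (case z of (x, t) => fx x t) i)"
     by (rule continuous_on_eq) (auto simp: fx)
   qed
   have "((%x. integral (cbox 0 1) (%t. F (x, t))) has_derivative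
     blinfun_apply (integral (cbox 0 1) (fx x0))) (at x0 within B)"
   proof (rule leibniz_rule[where fx=fx])
    show "((%x. F (x, t)) has_derivative blinfun_apply (fx x t)) (at x within B)" if "x \<in> B" "t \<in> cbox 0 1" for x t
    proof -
     have t: "t \<in> {0..1}" using that by simp
     show ?thesis unfolding fx[OF that(1) t] by (rule has_derivative_at_withinI[OF hd[OF that(1) t]])
    qed
    show "(%t. F (x, t)) integrable_on cbox 0 1" if "x \<in> B" for x
     using integrable_continuous_interval[OF c1[OF that]] by simp
    show "continuous_on (B \<times> cbox 0 1) (%(x, t). fx x t)" by (rule cfx)
    show "x0 \<in> B" "convex B" using e by (auto simp: B_def)
   qed
   moreover have "blinfun_apply (integral (cbox 0 1) (fx x0)) h = integral {0..1} (%t. pd (h, 0) F (x0, t))" for h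
   proof -
    have x0B: "x0 \<in> B" using e by (simp add: B_def)
    have "continuous_on {0..1} (fx x0)"
     using continuous_on_compose2[OF cfx continuous_on_Pair[OF continuous_on_const continuous_on_id], of x0 "{0..1}"] x0B
     by auto
    then have "fx x0 integrable_on cbox 0 1" by (simp add: integrable_continuous_interval)
    then have "blinfun_apply (integral (cbox 0 1) (fx x0)) h = integral (cbox 0 1) (%t. blinfun_apply (fx x0 t) h)"
     using integral_linear[of "fx x0" "cbox 0 1" "%f. blinfun_apply f h"] by (simp add: o_def blinfun.bounded_linear_left)
    also have "\<dots> = integral {0..1} (%t. pd (h, 0) F (x0, t))" by (auto intro!: integral_cong simp: fx[OF x0B])
    finally show ?thesis .
   qed
   ultimately show ?thesis using at_within_open[of x0 B] e by (simp add: B_def) (metis (no_types, lifting) ext)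
  qed
  have "ndiff_on n U (pd b (%x. integral {0..1} (%t. F (x, t))))" for b
   using Suc.IH[OF smooth_on_pd[OF assms(2) Suc.prems], of "(b, 0)"]
    ndiff_on_cong[OF assms(1), of "pd b (%x. integral {0..1} (%t. F (x, t)))"
     "%x. integral {0..1} (%t. pd (b, 0) F (x, t))"] pd_eqI[OF d] by blast
  moreover have "(%x. integral {0..1} (%t. F (x, t))) differentiable_on U"
   by (rule differentiable_on_openI, rule differentiableI[OF d])
  ultimately show ?case by simp
 qed simp
qed

lemma taylor1_integral:
 fixes phi :: "real => real"
 assumes "!!t. t \<in> {0..1} ==> (phi has_real_derivative phi' t) (at t)"
 shows "phi 1 = phi 0 + integral {0..1} phi'"
proof -
 have "(phi' has_integral phi 1 - phi 0) {0..1}" using assms by (intro fundamental_theorem_of_calculus)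
   (auto simp: has_real_derivative_iff_has_vector_derivative intro: has_vector_derivative_at_within)
 then show ?thesis by (simp add: integral_unique)
qed

text \<open>The function (1 - t) phi' + phi is a primitive of (1 - t) phi''.\<close>

lemma taylor2_integral:
 fixes phi :: "real => real"
 assumes "!!t. t \<in> {0..1} ==> (phi has_real_derivative phi' t) (at t)"
  and "!!t. t \<in> {0..1} ==> (phi' has_real_derivative phi'' t) (at t)"
 shows "phi 1 = phi 0 + phi' 0 + integral {0..1} (%t. (1 - t) * phi'' t)"
proof -
 have "((%t. (1 - t) * phi' t + phi t) has_real_derivative (1 - t) * phi'' t) (at t)" if "t \<in> {0..1}" for t
  using assms[OF that] by (auto intro!: derivative_eq_intros)
 from taylor1_integral[OF this] show ?thesis by simp
qed

lemma pd_slice: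
 fixes F :: "'a::real_normed_vector \<times> 'b::real_normed_vector => 'c::real_normed_vector"
 assumes "F differentiable (at (p, eps))"
 shows "pd v (%p. F (p, eps)) p = pd (v, 0) F (p, eps)"
proof -
 have "((%p. (p, eps)) has_derivative (%h. (h, 0))) (at p)" by (auto intro!: derivative_eq_intros)
 from diff_chain_at[OF this has_derivative_pd[OF assms]] show ?thesis by (intro pd_eqI) (simp add: o_def)
qed

lemma open_slice: "open W ==> open {p. (p, eps) \<in> W}"
 by (rule open_vimage[of W "%p. (p, eps)", unfolded vimage_def]) (auto intro!: continuous_intros)

lemma smooth_on_slice:
 assumes "open W" "smooth_on W F" shows "smooth_on {p. (p, eps) \<in> W} (%p. F (p, eps))"
 by (rule smooth_on_compose[OF assms(2) _ open_slice[OF assms(1)] assms(1)]) (auto intro!: smooth_intros open_slice[OF assms(1)])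

lemma partials_slice:
 assumes "open W" "smooth_on W F" "(p, eps) \<in> W"
 shows "partials vs (%p. F (p, eps)) p = partials (map (%v. (v, 0)) vs) F (p, eps)" using assms(3)
proof (induction vs arbitrary: p)
 case (Cons v vs)
 have "pd v (partials vs (%p. F (p, eps))) p = pd v (%p. partials (map (%v. (v, 0)) vs) F (p, eps)) p"
  by (rule pd_cong_open[OF open_slice[OF assms(1)]]) (use Cons in auto)
 also have "\<dots> = pd (v, 0) (partials (map (%v. (v, 0)) vs) F) (p, eps)"
  by (rule pd_slice[OF smooth_on_differentiable[OF smooth_on_partials[OF assms(1,2)] assms(1) Cons.prems]])
 finally show ?case by (simp add: partials_Cons_pd del: partials.simps(2))
qed simp

subsection \<open>Contact with lines\<close>

lemma deriv_cong_open:
 assumes "open T" "t \<in> T" "!!s. s \<in> T ==> f s = g s"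
 shows "deriv f t = deriv g t" by (rule deriv_cong_ev[OF _ refl]) (use assms eventually_nhds in blast)

text \<open>The affine term affects orders 0 and 1 only. From order 2 on, contact with a line is the
  vanishing of repeated derivatives in one direction.\<close>

lemma deriv_pow_line:
 fixes g :: "'a::euclidean_space => real"
 assumes "open U" "smooth_on U g" "p + t *. v \<in> U"
 shows "(deriv ^^ j) (%t. g (p + t *. v) - (c + t * d)) t =
  partials (replicate j v) g (p + t *. v) - (if j = 0 then c + t * d else if j = 1 then d else 0)" using assms(3)
proof (induction j arbitrary: t)
 case (Suc j)
 define T where "T = {t. p + t *. v \<in> U}"
 have "open T" unfolding T_def by (rule open_vimage[of U "%t. p + t *. v", unfolded vimage_def])
   (auto intro!: assms continuous_intros)
 define r where "r t = (if j = 0 then c + t * d else if j = 1 then d else 0)" for t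
 have "(deriv ^^ Suc j) (%t. g (p + t *. v) - (c + t * d)) t =
   deriv (%t. partials (replicate j v) g (p + t *. v) - r t) t" unfolding funpow.simps o_apply r_def
  by (rule deriv_cong_open[OF \<open>open T\<close>]) (use Suc T_def in auto)
 also have "\<dots> = pd v (partials (replicate j v) g) (p + t *. v) - (if j = 0 then d else 0)"
 proof (rule DERIV_imp_deriv, rule DERIV_diff)
  show "((%t. partials (replicate j v) g (p + t *. v)) has_real_derivative
    pd v (partials (replicate j v) g) (p + t *. v)) (at t)"
   using smooth_on_differentiable[OF smooth_on_partials[OF assms(1,2)] assms(1) Suc.prems] by (rule pd_along_line_real)
  show "(r has_real_derivative (if j = 0 then d else 0)) (at t)"
   unfolding r_def[abs_def] by (cases "j = 0") (auto intro!: derivative_eq_intros)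
 qed
 finally show ?case by (simp add: partials_Cons_pd del: partials.simps(2))
qed simp

lemma line_contact_iff:
 assumes "open U" "smooth_on U g" "p \<in> U"
 shows "line_contact k g p v \<longleftrightarrow> (\<forall>j. 2 \<le> j \<and> j < k --> partials (replicate j v) g p = 0)"
proof -
 have "(deriv ^^ j) (%t. g (p + t *. v) - (g p + t * frechet_derivative g (at p) v)) 0 = 0 \<longleftrightarrow>
   (2 \<le> j --> partials (replicate j v) g p = 0)" for j
 proof -
  have "j = 0 \<or> j = 1 \<or> 2 \<le> j" by linarith
  then show ?thesis using deriv_pow_line[OF assms(1,2), of p 0 v j "g p" "frechet_derivative g (at p) v"] assms(3) by auto
 qed
 then show ?thesis unfolding line_contact_def by auto
qed

subsection \<open>Common roots of a quadratic and a cubic form\<close>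

text \<open>As a function of the slope r the quadratic form is a20 + 2 a11 r + a02 r^2. Its roots
  are \<open>root_mid\<close> plus and minus a square root of \<open>half_gap_sq\<close>, which is
  the reduced discriminant divided by a02^2.\<close>

definition root_mid :: "real => real => real" where
 "root_mid a11 a02 = - a11 / a02"

definition half_gap_sq :: "real => real => real => real" where
 "half_gap_sq a20 a11 a02 = (a11\<^sup>2 - a20 * a02) / a02\<^sup>2"

text \<open>Modulo \<open>sig\<^sup>2 = Z\<close>, the cubic form takes the value \<open>rem_const + rem_lin * sig\<close> at
 \<open>(1, m + sig)\<close>, where \<open>m\<close> and \<open>Z\<close> are the two quantities above.\<close>

definition rem_const :: "real => real => real => real => real => real => real" where
 "rem_const m Z a30 a21 a12 a03 =
  a30 + 3 * m * a21 + 3 * m\<^sup>2 * a12 + m ^ 3 * a03 + Z * (3 * a12 + 3 * m * a03)"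

definition rem_lin :: "real => real => real => real => real => real" where
 "rem_lin m Z a21 a12 a03 = 3 * a21 + 6 * m * a12 + 3 * m\<^sup>2 * a03 + Z * a03"

lemma quadratic_form_shift:
 fixes x sig :: "'a::{real_normed_field}"
 assumes "a02 ~= 0"
 shows "of_real a20 * x\<^sup>2 + 2 * of_real a11 * x * (x * (of_real (root_mid a11 a02) + sig))
   + of_real a02 * (x * (of_real (root_mid a11 a02) + sig))\<^sup>2
  = of_real a02 * x\<^sup>2 * (sig\<^sup>2 - of_real (half_gap_sq a20 a11 a02))"
proof -
 define m :: 'a where "m = of_real (root_mid a11 a02)"
 have a02: "(of_real a02 :: 'a) ~= 0" using assms by simp
 have "of_real a02 * m = - (of_real a11 :: 'a)" unfolding m_def root_mid_def using a02 by simp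
 moreover have "(of_real a02)\<^sup>2 * of_real (half_gap_sq a20 a11 a02) = ((of_real a11)\<^sup>2 - of_real a20 * of_real a02 :: 'a)"
  unfolding half_gap_sq_def using a02 by simp
 ultimately show ?thesis unfolding m_def[symmetric] using a02 by algebra
qed

lemma cubic_form_shift:
 fixes x sig :: "'a::{real_normed_field}"
 assumes "sig\<^sup>2 = of_real Z"
 shows "of_real a30 * x ^ 3 + 3 * of_real a21 * x\<^sup>2 * (x * (of_real m + sig))
   + 3 * of_real a12 * x * (x * (of_real m + sig))\<^sup>2 + of_real a03 * (x * (of_real m + sig)) ^ 3
  = x ^ 3 * (of_real (rem_const m Z a30 a21 a12 a03) + of_real (rem_lin m Z a21 a12 a03) * sig)"
 unfolding rem_const_def rem_lin_def of_real_add of_real_mult of_real_power assms[symmetric] of_real_numeral by algebra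

lemma common_root_real_iff:
 fixes A B Z :: real
 shows "(\<exists>sig. sig\<^sup>2 = Z \<and> A + B * sig = 0) \<longleftrightarrow> Z \<ge> 0 \<and> A\<^sup>2 = Z * B\<^sup>2"
proof
 assume "\<exists>sig. sig\<^sup>2 = Z \<and> A + B * sig = 0"
 then obtain sig where "Z = sig\<^sup>2" "A = - (B * sig)" by (metis add.inverse_inverse add_eq_0_iff)
 then show "Z \<ge> 0 \<and> A\<^sup>2 = Z * B\<^sup>2" by (simp add: power_mult_distrib)
next
 assume a: "Z \<ge> 0 \<and> A\<^sup>2 = Z * B\<^sup>2"
 show "\<exists>sig. sig\<^sup>2 = Z \<and> A + B * sig = 0"
 proof (cases "B = 0")
  case True then show ?thesis using a by (intro exI[of _ "sqrt Z"]) auto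
 next
  case False then show ?thesis using a by (intro exI[of _ "- A / B"]) (auto simp: power_divide)
 qed
qed

text \<open>If B is nonzero the only candidate -A/B is real. Complex roots matter only for B = 0,
  where A = 0 and any square root of Z will do; this is where the handle of the umbrella
  enters.\<close>

lemma common_root_complex_iff:
 fixes A B Z :: real
 shows "(\<exists>sig. sig\<^sup>2 = complex_of_real Z \<and> complex_of_real A + complex_of_real B * sig = 0) \<longleftrightarrow> A\<^sup>2 = Z * B\<^sup>2"
proof
 assume "\<exists>sig. sig\<^sup>2 = complex_of_real Z \<and> complex_of_real A + complex_of_real B * sig = 0"
 then obtain sig where "complex_of_real Z = sig\<^sup>2" "complex_of_real A = - (complex_of_real B * sig)"
  by (metis add.inverse_inverse add_eq_0_iff)
 then have "complex_of_real (A\<^sup>2) = complex_of_real (Z * B\<^sup>2)" by (simp add: power_mult_distrib)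
 then show "A\<^sup>2 = Z * B\<^sup>2" using of_real_eq_iff by blast
next
 assume a: "A\<^sup>2 = Z * B\<^sup>2"
 show "\<exists>sig. sig\<^sup>2 = complex_of_real Z \<and> complex_of_real A + complex_of_real B * sig = 0"
 proof (cases "B = 0")
  case True then show ?thesis using a by (intro exI[of _ "csqrt (of_real Z)"]) auto
 next
  case False
  then have "(- A / B)\<^sup>2 = Z" "A + B * (- A / B) = 0" using a by (auto simp: power_divide)
  then show ?thesis by (intro exI[of _ "of_real (- A / B)"]) (metis of_real_power of_real_add of_real_mult of_real_0)
 qed
qed

lemma twist_eq:
 assumes "open U" "smooth_on U g" "p \<in> U"
 defines "gx \<equiv> pd (1,0) g p" and "gy \<equiv> pd (0,1) g p"
  and "alp \<equiv> %v. pd v (pd (1,0) g) p" and "bet \<equiv> %v. pd v (pd (0,1) g) p"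
 shows "twist g p (a, b) =
  a * bet (a, b) - b * alp (a, b) + (a * gx + b * gy) * (gx * bet (a, b) - gy * alp (a, b))"
proof -
 have n: "normal_vec g x = (- pd (1,0) g x) *. axis 1 1 + (- pd (0,1) g x) *. axis 2 1 + axis 3 1" for x
  by (simp add: normal_vec_def vec_eq_iff forall_3 vector_3 axis_def pd_def)
 have nd: "(normal_vec g has_derivative (%v. (- alp v) *. axis 1 1 + (- bet v) *. axis 2 1)) (at p)"
  unfolding n[abs_def] alp_def bet_def
  by (auto intro!: derivative_eq_intros smooth_on_has_derivative[OF smooth_on_pd[OF assms(1,2)] assms(1,3)])
 have n': "frechet_derivative (normal_vec g) (at p) v = (- alp v) *. axis 1 1 + (- bet v) *. axis 2 1" for v
  using fun_cong[OF frechet_derivative_at[OF nd], of v] by simp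
 have "frechet_derivative g (at p) (a, b) = a * gx + b * gy"
 proof -
  have "(a, b) = a *. (1, 0) + b *. (0, 1::real)" by simp
  then show ?thesis using pd_linear(1)[OF smooth_on_differentiable[OF assms(2,1,3)], of a "(1,0)" b "(0,1)"]
   unfolding gx_def gy_def pd_def by simp
 qed
 then show ?thesis unfolding twist_def n' n gx_def[symmetric] gy_def[symmetric]
  by (simp add: det_3 vector_3 axis_def algebra_simps)
qed

text \<open>The hypothesis says that (alp, bet) is orthogonal to (a, b), as holds along an
  asymptotic direction. The gradient terms then multiply the twist by the positive factor 1 +
  dg(v)^2 / |v|^2, so its sign is read off the Hessian alone.\<close>

lemma twist_sign:
 fixes a b alp bet gx gy :: real
 assumes "(a, b) ~= (0, 0)" "a * alp + b * bet = 0"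
 shows "sgn (a * bet - b * alp + (a * gx + b * gy) * (gx * bet - gy * alp)) = sgn (a * bet - b * alp)"
proof -
 have pos: "a\<^sup>2 + b\<^sup>2 > 0" using assms(1) by (simp add: sum_power2_gt_zero_iff)
 have e: "(a * bet - b * alp + (a * gx + b * gy) * (gx * bet - gy * alp)) * (a\<^sup>2 + b\<^sup>2) =
   (a * bet - b * alp) * (a\<^sup>2 + b\<^sup>2 + (a * gx + b * gy)\<^sup>2)" using assms(2) by algebra
 have "a\<^sup>2 + b\<^sup>2 + (a * gx + b * gy)\<^sup>2 > 0" using pos by (simp add: add_pos_nonneg)
 with pos arg_cong[OF e, of sgn] show ?thesis unfolding sgn_mult by (simp only: sgn_pos mult_1_right)
qed

subsection \<open>Families of graphs in a coordinate frame\<close>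

text \<open>The frame is the standard basis in either order. At a parabolic point with one
  asymptotic direction some diagonal entry of the Hessian is nonzero, and the order is chosen to
  make it the one along e'. In \<open>g21\<close> and its companions the digits count derivatives
  along e and e'.\<close>

locale graph_family =
 fixes W :: "(plane \<times> real) set" and f :: "real => plane => real" and e e' :: plane
 assumes openW: "open W" and smoothF: "smooth_on W (%(p, eps). f eps p)"
  and frame: "e = (1,0) \<and> e' = (0,1) \<or> e = (0,1) \<and> e' = (1,0)"
begin

definition F :: "plane \<times> real => real" where "F = (%(p, eps). f eps p)"
definition g20 where "g20 = pd (e,0) (pd (e,0) F)"
definition g11 where "g11 = pd (e,0) (pd (e',0) F)"
definition g02 where "g02 = pd (e',0) (pd (e',0) F)"
definition g30 where "g30 = pd (e,0) (pd (e,0) (pd (e,0) F))"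
definition g21 where "g21 = pd (e,0) (pd (e,0) (pd (e',0) F))"
definition g12 where "g12 = pd (e,0) (pd (e',0) (pd (e',0) F))"
definition g03 where "g03 = pd (e',0) (pd (e',0) (pd (e',0) F))"

lemma smooth_F: "smooth_on W F" using smoothF by (simp add: F_def)

lemma smooth_g: "smooth_on W g20" "smooth_on W g11" "smooth_on W g02"
 "smooth_on W g30" "smooth_on W g21" "smooth_on W g12" "smooth_on W g03"
 unfolding g20_def g11_def g02_def g30_def g21_def g12_def g03_def by (intro smooth_on_pd openW smooth_F)+

lemma diff_g: "smooth_on W G ==> w \<in> W ==> G differentiable (at w)" using smooth_on_differentiable openW by blast

lemma frame_expand: "v = (v \<bullet> e) *. e + (v \<bullet> e') *. e'"
 using frame by (cases v) (auto simp: inner_Pair)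

lemma frame_inner: "(a *. e + b *. e') \<bullet> e = a" "(a *. e + b *. e') \<bullet> e' = b"
 using frame by (auto simp: inner_Pair)

lemma frame_eq_0: "a *. e + b *. e' = 0 \<longleftrightarrow> a = 0 \<and> b = 0"
 using frame_inner[of a b] by (metis add.right_neutral inner_zero_left scaleR_zero_left)

lemma pd_frame:
 fixes G :: "plane \<times> real => real"
 assumes "G differentiable (at w)"
 shows "pd (a *. e + b *. e', 0) G w = a * pd (e, 0) G w + b * pd (e', 0) G w"
proof -
 have "(a *. e + b *. e', 0::real) = a *. (e, 0) + b *. (e', 0)" by simp
 then show ?thesis using pd_linear(1)[OF assms, of a "(e, 0)" b "(e', 0)"] by simp
qed

lemma pd_g:
 assumes "w \<in> W"
 shows "pd (e',0) (pd (e,0) F) w = g11 w"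
  "pd (e,0) g20 w = g30 w" "pd (e',0) g20 w = g21 w" "pd (e,0) g11 w = g21 w" "pd (e',0) g11 w = g12 w"
  "pd (e,0) g02 w = g12 w" "pd (e',0) g02 w = g03 w"
  "pd (e',0) (pd (e',0) (pd (e,0) F)) w = g12 w"
proof -
 have 1: "pd (e',0) (pd (e,0) F) w = g11 w" if "w \<in> W" for w unfolding g11_def by (rule pd_commute[OF openW smooth_F that])
 show "pd (e',0) (pd (e,0) F) w = g11 w" by (rule 1[OF assms])
 show "pd (e,0) g20 w = g30 w" "pd (e,0) g11 w = g21 w" "pd (e,0) g02 w = g12 w" "pd (e',0) g02 w = g03 w"
  by (simp_all add: g20_def g30_def g11_def g21_def g02_def g12_def g03_def)
 show 2: "pd (e',0) g11 w = g12 w" unfolding g11_def g12_def by (rule pd_commute[OF openW smooth_on_pd[OF openW smooth_F] assms])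
 have "pd (e',0) g20 w = pd (e,0) (pd (e',0) (pd (e,0) F)) w"
  unfolding g20_def by (rule pd_commute[OF openW smooth_on_pd[OF openW smooth_F] assms])
 also have "\<dots> = g21 w" using pd_cong_open[OF openW assms 1, where v="(e,0)"] by (simp add: g21_def g11_def)
 finally show "pd (e',0) g20 w = g21 w" .
 show "pd (e',0) (pd (e',0) (pd (e,0) F)) w = g12 w" using pd_cong_open[OF openW assms 1, where v="(e',0)"] 2 by simp
qed

lemma second_form:
 assumes "w \<in> W" "v = a *. e + b *. e'"
 shows "pd (v,0) (pd (v,0) F) w = g20 w * a\<^sup>2 + 2 * g11 w * a * b + g02 w * b\<^sup>2"
proof -
 have "pd (v,0) (pd (v,0) F) w = pd (v,0) (%w. a * pd (e,0) F w + b * pd (e',0) F w) w"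
  using assms(1) by (rule pd_cong_open[OF openW]) (simp add: assms(2) pd_frame diff_g smooth_F)
 also have "\<dots> = a * pd (v,0) (pd (e,0) F) w + b * pd (v,0) (pd (e',0) F) w"
  by (rule pd_eqI) (auto intro!: derivative_eq_intros has_derivative_pd diff_g smooth_on_pd openW smooth_F assms(1))
 also have "\<dots> = a * (a * g20 w + b * g11 w) + b * (a * g11 w + b * g02 w)" unfolding assms(2) using pd_g(1)[OF assms(1)]
  by (simp add: pd_frame diff_g smooth_on_pd openW smooth_F assms(1)) (simp add: g20_def g11_def g02_def)
 finally show ?thesis by (simp add: algebra_simps power2_eq_square)
qed

lemma third_form:
 assumes "w \<in> W" "v = a *. e + b *. e'"
 shows "pd (v,0) (pd (v,0) (pd (v,0) F)) w = g30 w * a ^ 3 + 3 * g21 w * a\<^sup>2 * b + 3 * g12 w * a * b\<^sup>2 + g03 w * b ^ 3"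
proof -
 have "pd (v,0) (pd (v,0) (pd (v,0) F)) w = pd (v,0) (%w. g20 w * a\<^sup>2 + 2 * g11 w * a * b + g02 w * b\<^sup>2) w"
  using assms(1) by (rule pd_cong_open[OF openW]) (rule second_form[OF _ assms(2)])
 also have "\<dots> = pd (v,0) g20 w * a\<^sup>2 + 2 * pd (v,0) g11 w * a * b + pd (v,0) g02 w * b\<^sup>2"
  by (rule pd_eqI) (auto intro!: derivative_eq_intros has_derivative_pd diff_g smooth_g assms(1))
 also have "\<dots> = (a * g30 w + b * g21 w) * a\<^sup>2 + 2 * (a * g21 w + b * g12 w) * a * b + (a * g12 w + b * g03 w) * b\<^sup>2"
  unfolding assms(2) by (simp add: pd_frame diff_g smooth_g assms(1) pd_g)
 finally show ?thesis by algebra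
qed

lemma slice_partials:
 "(p, eps) \<in> W ==> partials vs (f eps) p = partials (map (%v. (v, 0)) vs) F (p, eps)"
 using partials_slice[OF openW smooth_F] by (simp add: F_def)

lemma slice_pd:
 assumes "(p, eps) \<in> W"
 shows "pd v (pd u (f eps)) p = pd (v,0) (pd (u,0) F) (p, eps)"
  "pd v (pd u (pd u' (f eps))) p = pd (v,0) (pd (u,0) (pd (u',0) F)) (p, eps)"
 using slice_partials[OF assms, of "[v, u]"] slice_partials[OF assms, of "[v, u, u']"]
 by (simp_all add: partials_Cons_pd del: partials.simps(2))

lemma slice_open: "open {p. (p, eps) \<in> W}" by (rule open_slice[OF openW])

lemma slice_smooth: "smooth_on {p. (p, eps) \<in> W} (f eps)" using smooth_on_slice[OF openW smooth_F] by (simp add: F_def)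

lemma line_contact_3:
 assumes "(p, eps) \<in> W" "v = a *. e + b *. e'"
 shows "line_contact 3 (f eps) p v \<longleftrightarrow>
  g20 (p,eps) * a\<^sup>2 + 2 * g11 (p,eps) * a * b + g02 (p,eps) * b\<^sup>2 = 0"
proof -
 have j: "2 \<le> j \<and> j < 3 \<longleftrightarrow> j = 2" for j :: nat by auto
 show ?thesis unfolding line_contact_iff[OF slice_open slice_smooth, of p eps, simplified, OF assms(1)] j
  using second_form[OF assms] slice_pd[OF assms(1)] by (simp add: numeral_2_eq_2 partials_Cons_pd del: partials.simps(2))
qed

lemma line_contact_4:
 assumes "(p, eps) \<in> W" "v = a *. e + b *. e'"
 shows "line_contact 4 (f eps) p v \<longleftrightarrow>
  g20 (p,eps) * a\<^sup>2 + 2 * g11 (p,eps) * a * b + g02 (p,eps) * b\<^sup>2 = 0 \<and>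
  g30 (p,eps) * a ^ 3 + 3 * g21 (p,eps) * a\<^sup>2 * b + 3 * g12 (p,eps) * a * b\<^sup>2 + g03 (p,eps) * b ^ 3 = 0"
proof -
 have j: "2 \<le> j \<and> j < 4 \<longleftrightarrow> j = 2 \<or> j = 3" for j :: nat by auto
 show ?thesis unfolding line_contact_iff[OF slice_open slice_smooth, of p eps, simplified, OF assms(1)] j
  using second_form[OF assms] third_form[OF assms] slice_pd[OF assms(1)]
  by (auto simp: numeral_2_eq_2 numeral_3_eq_3 partials_Cons_pd simp del: partials.simps(2))
qed

lemma hess_det_eq:
 assumes "(p, eps) \<in> W"
 shows "hess_det (f eps) p = g20 (p,eps) * g02 (p,eps) - (g11 (p,eps))\<^sup>2" using frame pd_g(1)[OF assms]
 unfolding hess_det_def partials_Cons_pd partials.simps(1) slice_pd[OF assms] by (auto simp: g20_def g11_def g02_def)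

text \<open>\<open>cu\<close> and \<open>cv\<close> are the complex coordinates relative to the
  frame, and \<open>cw\<close> is the inverse; they give both orders of the axes the same
  formulas.\<close>

definition cu :: "complex \<times> complex => complex" where
 "cu w = of_real (fst e) * fst w + of_real (snd e) * snd w"
definition cv :: "complex \<times> complex => complex" where
 "cv w = of_real (fst e') * fst w + of_real (snd e') * snd w"

lemma cuv_eq_0: "w = 0 \<longleftrightarrow> cu w = 0 \<and> cv w = 0"
 using frame by (cases w) (auto simp: cu_def cv_def zero_prod_def)

definition cw :: "complex => complex => complex \<times> complex" where
 "cw a b = (of_real (fst e) * a + of_real (fst e') * b, of_real (snd e) * a + of_real (snd e') * b)"

lemma cuv_cw: "cu (cw a b) = a" "cv (cw a b) = b" using frame by (auto simp: cu_def cv_def cw_def)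

lemma jet_form_2:
 assumes "(p, eps) \<in> W"
 shows "jet_form 2 (f eps) p w = of_real (g20 (p,eps)) * (cu w)\<^sup>2 + 2 * of_real (g11 (p,eps)) * cu w * cv w
  + of_real (g02 (p,eps)) * (cv w)\<^sup>2" using frame pd_g(1)[OF assms]
 unfolding jet_form_def slice_partials[OF assms] cu_def cv_def
 by (auto simp: numeral_2_eq_2 partials_Cons_pd g20_def g11_def g02_def power2_eq_square simp del: partials.simps(2))

lemma jet_form_3:
 assumes "(p, eps) \<in> W"
 shows "jet_form 3 (f eps) p w = of_real (g30 (p,eps)) * (cu w) ^ 3 + 3 * of_real (g21 (p,eps)) * (cu w)\<^sup>2 * cv w
  + 3 * of_real (g12 (p,eps)) * cu w * (cv w)\<^sup>2 + of_real (g03 (p,eps)) * (cv w) ^ 3" using frame pd_g(3,8)[OF assms]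
 unfolding jet_form_def slice_partials[OF assms] cu_def cv_def
 by (auto simp: numeral_3_eq_3 numeral_2_eq_2 partials_Cons_pd g20_def g30_def g21_def g12_def g03_def
   simp del: partials.simps(2))

text \<open>Here e' is not asymptotic, so every asymptotic direction is a multiple of e plus a slope
  times e', and the slopes are the roots of a genuine quadratic.\<close>

definition W1 where "W1 = {w \<in> W. g02 w ~= 0}"
definition mm where "mm w = root_mid (g11 w) (g02 w)"
definition ZZ where "ZZ w = half_gap_sq (g20 w) (g11 w) (g02 w)"
definition AA where "AA w = rem_const (mm w) (ZZ w) (g30 w) (g21 w) (g12 w) (g03 w)"
definition BB where "BB w = rem_lin (mm w) (ZZ w) (g21 w) (g12 w) (g03 w)"

lemma W1_W: "w \<in> W1 ==> w \<in> W" "w \<in> W1 ==> g02 w ~= 0" by (auto simp: W1_def)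

lemma openW1: "open W1"
proof -
 have "W1 = W \<inter> g02 -` (- {0})" by (auto simp: W1_def)
 then show ?thesis using continuous_open_preimage[OF smooth_on_imp_continuous_on[OF smooth_g(3)] openW, of "- {0}"] by auto
qed

lemma smooth1: "smooth_on W1 mm" "smooth_on W1 ZZ" "smooth_on W1 AA" "smooth_on W1 BB"
proof -
 have sub: "W1 \<subseteq> W" by (auto simp: W1_def)
 note s = smooth_g[THEN smooth_on_subset, OF sub]
 show m: "smooth_on W1 mm" unfolding mm_def root_mid_def by (intro smooth_on_divide smooth_on_minus openW1 s) (auto simp: W1_def)
 show z: "smooth_on W1 ZZ" unfolding ZZ_def half_gap_sq_def
  by (intro smooth_on_divide smooth_intros openW1 s) (auto simp: W1_def)
 show "smooth_on W1 AA" "smooth_on W1 BB" unfolding AA_def BB_def rem_const_def rem_lin_def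
  by (intro smooth_intros openW1 s m z)+
qed

lemma real_root_form:
 assumes "w \<in> W1"
 shows "g20 w * a\<^sup>2 + 2 * g11 w * a * (a * (mm w + sig)) + g02 w * (a * (mm w + sig))\<^sup>2 = g02 w * a\<^sup>2 * (sig\<^sup>2 - ZZ w)"
  "sig\<^sup>2 = ZZ w ==> g30 w * a ^ 3 + 3 * g21 w * a\<^sup>2 * (a * (mm w + sig)) + 3 * g12 w * a * (a * (mm w + sig))\<^sup>2
   + g03 w * (a * (mm w + sig)) ^ 3 = a ^ 3 * (AA w + BB w * sig)"
 using quadratic_form_shift[OF W1_W(2)[OF assms], of "g20 w" a "g11 w" sig]
  cubic_form_shift[of sig "ZZ w" "g30 w" a "g21 w" "mm w" "g12 w" "g03 w"] by (auto simp: mm_def ZZ_def AA_def BB_def)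

lemma complex_root_form:
 assumes "w \<in> W1"
 shows "of_real (g20 w) * a\<^sup>2 + 2 * of_real (g11 w) * a * (a * (of_real (mm w) + sig))
   + of_real (g02 w) * (a * (of_real (mm w) + sig))\<^sup>2 = of_real (g02 w) * a\<^sup>2 * (sig\<^sup>2 - complex_of_real (ZZ w))"
  "sig\<^sup>2 = complex_of_real (ZZ w) ==> of_real (g30 w) * a ^ 3 + 3 * of_real (g21 w) * a\<^sup>2 * (a * (of_real (mm w) + sig))
   + 3 * of_real (g12 w) * a * (a * (of_real (mm w) + sig))\<^sup>2
   + of_real (g03 w) * (a * (of_real (mm w) + sig)) ^ 3 = a ^ 3 * (of_real (AA w) + of_real (BB w) * sig)"
 using quadratic_form_shift[OF W1_W(2)[OF assms], of "g20 w" a "g11 w" sig]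
  cubic_form_shift[of sig "ZZ w" "g30 w" a "g21 w" "mm w" "g12 w" "g03 w"] by (auto simp: mm_def ZZ_def AA_def BB_def)

lemma asymptotic_iff:
 assumes "(p, eps) \<in> W1"
 shows "asymptotic (f eps) p v \<longleftrightarrow>
  (\<exists>a sig. a ~= 0 \<and> v = a *. e + (a * (mm (p,eps) + sig)) *. e' \<and> sig\<^sup>2 = ZZ (p,eps))"
proof
 assume as: "asymptotic (f eps) p v"
 define a b where "a = v \<bullet> e" and "b = v \<bullet> e'"
 have v: "v = a *. e + b *. e'" unfolding a_def b_def by (rule frame_expand)
 have q: "g20 (p,eps) * a\<^sup>2 + 2 * g11 (p,eps) * a * b + g02 (p,eps) * b\<^sup>2 = 0" and "v ~= 0"
  using as line_contact_3[OF W1_W(1)[OF assms] v] by (auto simp: asymptotic_def)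
 have a0: "a ~= 0"
 proof
  assume "a = 0" then have "b = 0" using q W1_W(2)[OF assms] by simp
  then show False using \<open>a = 0\<close> v \<open>v ~= 0\<close> by simp
 qed
 define sig where "sig = b / a - mm (p,eps)"
 have b: "b = a * (mm (p,eps) + sig)" using a0 by (simp add: sig_def)
 have "sig\<^sup>2 = ZZ (p,eps)" using q real_root_form(1)[OF assms, of a sig] a0 W1_W(2)[OF assms] by (simp add: b)
 then show "\<exists>a sig. a ~= 0 \<and> v = a *. e + (a * (mm (p,eps) + sig)) *. e' \<and> sig\<^sup>2 = ZZ (p,eps)"
  using a0 v b by blast
next
 assume "\<exists>a sig. a ~= 0 \<and> v = a *. e + (a * (mm (p,eps) + sig)) *. e' \<and> sig\<^sup>2 = ZZ (p,eps)"
 then obtain a sig where a: "a ~= 0" "v = a *. e + (a * (mm (p,eps) + sig)) *. e'" "sig\<^sup>2 = ZZ (p,eps)" by blast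
 then show "asymptotic (f eps) p v"
  unfolding asymptotic_def using line_contact_3[OF W1_W(1)[OF assms] a(2)] real_root_form(1)[OF assms, of a sig]
  by (simp add: frame_eq_0)
qed

lemma contact_4_iff:
 assumes "(p, eps) \<in> W1" "a ~= 0" "v = a *. e + (a * (mm (p,eps) + sig)) *. e'" "sig\<^sup>2 = ZZ (p,eps)"
 shows "line_contact 4 (f eps) p v \<longleftrightarrow> AA (p,eps) + BB (p,eps) * sig = 0"
 using line_contact_4[OF W1_W(1)[OF assms(1)] assms(3)] real_root_form[OF assms(1), where a=a and sig=sig] assms(2,4) by simp

lemma real_flecnodal_iff:
 assumes "(p, eps) \<in> W1"
 shows "p \<in> real_flecnodal_curve (f eps) \<longleftrightarrow> ZZ (p,eps) \<ge> 0 \<and> (AA (p,eps))\<^sup>2 = ZZ (p,eps) * (BB (p,eps))\<^sup>2"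
proof -
 have "p \<in> real_flecnodal_curve (f eps) \<longleftrightarrow> (\<exists>sig. sig\<^sup>2 = ZZ (p,eps) \<and> AA (p,eps) + BB (p,eps) * sig = 0)" (is "_ \<longleftrightarrow> ?R")
 proof
  assume "p \<in> real_flecnodal_curve (f eps)"
  then obtain v where "asymptotic (f eps) p v" "line_contact 4 (f eps) p v" by (auto simp: real_flecnodal_curve_def)
  then show ?R using asymptotic_iff[OF assms] contact_4_iff[OF assms] by blast
 next
  assume ?R
  then obtain sig where s: "sig\<^sup>2 = ZZ (p,eps)" "AA (p,eps) + BB (p,eps) * sig = 0" by blast
  let ?v = "1 *. e + (1 * (mm (p,eps) + sig)) *. e'"
  have "asymptotic (f eps) p ?v" using s asymptotic_iff[OF assms] by (metis zero_neq_one)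
  moreover have "line_contact 4 (f eps) p ?v" using contact_4_iff[OF assms _ refl s(1), of 1] s by simp
  ultimately show "p \<in> real_flecnodal_curve (f eps)" unfolding real_flecnodal_curve_def by blast
 qed
 then show ?thesis by (simp add: common_root_real_iff)
qed

lemma complex_asymptotic_root:
 assumes "(p, eps) \<in> W1" "w ~= 0" "jet_form 2 (f eps) p w = 0"
 obtains sig where "cu w ~= 0" "sig\<^sup>2 = complex_of_real (ZZ (p,eps))"
  "jet_form 3 (f eps) p w = (cu w) ^ 3 * (of_real (AA (p,eps)) + of_real (BB (p,eps)) * sig)"
proof -
 note q = assms(3)[unfolded jet_form_2[OF W1_W(1)[OF assms(1)]]]
 have a0: "cu w ~= 0"
 proof
  assume "cu w = 0" then have "cv w = 0" using q W1_W(2)[OF assms(1)] by simp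
  then show False using \<open>cu w = 0\<close> assms(2) cuv_eq_0 by blast
 qed
 define sig where "sig = cv w / cu w - of_real (mm (p,eps))"
 have b: "cv w = cu w * (of_real (mm (p,eps)) + sig)" using a0 by (simp add: sig_def)
 have s: "sig\<^sup>2 = of_real (ZZ (p,eps))"
  using q complex_root_form(1)[OF assms(1), of "cu w" sig] a0 W1_W(2)[OF assms(1)] by (simp add: b)
 show ?thesis using that[OF a0 s] complex_root_form(2)[OF assms(1) s, of "cu w"]
  unfolding jet_form_3[OF W1_W(1)[OF assms(1)]] b[symmetric] by simp
qed

lemma jet_form_root:
 assumes "(p, eps) \<in> W1" "sig\<^sup>2 = complex_of_real (ZZ (p,eps))"
 shows "jet_form 2 (f eps) p (cw 1 (of_real (mm (p,eps)) + sig)) = 0"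
  "jet_form 3 (f eps) p (cw 1 (of_real (mm (p,eps)) + sig)) = of_real (AA (p,eps)) + of_real (BB (p,eps)) * sig"
  "cw 1 (of_real (mm (p,eps)) + sig) ~= 0"
 using complex_root_form(1)[OF assms(1), of 1 sig] complex_root_form(2)[OF assms(1,2), of 1] assms(2)
 unfolding jet_form_2[OF W1_W(1)[OF assms(1)]] jet_form_3[OF W1_W(1)[OF assms(1)]] cuv_cw by (auto simp: cuv_eq_0 cuv_cw)

lemma flecnodal_iff:
 assumes "(p, eps) \<in> W1"
 shows "p \<in> flecnodal_curve (f eps) \<longleftrightarrow> (AA (p,eps))\<^sup>2 = ZZ (p,eps) * (BB (p,eps))\<^sup>2"
proof -
 have "p \<in> flecnodal_curve (f eps) \<longleftrightarrow>
  (\<exists>sig. sig\<^sup>2 = complex_of_real (ZZ (p,eps)) \<and> complex_of_real (AA (p,eps)) + complex_of_real (BB (p,eps)) * sig = 0)" (is "_ \<longleftrightarrow> ?R")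
 proof
  assume "p \<in> flecnodal_curve (f eps)"
  then obtain w where "w ~= 0" "jet_form 2 (f eps) p w = 0" "jet_form 3 (f eps) p w = 0" by (auto simp: flecnodal_curve_def)
  then show ?R using complex_asymptotic_root[OF assms] by (metis mult_eq_0_iff power_eq_0_iff)
 next
  assume ?R then show "p \<in> flecnodal_curve (f eps)" unfolding flecnodal_curve_def using jet_form_root[OF assms] by fastforce
 qed
 then show ?thesis by (simp add: common_root_complex_iff)
qed

lemma hess_det_ZZ: "(p, eps) \<in> W1 ==> hess_det (f eps) p = - (g02 (p,eps))\<^sup>2 * ZZ (p,eps)"
 using W1_W[of "(p,eps)"] by (simp add: hess_det_eq ZZ_def half_gap_sq_def)

lemma gaussian_curvature_sgn:
 "elliptic_domain g = {p. hess_det g p > 0}" "hyperbolic_domain g = {p. hess_det g p < 0}"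
proof -
 have c: "(1 + (partials [(1,0)] g p)\<^sup>2 + (partials [(0,1)] g p)\<^sup>2)\<^sup>2 > 0" for p
  by (intro zero_less_power add_pos_nonneg) auto
 show "elliptic_domain g = {p. hess_det g p > 0}" "hyperbolic_domain g = {p. hess_det g p < 0}"
  unfolding elliptic_domain_def hyperbolic_domain_def gaussian_curvature_def pos_less_divide_eq[OF c] pos_divide_less_eq[OF c]
  by simp_all
qed

lemma domains_ZZ:
 assumes "(p, eps) \<in> W1"
 shows "p \<in> elliptic_domain (f eps) \<longleftrightarrow> ZZ (p,eps) < 0" "p \<in> hyperbolic_domain (f eps) \<longleftrightarrow> ZZ (p,eps) > 0"
  "p \<in> parabolic_curve (f eps) \<longleftrightarrow> ZZ (p,eps) = 0"
proof -
 have "(g02 (p,eps))\<^sup>2 > 0" using W1_W(2)[OF assms] by simp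
 then show "p \<in> elliptic_domain (f eps) \<longleftrightarrow> ZZ (p,eps) < 0" "p \<in> hyperbolic_domain (f eps) \<longleftrightarrow> ZZ (p,eps) > 0"
  "p \<in> parabolic_curve (f eps) \<longleftrightarrow> ZZ (p,eps) = 0"
  unfolding gaussian_curvature_sgn parabolic_curve_def mem_Collect_eq hess_det_ZZ[OF assms]
  by (auto simp: mult_less_0_iff zero_less_mult_iff)
qed

text \<open>Exchanging the two axes reverses the orientation and with it the sign of the
  twist.\<close>

definition orient :: real where "orient = (if e = (1,0) then 1 else -1)"

text \<open>The Hessian applied to v has e'-component \<open>a * g02 * sig\<close>, half the
  derivative of the quadratic at its root up to the factor a. The two simple roots therefore twist
  in opposite senses.\<close>

lemma twist_sgn:
 assumes "(p, eps) \<in> W1" "a ~= 0" "v = a *. e + (a * (mm (p,eps) + sig)) *. e'" "sig\<^sup>2 = ZZ (p,eps)"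
 shows "sgn (twist (f eps) p v) = sgn (orient * g02 (p,eps) * sig)"
proof -
 let ?w = "(p, eps)"
 note w = W1_W(1)[OF assms(1)]
 define U where "U = {p. (p, eps) \<in> W}"
 have U: "open U" "smooth_on U (f eps)" "p \<in> U" using slice_open slice_smooth w by (auto simp: U_def)
 have s2: "pd v (pd u (f eps)) p = pd (v,0) (pd (u,0) F) ?w" for v u
  using slice_partials[OF w, of "[v, u]"] by (simp add: partials_Cons_pd del: partials.simps(2))
 have fe: "pd (e,0) (pd (e,0) F) ?w = g20 ?w" "pd (e',0) (pd (e,0) F) ?w = g11 ?w"
  "pd (e,0) (pd (e',0) F) ?w = g11 ?w" "pd (e',0) (pd (e',0) F) ?w = g02 ?w"
  using pd_g(1)[OF w] by (simp_all add: g20_def g11_def g02_def)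
 define b where "b = a * (mm ?w + sig)"
 have ab: "pd (v,0) (pd (e,0) F) ?w = a * g20 ?w + b * g11 ?w" "pd (v,0) (pd (e',0) F) ?w = a * g11 ?w + b * g02 ?w"
  unfolding assms(3) b_def[symmetric] by (simp_all add: pd_frame diff_g smooth_on_pd openW smooth_F w fe)
 have q0: "a * (a * g20 ?w + b * g11 ?w) + b * (a * g11 ?w + b * g02 ?w) = 0"
  using real_root_form(1)[OF assms(1), of a sig] unfolding assms(4) b_def[symmetric]
  by (simp add: algebra_simps power2_eq_square)
 \<comment> \<open>The slope is measured from the midpoint of the roots, where the derivative of the
   quadratic vanishes.\<close>
 have gs: "a * g11 ?w + b * g02 ?w = a * (g02 ?w * sig)"
  unfolding b_def mm_def root_mid_def using W1_W(2)[OF assms(1)] by (simp add: field_simps)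
 have sa: "sgn (a * (a * (g02 ?w * sig)) - b * alp) = sgn (g02 ?w * sig)" if "a * alp + b * (a * (g02 ?w * sig)) = 0" for alp
 proof -
  have "a * (alp + b * (g02 ?w * sig)) = 0" using that by (simp add: algebra_simps)
  then have "alp + b * (g02 ?w * sig) = 0" using assms(2) by (simp only: mult_eq_0_iff) simp
  then have "alp = - (b * (g02 ?w * sig))" by linarith
  then have "a * (a * (g02 ?w * sig)) - b * alp = (a\<^sup>2 + b\<^sup>2) * (g02 ?w * sig)" by (simp add: algebra_simps power2_eq_square)
  moreover have "a\<^sup>2 + b\<^sup>2 > 0" using assms(2) by (simp add: sum_power2_gt_zero_iff)
  ultimately show ?thesis by (simp add: sgn_mult)
 qed
 define Q where "Q = a * g20 ?w + b * g11 ?w"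
 define G where "G = g02 ?w * sig"
 note q0 = q0[unfolded gs, folded Q_def G_def] and sa = sa[folded G_def]
 have pe: "pd v (pd e (f eps)) p = Q" and pe': "pd v (pd e' (f eps)) p = a * G" unfolding s2 ab gs Q_def G_def by simp_all
 have og: "orient * g02 (p, eps) * sig = orient * G" by (simp add: G_def)
 show ?thesis unfolding og
 proof (cases "e = (1,0)")
  case True
  have o: "orient = 1" unfolding orient_def using True by (rule if_P)
  have ee: "e' = (0,1)" using frame True by auto
  have v: "v = (a, b)" using assms(3) True ee by (simp add: b_def)
  have ab0: "(a, b) ~= (0, 0)" using assms(2) by simp
  show "sgn (twist (f eps) p v) = sgn (orient * G)"
   using twist_eq[OF U, of a b, folded v, unfolded pe[unfolded True] pe'[unfolded ee]]
    twist_sign[OF ab0 q0] sa[OF q0] o by simp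
 next
  case False
  have o: "orient = -1" unfolding orient_def using False by (rule if_not_P)
  have ee: "e = (0,1)" "e' = (1,0)" using frame False by auto
  have v: "v = (b, a)" using assms(3) ee by (simp add: b_def)
  have ab0: "(b, a) ~= (0, 0)" using assms(2) by simp
  have q0': "b * (a * G) + a * Q = 0" using q0 by simp
  have sg: "sgn (b * Q - a * (a * G)) = - sgn G" using sa[OF q0] by (metis minus_diff_eq sgn_minus)
  show "sgn (twist (f eps) p v) = sgn (orient * G)"
   using twist_eq[OF U, of b a, folded v, unfolded pe[unfolded ee(1)] pe'[unfolded ee(2)]]
    twist_sign[OF ab0 q0'] sg o by (simp add: sgn_minus)
 qed
qed

text \<open>Of the roots sig = sqrt Z and sig = -sqrt Z the sign of \<open>orient * g02\<close>
  decides which is the left one. On a region where that sign is constant, the left and right curves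
  have these two smooth equations.\<close>

lemma left_right_iff:
 assumes "(p, eps) \<in> W1"
 shows "p \<in> left_flecnodal (f eps) \<longleftrightarrow>
   ZZ (p,eps) > 0 \<and> AA (p,eps) - sgn (orient * g02 (p,eps)) * sqrt (ZZ (p,eps)) * BB (p,eps) = 0"
  "p \<in> right_flecnodal (f eps) \<longleftrightarrow>
   ZZ (p,eps) > 0 \<and> AA (p,eps) + sgn (orient * g02 (p,eps)) * sqrt (ZZ (p,eps)) * BB (p,eps) = 0"
proof -
 let ?w = "(p, eps)"
 define kpa where "kpa = sgn (orient * g02 ?w)"
 have k: "kpa = 1 \<or> kpa = -1" using W1_W(2)[OF assms] by (auto simp: kpa_def orient_def sgn_if)
 have main: "(\<exists>v. asymptotic (f eps) p v \<and> sgn (twist (f eps) p v) = s \<and> line_contact 4 (f eps) p v)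
  \<longleftrightarrow> AA ?w + s * kpa * sqrt (ZZ ?w) * BB ?w = 0" if z: "ZZ ?w > 0" and s: "s = 1 \<or> s = -1" for s
 proof
  assume "\<exists>v. asymptotic (f eps) p v \<and> sgn (twist (f eps) p v) = s \<and> line_contact 4 (f eps) p v"
  then obtain v a sig where v: "a ~= 0" "v = a *. e + (a * (mm ?w + sig)) *. e'" "sig\<^sup>2 = ZZ ?w"
   "sgn (twist (f eps) p v) = s" "line_contact 4 (f eps) p v" using asymptotic_iff[OF assms] by blast
  have "kpa * sgn sig = s" using twist_sgn[OF assms v(1-3)] v(4) by (simp add: kpa_def sgn_mult)
  then have "sgn sig = s * kpa" using k by auto
  moreover have "\<bar>sig\<bar> = sqrt (ZZ ?w)" using v(3) by (metis real_sqrt_abs)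
  ultimately have "sig = s * kpa * sqrt (ZZ ?w)" by (metis mult.commute abs_sgn mult_sgn_abs)
  then show "AA ?w + s * kpa * sqrt (ZZ ?w) * BB ?w = 0" using contact_4_iff[OF assms v(1-3)] v(5) by (simp add: mult_ac)
 next
  assume h: "AA ?w + s * kpa * sqrt (ZZ ?w) * BB ?w = 0"
  define sig where "sig = s * kpa * sqrt (ZZ ?w)"
  have sq: "sig\<^sup>2 = ZZ ?w" using k s z by (auto simp: sig_def power_mult_distrib)
  let ?v = "1 *. e + (1 * (mm ?w + sig)) *. e'"
  have "asymptotic (f eps) p ?v" using sq asymptotic_iff[OF assms] by (metis zero_neq_one)
  moreover have "line_contact 4 (f eps) p ?v" using contact_4_iff[OF assms _ refl sq, of 1] h by (simp add: sig_def mult_ac)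
  moreover have "sgn (twist (f eps) p ?v) = s"
   using twist_sgn[OF assms _ refl sq, of 1] k s z by (auto simp: sig_def sgn_mult kpa_def)
  ultimately show "\<exists>v. asymptotic (f eps) p v \<and> sgn (twist (f eps) p v) = s \<and> line_contact 4 (f eps) p v" by blast
 qed
 show "p \<in> left_flecnodal (f eps) \<longleftrightarrow>
   ZZ ?w > 0 \<and> AA ?w - sgn (orient * g02 ?w) * sqrt (ZZ ?w) * BB ?w = 0"
  using main[of "-1"] domains_ZZ(2)[OF assms] unfolding left_flecnodal_def kpa_def[symmetric] sgn_1_neg[symmetric] by auto
 show "p \<in> right_flecnodal (f eps) \<longleftrightarrow>
   ZZ ?w > 0 \<and> AA ?w + sgn (orient * g02 ?w) * sqrt (ZZ ?w) * BB ?w = 0"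
  using main[of 1] domains_ZZ(2)[OF assms] unfolding right_flecnodal_def kpa_def[symmetric] sgn_1_pos[symmetric] by auto
qed

end

subsection \<open>Implicit functions and curves in zero sets\<close>

lemma pd_Pair:
 "f differentiable (at x) ==> g differentiable (at x) ==> pd v (%x. (f x, g x)) x = (pd v f x, pd v g x)"
 by (intro pd_eqI has_derivative_Pair has_derivative_pd)

lemma pd_add: "f differentiable (at x) ==> g differentiable (at x) ==> pd v (%x. f x + g x) x = pd v f x + pd v g x"
 by (rule pd_eqI[OF has_derivative_add[OF has_derivative_pd has_derivative_pd]])

lemma pd_mult:
 fixes f g :: "'a::real_normed_vector => real"
 shows "f differentiable (at x) ==> g differentiable (at x) ==> pd v (%x. f x * g x) x = f x * pd v g x + pd v f x * g x"
 by (rule pd_eqI[OF has_derivative_mult[OF has_derivative_pd has_derivative_pd]])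

lemma pd_const: "pd v (%x. c) x = 0" by (auto intro!: pd_eqI derivative_eq_intros)

lemma pd_bounded_linear: "bounded_linear L ==> pd v L x = L v" by (rule pd_eqI[OF bounded_linear_imp_has_derivative])

lemma pd_fst_snd: "pd v fst x = fst v" "pd v snd x = snd v"
 by (simp_all add: pd_bounded_linear bounded_linear_fst bounded_linear_snd)

text \<open>The map (x, y) |-> (x, Phi(x, y)) is a local diffeomorphism, and the graph of m is its
  preimage of the level 0. The conclusion describes the zero set in V completely, with U as its
  exact projection.\<close>

lemma implicit_function:
 fixes Phi :: "'a::euclidean_space \<times> real => real"
 assumes "open Om" "smooth_on Om Phi" "(x0, y0) \<in> Om" "Phi (x0, y0) = 0" "pd (0, 1) Phi (x0, y0) ~= 0"
 obtains U V m where "open U" "x0 \<in> U" "open V" "(x0, y0) \<in> V" "V \<subseteq> Om" "smooth_on U m" "m x0 = y0"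
  "!!x. x \<in> U ==> (x, m x) \<in> V" "!!x y. (x, y) \<in> V ==> Phi (x, y) = 0 \<longleftrightarrow> x \<in> U \<and> y = m x"
proof -
 define T where "T = (%z. (fst z, Phi z))"
 have T: "smooth_on Om T" unfolding T_def by (intro smooth_intros assms(1,2))
 have dPhi: "Phi differentiable (at (x0, y0))" by (rule smooth_on_differentiable[OF assms(2,1,3)])
 have dT: "pd v T (x0, y0) = (fst v, pd v Phi (x0, y0))" for v unfolding T_def using dPhi
  by (subst pd_Pair) (auto simp: pd_fst_snd intro!: bounded_linear_imp_differentiable bounded_linear_fst)
 have inj: "v = 0" if "pd v T (x0, y0) = 0" for v
 proof -
  have f: "fst v = 0" and p: "pd v Phi (x0, y0) = 0" using that dT by (auto simp: zero_prod_def)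
  have "v = snd v *. (0, 1)" using f by (cases v) auto
  then have "snd v * pd (0, 1) Phi (x0, y0) = 0" using p pd_linear(3)[OF dPhi, of "snd v" "(0,1)"] by simp
  then show "v = 0" using f assms(5) by (cases v) (auto simp: zero_prod_def)
 qed
 obtain V where V: "open V" "V \<subseteq> Om" "(x0, y0) \<in> V" "diffeo_on V T"
  using smooth_inverse_function[OF assms(1) T assms(3) inj] by blast
 note D = diffeo_onD[OF V(4)]
 define U where "U = {x. (x, 0) \<in> T ` V}"
 define m where "m x = snd (inv_into V T (x, 0))" for x
 have U: "open U" unfolding U_def by (rule open_slice[OF D(2)])
 have i: "inv_into V T (x, 0) = (x, m x)" "(x, m x) \<in> V" "Phi (x, m x) = 0" if "x \<in> U" for x
 proof -
  have x: "(x, 0) \<in> T ` V" using that by (simp add: U_def)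
  have "T (inv_into V T (x, 0)) = (x, 0)" by (rule f_inv_into_f[OF x])
  then have e: "fst (inv_into V T (x, 0)) = x" "Phi (inv_into V T (x, 0)) = 0" by (auto simp: T_def)
  then show 1: "inv_into V T (x, 0) = (x, m x)" by (simp add: m_def prod_eq_iff)
  show "(x, m x) \<in> V" "Phi (x, m x) = 0" using inv_into_into[OF x] e 1 by auto
 qed
 have u: "x \<in> U \<and> y = m x" if "(x, y) \<in> V" "Phi (x, y) = 0" for x y
 proof -
  have "T (x, y) = (x, 0)" using that by (simp add: T_def)
  then have "x \<in> U" unfolding U_def using that(1) by (metis image_eqI mem_Collect_eq)
  moreover have "inv_into V T (x, 0) = (x, y)" using \<open>T (x, y) = (x, 0)\<close> that(1) D(3) by (metis inv_into_f_f)
  ultimately show ?thesis by (simp add: m_def)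
 qed
 have sm: "smooth_on U m" unfolding m_def
 proof (rule smooth_on_snd[OF U], rule smooth_on_compose[OF D(5) _ U D(2)])
  show "smooth_on U (%x. (x, 0::real))" by (intro smooth_intros U)
  show "(%x. (x, 0)) ` U \<subseteq> T ` V" by (auto simp: U_def)
 qed
 have x0: "x0 \<in> U \<and> y0 = m x0" by (rule u[OF V(3) assms(4)])
 show ?thesis using that[OF U _ V(1,3,2) sm, of] x0 i u by blast
qed

lemma smooth_curve_tangentI:
 fixes gam :: "real => plane"
 assumes "open T" "0 \<in> T" "smooth_on T gam" "gam 0 = p" "!!t. t \<in> T ==> gam t \<in> parabolic_curve g"
  and "v ~= 0" "(gam has_vector_derivative v) (at 0)"
 shows "tangent_to_parabolic g p v"
proof -
 obtain dlt where "dlt > 0" "ball 0 dlt \<subseteq> T" using assms(1,2) open_contains_ball by blast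
 moreover have "ball 0 dlt = {-dlt<..<dlt}" by (auto simp: dist_real_def)
 ultimately show ?thesis unfolding tangent_to_parabolic_def
  using assms smooth_on_subset by (intro exI[of _ gam] exI[of _ dlt]) auto
qed

text \<open>In the coordinates p + x v + y u the zero set is a graph y = m(x) because dG(u) is
  nonzero.\<close>

lemma regular_curve:
 fixes G :: "plane => real"
 assumes "open U" "smooth_on U G" "p \<in> U" "G p = 0" "pd v G p = 0" "pd u G p ~= 0"
 obtains T gam where "open T" "(0::real) \<in> T" "smooth_on T gam" "gam 0 = p" "!!t. t \<in> T ==> gam t \<in> U \<and> G (gam t) = 0"
  "(gam has_vector_derivative v) (at 0)"
proof -
 define L :: "real \<times> real => plane" where "L z = p + fst z *. v + snd z *. u" for z
 define Om where "Om = L -` U"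
 have sL: "smooth_on S L" if "open S" for S unfolding L_def by (intro smooth_intros that)
 have Om: "open Om" unfolding Om_def by (rule open_vimage[OF assms(1) smooth_on_imp_continuous_on[OF sL[OF open_UNIV]]])
 have sPhi: "smooth_on Om (%z. G (L z))" by (rule smooth_on_compose[OF assms(2) sL[OF Om] Om assms(1)]) (auto simp: Om_def)
 have L0: "L (0, 0) = p" by (simp add: L_def)
 have in0: "(0, 0) \<in> Om" using assms(3) by (simp add: Om_def L0)
 have pL: "pd z L x = fst z *. v + snd z *. u" for z x
  unfolding L_def by (rule pd_eqI) (auto intro!: derivative_eq_intros)
 have dG: "G differentiable (at p)" by (rule smooth_on_differentiable[OF assms(2,1,3)])
 have pPhi: "pd z (%z. G (L z)) (0, 0) = fst z * pd v G p + snd z * pd u G p" for z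
  using pd_compose[of L "(0,0)" G z] smooth_on_differentiable[OF sL[OF open_UNIV] open_UNIV, of "(0,0)"] dG
  by (simp add: L0 pL pd_linear(1)[OF dG])
 obtain T V m where m: "open T" "(0::real) \<in> T" "open V" "(0, 0) \<in> V" "V \<subseteq> Om" "smooth_on T m" "m 0 = 0"
  "!!x. x \<in> T ==> (x, m x) \<in> V" "!!x y. (x, y) \<in> V ==> G (L (x, y)) = 0 \<longleftrightarrow> x \<in> T \<and> y = m x"
  using implicit_function[OF Om sPhi in0] assms(4,6) by (auto simp: L0 pPhi)
 define gam where "gam t = L (t, m t)" for t
 have sm: "smooth_on T gam" unfolding gam_def
  by (rule smooth_on_compose[OF sL[OF open_UNIV] _ m(1) open_UNIV]) (auto intro!: smooth_intros m)
 have z: "gam t \<in> U \<and> G (gam t) = 0" if "t \<in> T" for t using m(5,8,9) that unfolding gam_def Om_def by blast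
 obtain m' where m': "(m has_real_derivative m') (at 0)"
  using smooth_on_differentiable[OF m(6,1,2)] real_differentiable_def by blast
 have "(gam has_vector_derivative (v + m' *. u)) (at 0)"
  unfolding gam_def L_def using m' by (auto intro!: derivative_eq_intros simp: has_real_derivative_iff_has_vector_derivative)
 then have g': "(gam has_derivative (%s. s *. (v + m' *. u))) (at 0)" by (simp add: has_vector_derivative_def)
 have g0: "gam 0 = p" using m(7) by (simp add: gam_def L0)
 have "pd 1 (%t. G (gam t)) 0 = pd (v + m' *. u) G p"
  using pd_compose[of gam 0 G 1] g' dG pd_eqI[OF g', of 1] by (simp add: g0 differentiableI)
 moreover have "pd 1 (%t. G (gam t)) 0 = pd 1 (%t::real. 0::real) 0" by (rule pd_cong_open[OF m(1,2)]) (use z in auto)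
 \<comment> \<open>The velocity v + m' u is annihilated by dG, and so is v, but u is not.\<close>
 ultimately have "m' = 0"
  using assms(5,6) pd_linear(2)[OF dG, of v "m' *. u"] pd_linear(3)[OF dG, of m' u] by (simp add: pd_const)
 then have "(gam has_vector_derivative v) (at 0)" using g' by (simp add: has_vector_derivative_def)
 then show ?thesis using that[OF m(1,2) sm g0 z] by blast
qed

text \<open>The quotient of G by the square of the distance to a critical point, in polar-like
 coordinates, is smooth: this is the blow-up of the critical point.\<close>

lemma critical_point_blowup:
 fixes G :: "plane => real"
 assumes "open U" "smooth_on U G" "p \<in> U" "G p = 0" "!!w. pd w G p = 0"
 obtains Om Phi where "open Om" "(0,0) \<in> Om" "smooth_on Om Phi"
  "!!t m. (t, m) \<in> Om ==> p + t *. (v + m *. u) \<in> U \<and> G (p + t *. (v + m *. u)) = t\<^sup>2 * Phi (t, m)"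
  "!!m. Phi (0, m) = (pd v (pd v G) p + 2 * m * pd v (pd u G) p + m\<^sup>2 * pd u (pd u G) p) / 2"
proof -
 obtain r where r: "r > 0" "ball p r \<subseteq> U" using assms(1,3) open_contains_ball by blast
 \<comment> \<open>For |m| < 1 this bounds the norm of v + m u; the summand 1 makes it
   positive.\<close>
 define c where "c = norm v + norm u + 1"
 have c: "c > 0" by (simp add: c_def add_nonneg_pos)
 define Om :: "(real \<times> real) set" where "Om = {-r/c<..<r/c} \<times> {-1<..<1}"
 have op: "open Om" unfolding Om_def by (intro open_Times) auto
 define L where "L z = p + (snd z * fst (fst z)) *. (v + snd (fst z) *. u)" for z :: "(real \<times> real) \<times> real"
 define S where "S = L -` U"
 have sL: "smooth_on X L" if "open X" for X unfolding L_def by (intro smooth_intros that)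
 have S: "open S" unfolding S_def by (rule open_vimage[OF assms(1) smooth_on_imp_continuous_on[OF sL[OF open_UNIV]]])
 have inS: "L ((t, m), tau) \<in> ball p r" if "(t, m) \<in> Om" "tau \<in> {0..1}" for t m tau
 proof -
  have b: "\<bar>t\<bar> < r / c" "\<bar>m\<bar> < 1" "\<bar>tau\<bar> \<le> 1" using that by (auto simp: Om_def)
  have "norm (v + m *. u) \<le> norm v + \<bar>m\<bar> * norm u" using norm_triangle_ineq[of v "m *. u"] by simp
  also have "\<dots> \<le> norm v + 1 * norm u" using b by (intro add_left_mono mult_right_mono) auto
  finally have n: "norm (v + m *. u) \<le> c" by (simp add: c_def)
  have "norm ((tau * t) *. (v + m *. u)) = \<bar>tau\<bar> * \<bar>t\<bar> * norm (v + m *. u)" by (simp add: abs_mult)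
  also have "\<dots> \<le> 1 * \<bar>t\<bar> * c" using b n by (intro mult_mono) auto
  also have "\<dots> < r" using b(1) c by (simp add: field_simps)
  finally show ?thesis by (simp add: L_def dist_norm)
 qed
 have sub: "Om \<times> {0..1} \<subseteq> S" using inS r by (force simp: S_def)
 \<comment> \<open>The second derivative of G in the direction v + m u, at the point reached at
   parameter tau. Phi is its Taylor average.\<close>
 define K where "K z = pd v (pd v G) (L z) + 2 * snd (fst z) * pd v (pd u G) (L z)
   + (snd (fst z))\<^sup>2 * pd u (pd u G) (L z)" for z
 have sK: "smooth_on S K"
 proof -
  have "smooth_on S (%z. pd a (pd b G) (L z))" for a b
   by (rule smooth_on_compose[OF smooth_on_pd[OF assms(1) smooth_on_pd[OF assms(1,2)]] sL[OF S] S assms(1)]) (auto simp: S_def)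
  then show ?thesis unfolding K_def by (intro smooth_intros S)
 qed
 define Phi where "Phi x = integral {0..1} (%tau. (1 - tau) * K (x, tau))" for x
 have "smooth_on S (%z. (1 - snd z) * K z)" by (intro smooth_intros S sK)
 from smooth_on_integral[OF op S sub this] have sPhi: "smooth_on Om Phi" by (simp add: Phi_def[abs_def])
 have main: "G (p + t *. (v + m *. u)) = t\<^sup>2 * Phi (t, m)" and mem: "p + t *. (v + m *. u) \<in> U" if x: "(t, m) \<in> Om" for t m
 proof -
  define w where "w = v + m *. u"
  have inU: "p + tau *. (t *. w) \<in> U" if "tau \<in> {0..1}" for tau
   using inS[OF x that] r by (auto simp: L_def w_def)
  show "p + t *. (v + m *. u) \<in> U" using inU[of 1] by (simp add: w_def)
  have dG: "G' differentiable (at (p + tau *. (t *. w)))" if "tau \<in> {0..1}" "smooth_on U G'" for tau and G' :: "plane => real"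
   by (rule smooth_on_differentiable[OF that(2) assms(1) inU[OF that(1)]])
  have lin: "pd (t *. w) G y = t * (pd v G y + m * pd u G y)" if "y \<in> U" for y
   using pd_linear(2,3)[OF smooth_on_differentiable[OF assms(2,1) that]] by (simp add: w_def)
  have KK: "pd (t *. w) (pd (t *. w) G) (p + tau *. (t *. w)) = t\<^sup>2 * K ((t, m), tau)" if tau: "tau \<in> {0..1}" for tau
  proof -
   define y where "y = p + tau *. (t *. w)"
   have y: "y \<in> U" using inU[OF tau] by (simp add: y_def)
   have yL: "L ((t, m), tau) = y" by (simp add: L_def y_def w_def)
   have d2: "pd b G differentiable (at y)" for b by (rule smooth_on_differentiable[OF smooth_on_pd[OF assms(1,2)] assms(1) y])
   have "pd (t *. w) (pd (t *. w) G) y = pd (t *. w) (%y. t * (pd v G y + m * pd u G y)) y"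
    by (rule pd_cong_open[OF assms(1) y]) (rule lin)
   also have "\<dots> = t * (pd (t *. w) (pd v G) y + m * pd (t *. w) (pd u G) y)"
    by (rule pd_eqI) (auto intro!: derivative_eq_intros has_derivative_pd d2)
   also have "\<dots> = t * (t * (pd v (pd v G) y + m * pd u (pd v G) y) + m * (t * (pd v (pd u G) y + m * pd u (pd u G) y)))"
    using pd_linear(2,3)[OF d2] by (simp add: w_def)
   also have "pd u (pd v G) y = pd v (pd u G) y" by (rule pd_commute[OF assms(1,2) y])
   finally show ?thesis unfolding y_def[symmetric] K_def yL by (simp add: algebra_simps power2_eq_square)
  qed
  have "(%tau. G (p + tau *. (t *. w))) 1 = (%tau. G (p + tau *. (t *. w))) 0
    + (%tau. pd (t *. w) G (p + tau *. (t *. w))) 0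
    + integral {0..1} (%tau. (1 - tau) * pd (t *. w) (pd (t *. w) G) (p + tau *. (t *. w)))"
   by (rule taylor2_integral; rule pd_along_line_real; rule dG) (auto intro: assms(2) smooth_on_pd[OF assms(1,2)])
  also have "integral {0..1} (%tau. (1 - tau) * pd (t *. w) (pd (t *. w) G) (p + tau *. (t *. w)))
    = integral {0..1} (%tau. t\<^sup>2 * ((1 - tau) * K ((t, m), tau)))" by (rule integral_cong, subst KK) simp_all
  finally show "G (p + t *. (v + m *. u)) = t\<^sup>2 * Phi (t, m)" using assms(4,5) by (simp add: Phi_def w_def)
 qed
 have "Phi (0, m) = (pd v (pd v G) p + 2 * m * pd v (pd u G) p + m\<^sup>2 * pd u (pd u G) p) / 2" for m
 proof -
  have "((%tau. 1 - tau) has_integral 1/2) {0..1::real}"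
  proof -
   have "((%tau. tau - tau\<^sup>2 / 2) has_vector_derivative 1 - x) (at x within {0..1})" for x :: real
    by (auto intro!: derivative_eq_intros simp: has_real_derivative_iff_has_vector_derivative[symmetric])
   from fundamental_theorem_of_calculus[OF _ this] show ?thesis by simp
  qed
  then show ?thesis by (simp add: Phi_def K_def L_def integral_unique)
 qed
 moreover have "(0, 0) \<in> Om" using r c by (simp add: Om_def)
 ultimately show ?thesis using that[OF op _ sPhi] main mem by blast
qed

text \<open>After the blow-up the isotropic direction v is the zero m = 0 of Phi(0, m), and the
  hypothesis on the mixed derivative makes it simple. The implicit function m(t) gives the branch p
  + t (v + m(t) u).\<close>

lemma saddle_curve:
 fixes G :: "plane => real"
 assumes "open U" "smooth_on U G" "p \<in> U" "G p = 0" "!!w. pd w G p = 0" and "pd v (pd v G) p = 0" "pd v (pd u G) p ~= 0"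
 obtains T gam where "open T" "(0::real) \<in> T" "smooth_on T gam" "gam 0 = p" "!!t. t \<in> T ==> gam t \<in> U \<and> G (gam t) = 0"
  "(gam has_vector_derivative v) (at 0)"
proof -
 obtain Om Phi where Om: "open Om" "(0,0) \<in> Om" "smooth_on Om Phi"
  and eq: "!!t m. (t, m) \<in> Om ==> p + t *. (v + m *. u) \<in> U \<and> G (p + t *. (v + m *. u)) = t\<^sup>2 * Phi (t, m)"
  and at0: "!!m. Phi (0, m) = (pd v (pd v G) p + 2 * m * pd v (pd u G) p + m\<^sup>2 * pd u (pd u G) p) / 2"
  using critical_point_blowup[OF assms(1-5), of v u] by blast
 have "((%m. Phi (0, m)) has_derivative (%s. pd (0, s) Phi (0, 0))) (at 0)"
 proof -
  have "((%m. (0::real, m::real)) has_derivative (%s. (0, s))) (at 0)" by (auto intro!: derivative_eq_intros)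
  from diff_chain_at[OF this smooth_on_has_derivative[OF Om(3,1,2)]] show ?thesis by (simp add: o_def)
 qed
 then have "pd 1 (%m. Phi (0, m)) 0 = pd (0, 1) Phi (0, 0)" by (rule pd_eqI)
 moreover have "((%m. Phi (0, m)) has_derivative (%h. h * pd v (pd u G) p)) (at 0)"
  unfolding at0 by (auto intro!: derivative_eq_intros)
 then have "pd 1 (%m. Phi (0, m)) 0 = pd v (pd u G) p" by (simp add: pd_eqI)
 ultimately have ne: "pd (0, 1) Phi (0, 0) ~= 0" using assms(7) by simp
 obtain T V m where m: "open T" "(0::real) \<in> T" "open V" "(0, 0) \<in> V" "V \<subseteq> Om" "smooth_on T m" "m 0 = 0"
  "!!x. x \<in> T ==> (x, m x) \<in> V" "!!x y. (x, y) \<in> V ==> Phi (x, y) = 0 \<longleftrightarrow> x \<in> T \<and> y = m x"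
  using implicit_function[OF Om(1,3,2) _ ne] assms(6) by (auto simp: at0)
 define gam where "gam t = p + t *. (v + m t *. u)" for t
 have sm: "smooth_on T gam" unfolding gam_def by (intro smooth_intros m)
 have z: "gam t \<in> U \<and> G (gam t) = 0" if "t \<in> T" for t
 proof -
  have "(t, m t) \<in> V" "Phi (t, m t) = 0" using m(8,9) that by auto
  then show ?thesis using eq[of t "m t"] m(5) by (auto simp: gam_def)
 qed
 obtain m' where m': "(m has_real_derivative m') (at 0)"
  using smooth_on_differentiable[OF m(6,1,2)] real_differentiable_def by blast
 have "(gam has_vector_derivative v) (at 0)"
  unfolding gam_def using m' m(7) by (auto intro!: derivative_eq_intros simp: has_real_derivative_iff_has_vector_derivative)
 moreover have "gam 0 = p" by (simp add: gam_def)
 ultimately show ?thesis using that[OF m(1,2) sm _ z] by blast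
qed

subsection \<open>A Morse singularity of the parabolic curve\<close>

text \<open>The last assumption is the only contribution of genericity; everything up to
  \<open>local_theorem\<close> is about a single family at a single point.\<close>

locale morse_family = graph_family +
 fixes q :: plane and eps0 :: real
 assumes w0: "(q, eps0) \<in> W" and g02_0: "g02 (q, eps0) ~= 0"
  and morse: "parabolic_morse (f eps0) q" and gen_pos: "general_position (f eps0) q"
  and versal: "pd (0, 1) (%(p, eps). hess_det (f eps) p) (q, eps0) ~= 0"
begin

definition H where "H w = g20 w * g02 w - (g11 w)\<^sup>2"

lemma smooth_H: "smooth_on W H" unfolding H_def by (intro smooth_intros openW smooth_g)

lemma hess_det_H: "(p, eps) \<in> W ==> hess_det (f eps) p = H (p, eps)" by (simp add: H_def hess_det_eq)

text \<open>Regarding \<open>H\<close> as a family of functions in its own right makes the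
  second-order coefficients of \<open>HH\<close> the second derivatives of \<open>H\<close>, so the
  results on quadratic forms apply to the Morse condition as well.\<close>

sublocale HH: graph_family W "%eps p. H (p, eps)" e e' by unfold_locales (use openW smooth_H frame in auto)

lemma HH_F: "HH.F = H" by (simp add: HH.F_def)

text \<open>The Hessian form of \<open>H\<close> at the singular point, restricted to directions of
  constant time. It is a symmetric bilinear form because the first derivatives of \<open>H\<close>
  in these directions vanish there.\<close>

definition hb where "hb u v = pd (u, 0) (pd (v, 0) H) (q, eps0)"

lemma diff_H: "H differentiable (at (q, eps0))" "pd v H differentiable (at (q, eps0))"
 by (rule smooth_on_differentiable[OF _ openW w0], intro smooth_on_pd openW smooth_H)+

lemma hb_sym: "hb u v = hb v u" unfolding hb_def by (rule pd_commute[OF openW smooth_H w0])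

lemma hb_add_left: "hb (u + u') v = hb u v + hb u' v" using pd_linear(2)[OF diff_H(2), of "(u,0)" "(u',0)"] by (simp add: hb_def)

lemma hb_scale_left: "hb (a *. u) v = a * hb u v" using pd_linear(3)[OF diff_H(2), of a "(u,0)"] by (simp add: hb_def)

lemma hb_add_right: "hb v (u + u') = hb v u + hb v u'" using hb_add_left hb_sym by metis

lemma hb_scale_right: "hb v (a *. u) = a * hb v u" using hb_scale_left hb_sym by metis

lemmas hb_simps = hb_add_left hb_scale_left hb_add_right hb_scale_right

lemma slice_pd_H: "(p, eps) \<in> W ==> pd v (hess_det (f eps)) p = pd (v, 0) H (p, eps)"
proof -
 assume p: "(p, eps) \<in> W"
 have "pd v (hess_det (f eps)) p = pd v (%p. H (p, eps)) p"
  by (rule pd_cong_open[OF slice_open[of eps]]) (use p hess_det_H in auto)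
 also have "\<dots> = pd (v, 0) H (p, eps)" by (rule pd_slice[OF smooth_on_differentiable[OF smooth_H openW p]])
 finally show ?thesis .
qed

lemma slice_pd2_H:
 assumes p: "(p, eps) \<in> W" shows "pd u (pd v (hess_det (f eps))) p = pd (u, 0) (pd (v, 0) H) (p, eps)"
proof -
 have "pd u (pd v (hess_det (f eps))) p = pd u (%p. pd (v, 0) H (p, eps)) p"
  by (rule pd_cong_open[OF slice_open[of eps]]) (use p slice_pd_H in auto)
 also have "\<dots> = pd (u, 0) (pd (v, 0) H) (p, eps)"
  by (rule pd_slice[OF smooth_on_differentiable[OF smooth_on_pd[OF openW smooth_H] openW p]])
 finally show ?thesis .
qed

lemma slice_smooth_H: "smooth_on {p. (p, eps) \<in> W} (hess_det (f eps))"
 using smooth_on_cong[OF slice_open, of eps "hess_det (f eps)" "%p. H (p, eps)"] hess_det_H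
  smooth_on_slice[OF openW smooth_H] by auto

lemma H0: "H (q, eps0) = 0" using morse hess_det_H[OF w0] by (simp add: parabolic_morse_def)

lemma dH0: "pd (v, 0) H (q, eps0) = 0" using morse slice_pd_H[OF w0, of v] unfolding parabolic_morse_def pd_def by metis

lemma Heps: "pd (0, 1) H (q, eps0) ~= 0"
proof -
 have "pd (0, 1) (%(p, eps). hess_det (f eps) p) (q, eps0) = pd (0, 1) H (q, eps0)"
  by (rule pd_cong_open[OF openW w0]) (auto simp: hess_det_H)
 then show ?thesis using versal by simp
qed

lemma pd_H_split: "pd (v, t) H (q, eps0) = t * pd (0, 1) H (q, eps0)"
proof -
 have "(v, t) = (v, 0) + t *. (0, 1)" by simp
 then show ?thesis using pd_linear(2,3)[OF diff_H(1)] dH0 by (metis add.left_neutral real_scaleR_def)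
qed

lemma hb_det: "hb e e * hb e' e' - (hb e e')\<^sup>2 ~= 0"
proof -
 have c: "partials vs (hess_det (f eps0)) q = partials vs (%p. H (p, eps0)) q" for vs
  by (rule partials_cong_open[OF slice_open[of eps0]]) (use w0 hess_det_H in auto)
 have "hess_det (hess_det (f eps0)) q = hess_det (%p. H (p, eps0)) q"
  unfolding hess_det_def[of "hess_det (f eps0)"] hess_det_def[of "%p. H (p, eps0)"] c ..
 also have "\<dots> = hb e e * hb e' e' - (hb e e')\<^sup>2"
  unfolding HH.hess_det_eq[OF w0] HH.g20_def HH.g11_def HH.g02_def HH_F hb_def ..
 finally show ?thesis using morse by (simp add: parabolic_morse_def)
qed

lemma w0_W1: "(q, eps0) \<in> W1" using w0 g02_0 by (simp add: W1_def)

lemma Z0: "ZZ (q, eps0) = 0" using H0 by (simp add: ZZ_def half_gap_sq_def H_def algebra_simps)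

text \<open>The asymptotic direction at q: the two slopes coincide in their midpoint since Z =
  0.\<close>

definition v0 where "v0 = e + mm (q, eps0) *. e'"

lemma asymptotic_q: "asymptotic (f eps0) q v \<longleftrightarrow> (\<exists>a. a ~= 0 \<and> v = a *. v0)"
 unfolding asymptotic_iff[OF w0_W1] Z0 v0_def by (simp add: scaleR_add_right)

lemma v0_e': "v = (v \<bullet> e) *. v0 + (v \<bullet> e' - v \<bullet> e * mm (q, eps0)) *. e'"
 using frame_expand[of v] by (simp add: v0_def algebra_simps)

lemma v0_ne: "v0 ~= 0" using frame_eq_0[of 1 "mm (q, eps0)"] by (simp add: v0_def)

lemma hb_det': "hb v0 v0 * hb e' e' - (hb v0 e')\<^sup>2 = hb e e * hb e' e' - (hb e e')\<^sup>2"
 unfolding v0_def hb_simps hb_sym[of e' e] by algebra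

text \<open>If \<open>v0\<close> were isotropic, nondegeneracy would give a nonzero value of the
  form on \<open>v0\<close> and e'. Then \<open>saddle_curve\<close> would provide a branch of the
  parabolic curve tangent to the asymptotic line, against general position.\<close>

lemma hvv: "hb v0 v0 ~= 0"
proof
 assume z: "hb v0 v0 = 0"
 then have n: "hb v0 e' ~= 0" using hb_det hb_det' by auto
 define U where "U = {p. (p, eps0) \<in> W}"
 have U: "open U" "smooth_on U (hess_det (f eps0))" "q \<in> U" using slice_open slice_smooth_H w0 by (auto simp: U_def)
 obtain T gam where g: "open T" "(0::real) \<in> T" "smooth_on T gam" "gam 0 = q"
  "!!t. t \<in> T ==> gam t \<in> U \<and> hess_det (f eps0) (gam t) = 0" "(gam has_vector_derivative v0) (at 0)"
  using saddle_curve[OF U, of v0 e'] z n H0 dH0 slice_pd2_H[OF w0] slice_pd_H[OF w0] hess_det_H[OF w0] by (auto simp: hb_def)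
 have "tangent_to_parabolic (f eps0) q v0"
  by (rule smooth_curve_tangentI[OF g(1-4) _ v0_ne g(6)]) (use g(5) in \<open>simp add: parabolic_curve_def\<close>)
 moreover have "asymptotic (f eps0) q v0" unfolding asymptotic_q by (intro exI[of _ 1]) simp
 ultimately show False using gen_pos unfolding general_position_def by blast
qed

text \<open>The orthogonal complement of \<open>v0\<close> for \<open>hb\<close>; it exists by
  \<open>hvv\<close> and diagonalises the form.\<close>

definition t0 where "t0 = e' - (hb v0 e' / hb v0 v0) *. v0"

lemma hb_t0: "hb v0 t0 = 0" "hb t0 t0 * hb v0 v0 = hb e e * hb e' e' - (hb e e')\<^sup>2"
proof -
 have t: "t0 = e' + (- (hb v0 e' / hb v0 v0)) *. v0" by (simp add: t0_def)
 show z: "hb v0 t0 = 0" unfolding t hb_simps using hvv by simp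
 have "hb t0 t0 = hb e' t0 + (- (hb v0 e' / hb v0 v0)) * hb v0 t0" by (subst (1) t) (simp only: hb_add_left hb_scale_left)
 also have "\<dots> = hb e' t0" using z by simp
 also have "\<dots> = hb e' e' + (- (hb v0 e' / hb v0 v0)) * hb e' v0" by (subst t) (simp only: hb_add_right hb_scale_right)
 also have "\<dots> = hb e' e' - (hb v0 e')\<^sup>2 / hb v0 v0" by (simp add: hb_sym[of e' v0] power2_eq_square)
 finally show "hb t0 t0 * hb v0 v0 = hb e e * hb e' e' - (hb e e')\<^sup>2" using hvv hb_det' by (simp add: field_simps)
qed

lemma htt: "hb t0 t0 ~= 0" using hb_t0(2) hb_det by auto

lemma hb_v0_t0: "hb (a *. v0 + b *. t0) v0 = a * hb v0 v0" "hb (a *. v0 + b *. t0) t0 = b * hb t0 t0"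
 unfolding hb_simps using hb_t0(1) hb_sym[of t0 v0] by auto

subsection \<open>The functions A and B to first order\<close>

lemma He_eq:
 assumes "w \<in> W"
 shows "pd (e,0) H w = g30 w * g02 w + g20 w * g12 w - 2 * g11 w * g21 w"
  "pd (e',0) H w = g21 w * g02 w + g20 w * g03 w - 2 * g11 w * g12 w"
proof -
 have h: "pd x H w = (g20 w * pd x g02 w + pd x g20 w * g02 w) - 2 * g11 w * pd x g11 w" for x unfolding H_def
  by (rule pd_eqI) (auto intro!: derivative_eq_intros has_derivative_pd diff_g smooth_g assms)
 then show "pd (e,0) H w = g30 w * g02 w + g20 w * g12 w - 2 * g11 w * g21 w"
  "pd (e',0) H w = g21 w * g02 w + g20 w * g03 w - 2 * g11 w * g12 w" unfolding h pd_g[OF assms] by simp_all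
qed

lemma ZZ_H: "w \<in> W1 ==> ZZ w = H w * (- 1 / (g02 w)\<^sup>2)" by (simp add: ZZ_def half_gap_sq_def H_def diff_divide_distrib)

text \<open>Differentiating the discriminant of the quadratic form produces third derivatives in the
  same combination as substituting its roots in the cubic form, up to multiples of Z. So, modulo Z,
  A is the derivative of \<open>H\<close> along the mean asymptotic direction and B three times the
  one along e', both divided by \<open>g02\<close>. The first derivatives of A and B at q are
  thereby values of \<open>hb\<close>.\<close>

lemma AB_H:
 assumes "w \<in> W1"
 shows "AA w = (pd (e,0) H w + mm w * pd (e',0) H w) / g02 w + 4 * ZZ w * (g12 w + mm w * g03 w)"
  "BB w = 3 * pd (e',0) H w / g02 w + 4 * ZZ w * g03 w"
proof -
 note d = W1_W(2)[OF assms]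
 have m: "g11 w = - mm w * g02 w" using d by (simp add: mm_def root_mid_def)
 have z: "g20 w = ((mm w)\<^sup>2 - ZZ w) * g02 w"
  using d by (simp add: mm_def root_mid_def ZZ_def half_gap_sq_def field_simps power2_eq_square)
 have "pd (e,0) H w = g02 w * (g30 w + ((mm w)\<^sup>2 - ZZ w) * g12 w + 2 * mm w * g21 w)"
  "pd (e',0) H w = g02 w * (g21 w + ((mm w)\<^sup>2 - ZZ w) * g03 w + 2 * mm w * g12 w)"
  unfolding He_eq[OF W1_W(1)[OF assms]] z m by (simp_all add: algebra_simps power2_eq_square)
 then have p: "pd (e,0) H w / g02 w = g30 w + ((mm w)\<^sup>2 - ZZ w) * g12 w + 2 * mm w * g21 w"
  "pd (e',0) H w / g02 w = g21 w + ((mm w)\<^sup>2 - ZZ w) * g03 w + 2 * mm w * g12 w" using d by simp_all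
 have c: "(pd (e,0) H w + mm w * pd (e',0) H w) / g02 w = pd (e,0) H w / g02 w + mm w * (pd (e',0) H w / g02 w)"
  "3 * pd (e',0) H w / g02 w = 3 * (pd (e',0) H w / g02 w)" by (simp_all add: add_divide_distrib)
 show "AA w = (pd (e,0) H w + mm w * pd (e',0) H w) / g02 w + 4 * ZZ w * (g12 w + mm w * g03 w)"
  "BB w = 3 * pd (e',0) H w / g02 w + 4 * ZZ w * g03 w" unfolding c p AA_def BB_def rem_const_def rem_lin_def by algebra+
qed

lemma smooth_W1: "smooth_on W G ==> smooth_on W1 G" by (rule smooth_on_subset[OF _ subsetI[OF W1_W(1)]])

lemma AB0: "AA (q, eps0) = 0" "BB (q, eps0) = 0" using AB_H[OF w0_W1] by (simp_all add: dH0 Z0)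

lemma diff_1: "smooth_on W1 G ==> w \<in> W1 ==> G differentiable (at w)" using smooth_on_differentiable openW1 by blast

text \<open>Since \<open>H\<close> is critical in space at q, only time changes Z to first
  order.\<close>

lemma pd_ZZ: "pd (v, t) ZZ (q, eps0) = t * (- pd (0, 1) H (q, eps0) / (g02 (q, eps0))\<^sup>2)"
proof -
 have "pd (v, t) ZZ (q, eps0) = pd (v, t) (%w. H w * (- 1 / (g02 w)\<^sup>2)) (q, eps0)"
  by (rule pd_cong_open[OF openW1 w0_W1 ZZ_H])
 also have "\<dots> = pd (v, t) H (q, eps0) * (- 1 / (g02 (q, eps0))\<^sup>2)"
 proof (subst pd_mult)
  have "smooth_on W1 (%w. - 1 / (g02 w)\<^sup>2)"
   by (intro smooth_on_divide smooth_intros openW1 smooth_W1 smooth_g) (use W1_W(2) in auto)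
  then show "(%w. - 1 / (g02 w)\<^sup>2) differentiable (at (q, eps0))" by (rule diff_1[OF _ w0_W1])
 qed (simp_all add: diff_H H0)
 finally show ?thesis unfolding pd_H_split[of v t] by simp
qed

lemma pd_AB:
 "pd (v, 0) AA (q, eps0) = hb v v0 / g02 (q, eps0)"
 "pd (v, 0) BB (q, eps0) = 3 * hb v e' / g02 (q, eps0)"
proof -
 let ?w = "(q, eps0)"
 have dm: "mm differentiable (at ?w)" "ZZ differentiable (at ?w)" "g12 differentiable (at ?w)" "g03 differentiable (at ?w)"
  "g02 differentiable (at ?w)" by (intro diff_1[OF _ w0_W1] smooth1 smooth_W1 smooth_g)+
 have "pd (v, 0) AA ?w = pd (v, 0) (%w. (pd (e,0) H w + mm w * pd (e',0) H w) / g02 w + 4 * ZZ w * (g12 w + mm w * g03 w)) ?w"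
  by (rule pd_cong_open[OF openW1 w0_W1 AB_H(1)])
 also have "\<dots> = (%x. (pd x (pd (e,0) H) ?w + mm ?w * pd x (pd (e',0) H) ?w) / g02 ?w
   + 4 * pd x ZZ ?w * (g12 ?w + mm ?w * g03 ?w)) (v, 0)"
  by (rule pd_eqI) (rule derivative_eq_intros has_derivative_pd dm diff_H refl g02_0 |
   simp add: dH0 Z0 field_simps power2_eq_square g02_0)+
 also have "\<dots> = (hb v e + mm ?w * hb v e') / g02 ?w" by (simp add: pd_ZZ hb_def)
 finally show "pd (v, 0) AA ?w = hb v v0 / g02 ?w" by (simp add: v0_def hb_simps)
 have "pd (v, 0) BB ?w = pd (v, 0) (%w. 3 * pd (e',0) H w / g02 w + 4 * ZZ w * g03 w) ?w"
  by (rule pd_cong_open[OF openW1 w0_W1 AB_H(2)])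
 also have "\<dots> = (%x. 3 * pd x (pd (e',0) H) ?w / g02 ?w + 4 * pd x ZZ ?w * g03 ?w) (v, 0)"
  by (rule pd_eqI) (rule derivative_eq_intros has_derivative_pd dm diff_H refl g02_0 |
   simp add: dH0 Z0 field_simps power2_eq_square g02_0)+
 also have "\<dots> = 3 * hb v e' / g02 ?w" by (simp add: pd_ZZ hb_def)
 finally show "pd (v, 0) BB ?w = 3 * hb v e' / g02 ?w" .
qed

lemma hb_nondegenerate:
 assumes "hb v v0 = 0" "hb v e' = 0" shows "v = 0"
proof -
 define a b where "a = v \<bullet> e" and "b = v \<bullet> e' - v \<bullet> e * mm (q, eps0)"
 have v: "v = a *. v0 + b *. e'" unfolding a_def b_def by (rule v0_e')
 have "a * hb v0 v0 + b * hb v0 e' = 0" "a * hb v0 e' + b * hb e' e' = 0"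
  using assms unfolding v hb_simps by (simp_all add: hb_sym[of e' v0])
 then have "a * (hb v0 v0 * hb e' e' - (hb v0 e')\<^sup>2) = 0" "b * (hb v0 v0 * hb e' e' - (hb v0 e')\<^sup>2) = 0" by algebra+
 then show ?thesis using hb_det hb_det' v by simp
qed

text \<open>In the frame the Jacobian is 3 det(hb) / g02^2, nonzero by the Morse condition.\<close>

lemma jacobian_AB:
 "pd ((1,0),0) AA (q, eps0) * pd ((0,1),0) BB (q, eps0) - pd ((0,1),0) AA (q, eps0) * pd ((1,0),0) BB (q, eps0) ~= 0"
proof -
 have "pd (e,0) AA (q, eps0) * pd (e',0) BB (q, eps0) - pd (e',0) AA (q, eps0) * pd (e,0) BB (q, eps0)
  = 3 * (hb e e * hb e' e' - (hb e e')\<^sup>2) / (g02 (q, eps0))\<^sup>2"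
  unfolding pd_AB v0_def hb_simps hb_sym[of e' e] using g02_0 by (simp add: field_simps power2_eq_square)
 then have "pd (e,0) AA (q, eps0) * pd (e',0) BB (q, eps0) - pd (e',0) AA (q, eps0) * pd (e,0) BB (q, eps0) ~= 0"
  using hb_det g02_0 by simp
 then show ?thesis using frame by auto
qed

lemma pd_tuple:
 assumes "smooth_on W1 G" "smooth_on W1 G'" "smooth_on W1 G''" "w \<in> W1"
 shows "pd x (%w. ((G w, G' w), G'' w)) w = ((pd x G w, pd x G' w), pd x G'' w)"
 using assms by (simp add: pd_Pair diff_1 smooth_on_differentiable[OF smooth_on_Pair[OF openW1] openW1])

end

subsection \<open>The umbrella\<close>

text \<open>A real parameter u is a root of u^2 = z, so the parametrisation misses exactly the
  handle: its image corresponds to the real flecnodal curve.\<close>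

lemma range_umbrella_param: "((x, y), z) \<in> range umbrella_param \<longleftrightarrow> z \<ge> 0 \<and> x\<^sup>2 = z * y\<^sup>2"
proof -
 have "((x, y), z) \<in> range umbrella_param \<longleftrightarrow> (\<exists>u. u\<^sup>2 = z \<and> x + y * u = 0)"
 proof
  assume "((x, y), z) \<in> range umbrella_param"
  then obtain u where "x = u * y" "z = u\<^sup>2" by (auto simp: umbrella_param_def)
  then show "\<exists>u. u\<^sup>2 = z \<and> x + y * u = 0" by (intro exI[of _ "- u"]) simp
 next
  assume "\<exists>u. u\<^sup>2 = z \<and> x + y * u = 0"
  then obtain u where "u\<^sup>2 = z" "x + y * u = 0" by blast
  then have "((x, y), z) = umbrella_param (- u, y)" by (simp add: umbrella_param_def eq_neg_iff_add_eq_0 mult.commute)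
  then show "((x, y), z) \<in> range umbrella_param" by blast
 qed
 then show ?thesis by (simp add: common_root_real_iff)
qed

context morse_family
begin

definition jac where "jac w = pd ((1,0),0) AA w * pd ((0,1),0) BB w - pd ((0,1),0) AA w * pd ((1,0),0) BB w"

text \<open>Here A and B are local coordinates on each surface, and \<open>g02\<close> has constant
  sign, so that left and right are told apart by the same root throughout.\<close>

definition W2 where "W2 = {w \<in> W1. jac w ~= 0 \<and> g02 w * g02 (q, eps0) > 0}"

lemma W2_W1: "w \<in> W2 ==> w \<in> W1" by (simp add: W2_def)

lemma openW2: "open W2"
proof -
 have "smooth_on W1 jac" unfolding jac_def by (intro smooth_intros openW1 smooth_on_pd smooth1)
 then have 1: "open (W1 \<inter> jac -` (- {0}))" by (intro continuous_open_preimage smooth_on_imp_continuous_on openW1) auto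
 have "continuous_on W1 (%w. g02 w * g02 (q, eps0))"
  by (intro smooth_on_imp_continuous_on smooth_intros openW1 smooth_W1 smooth_g)
 then have 2: "open (W1 \<inter> (%w. g02 w * g02 (q, eps0)) -` {0<..})" by (intro continuous_open_preimage openW1) auto
 have "W2 = (W1 \<inter> jac -` (- {0})) \<inter> (W1 \<inter> (%w. g02 w * g02 (q, eps0)) -` {0<..})" by (auto simp: W2_def)
 then show ?thesis using open_Int[OF 1 2] by simp
qed

lemma w0_W2: "(q, eps0) \<in> W2" using w0_W1 jacobian_AB g02_0 by (auto simp: W2_def jac_def zero_less_mult_iff)

lemma smooth2: "smooth_on W2 ZZ" "smooth_on W2 AA" "smooth_on W2 BB" "smooth_on W2 mm"
 using smooth1 smooth_on_subset[OF _ subsetI[OF W2_W1]] by blast+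

lemma slice_pd_1:
 assumes "open V" "smooth_on V G" "(p, eps) \<in> V"
 shows "partials [v] (%p. G (p, eps)) p = pd (v, 0) G (p, eps)"
 using pd_slice[OF smooth_on_differentiable[OF assms(2,1,3)]] by (simp add: partials_Cons_pd del: partials.simps(2))

text \<open>Where Z > 0 the left and right curves are A - kpa sqrt(Z) B = 0 and A + kpa sqrt(Z) B =
  0. They meet exactly where A = B = 0, and then transversally, because the Jacobian of the two
  equations is 2 kpa sqrt(Z) times that of (A, B).\<close>

lemma hyperbonode_iff:
 assumes w: "(p, eps) \<in> W2"
 shows "hyperbonode (f eps) p \<longleftrightarrow> ZZ (p, eps) > 0 \<and> AA (p, eps) = 0 \<and> BB (p, eps) = 0"
proof
 assume h: "hyperbonode (f eps) p"
 then have "p \<in> left_flecnodal (f eps)" "p \<in> right_flecnodal (f eps)"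
  by (auto simp: hyperbonode_def transverse_curves_def)
 moreover have "sgn (orient * g02 (p, eps)) ~= 0" using W1_W(2)[OF W2_W1[OF w]] by (auto simp: sgn_if orient_def)
 ultimately show "ZZ (p, eps) > 0 \<and> AA (p, eps) = 0 \<and> BB (p, eps) = 0" using left_right_iff[OF W2_W1[OF w]] by auto
next
 assume h: "ZZ (p, eps) > 0 \<and> AA (p, eps) = 0 \<and> BB (p, eps) = 0"
 define V where "V = {w \<in> W2. ZZ w > 0}"
 have V: "open V"
 proof -
  have "V = W2 \<inter> ZZ -` {0<..}" by (auto simp: V_def)
  then show ?thesis using continuous_open_preimage[OF smooth_on_imp_continuous_on[OF smooth2(1)] openW2, of "{0<..}"] by simp
 qed
 have sV: "smooth_on V AA" "smooth_on V BB" "smooth_on V ZZ" using smooth2 smooth_on_subset[of W2 _ V] by (auto simp: V_def)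
 have pV: "(p, eps) \<in> V" using w h by (simp add: V_def)
 define kpa where "kpa = sgn (orient * g02 (q, eps0))"
 have k: "kpa ~= 0" using g02_0 by (auto simp: kpa_def sgn_if orient_def)
 have kw: "sgn (orient * g02 w) = kpa" if "w \<in> W2" for w
  using that by (auto simp: kpa_def W2_def sgn_mult zero_less_mult_iff)
 define ab where "ab s w = AA w + s * kpa * sqrt (ZZ w) * BB w" for s :: real and w
 have sS: "smooth_on V (%w. sqrt (ZZ w))" by (rule smooth_on_sqrt[OF V sV(3)]) (auto simp: V_def)
 have sab: "smooth_on V (ab s)" for s unfolding ab_def by (intro smooth_intros V sV sS)
 define r where "r = kpa * sqrt (ZZ (p, eps))"
 \<comment> \<open>The derivative of the square root drops out because B vanishes at p.\<close>
 have pab: "pd v (ab s) (p, eps) = pd v AA (p, eps) + s * r * pd v BB (p, eps)" for s v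
 proof -
  have d: "G differentiable (at (p, eps))" if "smooth_on V G" for G :: "plane \<times> real => real"
   by (rule smooth_on_differentiable[OF that V pV])
  have 1: "smooth_on V (%w. s * kpa * sqrt (ZZ w))" by (intro smooth_intros V sS)
  have "pd v (ab s) (p, eps) = pd v AA (p, eps) + pd v (%w. s * kpa * sqrt (ZZ w) * BB w) (p, eps)"
   unfolding ab_def by (rule pd_add[OF d[OF sV(1)] d[OF smooth_on_mult[OF V 1 sV(2)]]])
  then show ?thesis using h by (simp add: pd_mult[OF d[OF 1] d[OF sV(2)]] r_def)
 qed
 define U where "U = {p. (p, eps) \<in> V}"
 have "transverse_curves (left_flecnodal (f eps)) (right_flecnodal (f eps)) p" unfolding transverse_curves_def
 proof (intro exI conjI)
  show "open U" unfolding U_def by (rule open_slice[OF V])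
  show "p \<in> U" using pV by (simp add: U_def)
  show "smooth_on U (%p. ab (-1) (p, eps))" "smooth_on U (%p. ab 1 (p, eps))"
   unfolding U_def by (rule smooth_on_slice[OF V sab])+
  have "x \<in> left_flecnodal (f eps) \<longleftrightarrow> ab (-1) (x, eps) = 0" "x \<in> right_flecnodal (f eps) \<longleftrightarrow> ab 1 (x, eps) = 0"
   if "x \<in> U" for x
  proof -
   have x: "(x, eps) \<in> W2" "ZZ (x, eps) > 0" using that by (auto simp: U_def V_def)
   show "x \<in> left_flecnodal (f eps) \<longleftrightarrow> ab (-1) (x, eps) = 0" "x \<in> right_flecnodal (f eps) \<longleftrightarrow> ab 1 (x, eps) = 0"
    unfolding left_right_iff[OF W2_W1[OF x(1)]] kw[OF x(1)] ab_def using x(2) by simp_all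
  qed
  then show "left_flecnodal (f eps) \<inter> U = {x \<in> U. ab (-1) (x, eps) = 0}"
   "right_flecnodal (f eps) \<inter> U = {x \<in> U. ab 1 (x, eps) = 0}" by blast+
  show "ab (-1) (p, eps) = 0" "ab 1 (p, eps) = 0" using h by (simp_all add: ab_def)
  have "jac (p, eps) ~= 0" using w by (simp add: W2_def)
  moreover have "r ~= 0" using k h by (simp add: r_def)
  moreover have "partials [(1,0)] (%p. ab (-1) (p, eps)) p * partials [(0,1)] (%p. ab 1 (p, eps)) p
    - partials [(0,1)] (%p. ab (-1) (p, eps)) p * partials [(1,0)] (%p. ab 1 (p, eps)) p = 2 * r * jac (p, eps)"
   unfolding slice_pd_1[OF V sab pV] pab jac_def by (simp add: algebra_simps)
  ultimately show "partials [(1,0)] (%p. ab (-1) (p, eps)) p * partials [(0,1)] (%p. ab 1 (p, eps)) p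
    - partials [(0,1)] (%p. ab (-1) (p, eps)) p * partials [(1,0)] (%p. ab 1 (p, eps)) p ~= 0" by simp
 qed
 then show "hyperbonode (f eps) p" using h domains_ZZ(2)[OF W2_W1[OF w]] by (simp add: hyperbonode_def)
qed

text \<open>For Z < 0 the equation A^2 = Z B^2 has only the solution A = B = 0 over the reals.
  Conversely, along the root i sqrt(-Z) the cubic form is A + i sqrt(-Z) B, and its Jacobian with
  the conjugate is -2 i sqrt(-Z) times that of (A, B).\<close>

lemma ellipnode_iff:
 assumes w: "(p, eps) \<in> W2"
 shows "ellipnode (f eps) p \<longleftrightarrow> ZZ (p, eps) < 0 \<and> AA (p, eps) = 0 \<and> BB (p, eps) = 0"
proof
 assume h: "ellipnode (f eps) p"
 then obtain w' where "w' ~= 0" "jet_form 2 (f eps) p w' = 0" "jet_form 3 (f eps) p w' = 0"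
  unfolding ellipnode_def Let_def by blast
 then have "p \<in> flecnodal_curve (f eps)" unfolding flecnodal_curve_def by blast
 then have eq: "(AA (p, eps))\<^sup>2 = ZZ (p, eps) * (BB (p, eps))\<^sup>2" using flecnodal_iff[OF W2_W1[OF w]] by blast
 moreover have z: "ZZ (p, eps) < 0" using h domains_ZZ(1)[OF W2_W1[OF w]] by (simp add: ellipnode_def)
 then have "ZZ (p, eps) * (BB (p, eps))\<^sup>2 \<le> 0" by (simp add: mult_le_0_iff)
 ultimately have "AA (p, eps) = 0" by (metis zero_le_power2 antisym power_eq_0_iff)
 then show "ZZ (p, eps) < 0 \<and> AA (p, eps) = 0 \<and> BB (p, eps) = 0" using eq z by auto
next
 assume h: "ZZ (p, eps) < 0 \<and> AA (p, eps) = 0 \<and> BB (p, eps) = 0"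
 define V where "V = {w \<in> W2. ZZ w < 0}"
 have V: "open V"
 proof -
  have "V = W2 \<inter> ZZ -` {..<0}" by (auto simp: V_def)
  then show ?thesis using continuous_open_preimage[OF smooth_on_imp_continuous_on[OF smooth2(1)] openW2, of "{..<0}"] by simp
 qed
 have sV: "smooth_on V AA" "smooth_on V BB" "smooth_on V ZZ" "smooth_on V mm"
  using smooth2 smooth_on_subset[of W2 _ V] by (auto simp: V_def)
 have pV: "(p, eps) \<in> V" using w h by (simp add: V_def)
 define k where "k w = sqrt (- ZZ w)" for w
 have sk: "smooth_on V k" unfolding k_def by (rule smooth_on_sqrt[OF V smooth_on_minus[OF V sV(3)]]) (auto simp: V_def)
 define U where "U = {p. (p, eps) \<in> V}"
 have U: "open U" "p \<in> U" unfolding U_def using pV by (auto intro: open_slice[OF V])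
 \<comment> \<open>A smooth choice of one of the two conjugate roots; the direction field
   \<open>wf\<close> has first frame coordinate 1 and therefore never vanishes.\<close>
 define s where "s x = complex_of_real (k (x, eps)) * \<i>" for x
 define wf where "wf x = cw 1 (of_real (mm (x, eps)) + s x)" for x
 define Phi where "Phi x = jet_form 3 (f eps) x (wf x)" for x
 have s2: "(s x)\<^sup>2 = complex_of_real (ZZ (x, eps))" if "x \<in> U" for x
  using that by (simp add: s_def power_mult_distrib U_def V_def k_def of_real_power[symmetric] del: of_real_power)
 have W1U: "(x, eps) \<in> W1" if "x \<in> U" for x using that W2_W1 by (auto simp: U_def V_def)
 note jr = jet_form_root[OF W1U s2, folded wf_def]
 have Phi: "Phi x = of_real (AA (x, eps)) + of_real (k (x, eps) * BB (x, eps)) * \<i>" if "x \<in> U" for x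
  unfolding Phi_def jr(2)[OF that that] by (simp add: s_def)
 have pdPhi: "pd v Phi p = of_real (pd (v,0) AA (p, eps)) + of_real (k (p, eps) * pd (v,0) BB (p, eps)) * \<i>" for v
 proof -
  define bet where "bet x = k (x, eps) * BB (x, eps)" for x
  have d: "((%p. G (p, eps)) has_derivative (%v. pd (v,0) G (p, eps))) (at p)" if "smooth_on V G" for G :: "plane \<times> real => real"
  proof -
   have "((%p. (p, eps)) has_derivative (%v. (v, 0))) (at p)" by (auto intro!: derivative_eq_intros)
   from diff_chain_at[OF this smooth_on_has_derivative[OF that V pV]] show ?thesis by (simp add: o_def)
  qed
  have "(bet has_derivative (%v. k (p, eps) * pd (v,0) BB (p, eps))) (at p)"
   unfolding bet_def using has_derivative_mult[OF d[OF sk] d[OF sV(2)]] h by simp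
  then have "((%x. complex_of_real (AA (x, eps)) + of_real (bet x) * \<i>) has_derivative
   (%v. of_real (pd (v,0) AA (p, eps)) + of_real (k (p, eps) * pd (v,0) BB (p, eps)) * \<i>)) (at p)"
   by (intro has_derivative_add has_derivative_mult_left has_derivative_of_real d sV)
  then have "pd v (%x. complex_of_real (AA (x, eps)) + of_real (bet x) * \<i>) p =
    of_real (pd (v,0) AA (p, eps)) + of_real (k (p, eps) * pd (v,0) BB (p, eps)) * \<i>" by (rule pd_eqI)
  moreover have "pd v Phi p = pd v (%x. complex_of_real (AA (x, eps)) + of_real (bet x) * \<i>) p"
   by (rule pd_cong_open[OF U]) (simp add: Phi bet_def)
  ultimately show ?thesis by simp
 qed
 have swf: "smooth_on U wf"
 proof -
  have "smooth_on U (%x. mm (x, eps))" "smooth_on U (%x. k (x, eps))"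
   unfolding U_def by (rule smooth_on_slice[OF V sV(4)], rule smooth_on_slice[OF V sk])
  then show ?thesis unfolding wf_def s_def cw_def by (intro smooth_intros U(1))
 qed
 have "pd (1,0) Phi p * cnj (pd (0,1) Phi p) - pd (0,1) Phi p * cnj (pd (1,0) Phi p) = of_real (- 2 * k (p, eps) * jac (p, eps)) * \<i>"
  unfolding pdPhi jac_def by (simp add: complex_eq_iff algebra_simps)
 moreover have "k (p, eps) ~= 0" "jac (p, eps) ~= 0" using h w by (auto simp: k_def W2_def)
 ultimately have ne: "pd (1,0) Phi p * cnj (pd (0,1) Phi p) - pd (0,1) Phi p * cnj (pd (1,0) Phi p) ~= 0" by simp
 have "\<exists>U w. open U \<and> p \<in> U \<and> smooth_on U w \<and> (\<forall>x\<in>U. w x ~= 0 \<and> jet_form 2 (f eps) x (w x) = 0) \<and>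
   (let Phi = (%x. jet_form 3 (f eps) x (w x)) in Phi p = 0 \<and>
     partials [(1,0)] Phi p * cnj (partials [(0,1)] Phi p)
      - partials [(0,1)] Phi p * cnj (partials [(1,0)] Phi p) ~= 0)" unfolding Let_def Phi_def[abs_def, symmetric]
 proof (intro exI[of _ U] exI[of _ wf] conjI ballI)
  show "(%x. jet_form 3 (f eps) x (wf x)) p = 0" using Phi[OF U(2)] h by (simp add: Phi_def)
  show "partials [(1,0)] (%x. jet_form 3 (f eps) x (wf x)) p * cnj (partials [(0,1)] (%x. jet_form 3 (f eps) x (wf x)) p)
      - partials [(0,1)] (%x. jet_form 3 (f eps) x (wf x)) p * cnj (partials [(1,0)] (%x. jet_form 3 (f eps) x (wf x)) p) ~= 0"
   using ne unfolding partials_Cons_pd partials.simps(1) Phi_def[abs_def] .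
 qed (use U swf jr in auto)
 then show "ellipnode (f eps) p" unfolding ellipnode_def using h domains_ZZ(1)[OF W2_W1[OF w]] by blast
qed

text \<open>The chart is (A, B, Z). Its differential at q is injective: Z detects time, and in
  directions of constant time A and B are the form \<open>hb\<close> against \<open>v0\<close> and
  e'.\<close>

theorem umbrella_theorem:
 "\<exists>V Th. umbrella_chart {(p, eps). p \<in> flecnodal_curve (f eps)} (q, eps0) V Th \<and> (\<forall>(p, eps) \<in> V.
    (p \<in> real_flecnodal_curve (f eps) \<longleftrightarrow> Th (p, eps) \<in> range umbrella_param) \<and>
    (hyperbonode (f eps) p \<longleftrightarrow> Th (p, eps) \<in> self_intersection_line) \<and>
    (ellipnode (f eps) p \<longleftrightarrow> Th (p, eps) \<in> handle)) \<and>
  isochronal_section_tangent V Th"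
proof -
 define Th where "Th = (%w. ((AA w, BB w), ZZ w))"
 have sTh: "smooth_on W2 Th" unfolding Th_def by (intro smooth_intros openW2 smooth2)
 have pTh: "pd x Th (q, eps0) = ((pd x AA (q, eps0), pd x BB (q, eps0)), pd x ZZ (q, eps0))" for x
  unfolding Th_def by (rule pd_tuple[OF smooth1(3,4,2) w0_W1])
 have Zt: "t = 0" if "pd (v, t) ZZ (q, eps0) = 0" for v t using that Heps g02_0 unfolding pd_ZZ by simp
 have inj: "x = 0" if "pd x Th (q, eps0) = 0" for x
 proof -
  obtain v t where x: "x = (v, t)" by (cases x)
  have 0: "pd x AA (q, eps0) = 0" "pd x BB (q, eps0) = 0" "pd x ZZ (q, eps0) = 0"
   using that unfolding pTh by (auto simp: zero_prod_def)
  have t: "t = 0" using Zt 0(3) x by blast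
  have "hb v v0 = 0" "hb v e' = 0" using 0(1,2) pd_AB[of v] g02_0 x t by auto
  then show "x = 0" using hb_nondegenerate x t by (simp add: zero_prod_def)
 qed
 obtain V where V: "open V" "V \<subseteq> W2" "(q, eps0) \<in> V" "diffeo_on V Th"
  using smooth_inverse_function[OF openW2 sTh w0_W2 inj] by blast
 have Th0: "Th (q, eps0) = 0" by (simp add: Th_def AB0 Z0 zero_prod_def)
 have "umbrella_chart {(p, eps). p \<in> flecnodal_curve (f eps)} (q, eps0) V Th" unfolding umbrella_chart_def
 proof (intro conjI V Th0 ballI)
  fix w assume "w \<in> V"
  obtain p eps where w: "w = (p, eps)" by (cases w)
  have "(p, eps) \<in> W1" using \<open>w \<in> V\<close> V(2) W2_W1 w by blast
  then show "w \<in> {(p, eps). p \<in> flecnodal_curve (f eps)} \<longleftrightarrow> Th w \<in> umbrella"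
   by (simp add: w Th_def umbrella_def flecnodal_iff)
 qed
 moreover have "\<forall>(p, eps) \<in> V.
    (p \<in> real_flecnodal_curve (f eps) \<longleftrightarrow> Th (p, eps) \<in> range umbrella_param) \<and>
    (hyperbonode (f eps) p \<longleftrightarrow> Th (p, eps) \<in> self_intersection_line) \<and>
    (ellipnode (f eps) p \<longleftrightarrow> Th (p, eps) \<in> handle)"
 proof (intro ballI, clarify)
  fix p eps assume "(p, eps) \<in> V"
  then have w: "(p, eps) \<in> W2" using V(2) by blast
  show "(p \<in> real_flecnodal_curve (f eps) \<longleftrightarrow> Th (p, eps) \<in> range umbrella_param) \<and>
    (hyperbonode (f eps) p \<longleftrightarrow> Th (p, eps) \<in> self_intersection_line) \<and>
    (ellipnode (f eps) p \<longleftrightarrow> Th (p, eps) \<in> handle)"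
   unfolding hyperbonode_iff[OF w] ellipnode_iff[OF w] real_flecnodal_iff[OF W2_W1[OF w]]
   by (auto simp: Th_def range_umbrella_param self_intersection_line_def handle_def)
 qed
 moreover have "isochronal_section_tangent V Th" unfolding isochronal_section_tangent_def
 proof
  fix h :: plane
  note D = diffeo_onD[OF V(4)]
  have 0: "0 \<in> Th ` V" using Th0 V(3) by (metis imageI)
  have i0: "inv_into V Th 0 = (q, eps0)" using Th0 V(3) D(3) by (metis inv_into_f_f)
  have u0: "umbrella_param 0 = 0" by (simp add: umbrella_param_def zero_prod_def)
  \<comment> \<open>The single tangent line is the B-axis. A vector mapped to it by the chart has dZ
    = 0, and dZ is a nonzero multiple of dt at q, hence the vector is isochronal.\<close>
  have du: "(umbrella_param has_derivative (%h. ((0, snd h), 0))) (at 0)" unfolding umbrella_param_def case_prod_unfold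
   by (auto intro!: derivative_eq_intros simp: zero_prod_def)
  have "((%x. inv_into V Th (umbrella_param x)) has_derivative (%h. pd ((0, snd h), 0) (inv_into V Th) 0)) (at 0)"
   using diff_chain_at[OF du, of "inv_into V Th"] smooth_on_has_derivative[OF D(5,2) 0] by (simp add: u0 o_def)
  then have "frechet_derivative (%x. inv_into V Th (umbrella_param x)) (at 0) h = pd ((0, snd h), 0) (inv_into V Th) 0"
   using pd_eqI[of _ _ 0 h] unfolding pd_def[of h] by blast
  moreover define x where "x = pd ((0, snd h), 0) (inv_into V Th) 0"
  have "pd x Th (q, eps0) = ((0, snd h), 0)" using diffeo_on_inv_pd[OF V(4) 0, of "((0, snd h), 0)"] by (simp add: x_def i0)
  then have "pd (fst x, snd x) ZZ (q, eps0) = 0" by (simp add: pTh)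
  then have "snd x = 0" by (rule Zt)
  ultimately show "snd (frechet_derivative (%x. inv_into V Th (umbrella_param x)) (at 0) h) = 0" by (simp add: x_def)
 qed
 ultimately show ?thesis by blast
qed

end

subsection \<open>Normal form of the A3 transition\<close>

lemma taylor1_dir:
 fixes g :: "'a::euclidean_space => real"
 assumes "open U" "smooth_on U g" "!!t. t \<in> {0..1} ==> x + (t * d) *. u \<in> U"
 shows "g (x + d *. u) = g x + d * integral {0..1} (%t. pd u g (x + (t * d) *. u))"
proof -
 have dg: "g differentiable (at (x + t *. (d *. u)))" if "t \<in> {0..1}" for t
  using smooth_on_differentiable[OF assms(2,1) assms(3)[OF that]] by simp
 have "((%t. g (x + t *. (d *. u))) has_real_derivative d * pd u g (x + (t * d) *. u)) (at t)" if "t \<in> {0..1}" for t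
  using pd_along_line_real[OF dg[OF that]] pd_linear(3)[OF dg[OF that], of d u] by simp
 from taylor1_integral[OF this] show ?thesis by simp
qed

lemma taylor2_dir:
 fixes g :: "'a::euclidean_space => real"
 assumes "open U" "smooth_on U g" "!!t. t \<in> {0..1} ==> x + (t * d) *. u \<in> U"
 shows "g (x + d *. u) = g x + d * pd u g x
  + d\<^sup>2 * integral {0..1} (%t. (1 - t) * pd u (pd u g) (x + (t * d) *. u))"
proof -
 have dg: "G differentiable (at (x + t *. (d *. u)))" if "t \<in> {0..1}" "smooth_on U G" for t and G :: "'a => real"
  using smooth_on_differentiable[OF that(2) assms(1) assms(3)[OF that(1)]] by simp
 have 1: "((%t. G (x + t *. (d *. u))) has_real_derivative d * pd u G (x + (t * d) *. u)) (at t)"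
  if "t \<in> {0..1}" "smooth_on U G" for t and G :: "'a => real"
  using pd_along_line_real[OF dg[OF that]] pd_linear(3)[OF dg[OF that], of d u] by simp
 have 2: "((%t. d * pd u g (x + (t * d) *. u)) has_real_derivative d * (d * pd u (pd u g) (x + (t * d) *. u))) (at t)"
  if "t \<in> {0..1}" for t using DERIV_cmult[OF 1[OF that smooth_on_pd[OF assms(1,2)]], of d] by simp
 have "g (x + 1 *. (d *. u)) = g (x + 0 *. (d *. u)) + d * pd u g (x + (0 * d) *. u)
   + integral {0..1} (%t. (1 - t) * (d * (d * pd u (pd u g) (x + (t * d) *. u))))"
  by (rule taylor2_integral[OF 1[OF _ assms(2)] 2])
 moreover have "(%t. (1 - t) * (d * (d * pd u (pd u g) (x + (t * d) *. u))))
   = (%t. d\<^sup>2 * ((1 - t) * pd u (pd u g) (x + (t * d) *. u)))" by (auto simp: power2_eq_square algebra_simps)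
 ultimately show ?thesis by simp
qed

lemma integral_one_minus: "integral {0..1} (%t. (1 - t) * c) = c / (2::real)"
proof -
 have "((%tau. tau - tau\<^sup>2 / 2) has_vector_derivative 1 - x) (at x within {0..1})" for x :: real
  by (auto intro!: derivative_eq_intros simp: has_real_derivative_iff_has_vector_derivative[symmetric])
 from fundamental_theorem_of_calculus[OF _ this] have "((%tau. 1 - tau) has_integral 1/2) {0..1::real}" by simp
 then show ?thesis by (simp add: integral_unique)
qed

lemma open_Collect_mem: "open V ==> continuous_on UNIV g ==> open {x. g x \<in> V}"
 using open_vimage[of V g] by (simp add: vimage_def)

abbreviation (input) eX :: "plane \<times> real" where "eX \<equiv> ((1, 0), 0)"
abbreviation (input) eY :: "plane \<times> real" where "eY \<equiv> ((0, 1), 0)"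
abbreviation (input) eT :: "plane \<times> real" where "eT \<equiv> ((0, 0), 1)"

lemma pd_coords:
 fixes g :: "plane \<times> real => real"
 assumes "g differentiable (at x)"
 shows "pd ((a, b), c) g x = a * pd eX g x + b * pd eY g x + c * pd eT g x"
proof -
 have "((a, b), c) = a *. eX + b *. eY + c *. eT" by simp
 then show ?thesis using pd_linear(2,3)[OF assms] by (metis real_scaleR_def)
qed

lemma open_contains_cube:
 fixes N :: "(plane \<times> real) set"
 assumes "open N" "0 \<in> N"
 obtains R where "R > 0" "!!X Y e. \<bar>X\<bar> < R ==> \<bar>Y\<bar> < R ==> \<bar>e\<bar> < R ==> ((X, Y), e) \<in> N"
proof -
 obtain r where r: "r > 0" "ball 0 r \<subseteq> N" using assms open_contains_ball by blast
 have "((X, Y), e) \<in> N" if "\<bar>X\<bar> < r / 3" "\<bar>Y\<bar> < r / 3" "\<bar>e\<bar> < r / 3" for X Y e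
 proof -
  have "norm ((X, Y), e) \<le> norm (X, Y) + norm e" "norm (X, Y) \<le> norm X + norm Y" by (rule norm_Pair_le)+
  then have "norm ((X, Y), e) < r" using that by simp
  then show ?thesis using r(2) by (auto simp: dist_norm)
 qed
 then show ?thesis using that[of "r/3"] r(1) by auto
qed

text \<open>Write zeta = e a + Y^2 r + X z1. Completing the square in X turns X^2 = Y^2 zeta into
  d^2 = Y^2 a (e + Y^2 rho) with d = X - Y^2 z1 / 2, and rescaling Y and d removes a and rho up to
  sign. The x of the normal form comes from Y, its y from X.\<close>

theorem A3_normal_form:
 fixes zeta :: "plane \<times> real => real"
 assumes N: "open N" "smooth_on N zeta" "0 \<in> N" and z0: "zeta 0 = 0" "pd eX zeta 0 = 0" "pd eY zeta 0 = 0"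
  and zyy: "pd eY (pd eY zeta) 0 ~= 0" and zt: "pd eT zeta 0 ~= 0"
 obtains V Th s1 s2 where "diffeo_on V Th" "0 \<in> V" "V \<subseteq> N" "Th 0 = 0" "s1 \<in> {1, -1::real}" "s2 \<in> {1, -1::real}"
  "!!X Y e. ((X, Y), e) \<in> V ==> snd (Th ((X, Y), e)) = s1 * e \<and>
   (X\<^sup>2 = Y\<^sup>2 * zeta ((X, Y), e) \<longleftrightarrow> fst (Th ((X, Y), e)) \<in> {(x, y). y\<^sup>2 = (s1 * e) * x\<^sup>2 + s2 * x ^ 4})"
proof -
 obtain R where R: "R > 0" "!!X Y e. \<bar>X\<bar> < R ==> \<bar>Y\<bar> < R ==> \<bar>e\<bar> < R ==> ((X, Y), e) \<in> N"
  using open_contains_cube[OF N(1,3)] by blast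
 \<comment> \<open>A cube, so that the segments parallel to the axes used in the expansions stay
   inside.\<close>
 define C where "C = {w :: plane \<times> real. \<bar>fst (fst w)\<bar> < R \<and> \<bar>snd (fst w)\<bar> < R \<and> \<bar>snd w\<bar> < R}"
 have C: "open C" unfolding C_def by (intro open_Collect_conj open_Collect_less continuous_intros)
 have C0: "0 \<in> C" using R(1) by (simp add: C_def)
 have CN: "C \<subseteq> N"
 proof
  fix w assume "w \<in> C"
  then show "w \<in> N" using R(2)[of "fst (fst w)" "snd (fst w)" "snd w"] by (simp add: C_def)
 qed
 have szeta: "smooth_on C zeta" by (rule smooth_on_subset[OF N(2) CN])
 note s1 = smooth_on_pd[OF C szeta] and s2 = smooth_on_pd[OF C smooth_on_pd[OF C szeta]]
 have small: "\<bar>t * x\<bar> < R" if "\<bar>x\<bar> < R" "t \<in> {0..1}" for t x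
  using that mult_left_le_one_le[of "\<bar>x\<bar>" t] by (auto simp: abs_mult)
 have had: "smooth_on C (%w. integral {0..1} (%t. q t * g (L (w, t))))"
  if "smooth_on C g" "smooth_on UNIV L" "smooth_on UNIV q" "!!w t. w \<in> C ==> t \<in> {0..1} ==> L (w, t) \<in> C"
  for g q :: "_ => real" and L :: "(plane \<times> real) \<times> real => plane \<times> real"
 proof -
  define S where "S = L -` C"
  have S: "open S" unfolding S_def by (rule open_vimage[OF C smooth_on_imp_continuous_on[OF that(2)]])
  have "smooth_on S (%z. q (snd z))" by (rule smooth_on_compose[OF that(3) _ S open_UNIV], intro smooth_intros S) simp
  moreover have "smooth_on S (%z. g (L z))"
   by (rule smooth_on_compose[OF that(1) smooth_on_subset[OF that(2)] S C]) (auto simp: S_def)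
  ultimately have "smooth_on S (%z. q (snd z) * g (L z))" by (intro smooth_on_mult S)
  moreover have "C \<times> {0..1} \<subseteq> S" using that(4) unfolding S_def by blast
  ultimately show ?thesis using smooth_on_integral[OF C S, of "%z. q (snd z) * g (L z)"] by simp
 qed
 \<comment> \<open>Remainders of an expansion to first order in X, then at X = 0 to first order in
   e, then at e = 0 to second order in Y, where value and first derivative vanish.\<close>
 define z1 where "z1 w = integral {0..1} (%t. pd eX zeta ((t * fst (fst w), snd (fst w)), snd w))" for w
 define a where "a w = integral {0..1} (%t. pd eT zeta ((0, snd (fst w)), t * snd w))" for w :: "plane \<times> real"
 define r where "r w = integral {0..1} (%t. (1 - t) * pd eY (pd eY zeta) ((0, t * snd (fst w)), 0))" for w :: "plane \<times> real"
 have sz: "smooth_on C z1" unfolding z1_def[abs_def]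
  by (rule had[where q="%_. 1" and L="%z. ((snd z * fst (fst (fst z)), snd (fst (fst z))), snd (fst z))", OF s1, simplified])
   (auto intro!: smooth_intros open_UNIV simp: C_def small)
 have sa: "smooth_on C a" unfolding a_def[abs_def]
  by (rule had[where q="%_. 1" and L="%z. ((0, snd (fst (fst z))), snd z * snd (fst z))", OF s1, simplified])
   (use R(1) in \<open>auto intro!: smooth_intros open_UNIV simp: C_def small\<close>)
 have sr: "smooth_on C r" unfolding r_def[abs_def]
  by (rule had[where q="%t. 1 - t" and L="%z. ((0, snd z * snd (fst (fst z))), 0)", OF s2, simplified])
   (use R(1) in \<open>auto intro!: smooth_intros open_UNIV simp: C_def small\<close>)
 have at0: "z1 0 = 0" "a 0 = pd eT zeta 0" "r 0 = pd eY (pd eY zeta) 0 / 2"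
  using z0 integral_one_minus by (simp_all add: z1_def a_def r_def zero_prod_def)
 have expand: "zeta ((X, Y), e) = e * a ((X, Y), e) + Y\<^sup>2 * r ((X, Y), e) + X * z1 ((X, Y), e)" if w: "((X, Y), e) \<in> C" for X Y e
 proof -
  have m: "\<bar>X\<bar> < R" "\<bar>Y\<bar> < R" "\<bar>e\<bar> < R" using w by (auto simp: C_def)
  have "zeta (((0, Y), e) + X *. eX) = zeta ((0, Y), e) + X * integral {0..1} (%t. pd eX zeta (((0, Y), e) + (t * X) *. eX))"
   by (rule taylor1_dir[OF C szeta]) (use m in \<open>simp add: C_def small\<close>)
  moreover have "zeta (((0, Y), 0) + e *. eT) = zeta ((0, Y), 0) + e * integral {0..1} (%t. pd eT zeta (((0, Y), 0) + (t * e) *. eT))"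
   by (rule taylor1_dir[OF C szeta]) (use m in \<open>simp add: C_def small\<close>)
  moreover have "zeta (((0, 0), 0) + Y *. eY) = zeta ((0, 0), 0) + Y * pd eY zeta ((0, 0), 0)
    + Y\<^sup>2 * integral {0..1} (%t. (1 - t) * pd eY (pd eY zeta) (((0, 0), 0) + (t * Y) *. eY))"
   by (rule taylor2_dir[OF C szeta]) (use m in \<open>simp add: C_def small\<close>)
  ultimately show ?thesis using z0 by (simp add: z1_def a_def r_def zero_prod_def)
 qed
 \<comment> \<open>The summand with z1 comes from completing the square; it vanishes at 0, so there
   the sign of rho is that of the quotient of the second derivative in Y by the time
   derivative.\<close>
 define rho where "rho w = (r w + (z1 w)\<^sup>2 / 4) / a w" for w
 define s su where "s = sgn (rho 0)" and "su = sgn (a 0)"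
 have a0: "a 0 ~= 0" and rho0: "rho 0 ~= 0" using zt zyy by (auto simp: rho_def at0)
 then have s: "s = 1 \<or> s = -1" "s * rho 0 > 0" "su = 1 \<or> su = -1" "su * a 0 > 0" by (auto simp: s_def su_def sgn_if)
 define A where "A = C \<inter> (%w. su * a w) -` {0<..}"
 have A: "open A" "0 \<in> A" "A \<subseteq> C"
  using continuous_open_preimage[OF smooth_on_imp_continuous_on[OF smooth_on_mult[OF C smooth_on_const sa]] C open_greaterThan] C0 s(4)
  by (auto simp: A_def)
 have srho: "smooth_on A rho" unfolding rho_def[abs_def]
  by (intro smooth_on_divide smooth_on_add smooth_on_power smooth_on_const A smooth_on_subset[OF sa] smooth_on_subset[OF sr] smooth_on_subset[OF sz])
   (auto simp: A_def)
 define P where "P = A \<inter> (%w. s * rho w) -` {0<..}"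
 have P: "open P" "0 \<in> P" "P \<subseteq> A"
  using continuous_open_preimage[OF smooth_on_imp_continuous_on[OF smooth_on_mult[OF A(1) smooth_on_const srho]] A(1) open_greaterThan] A(2) s(2)
  by (auto simp: P_def)
 have PC: "P \<subseteq> C" using P(3) A(3) by blast
 have pos: "s * rho w > 0" "su * a w > 0" if "w \<in> P" for w using that by (auto simp: P_def A_def)
 define k1 k2 where "k1 w = sqrt (s * rho w)" and "k2 w = sqrt (s * rho w / (su * a w))" for w
 note sP = smooth_on_subset[OF srho P(3)] smooth_on_subset[OF sa PC] smooth_on_subset[OF sz PC]
 have sk: "smooth_on P k1" "smooth_on P k2" unfolding k1_def[abs_def] k2_def[abs_def]
  by (intro smooth_on_sqrt smooth_on_divide smooth_on_mult smooth_on_const P sP; use pos in fastforce)+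
 \<comment> \<open>With k1^2 = s rho and k2^2 = s rho / (su a) the equation becomes y^2 = (su e) x^2
   + (su s) x^4; so time may be reversed, by the sign su.\<close>
 define Th where "Th w = ((snd (fst w) * k1 w, (fst (fst w) - (snd (fst w))\<^sup>2 * z1 w / 2) * k2 w), su * snd w)" for w
 have sTh: "smooth_on P Th" unfolding Th_def[abs_def] by (intro smooth_on_divide smooth_intros P sk sP) simp
 have Th0: "Th 0 = 0" by (simp add: Th_def zero_prod_def)
 have k0: "k1 0 > 0" "k2 0 > 0" using pos[OF P(2)] by (auto simp: k1_def k2_def)
 have dk: "(g has_derivative (%v. pd v g 0)) (at 0)" if "smooth_on P g" for g :: "plane \<times> real => real"
  by (rule smooth_on_has_derivative[OF that P(1,2)])
 have "(Th has_derivative (%v. ((snd (fst v) * k1 0, fst (fst v) * k2 0), su * snd v))) (at 0)"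
  unfolding Th_def[abs_def] using dk[OF sk(1)] dk[OF sk(2)] dk[OF sP(3)]
  by (auto intro!: derivative_eq_intros simp: power2_eq_square)
 then have pTh: "pd v Th 0 = ((snd (fst v) * k1 0, fst (fst v) * k2 0), su * snd v)" for v by (rule pd_eqI)
 have inj: "v = 0" if "pd v Th 0 = 0" for v using that k0 s(3) unfolding pTh by (cases v) (auto simp: zero_prod_def)
 obtain V where V: "open V" "V \<subseteq> P" "0 \<in> V" "diffeo_on V Th"
  using smooth_inverse_function[OF P(1) sTh P(2) inj] by blast
 have "snd (Th ((X, Y), e)) = su * e \<and>
   (X\<^sup>2 = Y\<^sup>2 * zeta ((X, Y), e) \<longleftrightarrow> fst (Th ((X, Y), e)) \<in> {(x, y). y\<^sup>2 = (su * e) * x\<^sup>2 + (su * s) * x ^ 4})"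
  if v: "((X, Y), e) \<in> V" for X Y e
 proof -
  let ?w = "((X, Y), e)"
  have w: "?w \<in> P" "?w \<in> C" using v V(2) PC by auto
  define d where "d = X - Y\<^sup>2 * z1 ?w / 2"
  have a: "a ?w ~= 0" using pos(2)[OF w(1)] by auto
  have ss: "s * s = 1" "su * su = 1" using s by auto
  have q: "a ?w * rho ?w = r ?w + (z1 ?w)\<^sup>2 / 4" using a by (simp add: rho_def)
  have main: "X\<^sup>2 - Y\<^sup>2 * zeta ?w = d\<^sup>2 - Y\<^sup>2 * a ?w * (e + Y\<^sup>2 * rho ?w)"
   unfolding expand[OF w(2)] d_def using q by algebra
  have k: "(k1 ?w)\<^sup>2 = s * rho ?w" "(su * a ?w) * (k2 ?w)\<^sup>2 = s * rho ?w"
   using pos[OF w(1)] a s(3) by (auto simp: k1_def k2_def)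
  have "(su * a ?w) * ((d * k2 ?w)\<^sup>2 - ((su * e) * (Y * k1 ?w)\<^sup>2 + (su * s) * (Y * k1 ?w) ^ 4))
    = s * rho ?w * (X\<^sup>2 - Y\<^sup>2 * zeta ?w)" unfolding main using k ss by algebra
  moreover have "su * a ?w ~= 0" "s * rho ?w ~= 0" using pos[OF w(1)] by auto
  ultimately have "X\<^sup>2 - Y\<^sup>2 * zeta ?w = 0 \<longleftrightarrow> (d * k2 ?w)\<^sup>2 - ((su * e) * (Y * k1 ?w)\<^sup>2 + (su * s) * (Y * k1 ?w) ^ 4) = 0"
   by (metis mult_eq_0_iff)
  then show ?thesis by (simp add: Th_def d_def)
 qed
 moreover have "su * s \<in> {1, -1}" "su \<in> {1, -1}" using s by auto
 ultimately show ?thesis using that[OF V(4,3) _ Th0] V(2) PC CN by blast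
qed

section \<open>Godrons, and the coordinates (A, B, eps) of surface-time\<close>

lemma convex_critical_pos:
 fixes k :: "real => real"
 assumes d1: "!!y. \<bar>y\<bar> < R ==> (k has_real_derivative k1 y) (at y)"
  and d2: "!!y. \<bar>y\<bar> < R ==> (k1 has_real_derivative k2 y) (at y)"
  and pos: "!!y. \<bar>y\<bar> < R ==> k2 y > 0" and "k 0 = 0" "k1 0 = 0" "\<bar>Y\<bar> < R" "Y ~= 0"
 shows "k Y > 0"
proof (cases "Y > 0")
 case True
 obtain z where z: "0 < z" "z < Y" "k Y - k 0 = (Y - 0) * k1 z" using MVT2[OF True, of k k1] d1 assms(6) by force
 obtain z' where "0 < z'" "z' < z" "k1 z - k1 0 = (z - 0) * k2 z'" using MVT2[OF z(1), of k1 k2] d2 z(2) assms(6) by force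
 then show ?thesis using z pos[of z'] assms by simp
next
 case False
 then have Y: "Y < 0" using assms by simp
 obtain z where z: "Y < z" "z < 0" "k 0 - k Y = (0 - Y) * k1 z" using MVT2[OF Y, of k k1] d1 assms(6) by force
 obtain z' where z': "z < z'" "z' < 0" "k1 0 - k1 z = (0 - z) * k2 z'" using MVT2[OF z(2), of k1 k2] d2 z(1) assms(6) by force
 have "k2 z' > 0" using z z' assms(6) by (intro pos) auto
 then have "k1 z < 0" using z z' assms(5) by (simp add: mult_neg_pos)
 then show ?thesis using z Y assms(4) by (simp add: mult_neg_neg)
qed

text \<open>A convex function that is negative at 0 has at most one zero on either side: the nearer
  of two zeros would lie on a chord from a negative value to 0.\<close>

lemma convex_zero_unique:
 fixes k :: "real => real"
 assumes "convex_on S k" "0 \<in> S" "k 0 < 0" "y \<in> S" "y' \<in> S" "k y = 0" "k y' = 0" "y * y' > 0"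
 shows "y = y'"
proof -
 have main: False if "convex_on S k" "y' \<in> S" "k y = 0" "k y' = 0" "\<bar>y\<bar> < \<bar>y'\<bar>" "y * y' > 0" for y y'
 proof -
  define t where "t = y / y'"
  have y': "y' ~= 0" using that by auto
  have t: "0 < t" "t < 1" using that y' by (auto simp: t_def zero_less_divide_iff zero_less_mult_iff divide_less_eq)
  have "k ((1 - t) *. 0 + t *. y') \<le> (1 - t) * k 0 + t * k y'"
   using that(1,2) assms(2) t by (intro convex_onD) auto
  then have "k y \<le> (1 - t) * k 0" using that y' by (simp add: t_def)
  moreover have "(1 - t) * k 0 < 0" using t assms(3) by (simp add: mult_pos_neg)
  ultimately show False using that by simp
 qed
 have "\<not> \<bar>y\<bar> < \<bar>y'\<bar>" "\<not> \<bar>y'\<bar> < \<bar>y\<bar>"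
  using main[OF assms(1,5,6,7)] main[OF assms(1,4,7,6)] assms(8) by (auto simp: mult.commute)
 then have "\<bar>y\<bar> = \<bar>y'\<bar>" by simp
 then show ?thesis using assms(8) by (auto simp: abs_if zero_less_mult_iff split: if_splits)
qed

context morse_family
begin

text \<open>Differentiating \<open>H\<close> along an arc of the parabolic curve tangent to v gives
  dH(v) = 0. As v is asymptotic and Z = 0, this derivative is A up to a nonzero factor.\<close>

lemma godronD:
 assumes w: "(p, eps) \<in> W1" and g: "godron (f eps) p"
 shows "ZZ (p, eps) = 0" "AA (p, eps) = 0"
proof -
 show z: "ZZ (p, eps) = 0" using g domains_ZZ(3)[OF w] by (simp add: godron_def)
 obtain v gam dlt where v: "asymptotic (f eps) p v" and gam: "dlt > 0" "gam 0 = p"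
  "!!t. t \<in> {-dlt<..<dlt} ==> gam t \<in> parabolic_curve (f eps)" "(gam has_vector_derivative v) (at 0)"
  using g unfolding godron_def tangent_to_parabolic_def by blast
 have dH: "hess_det (f eps) differentiable (at p)"
  using smooth_on_differentiable[OF slice_smooth_H slice_open] W1_W(1)[OF w] by blast
 have "(gam has_derivative (%s. s *. v)) (at 0)" using gam(4) by (simp add: has_vector_derivative_def)
 moreover have "(hess_det (f eps) has_derivative (%v. pd v (hess_det (f eps)) p)) (at (gam 0))"
  using has_derivative_pd[OF dH] by (simp add: gam(2))
 ultimately have "((%t. hess_det (f eps) (gam t)) has_derivative (%s. pd (s *. v) (hess_det (f eps)) p)) (at 0)"
  by (drule_tac diff_chain_at) (auto simp: o_def)
 then have "pd 1 (%t. hess_det (f eps) (gam t)) 0 = pd v (hess_det (f eps)) p" using pd_eqI by fastforce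
 moreover have "pd 1 (%t. hess_det (f eps) (gam t)) 0 = pd 1 (%t::real. 0::real) 0"
  by (rule pd_cong_open[of "{-dlt<..<dlt}"]) (use gam in \<open>auto simp: parabolic_curve_def\<close>)
 ultimately have 0: "pd (v, 0) H (p, eps) = 0" using slice_pd_H[OF W1_W(1)[OF w]] by (simp add: pd_const)
 obtain a where a: "a ~= 0" "v = a *. e + (a * mm (p, eps)) *. e'" using v z unfolding asymptotic_iff[OF w] by auto
 have "a * pd (e, 0) H (p, eps) + (a * mm (p, eps)) * pd (e', 0) H (p, eps) = 0"
  using 0 pd_frame[OF smooth_on_differentiable[OF smooth_H openW W1_W(1)[OF w]], of a "a * mm (p, eps)"] a(2) by simp
 then have "a * (pd (e, 0) H (p, eps) + mm (p, eps) * pd (e', 0) H (p, eps)) = 0" by (simp add: algebra_simps)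
 then show "AA (p, eps) = 0" using AB_H(1)[OF w] a(1) z by simp
qed

text \<open>For Z = 0 a nonzero B means that dH(e') is nonzero: the parabolic curve is regular
  there, and A = 0 makes the asymptotic direction its tangent.\<close>

lemma godronI:
 assumes w: "(p, eps) \<in> W1" and z: "ZZ (p, eps) = 0" "AA (p, eps) = 0" "BB (p, eps) ~= 0"
 shows "godron (f eps) p"
proof -
 note wW = W1_W(1)[OF w]
 define v where "v = 1 *. e + mm (p, eps) *. e'"
 have as: "asymptotic (f eps) p u \<longleftrightarrow> (\<exists>a. a ~= 0 \<and> u = a *. v)" for u
  unfolding asymptotic_iff[OF w] z v_def by (simp add: scaleR_add_right)
 have asv: "asymptotic (f eps) p v" unfolding as by (intro exI[of _ 1]) simp
 define U where "U = {p. (p, eps) \<in> W}"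
 have U: "open U" "smooth_on U (hess_det (f eps))" "p \<in> U" using slice_open slice_smooth_H wW by (auto simp: U_def)
 have "pd (v, 0) H (p, eps) = 0"
  unfolding v_def using pd_frame[OF smooth_on_differentiable[OF smooth_H openW wW], of 1 "mm (p, eps)"]
   AB_H(1)[OF w] z W1_W(2)[OF w] by simp
 then have 1: "pd v (hess_det (f eps)) p = 0" using slice_pd_H[OF wW] by simp
 have 2: "pd e' (hess_det (f eps)) p ~= 0" using AB_H(2)[OF w] z slice_pd_H[OF wW] by auto
 have 3: "hess_det (f eps) p = 0" using domains_ZZ(3)[OF w] z by (simp add: parabolic_curve_def)
 obtain T gam where g: "open T" "(0::real) \<in> T" "smooth_on T gam" "gam 0 = p"
  "!!t. t \<in> T ==> gam t \<in> U \<and> hess_det (f eps) (gam t) = 0" "(gam has_vector_derivative v) (at 0)"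
  using regular_curve[OF U 3 1 2] by metis
 have "tangent_to_parabolic (f eps) p v" by (rule smooth_curve_tangentI[OF g(1-4) _ _ g(6)])
   (use g(5) asv in \<open>auto simp: parabolic_curve_def asymptotic_def\<close>)
 then show ?thesis unfolding godron_def unique_asymptotic_def using asv as domains_ZZ(3)[OF w] z by blast
qed

text \<open>Unlike the umbrella chart, these coordinates respect the isochronal sections; in them
  the flecnodal curves are X^2 = Y^2 zeta.\<close>

definition Th1 where "Th1 w = ((AA w, BB w), snd w - eps0)"

lemma Th1_props:
 "smooth_on W2 Th1" "Th1 (q, eps0) = 0"
 "pd x Th1 (q, eps0) = ((pd x AA (q, eps0), pd x BB (q, eps0)), snd x)"
 "pd x Th1 (q, eps0) = 0 ==> x = 0"
proof -
 have s: "smooth_on W1 (%w. snd w - eps0)" by (intro smooth_intros openW1)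
 show "smooth_on W2 Th1" unfolding Th1_def by (intro smooth_intros openW2 smooth2)
 show "Th1 (q, eps0) = 0" by (simp add: Th1_def AB0 zero_prod_def)
 have "pd x (%w. snd w - eps0) (q, eps0) = snd x" for x :: "plane \<times> real"
  by (rule pd_eqI) (auto intro!: derivative_eq_intros)
 then show p: "pd x Th1 (q, eps0) = ((pd x AA (q, eps0), pd x BB (q, eps0)), snd x)" for x
  unfolding Th1_def using pd_tuple[OF smooth1(3,4) s w0_W1] by simp
 show "x = 0" if "pd x Th1 (q, eps0) = 0"
 proof -
  obtain v t where x: "x = (v, t)" by (cases x)
  have "t = 0" "pd (v, t) AA (q, eps0) = 0" "pd (v, t) BB (q, eps0) = 0" using that unfolding p by (auto simp: zero_prod_def x)
  then have "t = 0" "hb v v0 = 0" "hb v e' = 0" using pd_AB[of v] g02_0 by auto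
  then show "x = 0" using hb_nondegenerate x by (simp add: zero_prod_def)
 qed
qed

text \<open>The signs are what later counts godrons. The direction \<open>t0\<close> is carried to
  the Y-axis because dA(t0) = 0, so the second derivative of zeta in Y has the sign of that of Z
  along \<open>t0\<close>, opposite to \<open>hb t0 t0\<close>; likewise the time derivatives of
  zeta and \<open>H\<close> are opposite.\<close>

lemma zeta_chart:
 obtains V zeta where "V \<subseteq> W2" "(q, eps0) \<in> V" "diffeo_on V Th1" "smooth_on (Th1 ` V) zeta"
  "!!w. w \<in> V ==> zeta (Th1 w) = ZZ w" "zeta 0 = 0" "pd eX zeta 0 = 0" "pd eY zeta 0 = 0"
  "pd eT zeta 0 * pd (0, 1) H (q, eps0) < 0" "pd eY (pd eY zeta) 0 * hb t0 t0 < 0"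
proof -
 let ?w = "(q, eps0)"
 obtain V where V: "open V" "V \<subseteq> W2" "?w \<in> V" "diffeo_on V Th1"
  using smooth_inverse_function[OF openW2 Th1_props(1) w0_W2 Th1_props(4)] by metis
 note D = diffeo_onD[OF V(4)]
 define N where "N = Th1 ` V"
 define Psi where "Psi = inv_into V Th1"
 define zeta where "zeta y = ZZ (Psi y)" for y
 have Psi: "Psi (Th1 w) = w" if "w \<in> V" for w using that D(3) by (simp add: Psi_def inv_into_f_f)
 have Psi0: "Psi 0 = ?w" using Psi[OF V(3)] Th1_props(2) by simp
 have N: "open N" "0 \<in> N" "smooth_on N Psi" "Psi ` N \<subseteq> V"
  using D V(3) Th1_props(2) unfolding N_def Psi_def by (auto simp: inv_into_into intro: rev_image_eqI)
 have sZ: "smooth_on V ZZ" by (rule smooth_on_subset[OF smooth2(1) V(2)])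
 have szeta: "smooth_on N zeta" unfolding zeta_def by (rule smooth_on_compose[OF sZ N(3) N(1) V(1) N(4)])
 have zetaTh: "zeta (Th1 w) = ZZ w" if "w \<in> V" for w using Psi[OF that] by (simp add: zeta_def)
 have zeta0: "zeta 0 = 0" by (simp add: zeta_def Psi0 Z0)
 have pPsi: "snd (pd y Psi 0) = snd y" for y
 proof -
  have "pd (pd y Psi 0) Th1 ?w = y" using diffeo_on_inv_pd[OF V(4), of 0 y] N(2) Psi0 by (simp add: N_def Psi_def)
  then show ?thesis using Th1_props(3)[of "pd y Psi 0"] by (metis snd_conv)
 qed
 have dZ: "ZZ differentiable (at ?w)" "Psi differentiable (at 0)"
  by (rule smooth_on_differentiable[OF sZ V(1,3)], rule smooth_on_differentiable[OF N(3,1,2)])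
 have pzeta: "pd y zeta 0 = snd y * (- pd (0, 1) H ?w / (g02 ?w)\<^sup>2)" for y
 proof -
  have "pd y zeta 0 = pd (pd y Psi 0) ZZ (Psi 0)" unfolding zeta_def by (rule pd_compose) (use dZ Psi0 in auto)
  also have "\<dots> = pd (fst (pd y Psi 0), snd (pd y Psi 0)) ZZ ?w" by (simp add: Psi0)
  finally show ?thesis unfolding pd_ZZ pPsi .
 qed
 have 1: "pd eT zeta 0 * pd (0, 1) H ?w < 0"
 proof -
  have "(pd (0, 1) H ?w)\<^sup>2 / (g02 ?w)\<^sup>2 > 0" using Heps g02_0 by simp
  then show ?thesis unfolding pzeta by (simp add: power2_eq_square)
 qed
 define zX where "zX = pd eX zeta"
 define zY where "zY = pd eY zeta"
 have sz: "smooth_on N zX" "smooth_on N zY" unfolding zX_def zY_def by (rule smooth_on_pd[OF N(1) szeta])+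
 have z0: "zX 0 = 0" "zY 0 = 0" by (simp_all add: zX_def zY_def pzeta)
 have sc: "smooth_on V (%w. zX (Th1 w))" "smooth_on V (%w. zY (Th1 w))"
  using sz by (auto intro!: smooth_on_compose[OF _ D(4) V(1) N(1)] simp: N_def)
 have dV: "G differentiable (at w)" if "smooth_on V G" "w \<in> V" for G :: "plane \<times> real => real" and w
  by (rule smooth_on_differentiable[OF that(1) V(1) that(2)])
 have sAB: "smooth_on V AA" "smooth_on V BB" using smooth2 smooth_on_subset[OF _ V(2)] by auto
 \<comment> \<open>When this is differentiated once more along \<open>t0\<close> at q, only the
   second derivative of zeta in Y survives: dA(t0) = 0, and the gradient of zeta in X and Y vanishes
   at 0, which removes the second derivatives of the chart.\<close>
 have e1: "pd (t0, 0) ZZ w = pd (t0, 0) AA w * zX (Th1 w) + pd (t0, 0) BB w * zY (Th1 w)" if w: "w \<in> V" for w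
 proof -
  have wN: "Th1 w \<in> N" using w by (simp add: N_def)
  have dzeta: "zeta differentiable (at (Th1 w))" by (rule smooth_on_differentiable[OF szeta N(1) wN])
  have "pd (t0, 0) ZZ w = pd (t0, 0) (%w. zeta (Th1 w)) w" by (rule pd_cong_open[OF V(1) w]) (simp add: zetaTh)
  also have "\<dots> = pd (pd (t0, 0) Th1 w) zeta (Th1 w)"
   by (rule pd_compose[OF smooth_on_differentiable[OF D(4) V(1) w] dzeta])
  also have "pd (t0, 0) Th1 w = ((pd (t0, 0) AA w, pd (t0, 0) BB w), 0)"
  proof -
   have a: "smooth_on W1 (%w. snd w - eps0)" by (intro smooth_intros openW1)
   have "((%w :: plane \<times> real. snd w - eps0) has_derivative snd) (at w)" by (auto intro!: derivative_eq_intros)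
   from pd_eqI[OF this, of "(t0, 0)"] have b: "pd (t0, 0) (%w. snd w - eps0) w = 0" by simp
   have c: "w \<in> W1" using w V(2) W2_W1 by blast
   show ?thesis unfolding Th1_def using pd_tuple[OF smooth1(3,4) a c, of "(t0, 0)"] b by simp
  qed
  finally show ?thesis using pd_coords[OF dzeta, of "pd (t0, 0) AA w" "pd (t0, 0) BB w" 0] by (simp add: zX_def zY_def)
 qed
 define bet where "bet = pd (t0, 0) BB ?w"
 have A0: "pd (t0, 0) AA ?w = 0" using pd_AB(1)[of t0] hb_t0(1) hb_sym[of t0 v0] by simp
 have "pd (t0, 0) (pd (t0, 0) ZZ) ?w = pd (t0, 0) (%w. pd (t0, 0) AA w * zX (Th1 w) + pd (t0, 0) BB w * zY (Th1 w)) ?w"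
  by (rule pd_cong_open[OF V(1,3) e1])
 also have "\<dots> = bet * pd (t0, 0) (%w. zY (Th1 w)) ?w" using smooth_on_pd[OF V(1) sAB(1)] smooth_on_pd[OF V(1) sAB(2)] sc
  by (subst pd_add) (auto simp: pd_mult dV V(3) smooth_on_mult[OF V(1)] A0 z0 Th1_props(2) bet_def)
 also have "pd (t0, 0) (%w. zY (Th1 w)) ?w = pd (pd (t0, 0) Th1 ?w) zY 0"
  using pd_compose[OF smooth_on_differentiable[OF D(4) V(1,3)], of zY "(t0, 0)"]
   smooth_on_differentiable[OF sz(2) N(1,2)] by (simp add: Th1_props(2))
 also have "\<dots> = bet * pd eY zY 0"
  using pd_coords[OF smooth_on_differentiable[OF sz(2) N(1,2)], of 0 bet 0] by (simp add: Th1_props(3) A0 bet_def)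
 finally have zz: "pd (t0, 0) (pd (t0, 0) ZZ) ?w = bet\<^sup>2 * pd eY zY 0" by (simp add: power2_eq_square)
 have "pd (t0, 0) (pd (t0, 0) ZZ) ?w = - hb t0 t0 / (g02 ?w)\<^sup>2"
 proof -
  define c where "c w = - 1 / (g02 w)\<^sup>2" for w
  have scc: "smooth_on W1 c" unfolding c_def
   by (intro smooth_on_divide smooth_intros openW1 smooth_W1 smooth_g) (use W1_W(2) in auto)
  have sH: "smooth_on W1 H" by (rule smooth_W1[OF smooth_H])
  note sp = smooth_on_pd[OF openW1 sH] smooth_on_pd[OF openW1 scc]
  have "pd (t0, 0) ZZ w = H w * pd (t0, 0) c w + pd (t0, 0) H w * c w" if "w \<in> W1" for w
  proof -
   have "pd (t0, 0) ZZ w = pd (t0, 0) (%w. H w * c w) w" by (rule pd_cong_open[OF openW1 that]) (simp add: ZZ_H c_def)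
   then show ?thesis using that by (simp add: pd_mult diff_1 sH scc)
  qed
  then have "pd (t0, 0) (pd (t0, 0) ZZ) ?w = pd (t0, 0) (%w. H w * pd (t0, 0) c w + pd (t0, 0) H w * c w) ?w"
   by (rule pd_cong_open[OF openW1 w0_W1])
  also have "\<dots> = hb t0 t0 * c ?w"
   using w0_W1 by (subst pd_add) (auto simp: pd_mult diff_1 smooth_on_mult[OF openW1] sH scc sp H0 dH0 hb_def)
  finally show ?thesis by (simp add: c_def)
 qed
 then have "bet\<^sup>2 * pd eY zY 0 * hb t0 t0 = - (hb t0 t0)\<^sup>2 / (g02 ?w)\<^sup>2" using zz by (simp add: power2_eq_square)
 moreover have "(hb t0 t0)\<^sup>2 / (g02 ?w)\<^sup>2 > 0" using htt g02_0 by simp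
 ultimately have "bet\<^sup>2 * (pd eY zY 0 * hb t0 t0) < 0" by (simp add: mult.assoc)
 then have 2: "pd eY (pd eY zeta) 0 * hb t0 t0 < 0" by (simp add: mult_less_0_iff zY_def)
 show ?thesis using that[OF V(2,3,4) _ zetaTh zeta0 _ _ 1 2] szeta by (simp add: N_def pzeta)
qed

text \<open>Composing \<open>Th1\<close> with the normal form keeps time up to sign and translation.
  Restricting the composite to the section through q yields the curve singularity.\<close>

theorem A3_theorem:
 "A3_transition (%eps. flecnodal_curve (f eps)) q eps0" "A3_singularity (flecnodal_curve (f eps0)) q"
proof -
 obtain V zeta where V: "V \<subseteq> W2" "(q, eps0) \<in> V" "diffeo_on V Th1" "smooth_on (Th1 ` V) zeta"
  and zetaTh: "!!w. w \<in> V ==> zeta (Th1 w) = ZZ w" and z: "zeta 0 = 0" "pd eX zeta 0 = 0" "pd eY zeta 0 = 0"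
   "pd eT zeta 0 * pd (0, 1) H (q, eps0) < 0" "pd eY (pd eY zeta) 0 * hb t0 t0 < 0" using zeta_chart by metis
 note D = diffeo_onD[OF V(3)]
 have N0: "0 \<in> Th1 ` V" using V(2) Th1_props(2) by (metis imageI)
 have nz: "pd eY (pd eY zeta) 0 ~= 0" "pd eT zeta 0 ~= 0" using z(4,5) by auto
 obtain VN Th s1 s2 where T: "diffeo_on VN Th" "0 \<in> VN" "VN \<subseteq> Th1 ` V" "Th 0 = 0" "s1 \<in> {1, -1::real}" "s2 \<in> {1, -1::real}"
  and TT: "!!X Y e. ((X, Y), e) \<in> VN ==> snd (Th ((X, Y), e)) = s1 * e \<and>
   (X\<^sup>2 = Y\<^sup>2 * zeta ((X, Y), e) \<longleftrightarrow> fst (Th ((X, Y), e)) \<in> {(x, y). y\<^sup>2 = (s1 * e) * x\<^sup>2 + s2 * x ^ 4})"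
  by (rule A3_normal_form[OF D(2) V(4) N0 z(1-3) nz]) (rule that, assumption+)
 define V' where "V' = V \<inter> Th1 -` VN"
 have V': "open V'" "V' \<subseteq> V"
  unfolding V'_def using continuous_open_preimage[OF smooth_on_imp_continuous_on[OF D(4)] D(1) diffeo_onD(1)[OF T(1)]] by auto
 define tht where "tht w = Th (Th1 w)" for w
 have dtht: "diffeo_on V' tht" unfolding tht_def
  by (rule diffeo_on_compose[OF diffeo_on_subset[OF V(3) V'] T(1)]) (auto simp: V'_def)
 note E = diffeo_onD[OF dtht]
 have qV': "(q, eps0) \<in> V'" using V(2) T(2) Th1_props(2) by (simp add: V'_def)
 have tht0: "tht (q, eps0) = 0" by (simp add: tht_def Th1_props(2) T(4))
 have main: "snd (tht (p, eps)) = s1 * (eps - eps0) \<and>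
  (p \<in> flecnodal_curve (f eps) \<longleftrightarrow> fst (tht (p, eps)) \<in> {(x, y). y\<^sup>2 = (s1 * (eps - eps0)) * x\<^sup>2 + s2 * x ^ 4})"
  if "(p, eps) \<in> V'" for p eps
 proof -
  have v: "(p, eps) \<in> V" "Th1 (p, eps) \<in> VN" using that by (auto simp: V'_def)
  have w1: "(p, eps) \<in> W1" using v(1) V(1) W2_W1 by blast
  have "((AA (p, eps), BB (p, eps)), eps - eps0) \<in> VN" using v(2) by (simp add: Th1_def)
  from TT[OF this] zetaTh[OF v(1)] flecnodal_iff[OF w1] show ?thesis by (simp add: tht_def Th1_def mult.commute)
 qed
 show "A3_transition (%eps. flecnodal_curve (f eps)) q eps0" unfolding A3_transition_def equivalent_families_def
 proof (rule exI[of _ s2], intro conjI exI[of _ V'] exI[of _ tht] exI[of _ "%eps. s1 * (eps - eps0)"])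
  show "s2 ~= 0" using T(6) by auto
  show "\<forall>(p, eps)\<in>V'. snd (tht (p, eps)) = s1 * (eps - eps0) \<and>
   (p \<in> flecnodal_curve (f eps) \<longleftrightarrow>
    fst (tht (p, eps)) \<in> {(x, y). y\<^sup>2 = (s1 * (eps - eps0)) * x\<^sup>2 + s2 * x ^ 4})"
  proof (intro ballI)
   fix w assume "w \<in> V'"
   then show "case w of (p, eps) => snd (tht (p, eps)) = s1 * (eps - eps0) \<and>
   (p \<in> flecnodal_curve (f eps) \<longleftrightarrow>
    fst (tht (p, eps)) \<in> {(x, y). y\<^sup>2 = (s1 * (eps - eps0)) * x\<^sup>2 + s2 * x ^ 4})"
    using main[of "fst w" "snd w"] by (simp only: prod.collapse case_prod_unfold)
  qed
 qed (use dtht qV' tht0 in \<open>auto simp: zero_prod_def\<close>)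
 \<comment> \<open>The isochronal slice of the diffeomorphism. Its image is the whole slice at time
   0, since the new time s1 (eps - eps0) with s1 = 1 or -1 vanishes only for eps = eps0.\<close>
 define V0 where "V0 = {p. (p, eps0) \<in> V'}"
 define V0' where "V0' = {y. (y, 0) \<in> tht ` V'}"
 define g where "g y = fst (inv_into V' tht (y, 0))" for y
 have inv: "inv_into V' tht (tht w) = w" if "w \<in> V'" for w using that E(3) by (simp add: inv_into_f_f)
 have stht0: "tht (p, eps0) = (fst (tht (p, eps0)), 0)" if "p \<in> V0" for p
  using main[of p eps0] that by (simp add: V0_def prod_eq_iff)
 have "diffeo_on V0 (%p. fst (tht (p, eps0)))"
 proof (rule diffeo_onI)
  show "open V0" "open V0'" unfolding V0_def V0'_def by (intro open_slice V'(1) E(2))+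
  show "(%p. fst (tht (p, eps0))) ` V0 = V0'"
  proof (intro subset_antisym subsetI)
   fix y assume "y \<in> (%p. fst (tht (p, eps0))) ` V0"
   then obtain p where "p \<in> V0" "y = fst (tht (p, eps0))" by blast
   then show "y \<in> V0'" unfolding V0'_def using stht0[of p] V0_def by (metis imageI mem_Collect_eq)
  next
   fix y assume "y \<in> V0'"
   then obtain p eps where p: "(p, eps) \<in> V'" "(y, 0) = tht (p, eps)" by (auto simp: V0'_def)
   then have "s1 * (eps - eps0) = 0" using main[OF p(1)] by (metis snd_conv)
   then have "eps = eps0" using T(5) by auto
   then have "p \<in> V0" "y = fst (tht (p, eps0))" using p by (auto simp: V0_def prod_eq_iff)
   then show "y \<in> (%p. fst (tht (p, eps0))) ` V0" by blast
  qed
  show "smooth_on V0 (%p. fst (tht (p, eps0)))" unfolding V0_def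
   using smooth_on_slice[OF V'(1) E(4)] by (intro smooth_on_fst open_slice V'(1))
  show "smooth_on V0' g" unfolding V0'_def g_def using smooth_on_slice[OF E(2,5)] by (intro smooth_on_fst open_slice E(2))
  show "g (fst (tht (p, eps0))) = p" if "p \<in> V0" for p
   using inv[of "(p, eps0)"] stht0[OF that] that unfolding g_def V0_def by (metis fst_conv mem_Collect_eq)
 qed
 moreover have "q \<in> V0" using qV' by (simp add: V0_def)
 moreover have "p \<in> flecnodal_curve (f eps0) \<longleftrightarrow> fst (tht (p, eps0)) \<in> {(x, y). y\<^sup>2 = s2 * x ^ 4}" if "p \<in> V0" for p
  using main[of p eps0] that by (simp add: V0_def)
 ultimately show "A3_singularity (flecnodal_curve (f eps0)) q"
  unfolding A3_singularity_def using T(6) tht0 by (intro exI[of _ V0] exI[of _ "%p. fst (tht (p, eps0))"] bexI[of _ s2]) auto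
qed

end

subsection \<open>Regions cut out by convex and saddle functions\<close>

text \<open>A convex open set is the interior of its closure, so the homeomorphism of compact convex
  bodies can be restricted to interiors.\<close>

lemma convex_open_homeomorphic_ball:
 fixes S :: "'a::euclidean_space set"
 assumes "convex S" "open S" "bounded S" "S ~= {}"
 shows "S homeomorphic (ball 0 1 :: 'a set)"
proof -
 have i: "interior (closure S) = S" using convex_interior_closure[OF assms(1)] interior_open[OF assms(2)] by simp
 have "closure S homeomorphic (cball 0 1 :: 'a set)"
  by (rule homeomorphic_convex_compact_cball) (use assms i convex_closure compact_closure in auto)
 then have "interior (closure S) homeomorphic interior (cball 0 1 :: 'a set)"
  by (rule homeomorphic_interiors_same_dimension) simp
 then show ?thesis by (simp add: i)
qed

lemma convex_open_frontier_homeomorphic_sphere: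
 fixes S :: "'a::euclidean_space set"
 assumes "convex S" "open S" "bounded S" "S ~= {}"
 shows "frontier S homeomorphic (sphere 0 1 :: 'a set)"
proof -
 have "rel_frontier S homeomorphic rel_frontier (cball 0 1 :: 'a set)"
  by (rule homeomorphic_rel_frontiers_convex_bounded_sets) (use assms in \<open>auto simp: aff_dim_open aff_dim_cball\<close>)
 moreover have "rel_frontier S = frontier S" by (rule rel_frontier_nonempty_interior) (use assms interior_open in auto)
 moreover have "rel_frontier (cball 0 1 :: 'a set) = sphere 0 1" by (subst rel_frontier_nonempty_interior) auto
 ultimately show ?thesis by simp
qed

text \<open>The sublevel set of a convex function is convex, and positivity on the boundary of U
  keeps its closure inside U.\<close>

lemma convex_island:
 fixes g :: "'a::euclidean_space => real"
 assumes U: "open U" "convex U" "bounded U" and g: "continuous_on (closure U) g" "convex_on U g"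
  and q: "q \<in> U" "g q < 0" and fr: "!!x. x \<in> frontier U ==> g x > 0"
 defines "R \<equiv> {x \<in> U. g x < 0}"
 shows "R homeomorphic (ball 0 1 :: 'a set)" "compact (closure R)" "closure R \<subseteq> U"
  "frontier R = {x \<in> U. g x = 0}" "frontier R homeomorphic (sphere 0 1 :: 'a set)"
proof -
 have cU: "continuous_on U g" using g(1) closure_subset continuous_on_subset by blast
 have R: "open R"
 proof -
  have "R = U \<inter> g -` {..<0}" by (auto simp: R_def)
  then show ?thesis using continuous_open_preimage[OF cU U(1), of "{..<0}"] by simp
 qed
 have cR: "convex R"
 proof (rule convexI)
  fix x y and u v :: real assume xy: "x \<in> R" "y \<in> R" "0 \<le> u" "0 \<le> v" "u + v = 1"
  have m: "u *. x + v *. y \<in> U" using xy U(2) by (auto simp: R_def convex_def)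
  have u: "u = 1 - v" using xy by simp
  have "g (u *. x + v *. y) \<le> u * g x + v * g y"
   unfolding u by (rule convex_onD[OF g(2)]) (use xy in \<open>auto simp: R_def\<close>)
  also have "\<dots> < 0"
  proof (cases "u = 0")
   case False
   then have "u * g x < 0" "v * g y \<le> 0" using xy by (auto simp: R_def mult_pos_neg mult_le_0_iff)
   then show ?thesis by simp
  qed (use xy in \<open>auto simp: R_def\<close>)
  finally show "u *. x + v *. y \<in> R" using m by (simp add: R_def)
 qed
 have bR: "bounded R" by (rule bounded_subset[OF U(3)]) (auto simp: R_def)
 have neR: "R ~= {}" using q by (auto simp: R_def)
 show "R homeomorphic (ball 0 1 :: 'a set)" by (rule convex_open_homeomorphic_ball[OF cR R bR neR])
 show "frontier R homeomorphic (sphere 0 1 :: 'a set)" by (rule convex_open_frontier_homeomorphic_sphere[OF cR R bR neR])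
 show "compact (closure R)" using bR by (simp add: compact_closure)
 have cl: "x \<in> closure U \<and> g x \<le> 0" if "x \<in> closure R" for x
 proof
  show "x \<in> closure U" using that closure_mono[of R U] by (auto simp: R_def)
  have "closed {x \<in> closure U. g x \<le> 0}" using continuous_closed_preimage[OF g(1) closed_closure, of "{..0}"]
   by (simp add: vimage_def Collect_conj_eq)
  moreover have "R \<subseteq> {x \<in> closure U. g x \<le> 0}" using closure_subset[of U] by (auto simp: R_def)
  ultimately show "g x \<le> 0" using closure_minimal that by blast
 qed
 show clU: "closure R \<subseteq> U"
 proof
  fix x assume "x \<in> closure R"
  then have "x \<in> closure U" "g x \<le> 0" using cl by auto
  then show "x \<in> U" using fr[of x] U(1) by (auto simp: frontier_def interior_open)
 qed
 show "frontier R = {x \<in> U. g x = 0}"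
 proof (intro subset_antisym subsetI)
  fix x assume "x \<in> frontier R"
  then have "x \<in> closure R" "x \<notin> R" using R by (auto simp: frontier_def interior_open)
  then show "x \<in> {x \<in> U. g x = 0}" using cl clU by (force simp: R_def)
 next
  fix x assume x: "x \<in> {x \<in> U. g x = 0}"
  \<comment> \<open>Approach x along the segment to q: convexity and g(q) < 0 make g negative on it
    before x is reached.\<close>
  have "x \<in> closure R"
  proof (rule Lim_in_closed_set[where f="%n. (1 - inverse (real (Suc n))) *. x + inverse (real (Suc n)) *. q" and F=sequentially])
   show "\<forall>\<^sub>F n in sequentially. (1 - inverse (real (Suc n))) *. x + inverse (real (Suc n)) *. q \<in> closure R"
   proof (rule always_eventually, rule allI)
    fix n
    define t where "t = inverse (real (Suc n))"
    have t: "0 < t" "t \<le> 1" by (auto simp: t_def field_simps)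
    have "g ((1 - t) *. x + t *. q) \<le> (1 - t) * g x + t * g q"
     by (rule convex_onD[OF g(2)]) (use t x q in auto)
    also have "\<dots> < 0" using x t q by (simp add: mult_pos_neg)
    finally have "g ((1 - t) *. x + t *. q) < 0" .
    moreover have "(1 - t) *. x + t *. q \<in> U" using U(2) x q t by (simp add: convex_alt)
    ultimately show "(1 - inverse (real (Suc n))) *. x + inverse (real (Suc n)) *. q \<in> closure R"
     using closure_subset[of R] by (auto simp: R_def t_def)
   qed
   have "(%n. (1 - inverse (real (Suc n))) *. x + inverse (real (Suc n)) *. q) \<longlonglongrightarrow> (1 - 0) *. x + 0 *. q"
    by (intro tendsto_intros LIMSEQ_inverse_real_of_nat)
   then show "(%n. (1 - inverse (real (Suc n))) *. x + inverse (real (Suc n)) *. q) \<longlonglongrightarrow> x" by simp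
  qed auto
  then show "x \<in> frontier R" using x R by (auto simp: frontier_def interior_open R_def)
 qed
qed

lemma connected_by_connected_subsets:
 assumes "!!x y. x \<in> S ==> y \<in> S ==> \<exists>T. connected T \<and> T \<subseteq> S \<and> x \<in> T \<and> y \<in> T"
 shows "connected S" unfolding connected_iff_connected_component
proof (intro ballI)
 fix x y assume "x \<in> S" "y \<in> S"
 then obtain T where "connected T" "T \<subseteq> S" "x \<in> T" "y \<in> T" using assms by blast
 then show "connected_component S x y" unfolding connected_component_def by blast
qed

lemma components_two:
 assumes "connected A" "connected B" "open A" "open B" "A ~= {}" "B ~= {}" "A \<inter> B = {}"
 shows "card (components (A \<union> B)) = 2"
proof -
 have c: "C \<in> components (A \<union> B)" if C: "C = A \<or> C = B" for C
 proof -
  have *: "C = connected_component_set (A \<union> B) x" if "x \<in> C" "connected C" "open C" "open C'" "C \<inter> C' = {}" "A \<union> B = C \<union> C'" for C C' x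
  proof
   show "C \<subseteq> connected_component_set (A \<union> B) x" by (rule connected_component_maximal) (use that in auto)
   let ?D = "connected_component_set (A \<union> B) x"
   have "?D \<subseteq> C \<union> C'" using connected_component_subset that(6) by metis
   moreover have "connected ?D" by simp
   ultimately have "C \<inter> ?D = {} \<or> C' \<inter> ?D = {}" using connectedD[of ?D C C'] that(3,4,5) by blast
   moreover have "x \<in> C \<inter> ?D" using that by (auto intro: connected_component_refl)
   ultimately show "?D \<subseteq> C" using \<open>?D \<subseteq> C \<union> C'\<close> by blast
  qed
  obtain x where x: "x \<in> C" using C assms(5,6) by blast
  have "C = connected_component_set (A \<union> B) x" using C
  proof
   assume "C = A" then show ?thesis using *[of x A B] assms x by blast
  next
   assume "C = B" then show ?thesis using *[of x B A] assms x by blast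
  qed
  then show ?thesis using x C by (auto simp: components_iff)
 qed
 have "components (A \<union> B) = {A, B}"
 proof (intro subset_antisym subsetI)
  fix C assume C: "C \<in> components (A \<union> B)"
  then obtain x where "x \<in> C" "x \<in> A \<union> B" by (metis components_iff connected_component_refl mem_Collect_eq)
  then show "C \<in> {A, B}" using components_eq[OF C c] by blast
 qed (use c in blast)
 moreover have "A ~= B" using assms by blast
 ultimately show ?thesis by simp
qed

text \<open>Horizontal slices of the negative set are intervals meeting the vertical axis, so they
  are all joined through that axis. In the right half of the positive set, moving to the right stays
  inside by convexity, and two points moved to the same vertical line are joined along it by
  concavity.\<close>

lemma saddle_connected:
 fixes k :: "real \<times> real => real"
 assumes cx: "!!t. \<bar>t\<bar> < r ==> convex_on {-r<..<r} (%s. k (s, t))"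
  and cc: "!!s. \<bar>s\<bar> < r ==> convex_on {-r<..<r} (%t. - k (s, t))" and neg: "!!t. \<bar>t\<bar> < r ==> k (0, t) < 0"
 shows "connected {x. \<bar>fst x\<bar> < r \<and> \<bar>snd x\<bar> < r \<and> k x < 0}" (is "connected ?A")
  "connected {x. \<bar>fst x\<bar> < r \<and> \<bar>snd x\<bar> < r \<and> k x > 0 \<and> fst x > 0}" (is "connected ?B")
proof -
 have horiz: "connected (S \<times> {t})" if "connected S" for S :: "real set" and t :: real
  using that by (intro connected_Times) auto
 have vert: "connected ({s} \<times> S)" if "connected S" for S :: "real set" and s :: real
  using that by (intro connected_Times) auto
 show "connected ?A"
 proof (rule connected_by_connected_subsets)
  fix x y assume xy: "x \<in> ?A" "y \<in> ?A"
  define Sl where "Sl t = {s. \<bar>s\<bar> < r \<and> k (s, t) < 0}" for t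
  have Sl: "connected (Sl t)" if "\<bar>t\<bar> < r" for t
  proof (rule convex_connected, rule convexI)
   fix a b u v :: real assume h: "a \<in> Sl t" "b \<in> Sl t" "0 \<le> u" "0 \<le> v" "u + v = 1"
   then have u: "u = 1 - v" by simp
   have "a \<in> {-r<..<r}" "b \<in> {-r<..<r}" using h by (auto simp: Sl_def)
   then have m: "u *. a + v *. b \<in> {-r<..<r}" using h by (intro convexD) auto
   have "k ((1 - v) *. a + v *. b, t) \<le> (1 - v) * k (a, t) + v * k (b, t)"
    by (rule convex_onD[OF cx[OF that]]) (use h in \<open>auto simp: Sl_def\<close>)
   also have "\<dots> < 0"
   proof (cases "v = 1")
    case False
    then have "(1 - v) * k (a, t) < 0" "v * k (b, t) \<le> 0" using h by (auto simp: Sl_def mult_pos_neg mult_le_0_iff)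
    then show ?thesis by simp
   qed (use h in \<open>auto simp: Sl_def\<close>)
   finally show "u *. a + v *. b \<in> Sl t" using m by (auto simp: Sl_def u)
  qed
  \<comment> \<open>An H-shaped set: the two horizontal slices and the vertical axis.\<close>
  define T where "T = Sl (snd x) \<times> {snd x} \<union> ({0} \<times> {-r<..<r} \<union> Sl (snd y) \<times> {snd y})"
  have r: "r > 0" using xy by auto
  have "(0, snd y) \<in> {0} \<times> {-r<..<r} \<inter> Sl (snd y) \<times> {snd y}"
   "(0, snd x) \<in> Sl (snd x) \<times> {snd x} \<inter> ({0} \<times> {-r<..<r} \<union> Sl (snd y) \<times> {snd y})"
   using xy neg r by (auto simp: Sl_def)
  then have ne: "{0} \<times> {-r<..<r} \<inter> Sl (snd y) \<times> {snd y} ~= {}"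
   "Sl (snd x) \<times> {snd x} \<inter> ({0} \<times> {-r<..<r} \<union> Sl (snd y) \<times> {snd y}) ~= {}" by blast+
  have "connected T" unfolding T_def using xy by (intro connected_Un horiz vert Sl ne) auto
  moreover have "T \<subseteq> ?A" using xy neg r by (auto simp: T_def Sl_def)
  moreover have "x \<in> T" "y \<in> T" using xy by (cases x; cases y; auto simp: T_def Sl_def)+
  ultimately show "\<exists>T. connected T \<and> T \<subseteq> ?A \<and> x \<in> T \<and> y \<in> T" by blast
 qed
 have mono: "k (s', t) > 0" if "k (s, t) > 0" "0 < s" "s \<le> s'" "s' < r" "\<bar>t\<bar> < r" for s s' t
 proof (rule ccontr)
  assume c: "\<not> k (s', t) > 0"
  define u where "u = s / s'"
  have u: "0 < u" "u \<le> 1" using that by (auto simp: u_def divide_le_eq)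
  have "k ((1 - u) *. 0 + u *. s', t) \<le> (1 - u) * k (0, t) + u * k (s', t)"
   by (rule convex_onD[OF cx[OF that(5)]]) (use u that in auto)
  also have "\<dots> \<le> 0"
  proof -
   have "(1 - u) * k (0, t) \<le> 0" "u * k (s', t) \<le> 0" using u c neg[OF that(5)] by (auto simp: mult_le_0_iff)
   then show ?thesis by simp
  qed
  finally show False using that by (simp add: u_def)
 qed
 show "connected ?B"
 proof (rule connected_by_connected_subsets)
  fix x y assume xy: "x \<in> ?B" "y \<in> ?B"
  \<comment> \<open>The line of the rightmost point; the other point can be moved to it.\<close>
  define S where "S = max (fst x) (fst y)"
  define Vl where "Vl = {t. \<bar>t\<bar> < r \<and> k (S, t) > 0}"
  have S: "0 < S" "S < r" "fst x \<le> S" "fst y \<le> S" using xy by (auto simp: S_def)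
  have Vl: "connected Vl"
  proof (rule convex_connected, rule convexI)
   fix a b u v :: real assume h: "a \<in> Vl" "b \<in> Vl" "0 \<le> u" "0 \<le> v" "u + v = 1"
   then have u: "u = 1 - v" by simp
   have "a \<in> {-r<..<r}" "b \<in> {-r<..<r}" using h by (auto simp: Vl_def)
   then have m: "u *. a + v *. b \<in> {-r<..<r}" using h by (intro convexD) auto
   have sr: "\<bar>S\<bar> < r" using S by simp
   have "- k (S, (1 - v) *. a + v *. b) \<le> (1 - v) * (- k (S, a)) + v * (- k (S, b))"
    by (rule convex_onD[OF cc[OF sr]]) (use h in \<open>auto simp: Vl_def\<close>)
   also have "\<dots> < 0"
   proof (cases "v = 1")
    case False
    then have "(1 - v) * (- k (S, a)) < 0" "v * (- k (S, b)) \<le> 0" using h by (auto simp: Vl_def mult_pos_neg mult_le_0_iff)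
    then show ?thesis by simp
   qed (use h in \<open>auto simp: Vl_def\<close>)
   finally show "u *. a + v *. b \<in> Vl" using m by (auto simp: Vl_def u)
  qed
  have xm: "k (s, snd x) > 0" if "fst x \<le> s" "s \<le> S" for s using mono[of "fst x" "snd x" s] xy that S by auto
  have ym: "k (s, snd y) > 0" if "fst y \<le> s" "s \<le> S" for s using mono[of "fst y" "snd y" s] xy that S by auto
  define T where "T = {fst x..S} \<times> {snd x} \<union> ({S} \<times> Vl \<union> {fst y..S} \<times> {snd y})"
  have "(S, snd y) \<in> {S} \<times> Vl \<inter> {fst y..S} \<times> {snd y}"
   "(S, snd x) \<in> {fst x..S} \<times> {snd x} \<inter> ({S} \<times> Vl \<union> {fst y..S} \<times> {snd y})"
   using xy xm ym S by (auto simp: Vl_def)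
  then have ne: "{S} \<times> Vl \<inter> {fst y..S} \<times> {snd y} ~= {}"
   "{fst x..S} \<times> {snd x} \<inter> ({S} \<times> Vl \<union> {fst y..S} \<times> {snd y}) ~= {}" by blast+
  have "connected T" unfolding T_def by (intro connected_Un horiz vert Vl ne) auto
  moreover have "T \<subseteq> ?B" using xy xm ym S by (auto simp: T_def Vl_def)
  moreover have "x \<in> T" "y \<in> T" using S by (cases x; cases y; auto simp: T_def)+
  ultimately show "\<exists>T. connected T \<and> T \<subseteq> ?B \<and> x \<in> T \<and> y \<in> T" by blast
 qed
qed

text \<open>The vertical axis, where k < 0, connects the negative region and separates the positive
  one into two halves; the values at a and -a show that neither half is empty. L carries the model
  square to the surface.\<close>

lemma saddle_regions:
 fixes k :: "real \<times> real => real" and L :: "real \<times> real => 'a::euclidean_space"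
 assumes cx: "!!t. \<bar>t\<bar> < r ==> convex_on {-r<..<r} (%s. k (s, t))"
  and cc: "!!s. \<bar>s\<bar> < r ==> convex_on {-r<..<r} (%t. - k (s, t))"
  and neg: "!!t. \<bar>t\<bar> < r ==> k (0, t) < 0" and r: "0 < r" and pos: "0 < a" "a < r" "k (a, 0) > 0" "k (- a, 0) > 0"
  and cont: "continuous_on {x. \<bar>fst x\<bar> < r \<and> \<bar>snd x\<bar> < r} k"
  and L: "continuous_on UNIV L" "inj L" "!!S. open S ==> open (L ` S)"
 shows "card (components (L ` {x. \<bar>fst x\<bar> < r \<and> \<bar>snd x\<bar> < r \<and> k x < 0})) = 1"
  "card (components (L ` {x. \<bar>fst x\<bar> < r \<and> \<bar>snd x\<bar> < r \<and> k x > 0})) = 2"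
proof -
 let ?Q = "{x. \<bar>fst x\<bar> < r \<and> \<bar>snd x\<bar> < r} :: (real \<times> real) set"
 have cL: "connected (L ` S)" if "connected S" for S
  by (rule connected_continuous_image[OF continuous_on_subset[OF L(1)] that]) simp
 have "connected (L ` {x. \<bar>fst x\<bar> < r \<and> \<bar>snd x\<bar> < r \<and> k x < 0})"
  by (rule cL[OF saddle_connected(1)[OF cx cc neg]])
 moreover have "L ` {x. \<bar>fst x\<bar> < r \<and> \<bar>snd x\<bar> < r \<and> k x < 0} ~= {}"
  using neg[of 0] r by (auto intro!: exI[of _ 0] simp: zero_prod_def)
 ultimately have "components (L ` {x. \<bar>fst x\<bar> < r \<and> \<bar>snd x\<bar> < r \<and> k x < 0})
   = {L ` {x. \<bar>fst x\<bar> < r \<and> \<bar>snd x\<bar> < r \<and> k x < 0}}"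
  unfolding components_eq_sing_iff by (rule conjI)
 then show "card (components (L ` {x. \<bar>fst x\<bar> < r \<and> \<bar>snd x\<bar> < r \<and> k x < 0})) = 1" by simp
 define A where "A = {x. \<bar>fst x\<bar> < r \<and> \<bar>snd x\<bar> < r \<and> k x > 0 \<and> fst x > 0}"
 define B where "B = {x. \<bar>fst x\<bar> < r \<and> \<bar>snd x\<bar> < r \<and> k x > 0 \<and> fst x < 0}"
 have AB: "{x. \<bar>fst x\<bar> < r \<and> \<bar>snd x\<bar> < r \<and> k x > 0} = A \<union> B"
 proof -
  have nz: "fst x ~= 0" if "\<bar>snd x\<bar> < r" "k x > 0" for x using neg[of "snd x"] that by (cases x) auto
  have "x \<in> {x. \<bar>fst x\<bar> < r \<and> \<bar>snd x\<bar> < r \<and> k x > 0} \<longleftrightarrow> x \<in> A \<union> B" for x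
   using nz[of x] unfolding A_def B_def neq_iff mem_Collect_eq Un_iff by blast
  then show ?thesis by blast
 qed
 have oQ: "open ?Q" by (intro open_Collect_conj open_Collect_less continuous_intros)
 have ok: "open (?Q \<inter> k -` {0<..})" by (rule continuous_open_preimage[OF cont oQ]) simp
 have "A = ?Q \<inter> k -` {0<..} \<inter> {x. fst x > 0}" "B = ?Q \<inter> k -` {0<..} \<inter> {x. fst x < 0}" by (auto simp: A_def B_def)
 moreover have "open {x :: real \<times> real. fst x > 0}" "open {x :: real \<times> real. fst x < 0}"
  by (intro open_Collect_less continuous_intros)+
 ultimately have op: "open A" "open B" using ok by (auto intro: open_Int)
 have conA: "connected A" unfolding A_def by (rule saddle_connected(2)[OF cx cc neg])
 have conB: "connected B"
 proof -
  \<comment> \<open>Reflection in the vertical axis reduces the left half to the right one.\<close>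
  define k' where "k' x = k (- fst x, snd x)" for x
  have c1: "convex_on {-r<..<r} (%s. k' (s, t))" if "\<bar>t\<bar> < r" for t
  proof (rule convex_onI)
   fix u x y :: real assume h: "0 < u" "u < 1" "x \<in> {-r<..<r}" "y \<in> {-r<..<r}"
   have "k ((1 - u) *. (- x) + u *. (- y), t) \<le> (1 - u) * k (- x, t) + u * k (- y, t)"
    by (rule convex_onD[OF cx[OF that]]) (use h in auto)
   moreover have "(1 - u) *. (- x) + u *. (- y) = - ((1 - u) *. x + u *. y)" by simp
   ultimately show "k' ((1 - u) *. x + u *. y, t) \<le> (1 - u) * k' (x, t) + u * k' (y, t)"
    unfolding k'_def by (simp del: scaleR_minus_right)
  qed simp
  have c2: "convex_on {-r<..<r} (%t. - k' (s, t))" if "\<bar>s\<bar> < r" for s using cc[of "- s"] that by (simp add: k'_def)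
  have "connected {x. \<bar>fst x\<bar> < r \<and> \<bar>snd x\<bar> < r \<and> k' x > 0 \<and> fst x > 0}"
   by (rule saddle_connected(2)[OF c1 c2]) (use neg in \<open>auto simp: k'_def\<close>)
  then have "connected ((%x. (- fst x, snd x)) ` {x. \<bar>fst x\<bar> < r \<and> \<bar>snd x\<bar> < r \<and> k' x > 0 \<and> fst x > 0})"
   by (rule connected_continuous_image[rotated]) (intro continuous_intros)
  moreover have "(%x. (- fst x, snd x)) ` {x. \<bar>fst x\<bar> < r \<and> \<bar>snd x\<bar> < r \<and> k' x > 0 \<and> fst x > 0} = B"
  proof (intro subset_antisym subsetI)
   fix x assume "x \<in> B"
   then show "x \<in> (%x. (- fst x, snd x)) ` {x. \<bar>fst x\<bar> < r \<and> \<bar>snd x\<bar> < r \<and> k' x > 0 \<and> fst x > 0}"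
    by (intro image_eqI[of _ _ "(- fst x, snd x)"]) (auto simp: B_def k'_def)
  qed (auto simp: B_def k'_def)
  ultimately show ?thesis by simp
 qed
 have "(a, 0) \<in> A" "(- a, 0) \<in> B" using pos r by (auto simp: A_def B_def)
 moreover have "L ` A \<inter> L ` B = {}" using image_Int[OF L(2), of A B] by (auto simp: A_def B_def)
 ultimately have "card (components (L ` A \<union> L ` B)) = 2" by (intro components_two cL conA conB L(3) op) auto
 then show "card (components (L ` {x. \<bar>fst x\<bar> < r \<and> \<bar>snd x\<bar> < r \<and> k x > 0})) = 2" by (simp add: AB image_Un)
qed

text \<open>The sign s lets one statement serve both directions of time.\<close>

lemma monotone_sign:
 fixes g :: "real => real"
 assumes d: "!!e. \<bar>e\<bar> < R ==> (g has_real_derivative g' e) (at e)" "!!e. \<bar>e\<bar> < R ==> s * g' e > 0"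
  and "\<bar>e\<bar> < R"
 shows "s * e > 0 ==> g e > g 0" "s * e < 0 ==> g e < g 0"
proof -
 have "\<exists>z. \<bar>z\<bar> < R \<and> g e - g 0 = e * g' z"
 proof -
  consider "e > 0" | "e < 0" | "e = 0" by linarith
  then show ?thesis
  proof cases
   case 1
   then obtain z where "0 < z" "z < e" "g e - g 0 = (e - 0) * g' z" using MVT2[OF 1, of g g'] d(1) assms(3) by force
   then show ?thesis using assms(3) by (intro exI[of _ z]) auto
  next
   case 2
   then obtain z where "e < z" "z < 0" "g 0 - g e = (0 - e) * g' z" using MVT2[OF 2, of g g'] d(1) assms(3) by force
   then show ?thesis using assms(3) by (intro exI[of _ z]) auto
  next
   case 3 then show ?thesis using assms(3) by (intro exI[of _ 0]) auto
  qed
 qed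
 then obtain z where z: "\<bar>z\<bar> < R" "g e - g 0 = e * g' z" by blast
 have "s * g' z > 0" using d(2) z by blast
 then have s: "s ~= 0" "s * s > 0" by (auto simp: zero_less_mult_iff not_less_iff_gr_or_eq)
 have eq: "(g e - g 0) * (s * s) = (s * e) * (s * g' z)" using z by simp
 show "g e > g 0" if "s * e > 0"
 proof -
  have "(g e - g 0) * (s * s) > 0" unfolding eq using that \<open>s * g' z > 0\<close> by (rule mult_pos_pos)
  from zero_less_mult_pos2[OF this s(2)] show ?thesis by simp
 qed
 show "g e < g 0" if "s * e < 0"
 proof -
  have "(g e - g 0) * (s * s) < 0" unfolding eq using that \<open>s * g' z > 0\<close> by (rule mult_neg_pos)
  then show ?thesis using s(2) mult_nonneg_nonneg[of "g e - g 0" "s * s"] by linarith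
 qed
qed

section \<open>The direction of time and the two godrons\<close>

context morse_family
begin

text \<open>Godrons lie on the curve A = 0, tangent to \<open>t0\<close>, where \<open>H\<close> is
  approximately hb(t0, t0) Y^2 / 2 plus its time derivative times eps - eps0, for a suitable
  parameter Y. This has two zeros exactly when the two summands have opposite signs, and
  \<open>birth\<close> is the sign of eps - eps0 for which they do.\<close>

definition birth :: real where "birth = - sgn (hb t0 t0 * pd (0, 1) H (q, eps0))"

lemma birth: "birth \<in> {1, -1}" "birth * (hb t0 t0 * pd (0, 1) H (q, eps0)) < 0"
proof -
 have "hb t0 t0 * pd (0, 1) H (q, eps0) ~= 0" using htt Heps by simp
 then have "hb t0 t0 * pd (0, 1) H (q, eps0) < 0 \<or> hb t0 t0 * pd (0, 1) H (q, eps0) > 0" by linarith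
 then show "birth \<in> {1, -1}" "birth * (hb t0 t0 * pd (0, 1) H (q, eps0)) < 0" unfolding birth_def by auto
qed

lemma isochronal_ball_in_open:
 assumes "open V" "(q, eps0) \<in> V" "open N" "q \<in> N"
 obtains r d where "r > 0" "d > 0" "cball q r \<subseteq> N" "!!p eps. p \<in> cball q r ==> \<bar>eps - eps0\<bar> < d ==> (p, eps) \<in> V"
proof -
 obtain A B where AB: "open A" "open B" "(q, eps0) \<in> A \<times> B" "A \<times> B \<subseteq> V" using assms(1,2) by (rule open_prod_elim)
 obtain r where r: "r > 0" "cball q r \<subseteq> A \<inter> N"
 proof -
  have "open (A \<inter> N)" "q \<in> A \<inter> N" using AB assms by auto
  then show ?thesis using that unfolding open_contains_cball by blast
 qed
 obtain d where d: "d > 0" "ball eps0 d \<subseteq> B" using AB open_contains_ball by blast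
 have "(p, eps) \<in> V" if "p \<in> cball q r" "\<bar>eps - eps0\<bar> < d" for p eps
 proof -
  have "eps \<in> ball eps0 d" using that by (simp add: dist_real_def abs_minus_commute)
  then show ?thesis using that r d AB by blast
 qed
 then show ?thesis using that[of r d] r d by auto
qed

end

context morse_family
begin

text \<open>In the coordinates of \<open>Th1\<close> godrons are zeros of Y |-> zeta((0, Y), e). Up
  to sign this function is strictly convex in Y and monotone in e, with a double zero at e = 0:
  moving it up removes the zero, moving it down splits it into two.\<close>

theorem godron_theorem: "two_godrons_transition f q eps0 birth"
proof -
 obtain V zeta where V: "V \<subseteq> W2" "(q, eps0) \<in> V" "diffeo_on V Th1" "smooth_on (Th1 ` V) zeta"
  and zetaTh: "!!w. w \<in> V ==> zeta (Th1 w) = ZZ w" and z: "zeta 0 = 0" "pd eX zeta 0 = 0" "pd eY zeta 0 = 0"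
   "pd eT zeta 0 * pd (0, 1) H (q, eps0) < 0" "pd eY (pd eY zeta) 0 * hb t0 t0 < 0" using zeta_chart by metis
 note D = diffeo_onD[OF V(3)]
 define N where "N = Th1 ` V"
 have N: "open N" "0 \<in> N" "smooth_on N zeta" using D(2) V(2,4) Th1_props(2) by (auto simp: N_def intro: rev_image_eqI)
 \<comment> \<open>The sign that makes the function convex.\<close>
 define kpa where "kpa = - sgn (hb t0 t0)"
 have k: "kpa ~= 0" using htt by (auto simp: kpa_def sgn_if)
 have sg0: "kpa * pd eY (pd eY zeta) 0 > 0" "- birth * (kpa * pd eT zeta 0) > 0"
  using z(4,5) by (auto simp: kpa_def birth_def sgn_mult mult_less_0_iff)
 have s2: "smooth_on N (%y. kpa * pd eY (pd eY zeta) y)" "smooth_on N (%y. - birth * (kpa * pd eT zeta y))"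
  by (intro smooth_intros N smooth_on_pd)+
 define N' where "N' = (N \<inter> (%y. kpa * pd eY (pd eY zeta) y) -` {0<..}) \<inter> (N \<inter> (%y. - birth * (kpa * pd eT zeta y)) -` {0<..})"
 have N': "open N'" "0 \<in> N'" unfolding N'_def using sg0 N(2)
   open_Int[OF continuous_open_preimage[OF smooth_on_imp_continuous_on[OF s2(1)] N(1) open_greaterThan[of 0]]
    continuous_open_preimage[OF smooth_on_imp_continuous_on[OF s2(2)] N(1) open_greaterThan[of 0]]] by simp_all
 obtain R where R: "R > 0" "!!X Y e. \<bar>X\<bar> < R ==> \<bar>Y\<bar> < R ==> \<bar>e\<bar> < R ==> ((X, Y), e) \<in> N'"
  using open_contains_cube[OF N'] by blast
 define kf where "kf e Y = kpa * zeta ((0, Y), e)" for e Y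
 have dY: "((%Y. kpa * g ((0, Y), e)) has_real_derivative kpa * pd eY g ((0, Y), e)) (at Y)"
  and dT: "((%e. kpa * g ((0, Y), e)) has_real_derivative kpa * pd eT g ((0, Y), e)) (at e)"
  if "smooth_on N g" "\<bar>Y\<bar> < R" "\<bar>e\<bar> < R" for g :: "plane \<times> real => real" and Y e
 proof -
  have "((0, Y), e) \<in> N" using R(2)[of 0 Y e] R(1) that by (simp add: N'_def)
  then have d: "g differentiable (at ((0, Y), e))" using smooth_on_differentiable[OF that(1) N(1)] by blast
  have 1: "g differentiable (at (((0, 0), e) + Y *. eY))" "g differentiable (at (((0, Y), 0) + e *. eT))" using d by simp_all
  show "((%Y. kpa * g ((0, Y), e)) has_real_derivative kpa * pd eY g ((0, Y), e)) (at Y)"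
   using DERIV_cmult[OF pd_along_line_real[OF 1(1)], of kpa] by simp
  show "((%e. kpa * g ((0, Y), e)) has_real_derivative kpa * pd eT g ((0, Y), e)) (at e)"
   using DERIV_cmult[OF pd_along_line_real[OF 1(2)], of kpa] by simp
 qed
 have sY: "smooth_on N (pd eY zeta)" by (rule smooth_on_pd[OF N(1,3)])
 have kYY: "kpa * pd eY (pd eY zeta) ((0, Y), e) > 0" "- birth * (kpa * pd eT zeta ((0, Y), e)) > 0" if "\<bar>Y\<bar> < R" "\<bar>e\<bar> < R" for Y e
  using R(2)[of 0 Y e] R(1) that by (auto simp: N'_def)
 have k00: "kf 0 0 = 0" using z(1) by (simp add: kf_def zero_prod_def)
 have kpos: "kf 0 Y > 0" if "\<bar>Y\<bar> < R" "Y ~= 0" for Y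
  by (rule convex_critical_pos[where k="kf 0" and ?k1.0="%Y. kpa * pd eY zeta ((0, Y), 0)"
    and ?k2.0="%Y. kpa * pd eY (pd eY zeta) ((0, Y), 0)" and R=R, OF _ _ _ k00 _ that])
   (use dY[OF N(3), of _ 0] dY[OF sY, of _ 0] kYY(1)[of _ 0] R(1) z(3) in \<open>simp_all add: kf_def[abs_def] zero_prod_def\<close>)
 have kmono: "- birth * e > 0 ==> kf e Y > kf 0 Y" "- birth * e < 0 ==> kf e Y < kf 0 Y" if "\<bar>Y\<bar> < R" "\<bar>e\<bar> < R" for e Y
  using monotone_sign[where g="%e. kf e Y" and g'="%e. kpa * pd eT zeta ((0, Y), e)" and s="- birth" and R=R and e=e] dT[OF N(3) that(1)] kYY(2)[OF that(1)] that(2)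
  by (simp_all add: kf_def)
 have kconv: "convex_on {-R<..<R} (kf e)" if "\<bar>e\<bar> < R" for e unfolding kf_def
 proof (rule f''_ge0_imp_convex)
  fix Y assume "Y \<in> {-R<..<R}"
  then have Y: "\<bar>Y\<bar> < R" by auto
  show "DERIV (%Y. kpa * zeta ((0, Y), e)) Y :> kpa * pd eY zeta ((0, Y), e)" by (rule dY[OF N(3) Y that])
  show "DERIV (%Y. kpa * pd eY zeta ((0, Y), e)) Y :> kpa * pd eY (pd eY zeta) ((0, Y), e)" by (rule dY[OF sY Y that])
  show "0 \<le> kpa * pd eY (pd eY zeta) ((0, Y), e)" using kYY(1)[OF Y that] by simp
 qed simp
 define Cb where "Cb = {w :: plane \<times> real. \<bar>fst (fst w)\<bar> < R \<and> \<bar>snd (fst w)\<bar> < R \<and> \<bar>snd w\<bar> < R}"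
 have Cb: "open Cb" unfolding Cb_def by (intro open_Collect_conj open_Collect_less continuous_intros)
 define V' where "V' = V \<inter> Th1 -` Cb"
 have V': "open V'" "(q, eps0) \<in> V'"
  unfolding V'_def using continuous_open_preimage[OF smooth_on_imp_continuous_on[OF D(4)] D(1) Cb] V(2) R(1)
  by (auto simp: Th1_props(2) Cb_def)
 have zero: "kf (eps - eps0) (BB (p, eps)) = 0 \<and> \<bar>BB (p, eps)\<bar> < R \<and> Th1 (p, eps) = ((0, BB (p, eps)), eps - eps0)"
  if "(p, eps) \<in> V'" "godron (f eps) p" for p eps
 proof -
  have v: "(p, eps) \<in> V" using that(1) by (simp add: V'_def)
  then have "(p, eps) \<in> W1" using V(1) W2_W1 by blast
  then have g: "ZZ (p, eps) = 0" "AA (p, eps) = 0" using godronD that(2) by auto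
  then have t: "Th1 (p, eps) = ((0, BB (p, eps)), eps - eps0)" by (simp add: Th1_def)
  moreover have "Th1 (p, eps) \<in> Cb" using that(1) by (simp add: V'_def)
  ultimately show ?thesis using zetaTh[OF v] g by (simp add: kf_def Cb_def)
 qed
 show ?thesis unfolding two_godrons_transition_def local_transition_def
 proof (intro allI impI, elim conjE)
  fix N0 :: "plane set" assume N0: "open N0" "q \<in> N0"
  obtain r d where rd: "r > 0" "d > 0" "cball q r \<subseteq> N0"
   "!!p eps. p \<in> cball q r ==> \<bar>eps - eps0\<bar> < d ==> (p, eps) \<in> V'"
   using isochronal_ball_in_open[OF V' N0] by blast
  have BV: "ball q r \<times> ball eps0 d \<subseteq> V"
   using rd(4) by (auto simp: V'_def dist_real_def abs_minus_commute subset_iff)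
  \<comment> \<open>Zeros found in coordinates must correspond to points of the prescribed ball; T
    is the image of the ball over the time interval.\<close>
  define T where "T = Th1 ` (ball q r \<times> ball eps0 d)"
  have T: "open T" "0 \<in> T"
  proof -
   show "open T" unfolding T_def by (rule diffeo_on_open_image[OF V(3) _ BV]) (intro open_Times open_ball)
   have "(q, eps0) \<in> ball q r \<times> ball eps0 d" using rd by simp
   then show "0 \<in> T" unfolding T_def using Th1_props(2) by (metis imageI)
  qed
  obtain R2 where R2: "R2 > 0" "!!X Y e. \<bar>X\<bar> < R2 ==> \<bar>Y\<bar> < R2 ==> \<bar>e\<bar> < R2 ==> ((X, Y), e) \<in> T"
   using open_contains_cube[OF T] by blast
  \<comment> \<open>At Y = c and Y = -c the function is positive for e = 0 and remains so for small
    e. On the side after birth it is negative at 0, so it changes sign on either side of 0.\<close>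
  define c where "c = min R R2 / 2"
  have c: "0 < c" "c < R" "c < R2" using R(1) R2(1) by (auto simp: c_def min_def)
  have "\<forall>\<^sub>F e in at 0. kf e y > 0" if "y = c \<or> y = - c" for y
  proof -
   have y: "\<bar>y\<bar> < R" "y ~= 0" using that c by auto
   have "isCont (%e. kf e y) 0" using DERIV_isCont[OF dT[OF N(3) y(1), of 0]] R(1) by (simp add: kf_def)
   then have "((%e. kf e y) \<longlongrightarrow> kf 0 y) (at 0)" by (simp add: isCont_def)
   from order_tendstoD(1)[OF this kpos[OF y]] show ?thesis .
  qed
  then have "\<forall>\<^sub>F e in at 0. kf e c > 0 \<and> kf e (- c) > 0" by (simp add: eventually_conj)
  then obtain dlt1 where d1: "dlt1 > 0" "!!e. e ~= 0 ==> \<bar>e\<bar> < dlt1 ==> kf e c > 0 \<and> kf e (- c) > 0"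
   unfolding eventually_at by (auto simp: dist_real_def)
  define dlt where "dlt = min (min dlt1 d) (min R R2)"
  have dlt: "dlt > 0" "dlt \<le> dlt1" "dlt \<le> d" "dlt \<le> R" "dlt \<le> R2" using d1 rd R R2 by (auto simp: dlt_def)
  have ab: "\<bar>birth * e\<bar> = \<bar>e\<bar>" for e using birth(1) by auto
  have after: "card {p \<in> ball q r. godron (f eps) p} = 2" if e: "0 < birth * (eps - eps0)" "birth * (eps - eps0) < dlt" for eps
  proof -
   define e where "e = eps - eps0"
   have e: "\<bar>e\<bar> < dlt" "e ~= 0" "- birth * e < 0" using e ab[of e] by (auto simp: e_def)
   have k0: "kf e 0 < 0" using kmono(2)[of 0 e] e k00 R(1) dlt by simp
   have kc: "kf e c > 0" "kf e (- c) > 0" using d1(2)[OF e(2)] e(1) dlt by auto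
   have eR: "\<bar>e\<bar> < R" using e dlt by simp
   have cont: "isCont (kf e) Y" if "\<bar>Y\<bar> < R" for Y
    using DERIV_isCont[OF dY[OF N(3) that eR]] by (simp add: kf_def[abs_def])
   obtain Y2 where Y2: "0 \<le> Y2" "Y2 \<le> c" "kf e Y2 = 0" using IVT[of "kf e" 0 0 c] k0 kc c cont by force
   obtain Y1 where Y1: "- c \<le> Y1" "Y1 \<le> 0" "kf e Y1 = 0" using IVT2[of "kf e" 0 0 "- c"] k0 kc c cont by force
   have Yne: "Y1 < 0" "Y2 > 0" using Y1 Y2 k0 by (auto simp: less_le)
   have ex: "\<exists>p \<in> ball q r. godron (f eps) p \<and> BB (p, eps) = Y \<and> Th1 (p, eps) = ((0, Y), e)"
    if Y: "\<bar>Y\<bar> \<le> c" "kf e Y = 0" "Y ~= 0" for Y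
   proof -
    have "((0, Y), e) \<in> T" using R2(2)[of 0 Y e] Y(1) c e dlt by auto
    then obtain p eps' where p: "p \<in> ball q r" "eps' \<in> ball eps0 d" "Th1 (p, eps') = ((0, Y), e)" by (auto simp: T_def)
    then have "eps' = eps" by (simp add: Th1_def e_def)
    then have v: "(p, eps) \<in> V" using p BV by blast
    then have w: "(p, eps) \<in> W1" using V(1) W2_W1 by blast
    have AB: "AA (p, eps) = 0" "BB (p, eps) = Y" using p(3) \<open>eps' = eps\<close> by (auto simp: Th1_def)
    have "ZZ (p, eps) = 0" using zetaTh[OF v] p(3) \<open>eps' = eps\<close> Y(2) k by (simp add: kf_def)
    then have "godron (f eps) p" using godronI[OF w] AB Y(3) by simp
    then show ?thesis using p AB \<open>eps' = eps\<close> by blast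
   qed
   obtain p1 where p1: "p1 \<in> ball q r" "godron (f eps) p1" "BB (p1, eps) = Y1" "Th1 (p1, eps) = ((0, Y1), e)"
    using ex[of Y1] Y1 Yne by auto
   obtain p2 where p2: "p2 \<in> ball q r" "godron (f eps) p2" "BB (p2, eps) = Y2" "Th1 (p2, eps) = ((0, Y2), e)"
    using ex[of Y2] Y2 Yne by auto
   have inV: "(p, eps) \<in> V'" if "p \<in> ball q r" for p using rd(4)[of p eps] that e(1) dlt by (auto simp: e_def)
   have "p = p1 \<or> p = p2" if p: "p \<in> ball q r" "godron (f eps) p" for p
   proof -
    define Y where "Y = BB (p, eps)"
    have Y: "kf e Y = 0" "\<bar>Y\<bar> < R" "Th1 (p, eps) = ((0, Y), e)" using zero[OF inV[OF p(1)] p(2)] by (auto simp: Y_def e_def)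
    have "Y ~= 0" using Y(1) k0 by auto
    \<comment> \<open>By convexity there is one zero for each sign of Y, and the chart is
      injective.\<close>
    have uq: "Y = Y'" if "Y * Y' > 0" "kf e Y' = 0" "\<bar>Y'\<bar> < R" for Y'
     by (rule convex_zero_unique[OF kconv[OF eR] _ k0 _ _ Y(1) that(2,1)]) (use Y(2) that(3) R(1) in auto)
    have "Y = Y1 \<or> Y = Y2"
     using uq[of Y1] uq[of Y2] \<open>Y ~= 0\<close> Yne Y1 Y2 c by (cases "Y > 0") (auto simp: mult_neg_neg)
    then have "Th1 (p, eps) = Th1 (p1, eps) \<or> Th1 (p, eps) = Th1 (p2, eps)" using Y(3) p1(4) p2(4) by auto
    then show ?thesis using inj_onD[OF D(3), of "(p, eps)" "(p1, eps)"] inj_onD[OF D(3), of "(p, eps)" "(p2, eps)"]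
      inV[OF p(1)] inV[OF p1(1)] inV[OF p2(1)] unfolding V'_def by blast
   qed
   then have "{p \<in> ball q r. godron (f eps) p} = {p1, p2}" using p1 p2 by auto
   moreover have "p1 ~= p2" using p1(3) p2(3) Yne by auto
   ultimately show ?thesis by simp
  qed
  have before: "{p \<in> ball q r. godron (f eps) p} = {}" if e: "- dlt < birth * (eps - eps0)" "birth * (eps - eps0) < 0" for eps
  proof -
   define e where "e = eps - eps0"
   have e: "\<bar>e\<bar> < dlt" "- birth * e > 0" using e ab[of e] by (auto simp: e_def)
   have False if p: "p \<in> ball q r" "godron (f eps) p" for p
   proof -
    have "(p, eps) \<in> V'" using rd(4)[of p eps] p e(1) dlt by (auto simp: e_def)
    from zero[OF this p(2)] have Y: "kf e (BB (p, eps)) = 0" "\<bar>BB (p, eps)\<bar> < R" by (auto simp: e_def)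
    have "kf 0 (BB (p, eps)) \<ge> 0" using kpos[OF Y(2)] k00 by (cases "BB (p, eps) = 0") auto
    then show False using kmono(1)[OF Y(2), of e] e dlt Y(1) by auto
   qed
   then show ?thesis by blast
  qed
  show "\<exists>U dlt. open U \<and> q \<in> U \<and> U \<subseteq> N0 \<and> U homeomorphic (ball 0 1 :: plane set) \<and> dlt > 0 \<and>
    (\<forall>eps. 0 < birth * (eps - eps0) \<and> birth * (eps - eps0) < dlt --> card {p \<in> U. godron (f eps) p} = 2) \<and>
    (\<forall>eps. - dlt < birth * (eps - eps0) \<and> birth * (eps - eps0) < 0 --> {p \<in> U. godron (f eps) p} = {})"
   using after before rd dlt(1) ball_subset_cball[of q r]
   by (intro exI[of _ "ball q r"] exI[of _ dlt]) (auto intro: convex_open_homeomorphic_ball)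
 qed
qed

end

section \<open>Second-order expansions, and the definite case: islands\<close>

lemma pd2_quadratic:
 fixes G :: "'a::euclidean_space => real"
 assumes "open U" "smooth_on U G" "x \<in> U"
 shows "pd (a *. v + b *. w) (pd (a *. v + b *. w) G) x
  = a\<^sup>2 * pd v (pd v G) x + 2 * a * b * pd v (pd w G) x + b\<^sup>2 * pd w (pd w G) x"
proof -
 note d = smooth_on_differentiable[OF _ assms(1)]
 have "pd u (pd (a *. v + b *. w) G) x = a * pd u (pd v G) x + b * pd u (pd w G) x" for u
 proof -
  have "pd u (pd (a *. v + b *. w) G) x = pd u (%y. a * pd v G y + b * pd w G y) x"
   by (rule pd_cong_open[OF assms(1,3)]) (simp add: pd_linear(1)[OF d[OF assms(2)]])
  also have "\<dots> = a * pd u (pd v G) x + b * pd u (pd w G) x"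
   by (rule pd_eqI) (auto intro!: derivative_eq_intros has_derivative_pd d smooth_on_pd assms)
  finally show ?thesis .
 qed
 moreover have "pd (a *. v + b *. w) (pd v G) x = a * pd v (pd v G) x + b * pd w (pd v G) x" for v
  using pd_linear(1)[OF d[OF smooth_on_pd[OF assms(1,2), of v] assms(3)]] by simp
 moreover have "pd (a *. v + b *. w) (pd w G) x = a * pd v (pd w G) x + b * pd w (pd w G) x"
  using pd_linear(1)[OF d[OF smooth_on_pd[OF assms(1,2), of w] assms(3)]] by simp
 ultimately show ?thesis using pd_commute[OF assms, of w v] by (simp add: power2_eq_square algebra_simps)
qed

text \<open>Taylor's formula with integral remainder along the ray from q; the second derivative in
  the direction p - q is expanded in the basis v, w with coordinates alp, bet.\<close>

lemma hadamard_quadratic: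
 fixes G :: "'a::euclidean_space => real"
 assumes U: "open U" "convex U" "q \<in> U" "smooth_on U G" and crit: "G q = 0" "!!v. pd v G q = 0"
  and coord: "!!p. p = q + alp p *. v + bet p *. w"
 obtains h11 h12 h22 where "smooth_on U h11" "smooth_on U h12" "smooth_on U h22"
  "!!p. p \<in> U ==> G p = h11 p * (alp p)\<^sup>2 + 2 * h12 p * alp p * bet p + h22 p * (bet p)\<^sup>2"
  "h11 q = pd v (pd v G) q / 2" "h12 q = pd v (pd w G) q / 2" "h22 q = pd w (pd w G) q / 2"
proof -
 define h where "h g p = integral {0..1} (%t. (1 - t) * g (q + t *. (p - q)))" for g :: "'a => real" and p
 have seg: "q + t *. (p - q) \<in> U" if "p \<in> U" "t \<in> {0..1}" for p t
 proof -
  have "(1 - t) *. q + t *. p \<in> U" using that U(2,3) by (auto intro: convexD_alt)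
  moreover have "(1 - t) *. q + t *. p = q + t *. (p - q)" by (simp add: algebra_simps)
  ultimately show ?thesis by simp
 qed
 have sm: "smooth_on U (h g)" if g: "smooth_on U g" for g
 proof -
  define Om where "Om = {z :: 'a \<times> real. q + snd z *. (fst z - q) \<in> U}"
  have O: "open Om" unfolding Om_def by (rule open_Collect_mem[OF U(1)]) (intro continuous_intros)
  have "smooth_on Om (%z. q + snd z *. (fst z - q))" by (intro smooth_intros O)
  then have "smooth_on Om (%z. g (q + snd z *. (fst z - q)))"
   by (rule smooth_on_compose[OF g _ O U(1)]) (auto simp: Om_def)
  then have "smooth_on Om (%z. (1 - snd z) * g (q + snd z *. (fst z - q)))" by (intro smooth_intros O)
  moreover have "U \<times> {0..1} \<subseteq> Om" using seg by (auto simp: Om_def)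
  ultimately show ?thesis using smooth_on_integral[OF U(1) O, of "%z. (1 - snd z) * g (q + snd z *. (fst z - q))"]
   by (simp add: h_def[abs_def])
 qed
 have int: "(%t. (1 - t) * g (q + t *. (p - q))) integrable_on {0..1}" if "smooth_on U g" "p \<in> U" for g p
  by (intro integrable_continuous_interval continuous_intros continuous_on_compose2[OF smooth_on_imp_continuous_on[OF that(1)]])
   (use seg[OF that(2)] in auto)
 have hq: "h g q = g q / 2" for g using integral_one_minus[of "g q"] by (simp add: h_def)
 define g1 g2 g3 where "g1 = pd v (pd v G)" and "g2 = pd v (pd w G)" and "g3 = pd w (pd w G)"
 have sg: "smooth_on U g1" "smooth_on U g2" "smooth_on U g3" unfolding g1_def g2_def g3_def by (intro smooth_on_pd U)+
 have eq: "G p = h g1 p * (alp p)\<^sup>2 + 2 * h g2 p * alp p * bet p + h g3 p * (bet p)\<^sup>2" if p: "p \<in> U" for p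
 proof -
  define u where "u = p - q"
  have u: "u = alp p *. v + bet p *. w" using coord[of p] by (simp add: u_def algebra_simps)
  have "G (q + 1 *. u) = G q + 1 * pd u G q + 1\<^sup>2 * integral {0..1} (%t. (1 - t) * pd u (pd u G) (q + (t * 1) *. u))"
   by (rule taylor2_dir[OF U(1,4)]) (use seg[OF p] in \<open>simp add: u_def\<close>)
  then have "G p = integral {0..1} (%t. (1 - t) * pd u (pd u G) (q + t *. (p - q)))" using crit by (simp add: u_def)
  also have "\<dots> = integral {0..1} (%t. (alp p)\<^sup>2 * ((1 - t) * g1 (q + t *. (p - q)))
    + (2 * alp p * bet p) * ((1 - t) * g2 (q + t *. (p - q))) + (bet p)\<^sup>2 * ((1 - t) * g3 (q + t *. (p - q))))"
  proof (rule integral_cong)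
   fix t :: real assume t: "t \<in> {0..1}"
   show "(1 - t) * pd u (pd u G) (q + t *. (p - q)) = (alp p)\<^sup>2 * ((1 - t) * g1 (q + t *. (p - q)))
    + (2 * alp p * bet p) * ((1 - t) * g2 (q + t *. (p - q))) + (bet p)\<^sup>2 * ((1 - t) * g3 (q + t *. (p - q)))"
    unfolding u pd2_quadratic[OF U(1,4) seg[OF p t]] g1_def g2_def g3_def by algebra
  qed
  also have "\<dots> = (alp p)\<^sup>2 * h g1 p + (2 * alp p * bet p) * h g2 p + (bet p)\<^sup>2 * h g3 p"
   unfolding h_def by (intro integral_unique has_integral_add has_integral_mult_right integrable_integral int sg p)
  finally show ?thesis by (simp add: algebra_simps)
 qed
 show ?thesis using that[OF sm[OF sg(1)] sm[OF sg(2)] sm[OF sg(3)] eq] hq[of g1] hq[of g2] hq[of g3]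
  unfolding g1_def g2_def g3_def by blast
qed

lemma line_derivative:
 fixes g :: "plane \<times> real => real"
 assumes "open W" "smooth_on W g" "(p + t *. v, eps) \<in> W"
 shows "((%t. g (p + t *. v, eps)) has_real_derivative pd (v, 0) g (p + t *. v, eps)) (at t)"
 using pd_along_line_real[of g "(p, eps)" t "(v, 0)"] smooth_on_differentiable[OF assms(2,1,3)] by simp

lemma time_derivative:
 fixes g :: "plane \<times> real => real"
 assumes "open W" "smooth_on W g" "(p, eps0 + t) \<in> W"
 shows "((%t. g (p, eps0 + t)) has_real_derivative pd (0, 1) g (p, eps0 + t)) (at t)"
 using pd_along_line_real[of g "(p, eps0)" t "(0, 1)"] smooth_on_differentiable[OF assms(2,1,3)] by simp

lemma convex_on_line:
 fixes g :: "plane \<times> real => real"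
 assumes "open W" "smooth_on W g" "convex I"
  and "!!t. t \<in> I ==> (p + t *. v, eps) \<in> W \<and> pd (v, 0) (pd (v, 0) g) (p + t *. v, eps) \<ge> 0"
 shows "convex_on I (%t. g (p + t *. v, eps))" by (rule f''_ge0_imp_convex[OF assms(3) line_derivative[OF assms(1,2)]
    line_derivative[OF assms(1) smooth_on_pd[OF assms(1,2)]]]) (use assms(4) in blast)+

lemma positive_on_line:
 fixes g :: "plane \<times> real => real"
 assumes "open W" "smooth_on W g" "g (p, eps) = 0" "pd (v, 0) g (p, eps) = 0" "\<bar>t\<bar> < R" "t ~= 0"
  and "!!t. \<bar>t\<bar> < R ==> (p + t *. v, eps) \<in> W \<and> pd (v, 0) (pd (v, 0) g) (p + t *. v, eps) > 0"
 shows "g (p + t *. v, eps) > 0"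
proof (rule convex_critical_pos[where k="%t. g (p + t *. v, eps)" and R=R, OF line_derivative[OF assms(1,2)]
    line_derivative[OF assms(1) smooth_on_pd[OF assms(1,2)]]])
 show "\<bar>t\<bar> < R" "t ~= 0" by fact+
 show "g (p + 0 *. v, eps) = 0" "pd (v, 0) g (p + 0 *. v, eps) = 0" using assms(3,4) by simp_all
qed (use assms(7) in blast)+

context morse_family
begin

text \<open>Normalised to be positive along the asymptotic line near q. The asymptotic line thus
  points to the region KK > 0, which is the elliptic or the hyperbolic one according to the sign of
  \<open>hb v0 v0\<close>.\<close>

definition KK where "KK w = sgn (hb v0 v0) * H w"

lemma smooth_KK: "smooth_on W KK" unfolding KK_def by (intro smooth_intros openW smooth_H)

lemma sgn_hvv: "sgn (hb v0 v0) = 1 \<or> sgn (hb v0 v0) = -1" using hvv by (auto simp: sgn_if)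

lemma pd_KK: "w \<in> W ==> pd v KK w = sgn (hb v0 v0) * pd v H w"
 unfolding KK_def by (rule pd_eqI) (auto intro!: derivative_eq_intros has_derivative_pd diff_g smooth_H)

lemma pd2_KK: "w \<in> W ==> pd u (pd v KK) w = sgn (hb v0 v0) * pd u (pd v H) w"
proof -
 assume w: "w \<in> W"
 have "pd u (pd v KK) w = pd u (%w. sgn (hb v0 v0) * pd v H w) w" by (rule pd_cong_open[OF openW w]) (simp add: pd_KK)
 also have "\<dots> = sgn (hb v0 v0) * pd u (pd v H) w"
  by (rule pd_eqI) (auto intro!: derivative_eq_intros has_derivative_pd diff_g smooth_on_pd openW smooth_H w)
 finally show ?thesis .
qed

lemma KK_q: "KK (q, eps0) = 0" "pd (v, 0) KK (q, eps0) = 0"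
 "pd (u, 0) (pd (v, 0) KK) (q, eps0) = sgn (hb v0 v0) * hb u v"
 using H0 dH0 pd_KK[OF w0] pd2_KK[OF w0] by (auto simp: KK_def hb_def)

lemma domains_KK:
 assumes "(p, eps) \<in> W"
 shows "p \<in> (if hb v0 v0 > 0 then elliptic_domain (f eps) else hyperbolic_domain (f eps)) \<longleftrightarrow> KK (p, eps) > 0"
  "p \<in> (if hb v0 v0 > 0 then hyperbolic_domain (f eps) else elliptic_domain (f eps)) \<longleftrightarrow> KK (p, eps) < 0"
  "p \<in> parabolic_curve (f eps) \<longleftrightarrow> KK (p, eps) = 0"
 using hvv unfolding gaussian_curvature_sgn parabolic_curve_def mem_Collect_eq KK_def by (auto simp: hess_det_H[OF assms] sgn_if)

text \<open>For a definite form KK is convex near q and decreases as time moves in the direction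
  \<open>birth\<close>. Before the transition it is positive; afterwards it is negative at q and
  still positive on a surrounding circle, so its sublevel set is an island.\<close>

lemma definite_regions:
 assumes pos: "hb e e * hb e' e' - (hb e e')\<^sup>2 > 0" and N: "open N" "q \<in> N"
 obtains U dlt where "open U" "convex U" "bounded U" "q \<in> U" "U \<subseteq> N" "dlt > 0"
  "!!p eps. p \<in> U ==> \<bar>eps - eps0\<bar> < dlt ==> (p, eps) \<in> W"
  "!!p. p \<in> U ==> p ~= q ==> KK (p, eps0) > 0"
  "!!p eps. p \<in> U ==> - dlt < birth * (eps - eps0) ==> birth * (eps - eps0) < 0 ==> KK (p, eps) > 0"
  "!!eps R. 0 < birth * (eps - eps0) ==> birth * (eps - eps0) < dlt ==> R = {p \<in> U. KK (p, eps) < 0} ==>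
   R homeomorphic (ball 0 1 :: plane set) \<and> compact (closure R) \<and> closure R \<subseteq> U \<and>
   frontier R = {p \<in> U. KK (p, eps) = 0} \<and> frontier R homeomorphic (sphere 0 1 :: plane set)"
proof -
 let ?sig = "sgn (hb v0 v0)"
 \<comment> \<open>The three open conditions that persist near q: the leading coefficient and the
   determinant of the Hessian form are positive, and KK decreases in the direction
   \<open>birth\<close>.\<close>
 define g1 where "g1 w = ?sig * HH.g20 w" for w
 define g2 where "g2 w = HH.g20 w * HH.g02 w - (HH.g11 w)\<^sup>2" for w
 define g3 where "g3 w = - birth * (?sig * pd (0, 1) H w)" for w
 have s: "smooth_on W g1" "smooth_on W g2" "smooth_on W g3"
  unfolding g1_def g2_def g3_def by (intro smooth_intros HH.smooth_g openW smooth_on_pd smooth_H)+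
 have hb_g: "HH.g20 (q, eps0) = hb e e" "HH.g11 (q, eps0) = hb e e'" "HH.g02 (q, eps0) = hb e' e'"
  by (simp_all add: HH.g20_def HH.g11_def HH.g02_def HH_F hb_def)
 have sq: "sgn (hb e e) = ?sig"
 proof -
  have "hb v0 v0 = hb e e + 2 * mm (q, eps0) * hb e e' + (mm (q, eps0))\<^sup>2 * hb e' e'"
   unfolding v0_def hb_simps hb_sym[of e' e] by algebra
  then have "hb e e * hb v0 v0 = (hb e e + mm (q, eps0) * hb e e')\<^sup>2 + (mm (q, eps0))\<^sup>2 * (hb e e * hb e' e' - (hb e e')\<^sup>2)"
   by algebra
  then have "hb e e * hb v0 v0 \<ge> 0" using pos by simp
  moreover have "hb e e ~= 0" using pos by auto
  ultimately show ?thesis using hvv by (auto simp: sgn_if zero_le_mult_iff)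
 qed
 have ht: "sgn (hb t0 t0) = ?sig"
 proof -
  have "hb t0 t0 * hb v0 v0 > 0" using hb_t0(2) pos by simp
  then show ?thesis by (auto simp: sgn_if zero_less_mult_iff)
 qed
 have g3q: "g3 (q, eps0) > 0"
 proof -
  have "hb t0 t0 = \<bar>hb t0 t0\<bar> * ?sig" using ht by (metis abs_mult_sgn)
  then have "birth * ((\<bar>hb t0 t0\<bar> * ?sig) * pd (0, 1) H (q, eps0)) < 0" using birth(2) by (rule subst[where P="%z. birth * (z * pd (0, 1) H (q, eps0)) < 0"])
  then have "\<bar>hb t0 t0\<bar> * g3 (q, eps0) > 0" unfolding g3_def by (simp add: algebra_simps)
  then show ?thesis by (rule zero_less_mult_pos) (simp add: htt)
 qed
 have g1q: "g1 (q, eps0) > 0" using sq hvv by (auto simp: g1_def hb_g sgn_if split: if_splits)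
 define V where "V = (W \<inter> g1 -` {0<..}) \<inter> (W \<inter> g2 -` {0<..}) \<inter> (W \<inter> g3 -` {0<..})"
 have V: "open V" unfolding V_def
  by (intro open_Int continuous_open_preimage[OF smooth_on_imp_continuous_on openW] s open_greaterThan)
 have Vq: "(q, eps0) \<in> V" unfolding V_def using w0 pos g1q g3q by (simp add: g2_def hb_g)
 have sec: "pd (v, 0) (pd (v, 0) KK) w > 0" if w: "w \<in> V" "v ~= 0" for w v
 proof -
  have W: "w \<in> W" using w(1) by (simp add: V_def)
  define a b where "a = v \<bullet> e" and "b = v \<bullet> e'"
  have v: "v = a *. e + b *. e'" using frame_expand by (simp add: a_def b_def)
  have ab: "a ~= 0 \<or> b ~= 0" using w(2) v by auto
  have g: "g1 w > 0" "g2 w > 0" using w(1) by (auto simp: V_def)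
  have "pd (v, 0) (pd (v, 0) KK) w = ?sig * (HH.g20 w * a\<^sup>2 + 2 * HH.g11 w * a * b + HH.g02 w * b\<^sup>2)"
   using HH.second_form[OF W v] by (simp add: HH_F pd2_KK[OF W])
  moreover have "?sig * ?sig = 1" using sgn_hvv by auto
  \<comment> \<open>Completing the square, multiplied by the leading coefficient.\<close>
  ultimately have "g1 w * pd (v, 0) (pd (v, 0) KK) w = (HH.g20 w * a + HH.g11 w * b)\<^sup>2 + g2 w * b\<^sup>2"
   unfolding g1_def g2_def by algebra
  moreover have "(HH.g20 w * a + HH.g11 w * b)\<^sup>2 + g2 w * b\<^sup>2 > 0"
  proof (cases "b = 0")
   case True
   then show ?thesis using ab g by (auto simp: g1_def)
  next
   case False
   then show ?thesis using g by (intro add_nonneg_pos) auto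
  qed
  ultimately show ?thesis using g(1) by (metis zero_less_mult_pos)
 qed
 obtain r d where rd: "r > 0" "d > 0" "cball q r \<subseteq> N" "!!p eps. p \<in> cball q r ==> \<bar>eps - eps0\<bar> < d ==> (p, eps) \<in> V"
  using isochronal_ball_in_open[OF V Vq N] by blast
 have W: "(p, eps) \<in> W" if "p \<in> cball q r" "\<bar>eps - eps0\<bar> < d" for p eps using rd(4)[OF that] by (simp add: V_def)
 have pos0: "KK (p, eps0) > 0" if p: "p \<in> cball q (r/2)" "p ~= q" for p
 proof -
  \<comment> \<open>Only points within r/2 are treated, so the parameter may run up to 2 without
    leaving the ball of radius r and t = 1 is an interior value.\<close>
  have "KK (q + 1 *. (p - q), eps0) > 0"
  proof (rule positive_on_line[OF openW smooth_KK, where R=2])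
   fix t :: real assume "\<bar>t\<bar> < 2"
   then have "\<bar>t\<bar> * norm (p - q) \<le> 2 * (r / 2)"
    using p(1) rd(1) by (intro mult_mono) (auto simp: dist_norm norm_minus_commute)
   then have "q + t *. (p - q) \<in> cball q r" by (simp add: dist_norm)
   then have "(q + t *. (p - q), eps0) \<in> V" using rd(2,4) by simp
   then show "(q + t *. (p - q), eps0) \<in> W \<and> pd (p - q, 0) (pd (p - q, 0) KK) (q + t *. (p - q), eps0) > 0"
    using sec p(2) by (simp add: V_def)
  qed (use KK_q in auto)
  then show ?thesis by simp
 qed
 have conv: "convex_on (ball q (r/2)) (%p. KK (p, eps))" if e: "\<bar>eps - eps0\<bar> < d" for eps
 proof (rule convex_onI)
  fix t :: real and x y assume t: "0 < t" "t < 1" and xy: "x \<in> ball q (r/2)" "y \<in> ball q (r/2)"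
  have "convex_on {0..1} (%t. KK (x + t *. (y - x), eps))"
  proof (rule convex_on_line[OF openW smooth_KK])
   fix t :: real assume t: "t \<in> {0..1}"
   have "(1 - t) *. x + t *. y \<in> ball q (r/2)" using xy t by (intro convexD_alt) auto
   moreover have "(1 - t) *. x + t *. y = x + t *. (y - x)" by (simp add: algebra_simps)
   ultimately have "x + t *. (y - x) \<in> cball q r" using rd(1) by (simp add: less_imp_le)
   from rd(4)[OF this e] have v: "(x + t *. (y - x), eps) \<in> V" .
   have "pd (y - x, 0) (pd (y - x, 0) KK) (x + t *. (y - x), eps) \<ge> 0"
   proof (cases "y = x")
    case True
    then show ?thesis using v by (auto simp: zero_prod_def[symmetric] pd_linear(4)[OF diff_g[OF smooth_on_pd[OF openW smooth_KK]]] V_def)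
   next
    case False
    then show ?thesis using sec[OF v, of "y - x"] by simp
   qed
   then show "(x + t *. (y - x), eps) \<in> W \<and> pd (y - x, 0) (pd (y - x, 0) KK) (x + t *. (y - x), eps) \<ge> 0"
    using v by (simp add: V_def)
  qed simp
  from convex_onD[OF this, of t 0 1] t
  have "KK (x + t *. (y - x), eps) \<le> (1 - t) * KK (x, eps) + t * KK (y, eps)" by simp
  then show "KK ((1 - t) *. x + t *. y, eps) \<le> (1 - t) * KK (x, eps) + t * KK (y, eps)"
   by (simp add: algebra_simps)
 qed simp
 have mono: "- birth * (eps - eps0) > 0 ==> KK (p, eps) > KK (p, eps0)" "- birth * (eps - eps0) < 0 ==> KK (p, eps) < KK (p, eps0)"
  if "p \<in> cball q r" "\<bar>eps - eps0\<bar> < d" for p eps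
 proof -
  have V: "(p, eps0 + t) \<in> V" if "\<bar>t\<bar> < d" for t using rd(4)[of p "eps0 + t"] \<open>p \<in> _\<close> that by simp
  have 1: "((%t. KK (p, eps0 + t)) has_real_derivative pd (0, 1) KK (p, eps0 + t)) (at t)" if "\<bar>t\<bar> < d" for t
   using V[OF that] by (intro time_derivative[OF openW smooth_KK]) (simp add: V_def)
  have 2: "- birth * pd (0, 1) KK (p, eps0 + t) > 0" if "\<bar>t\<bar> < d" for t
   using V[OF that] by (auto simp: V_def g3_def pd_KK)
  show "- birth * (eps - eps0) > 0 ==> KK (p, eps) > KK (p, eps0)" "- birth * (eps - eps0) < 0 ==> KK (p, eps) < KK (p, eps0)"
   using monotone_sign[OF 1 2 that(2)] by simp_all
 qed
 \<comment> \<open>Positivity on the compact circle at time eps0 persists for a uniform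
   time.\<close>
 obtain d' where d': "d' > 0" "!!p eps. p \<in> sphere q (r/2) ==> \<bar>eps - eps0\<bar> < d' ==> KK (p, eps) > 0"
 proof -
  have o: "open (W \<inter> KK -` {0<..})"
   by (intro continuous_open_preimage[OF smooth_on_imp_continuous_on openW] smooth_KK open_greaterThan)
  have "sphere q (r/2) \<times> {eps0} \<subseteq> W \<inter> KK -` {0<..}"
  proof safe
   fix p assume p: "p \<in> sphere q (r/2)"
   then have "p \<in> cball q r" "p \<in> cball q (r/2)" "p ~= q" using rd(1) by auto
   then show "(p, eps0) \<in> W" "(p, eps0) \<in> KK -` {0<..}" using W[of p eps0] pos0 rd(2) by auto
  qed
  moreover have "compact (sphere q (r/2) \<times> {eps0})" by (intro compact_Times) auto
  ultimately obtain d' where d': "d' > 0" "(\<Union>x\<in>sphere q (r/2) \<times> {eps0}. ball x d') \<subseteq> W \<inter> KK -` {0<..}"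
   using compact_subset_open_imp_ball_epsilon_subset[OF _ o] by metis
  have "KK (p, eps) > 0" if "p \<in> sphere q (r/2)" "\<bar>eps - eps0\<bar> < d'" for p eps
  proof -
   have "(p, eps) \<in> ball (p, eps0) d'" using that(2) by (simp add: dist_Pair_Pair dist_real_def abs_minus_commute)
   then show ?thesis using d'(2) that(1) by blast
  qed
  then show ?thesis using that d'(1) by blast
 qed
 have ab: "\<bar>birth * e\<bar> = \<bar>e\<bar>" for e using birth(1) by auto
 define U where "U = ball q (r/2)"
 have Ur: "p \<in> cball q r" "p \<in> cball q (r/2)" if "p \<in> closure U" for p using that rd(1) by (auto simp: U_def)
 have UcU: "p \<in> closure U" if "p \<in> U" for p using that closure_subset by blast
 show ?thesis
 proof (rule that[of U "min d d'"])
  show "open U" "convex U" "bounded U" "q \<in> U" "min d d' > 0" using rd d' by (auto simp: U_def)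
  show "U \<subseteq> N" using rd(3) Ur UcU by blast
  show "(p, eps) \<in> W" if "p \<in> U" "\<bar>eps - eps0\<bar> < min d d'" for p eps using W Ur UcU that by simp
  show "KK (p, eps0) > 0" if "p \<in> U" "p ~= q" for p using pos0 Ur UcU that by simp
  then have nn: "KK (p, eps0) \<ge> 0" if "p \<in> U" for p using that KK_q(1) by (cases "p = q") (auto simp: less_imp_le)
  show "KK (p, eps) > 0" if "p \<in> U" "- min d d' < birth * (eps - eps0)" "birth * (eps - eps0) < 0" for p eps
  proof -
   have "\<bar>eps - eps0\<bar> < d" using that(2,3) ab[of "eps - eps0"] by auto
   from mono(1)[OF Ur(1)[OF UcU[OF that(1)]] this] show ?thesis using nn[OF that(1)] that(3) by simp
  qed
  fix eps R assume e: "0 < birth * (eps - eps0)" "birth * (eps - eps0) < min d d'" and R: "R = {p \<in> U. KK (p, eps) < 0}"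
  have e': "\<bar>eps - eps0\<bar> < d" "\<bar>eps - eps0\<bar> < d'" using e ab[of "eps - eps0"] by auto
  have neg: "KK (q, eps) < 0" using mono(2)[of q eps] e e' KK_q(1) rd(1) by simp
  have "continuous_on (closure U) (%p. KK (p, eps))"
   by (rule continuous_on_compose2[OF smooth_on_imp_continuous_on[OF smooth_KK], where f="%p. (p, eps)"])
    (use W[OF Ur(1) e'(1)] in \<open>auto intro!: continuous_intros\<close>)
  moreover have "KK (p, eps) > 0" if "p \<in> frontier U" for p using d'(2) e'(2) that rd(1) by (simp add: U_def frontier_ball)
  ultimately show "R homeomorphic (ball 0 1 :: plane set) \<and> compact (closure R) \<and> closure R \<subseteq> U \<and>
   frontier R = {p \<in> U. KK (p, eps) = 0} \<and> frontier R homeomorphic (sphere 0 1 :: plane set)"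
   unfolding R using convex_island[where U=U and g="%p. KK (p, eps)" and q=q] conv[OF e'(1)] neg rd(1) by (simp add: U_def)
 qed
qed

text \<open>Near q at time eps0 the sign of \<open>H\<close> is that of \<open>hb v0 v0\<close>: a
  positive value gives an elliptic surrounding, case (d), a negative one case (a).\<close>

lemma definite_cases:
 assumes pos: "hb e e * hb e' e' - (hb e e')\<^sup>2 > 0"
 shows "case_a f q eps0 birth \<or> case_d f q eps0 birth"
proof -
 have ab: "\<bar>birth * e\<bar> = \<bar>e\<bar>" for e using birth(1) by auto
 define Rp Rn where "Rp eps = (if hb v0 v0 > 0 then elliptic_domain (f eps) else hyperbolic_domain (f eps))"
  and "Rn eps = (if hb v0 v0 > 0 then hyperbolic_domain (f eps) else elliptic_domain (f eps))" for eps
 have dom: "p \<in> Rp eps \<longleftrightarrow> KK (p, eps) > 0" "p \<in> Rn eps \<longleftrightarrow> KK (p, eps) < 0" "p \<in> parabolic_curve (f eps) \<longleftrightarrow> KK (p, eps) = 0"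
  if "(p, eps) \<in> W" for p eps using domains_KK[OF that] unfolding Rp_def Rn_def by auto
 have iso: "isolated_parabolic_in (f eps0) q (Rp eps0)"
 proof -
  obtain U dlt where U: "open U" "q \<in> U" "dlt > 0" "!!p eps. p \<in> U ==> \<bar>eps - eps0\<bar> < dlt ==> (p, eps) \<in> W"
   "!!p. p \<in> U ==> p ~= q ==> KK (p, eps0) > 0"
   by (rule definite_regions[OF pos open_UNIV UNIV_I]) (rule that, assumption+)
  have sub: "U - {q} \<subseteq> Rp eps0"
  proof
   fix p assume p: "p \<in> U - {q}"
   have "(p, eps0) \<in> W" by (rule U(4)) (use p U(3) in auto)
   moreover have "KK (p, eps0) > 0" by (rule U(5)) (use p in auto)
   ultimately show "p \<in> Rp eps0" by (simp add: dom(1))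
  qed
  have "q \<in> parabolic_curve (f eps0)" using dom(3)[OF w0] KK_q(1) by simp
  with sub U(1,2) show ?thesis unfolding isolated_parabolic_in_def by (intro conjI exI[of _ U])
 qed
 have tr: "local_transition birth q eps0 (%eps U. U \<subseteq> Rp eps) (%eps U. island (f eps) (Rn eps) U)"
  unfolding local_transition_def
 proof (intro allI impI, elim conjE)
  fix N :: "plane set" assume "open N" "q \<in> N"
  obtain U dlt where U: "open U" "convex U" "bounded U" "q \<in> U" "U \<subseteq> N" "dlt > 0"
   and UW: "!!p eps. p \<in> U ==> \<bar>eps - eps0\<bar> < dlt ==> (p, eps) \<in> W"
   and before: "!!p eps. p \<in> U ==> - dlt < birth * (eps - eps0) ==> birth * (eps - eps0) < 0 ==> KK (p, eps) > 0"
   and after: "!!eps R. 0 < birth * (eps - eps0) ==> birth * (eps - eps0) < dlt ==> R = {p \<in> U. KK (p, eps) < 0} ==>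
   R homeomorphic (ball 0 1 :: plane set) \<and> compact (closure R) \<and> closure R \<subseteq> U \<and>
   frontier R = {p \<in> U. KK (p, eps) = 0} \<and> frontier R homeomorphic (sphere 0 1 :: plane set)"
   by (rule definite_regions[OF pos \<open>open N\<close> \<open>q \<in> N\<close>]) (rule that, assumption+)
  have isl: "island (f eps) (Rn eps) U" if e: "0 < birth * (eps - eps0)" "birth * (eps - eps0) < dlt" for eps
  proof -
   have w: "(p, eps) \<in> W" if "p \<in> U" for p by (rule UW[OF that]) (use e ab[of "eps - eps0"] in auto)
   have eq: "Rn eps \<inter> U = {p \<in> U. KK (p, eps) < 0}" "parabolic_curve (f eps) \<inter> U = {p \<in> U. KK (p, eps) = 0}"
    using dom(2,3)[OF w] by auto
   have A: "(Rn eps \<inter> U) homeomorphic (ball 0 1 :: plane set)" "compact (closure (Rn eps \<inter> U))"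
    "closure (Rn eps \<inter> U) \<subseteq> U" "frontier (Rn eps \<inter> U) = {p \<in> U. KK (p, eps) = 0}"
    "frontier (Rn eps \<inter> U) homeomorphic (sphere 0 1 :: plane set)" by (use after[OF e eq(1)] in argo)+
   show ?thesis unfolding island_def eq(2) using A(1-4) A(5)[unfolded A(4)] by blast
  qed
  have hyp: "U \<subseteq> Rp eps" if e: "- dlt < birth * (eps - eps0)" "birth * (eps - eps0) < 0" for eps
  proof
   fix p assume p: "p \<in> U"
   have "(p, eps) \<in> W" by (rule UW[OF p]) (use e ab[of "eps - eps0"] in auto)
   from dom(1)[OF this] before[OF p e] show "p \<in> Rp eps" by simp
  qed
  have "U homeomorphic (ball 0 1 :: plane set)" using U by (intro convex_open_homeomorphic_ball) auto
  then show "\<exists>U dlt. open U \<and> q \<in> U \<and> U \<subseteq> N \<and> U homeomorphic (ball 0 1 :: plane set) \<and> dlt > 0 \<and>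
    (\<forall>eps. 0 < birth * (eps - eps0) \<and> birth * (eps - eps0) < dlt --> island (f eps) (Rn eps) U) \<and>
    (\<forall>eps. - dlt < birth * (eps - eps0) \<and> birth * (eps - eps0) < 0 --> U \<subseteq> Rp eps)"
   using U isl hyp by (intro exI[of _ U] exI[of _ dlt]) auto
 qed
 show ?thesis
 proof (cases "hb v0 v0 > 0")
  case True
  then show ?thesis using iso tr unfolding case_d_def Rp_def Rn_def by simp
 next
  case False
  then show ?thesis using iso tr unfolding case_a_def Rp_def Rn_def by simp
 qed
qed

end

section \<open>The indefinite case: crossing branches, merging and separating regions\<close>

context morse_family
begin

text \<open>Affine coordinates along the diagonalising basis, in which KK is convex in the first and
  concave in the second variable.\<close>

definition LL :: "plane => plane" where "LL x = q + fst x *. v0 + snd x *. t0"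

lemma LL_props:
 "continuous_on UNIV LL" "inj LL" "!!S. open S ==> open (LL ` S)" "LL 0 = q"
 "!!r. bounded (LL ` {x. \<bar>fst x\<bar> < r \<and> \<bar>snd x\<bar> < r})" "!!S. convex S ==> convex (LL ` S)"
proof -
 define l :: "plane => plane" where "l x = fst x *. v0 + snd x *. t0" for x
 have l: "linear l" by (rule linearI) (auto simp: l_def algebra_simps)
 have LL: "LL = (%x. q + l x)" by (auto simp: LL_def l_def add.assoc)
 have "x = 0" if "l x = 0" for x
 proof -
  have "fst x * hb v0 v0 = 0" "snd x * hb t0 t0 = 0"
   using hb_v0_t0[of "fst x" "snd x"] that hb_scale_left[of 0 0] by (auto simp: l_def)
  then show "x = 0" using hvv htt by (simp add: prod_eq_iff)
 qed
 then have inj: "inj l" by (simp add: linear_injective_0[OF l])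
 then have surj: "surj l" by (rule linear_injective_imp_surjective[OF l]) simp
 show "inj LL" using inj by (auto simp: LL inj_def)
 show c: "continuous_on UNIV LL" unfolding LL_def by (intro continuous_intros)
 show "open (LL ` S)" if "open S" for S
 proof -
  have "LL ` S = (+) q ` (l ` S)" by (auto simp: LL image_image)
  then show ?thesis using open_surjective_linear_image[OF that l surj] by (simp add: open_translation)
 qed
 show "LL 0 = q" by (simp add: LL_def)
 show "bounded (LL ` {x. \<bar>fst x\<bar> < r \<and> \<bar>snd x\<bar> < r})" for r
 proof -
  have "LL ` {x. \<bar>fst x\<bar> < r \<and> \<bar>snd x\<bar> < r} \<subseteq> LL ` ({-r..r} \<times> {-r..r})" by (rule image_mono) auto
  moreover have "compact (LL ` ({-r..r} \<times> {-r..r}))"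
   by (intro compact_continuous_image continuous_on_subset[OF c] compact_Times) auto
  ultimately show ?thesis using compact_imp_bounded bounded_subset by blast
 qed
 show "convex (LL ` S)" if "convex S" for S
 proof -
  have "LL ` S = (+) q ` (l ` S)" by (auto simp: LL image_image)
  then show ?thesis using convex_linear_image[OF l that] by (simp add: convex_translation)
 qed
qed

text \<open>Here KK increases in the direction \<open>birth\<close>. Before, it is negative on the
  whole \<open>t0\<close>-axis, which separates the positive region; afterwards it is positive on
  the whole \<open>v0\<close>-axis, which separates the negative one.\<close>

lemma indefinite_regions:
 assumes neg: "hb e e * hb e' e' - (hb e e')\<^sup>2 < 0" and N: "open N" "q \<in> N"
 obtains U dlt where "open U" "convex U" "bounded U" "q \<in> U" "U \<subseteq> N" "dlt > 0"
  "!!p eps. p \<in> U ==> \<bar>eps - eps0\<bar> < dlt ==> (p, eps) \<in> W"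
  "!!s. s ~= 0 ==> \<bar>s\<bar> < dlt ==> (q + s *. v0, eps0) \<in> W \<and> KK (q + s *. v0, eps0) > 0"
  "!!eps. - dlt < birth * (eps - eps0) ==> birth * (eps - eps0) < 0 ==>
   card (components {p \<in> U. KK (p, eps) > 0}) = 2 \<and> card (components {p \<in> U. KK (p, eps) < 0}) = 1"
  "!!eps. 0 < birth * (eps - eps0) ==> birth * (eps - eps0) < dlt ==>
   card (components {p \<in> U. KK (p, eps) > 0}) = 1 \<and> card (components {p \<in> U. KK (p, eps) < 0}) = 2"
proof -
 let ?sig = "sgn (hb v0 v0)"
 define g1 where "g1 = pd (v0, 0) (pd (v0, 0) KK)"
 define g2 where "g2 w = - pd (t0, 0) (pd (t0, 0) KK) w" for w
 define g3 where "g3 w = birth * pd (0, 1) KK w" for w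
 have s: "smooth_on W g1" "smooth_on W g2" "smooth_on W g3"
  unfolding g1_def g2_def g3_def by (intro smooth_intros openW smooth_on_pd smooth_KK)+
 have tv: "hb t0 t0 * hb v0 v0 < 0" using hb_t0(2) neg by simp
 then have ht: "sgn (hb t0 t0) = - ?sig" by (auto simp: sgn_if mult_less_0_iff)
 have gq: "g1 (q, eps0) > 0" "g2 (q, eps0) > 0" "g3 (q, eps0) > 0"
 proof -
  show "g1 (q, eps0) > 0" using hvv by (simp add: g1_def KK_q sgn_mult_self_eq[symmetric] abs_sgn[symmetric] mult.commute)
  have "g2 (q, eps0) = sgn (hb t0 t0) * hb t0 t0" by (simp add: g2_def KK_q ht)
  also have "\<dots> = \<bar>hb t0 t0\<bar>" by (metis abs_sgn mult.commute)
  finally show "g2 (q, eps0) > 0" using htt by simp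
  have "hb t0 t0 = \<bar>hb t0 t0\<bar> * (- ?sig)" using ht by (metis abs_mult_sgn)
  then have "birth * ((\<bar>hb t0 t0\<bar> * (- ?sig)) * pd (0, 1) H (q, eps0)) < 0"
   using birth(2) by (rule subst[where P="%z. birth * (z * pd (0, 1) H (q, eps0)) < 0"])
  then have "\<bar>hb t0 t0\<bar> * g3 (q, eps0) > 0" by (simp add: g3_def pd_KK[OF w0] algebra_simps)
  then show "g3 (q, eps0) > 0" by (rule zero_less_mult_pos) (simp add: htt)
 qed
 define V where "V = (W \<inter> g1 -` {0<..}) \<inter> (W \<inter> g2 -` {0<..}) \<inter> (W \<inter> g3 -` {0<..})"
 have V: "open V" unfolding V_def
  by (intro open_Int continuous_open_preimage[OF smooth_on_imp_continuous_on openW] s open_greaterThan)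
 have Vq: "(q, eps0) \<in> V" unfolding V_def using w0 gq by simp
 obtain r d where rd: "r > 0" "d > 0" "cball q r \<subseteq> N" "!!p eps. p \<in> cball q r ==> \<bar>eps - eps0\<bar> < d ==> (p, eps) \<in> V"
  using isochronal_ball_in_open[OF V Vq N] by blast
 obtain R where R: "R > 0" "!!a b. \<bar>a\<bar> < R ==> \<bar>b\<bar> < R ==> LL (a, b) \<in> cball q r"
 proof -
  define R where "R = r / (norm v0 + norm t0 + 1)"
  have n: "norm v0 + norm t0 + 1 > 0" by (simp add: add_nonneg_pos)
  have R0: "R > 0" using rd(1) n by (simp add: R_def)
  have "LL (a, b) \<in> cball q r" if "\<bar>a\<bar> < R" "\<bar>b\<bar> < R" for a b
  proof -
   have "norm (a *. v0 + b *. t0) \<le> \<bar>a\<bar> * norm v0 + \<bar>b\<bar> * norm t0"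
    using norm_triangle_ineq[of "a *. v0" "b *. t0"] by simp
   also have "\<dots> \<le> R * norm v0 + R * norm t0" using that by (intro add_mono mult_right_mono) auto
   also have "\<dots> \<le> R * (norm v0 + norm t0 + 1)" using R0 by (simp add: algebra_simps)
   also have "\<dots> = r" using n by (simp add: R_def)
   finally have "norm (a *. v0 + b *. t0) \<le> r" .
   moreover have "dist q (LL (a, b)) = norm (a *. v0 + b *. t0)"
   proof -
    have "LL (a, b) - q = a *. v0 + b *. t0" by (simp add: LL_def)
    then show ?thesis by (metis dist_commute dist_norm)
   qed
   ultimately show ?thesis by simp
  qed
  then show ?thesis using that R0 by blast
 qed
 have LV: "(LL (a, b), eps) \<in> V" if "\<bar>a\<bar> < R" "\<bar>b\<bar> < R" "\<bar>eps - eps0\<bar> < d" for a b eps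
  using rd(4) R(2) that by blast
 have L1: "LL (a, b) = (q + b *. t0) + a *. v0" "LL (a, b) = (q + a *. v0) + b *. t0" for a b
  by (simp_all add: LL_def)
 define k where "k eps x = KK (LL x, eps)" for eps x
 have cx: "convex_on {-R<..<R} (%s. k eps (s, t))" if "\<bar>t\<bar> < R" "\<bar>eps - eps0\<bar> < d" for t eps
  unfolding k_def L1(1)
 proof (rule convex_on_line[OF openW smooth_KK])
  fix s assume "s \<in> {-R<..<R}"
  then have "(LL (s, t), eps) \<in> V" using LV that by auto
  then show "(q + t *. t0 + s *. v0, eps) \<in> W \<and> 0 \<le> pd (v0, 0) (pd (v0, 0) KK) (q + t *. t0 + s *. v0, eps)"
   unfolding L1(1) by (simp add: V_def g1_def)
 qed simp
 have sK: "smooth_on W (%w. - KK w)" by (intro smooth_intros openW smooth_KK)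
 have pdm: "pd v (%w. - KK w) w = - pd v KK w" "pd v (pd v (%w. - KK w)) w = - pd v (pd v KK) w" if w: "w \<in> W" for v w
 proof -
  have 1: "pd v (%w. - KK w) w = - pd v KK w" if w: "w \<in> W" for w
   by (rule pd_eqI) (auto intro!: derivative_eq_intros has_derivative_pd diff_g smooth_KK w)
  then show "pd v (%w. - KK w) w = - pd v KK w" using w by blast
  have "pd v (pd v (%w. - KK w)) w = pd v (%w. - pd v KK w) w" by (rule pd_cong_open[OF openW w]) (simp add: 1)
  also have "\<dots> = - pd v (pd v KK) w"
   by (rule pd_eqI) (auto intro!: derivative_eq_intros has_derivative_pd diff_g smooth_on_pd openW smooth_KK w)
  finally show "pd v (pd v (%w. - KK w)) w = - pd v (pd v KK) w" .
 qed
 have cc: "convex_on {-R<..<R} (%t. - k eps (s, t))" if "\<bar>s\<bar> < R" "\<bar>eps - eps0\<bar> < d" for s eps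
  unfolding k_def L1(2)
 proof (rule convex_on_line[OF openW sK])
  fix t assume "t \<in> {-R<..<R}"
  then have "(LL (s, t), eps) \<in> V" using LV that by auto
  then show "(q + s *. v0 + t *. t0, eps) \<in> W \<and> 0 \<le> pd (t0, 0) (pd (t0, 0) (%w. - KK w)) (q + s *. v0 + t *. t0, eps)"
   unfolding L1(2) by (simp add: V_def g2_def pdm)
 qed simp
 have pos0: "k eps0 (s, 0) > 0" if s: "\<bar>s\<bar> < R" "s ~= 0" for s
 proof -
  have "KK (q + s *. v0, eps0) > 0"
  proof (rule positive_on_line[OF openW smooth_KK KK_q(1) KK_q(2) s])
   fix s assume "\<bar>s\<bar> < R"
   then have "(LL (s, 0), eps0) \<in> V" using LV R(1) rd(2) by auto
   then show "(q + s *. v0, eps0) \<in> W \<and> 0 < pd (v0, 0) (pd (v0, 0) KK) (q + s *. v0, eps0)"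
    by (simp add: L1 V_def g1_def)
  qed
  then show ?thesis by (simp add: k_def L1)
 qed
 have neg0: "k eps0 (0, t) < 0" if t: "\<bar>t\<bar> < R" "t ~= 0" for t
 proof -
  have "- KK (q + t *. t0, eps0) > 0"
  proof (rule positive_on_line[OF openW sK _ _ t])
   show "- KK (q, eps0) = 0" "pd (t0, 0) (%w. - KK w) (q, eps0) = 0" using KK_q pdm[OF w0] by simp_all
   fix t assume "\<bar>t\<bar> < R"
   then have "(LL (0, t), eps0) \<in> V" using LV R(1) rd(2) by auto
   then show "(q + t *. t0, eps0) \<in> W \<and> 0 < pd (t0, 0) (pd (t0, 0) (%w. - KK w)) (q + t *. t0, eps0)"
    by (simp add: L1 V_def g2_def pdm)
  qed
  then show ?thesis by (simp add: k_def L1)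
 qed
 have k0: "k eps0 (0, 0) = 0" using KK_q(1) by (simp add: k_def L1)
 have mono: "birth * (eps - eps0) > 0 ==> k eps (a, b) > k eps0 (a, b)" "birth * (eps - eps0) < 0 ==> k eps (a, b) < k eps0 (a, b)"
  if "\<bar>a\<bar> < R" "\<bar>b\<bar> < R" "\<bar>eps - eps0\<bar> < d" for a b eps
 proof -
  have V: "(LL (a, b), eps0 + t) \<in> V" if "\<bar>t\<bar> < d" for t using LV[of a b "eps0 + t"] \<open>\<bar>a\<bar> < R\<close> \<open>\<bar>b\<bar> < R\<close> that by simp
  have 1: "((%t. KK (LL (a, b), eps0 + t)) has_real_derivative pd (0, 1) KK (LL (a, b), eps0 + t)) (at t)" if "\<bar>t\<bar> < d" for t
   using V[OF that] by (intro time_derivative[OF openW smooth_KK]) (simp add: V_def)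
  have 2: "birth * pd (0, 1) KK (LL (a, b), eps0 + t) > 0" if "\<bar>t\<bar> < d" for t
   using V[OF that] by (simp add: V_def g3_def)
  show "birth * (eps - eps0) > 0 ==> k eps (a, b) > k eps0 (a, b)" "birth * (eps - eps0) < 0 ==> k eps (a, b) < k eps0 (a, b)"
   using monotone_sign[OF 1 2 that(3)] by (simp_all add: k_def)
 qed
 define c where "c = R / 2"
 have c: "0 < c" "c < R" using R(1) by (auto simp: c_def)
 have kc: "((%eps. k eps (a, b)) \<longlongrightarrow> k eps0 (a, b)) (at eps0)" if "\<bar>a\<bar> < R" "\<bar>b\<bar> < R" for a b
 proof -
  have "(LL (a, b), eps0 + 0) \<in> W" using LV[of a b eps0] that rd(2) by (simp add: V_def)
  from DERIV_isCont[OF time_derivative[OF openW smooth_KK this]] have "isCont (%t. k (eps0 + t) (a, b)) 0" by (simp add: k_def)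
  then have "isCont (%eps. k (eps0 + (eps - eps0)) (a, b)) eps0"
   by (intro isCont_o2[where f="%eps. eps - eps0" and g="%t. k (eps0 + t) (a, b)"]) simp_all
  then have "isCont (%eps. k eps (a, b)) eps0" by simp
  then show ?thesis by (simp add: isCont_def)
 qed
 have "\<forall>\<^sub>F eps in at eps0. (k eps (c, 0) > 0 \<and> k eps (- c, 0) > 0) \<and> (k eps (0, c) < 0 \<and> k eps (0, - c) < 0)"
  using order_tendstoD(1)[OF kc[of c 0] pos0[of c]] order_tendstoD(1)[OF kc[of "- c" 0] pos0[of "- c"]]
   order_tendstoD(2)[OF kc[of 0 c] neg0[of c]] order_tendstoD(2)[OF kc[of 0 "- c"] neg0[of "- c"]] c R(1)
  by (intro eventually_conj) auto
 then obtain d' where d': "d' > 0" "!!eps. eps ~= eps0 ==> \<bar>eps - eps0\<bar> < d' ==>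
   (k eps (c, 0) > 0 \<and> k eps (- c, 0) > 0) \<and> (k eps (0, c) < 0 \<and> k eps (0, - c) < 0)"
  unfolding eventually_at by (auto simp: dist_real_def)
 define dlt where "dlt = min (min d d') R"
 have dlt: "dlt > 0" "dlt \<le> d" "dlt \<le> d'" "dlt \<le> R" using rd(2) d' R(1) by (auto simp: dlt_def)
 define Q where "Q = {x :: plane. \<bar>fst x\<bar> < R \<and> \<bar>snd x\<bar> < R}"
 have Q: "open Q" "convex Q" "0 \<in> Q"
 proof -
  have "Q = {-R<..<R} \<times> {-R<..<R}" by (auto simp: Q_def)
  then show "open Q" "convex Q" by (auto intro!: open_Times convex_Times)
  show "0 \<in> Q" using R(1) by (simp add: Q_def)
 qed
 have ab: "\<bar>birth * e\<bar> = \<bar>e\<bar>" for e using birth(1) by auto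
 have contk: "continuous_on Q (k eps)" if "\<bar>eps - eps0\<bar> < d" for eps unfolding k_def
  by (rule continuous_on_compose2[OF smooth_on_imp_continuous_on[OF smooth_KK], where f="%x. (LL x, eps)"])
   (use LV that in \<open>auto intro!: continuous_intros continuous_on_subset[OF LL_props(1)] simp: Q_def V_def\<close>)
 have img: "{p \<in> LL ` Q. KK (p, eps) > 0} = LL ` {x. \<bar>fst x\<bar> < R \<and> \<bar>snd x\<bar> < R \<and> k eps x > 0}"
  "{p \<in> LL ` Q. KK (p, eps) < 0} = LL ` {x. \<bar>fst x\<bar> < R \<and> \<bar>snd x\<bar> < R \<and> k eps x < 0}" for eps
  by (auto simp: Q_def k_def)
 have before: "card (components {p \<in> LL ` Q. KK (p, eps) > 0}) = 2 \<and> card (components {p \<in> LL ` Q. KK (p, eps) < 0}) = 1"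
  if e: "- dlt < birth * (eps - eps0)" "birth * (eps - eps0) < 0" for eps
 proof -
  have e': "\<bar>eps - eps0\<bar> < d" "\<bar>eps - eps0\<bar> < d'" "eps ~= eps0" using e ab[of "eps - eps0"] dlt by auto
  have neg: "k eps (0, t) < 0" if "\<bar>t\<bar> < R" for t
   using mono(2)[of 0 t eps] e(2) e'(1) neg0[of t] k0 that R(1) by (cases "t = 0") auto
  have kk: "k eps (c, 0) > 0" "k eps (- c, 0) > 0" using d'(2)[OF e'(3,2)] by simp_all
  note S = saddle_regions[OF cx[OF _ e'(1)] cc[OF _ e'(1)] neg R(1) c kk contk[OF e'(1), unfolded Q_def] LL_props(1-3)]
  show ?thesis unfolding img by (intro conjI S)
 qed
 have after: "card (components {p \<in> LL ` Q. KK (p, eps) > 0}) = 1 \<and> card (components {p \<in> LL ` Q. KK (p, eps) < 0}) = 2"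
  if e: "0 < birth * (eps - eps0)" "birth * (eps - eps0) < dlt" for eps
 proof -
  have e': "\<bar>eps - eps0\<bar> < d" "\<bar>eps - eps0\<bar> < d'" "eps ~= eps0" using e ab[of "eps - eps0"] dlt by auto
  \<comment> \<open>Exchanging the variables and changing the sign gives a saddle of the first kind
    again.\<close>
  define k' where "k' x = - k eps (snd x, fst x)" for x
  have cx': "convex_on {-R<..<R} (%s. k' (s, t))" if "\<bar>t\<bar> < R" for t using cc[OF that e'(1)] by (simp add: k'_def)
  have cc': "convex_on {-R<..<R} (%t. - k' (s, t))" if "\<bar>s\<bar> < R" for s using cx[OF that e'(1)] by (simp add: k'_def)
  have neg: "k' (0, t) < 0" if "\<bar>t\<bar> < R" for t
   using mono(1)[of t 0 eps] e(1) e'(1) pos0[of t] k0 that R(1) by (cases "t = 0") (auto simp: k'_def)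
  have sw: "continuous_on UNIV (prod.swap :: plane => plane)" by (rule continuous_on_swap)
  have ck: "continuous_on {x. \<bar>fst x\<bar> < R \<and> \<bar>snd x\<bar> < R} k'" unfolding k'_def
   by (intro continuous_intros continuous_on_compose2[OF contk[OF e'(1)]]) (auto simp: Q_def)
  have L1: "continuous_on UNIV (LL \<circ> prod.swap)"
   by (intro continuous_on_compose sw continuous_on_subset[OF LL_props(1)]) auto
  have L2: "inj (LL \<circ> prod.swap)" by (intro inj_compose LL_props) simp
  have L3: "open ((LL \<circ> prod.swap) ` S)" if "open S" for S
  proof -
   have "x \<in> prod.swap ` S" if "prod.swap x \<in> S" for x using imageI[OF that, of prod.swap] by simp
   then have "prod.swap ` S = prod.swap -` S" by auto
   then have "open (prod.swap ` S)" using open_vimage[OF that sw] by simp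
   then show ?thesis unfolding image_comp[symmetric] by (rule LL_props(3))
  qed
  have I: "(LL \<circ> prod.swap) ` {x. \<bar>fst x\<bar> < R \<and> \<bar>snd x\<bar> < R \<and> k' x < 0} = LL ` {x. \<bar>fst x\<bar> < R \<and> \<bar>snd x\<bar> < R \<and> k eps x > 0}"
   "(LL \<circ> prod.swap) ` {x. \<bar>fst x\<bar> < R \<and> \<bar>snd x\<bar> < R \<and> k' x > 0} = LL ` {x. \<bar>fst x\<bar> < R \<and> \<bar>snd x\<bar> < R \<and> k eps x < 0}"
   unfolding image_comp[symmetric] by (intro arg_cong[where f="image LL"]; force simp: k'_def image_iff)+
  have kk: "k' (c, 0) > 0" "k' (- c, 0) > 0" using d'(2)[OF e'(3,2)] by (auto simp: k'_def)
  note S = saddle_regions[OF cx' cc' neg R(1) c kk ck L1 L2 L3]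
  show ?thesis unfolding img by (intro conjI S[unfolded I])
 qed
 show ?thesis
 proof (rule that[of "LL ` Q" dlt])
  show "open (LL ` Q)" "convex (LL ` Q)" "bounded (LL ` Q)" "dlt > 0"
   using LL_props(3)[OF Q(1)] LL_props(6)[OF Q(2)] LL_props(5)[of R] dlt by (auto simp: Q_def)
  show "q \<in> LL ` Q" using LL_props(4) Q(3) by (metis imageI)
  show "LL ` Q \<subseteq> N" using R(2) rd(3) by (auto simp: Q_def)
  show "(p, eps) \<in> W" if pe: "p \<in> LL ` Q" "\<bar>eps - eps0\<bar> < dlt" for p eps
  proof -
   obtain x where "p = LL x" "x \<in> Q" using pe(1) by blast
   then show ?thesis using LV[of "fst x" "snd x" eps] pe(2) dlt by (simp add: V_def Q_def)
  qed
  show "(q + s *. v0, eps0) \<in> W \<and> KK (q + s *. v0, eps0) > 0" if "s ~= 0" "\<bar>s\<bar> < dlt" for s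
   using pos0[of s] LV[of s 0 eps0] that dlt R(1) rd(2) by (simp add: k_def LL_def V_def)
 qed (rule before after; assumption)+
qed

text \<open>Near q the function is a quadratic form in two coordinates with smooth coefficients and
  negative determinant, and it factors into two smooth functions, one for each branch.\<close>

lemma indefinite_crossing:
 assumes neg: "hb e e * hb e' e' - (hb e e')\<^sup>2 < 0"
 shows "parabolic_crossing (f eps0) q"
proof -
 define G where "G = hess_det (f eps0)"
 define alp bet where "alp p = (p - q) \<bullet> e" and "bet p = (p - q) \<bullet> e' - (p - q) \<bullet> e * mm (q, eps0)" for p
 obtain r where r: "r > 0" "ball q r \<subseteq> {p. (p, eps0) \<in> W}"
  using slice_open[of eps0] w0 unfolding open_contains_ball by blast
 define B where "B = ball q r"
 have B: "open B" "convex B" "q \<in> B" "smooth_on B G" using r smooth_on_subset[OF slice_smooth_H] by (auto simp: B_def G_def)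
 have crit: "G q = 0" "pd v G q = 0" for v using hess_det_H[OF w0] H0 slice_pd_H[OF w0] dH0 by (auto simp: G_def)
 have coord: "p = q + alp p *. v0 + bet p *. e'" for p
  using v0_e'[of "p - q"] by (simp add: alp_def bet_def algebra_simps)
 obtain h11 h12 h22 where h: "smooth_on B h11" "smooth_on B h12" "smooth_on B h22"
  "!!p. p \<in> B ==> G p = h11 p * (alp p)\<^sup>2 + 2 * h12 p * alp p * bet p + h22 p * (bet p)\<^sup>2"
  "h11 q = pd v0 (pd v0 G) q / 2" "h12 q = pd v0 (pd e' G) q / 2" "h22 q = pd e' (pd e' G) q / 2"
  by (rule hadamard_quadratic[OF B crit coord]) (rule that, assumption+)
 define D where "D p = (h12 p)\<^sup>2 - h11 p * h22 p" for p
 have hq: "h11 q = hb v0 v0 / 2" "h12 q = hb v0 e' / 2" "h22 q = hb e' e' / 2"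
  unfolding h(5-7) G_def slice_pd2_H[OF w0] hb_def by simp_all
 have "D q = - (hb v0 v0 * hb e' e' - (hb v0 e')\<^sup>2) / 4" unfolding D_def hq by (simp add: power2_eq_square field_simps)
 then have Dq: "D q > 0" using neg hb_det' by simp
 have sD: "smooth_on B D" unfolding D_def by (intro smooth_intros h B)
 define U where "U = (B \<inter> D -` {0<..}) \<inter> (B \<inter> h11 -` (- {0}))"
 have U: "open U" "q \<in> U" unfolding U_def using Dq hq(1) hvv B(3)
  by (auto intro!: open_Int continuous_open_preimage[OF smooth_on_imp_continuous_on[OF sD] B(1)]
    continuous_open_preimage[OF smooth_on_imp_continuous_on[OF h(1)] B(1)])
 have UB: "U \<subseteq> B" by (auto simp: U_def)
 note sh = h(1-3)[THEN smooth_on_subset, OF UB]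
 have sR: "smooth_on U (%p. sqrt (D p))" by (rule smooth_on_sqrt[OF U(1) smooth_on_subset[OF sD UB]]) (simp add: U_def)
 \<comment> \<open>The product of the two factors is h11 times the quadratic form. Taking
   \<open>v0\<close> as first basis vector makes h11 nonzero, by \<open>hvv\<close>.\<close>
 define a where "a kpa p = h11 p * alp p + (h12 p + kpa * sqrt (D p)) * bet p" for kpa p
 have sl: "smooth_on U alp" "smooth_on U bet" unfolding alp_def bet_def by (intro smooth_intros U)+
 have sa: "smooth_on U (a kpa)" for kpa unfolding a_def by (intro smooth_intros U sh sR sl)
 have aq: "a kpa q = 0" for kpa by (simp add: a_def alp_def bet_def)
 have da: "pd v (a kpa) q = h11 q * (v \<bullet> e) + (h12 q + kpa * sqrt (D q)) * (v \<bullet> e' - v \<bullet> e * mm (q, eps0))" for kpa v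
 proof -
  have "(h11 has_derivative (%v. pd v h11 q)) (at q)" "((%p. h12 p + kpa * sqrt (D p)) has_derivative (%v. pd v (%p. h12 p + kpa * sqrt (D p)) q)) (at q)"
   by (rule smooth_on_has_derivative[OF _ U], intro smooth_intros U sh sR)+
  moreover have "(alp has_derivative (%v. v \<bullet> e)) (at q)" "(bet has_derivative (%v. v \<bullet> e' - v \<bullet> e * mm (q, eps0))) (at q)"
   unfolding alp_def bet_def by (auto intro!: derivative_eq_intros)
  ultimately have "(a kpa has_derivative (%v. (h11 q * (v \<bullet> e) + pd v h11 q * alp q)
    + ((h12 q + kpa * sqrt (D q)) * (v \<bullet> e' - v \<bullet> e * mm (q, eps0)) + pd v (%p. h12 p + kpa * sqrt (D p)) q * bet q))) (at q)"
   unfolding a_def by (intro has_derivative_add has_derivative_mult)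
  from pd_eqI[OF this, of v] show ?thesis by (simp add: alp_def bet_def)
 qed
 define A1 A2 where "A1 = {p \<in> U. a 1 p = 0}" and "A2 = {p \<in> U. a (-1) p = 0}"
 have jac: "partials [(1,0)] (a 1) q * partials [(0,1)] (a (-1)) q - partials [(0,1)] (a 1) q * partials [(1,0)] (a (-1)) q ~= 0"
 proof -
  have nz: "h11 q ~= 0" "sqrt (D q) ~= 0" using hq(1) hvv Dq by auto
  show ?thesis unfolding partials.simps pd_def[symmetric] da using frame nz by (auto simp: algebra_simps)
 qed
 have "transverse_curves A1 A2 q" unfolding transverse_curves_def
  by (intro exI[of _ U] exI[of _ "a 1"] exI[of _ "a (-1)"] conjI sa U aq jac) (auto simp: A1_def A2_def)
 moreover have "parabolic_curve (f eps0) \<inter> U = (A1 \<union> A2) \<inter> U"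
 proof -
  have "G p = 0 \<longleftrightarrow> a 1 p = 0 \<or> a (-1) p = 0" if p: "p \<in> U" for p
  proof -
   have "D p > 0" "h11 p ~= 0" "p \<in> B" using p by (auto simp: U_def)
   have "(sqrt (D p))\<^sup>2 = (h12 p)\<^sup>2 - h11 p * h22 p" using \<open>D p > 0\<close> by (simp add: D_def)
   then have "a 1 p * a (-1) p = h11 p * G p" unfolding a_def h(4)[OF \<open>p \<in> B\<close>] by algebra
   then show ?thesis using \<open>h11 p ~= 0\<close> by (metis mult_eq_0_iff)
  qed
  then show ?thesis by (auto simp: parabolic_curve_def A1_def A2_def G_def)
 qed
 ultimately show ?thesis unfolding parabolic_crossing_def using U by blast
qed

lemma indefinite_cases:
 assumes neg: "hb e e * hb e' e' - (hb e e')\<^sup>2 < 0"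
 shows "case_b f q eps0 birth \<or> case_c f q eps0 birth"
proof -
 have ab: "\<bar>birth * e\<bar> = \<bar>e\<bar>" for e using birth(1) by auto
 define Rp Rn where "Rp eps = (if hb v0 v0 > 0 then elliptic_domain (f eps) else hyperbolic_domain (f eps))"
  and "Rn eps = (if hb v0 v0 > 0 then hyperbolic_domain (f eps) else elliptic_domain (f eps))" for eps
 have dom: "p \<in> Rp eps \<longleftrightarrow> KK (p, eps) > 0" "p \<in> Rn eps \<longleftrightarrow> KK (p, eps) < 0"
  if "(p, eps) \<in> W" for p eps using domains_KK[OF that] unfolding Rp_def Rn_def by auto
 have pts: "asymptotic_points_to (f eps0) q (Rp eps0)" unfolding asymptotic_points_to_def asymptotic_q
 proof (intro allI impI, elim exE conjE)
  fix v c assume c: "c ~= 0" and v: "v = c *. v0"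
  obtain U :: "plane set" and dlt where U: "open U" "dlt > 0"
   "!!s. s ~= 0 ==> \<bar>s\<bar> < dlt ==> (q + s *. v0, eps0) \<in> W \<and> KK (q + s *. v0, eps0) > 0"
   by (rule indefinite_regions[OF neg open_UNIV UNIV_I]) (rule that, assumption+)
  have "q + t *. v \<in> Rp eps0" if "t ~= 0" "\<bar>t\<bar> < dlt / \<bar>c\<bar>" for t
  proof -
   have "(q + (t * c) *. v0, eps0) \<in> W \<and> KK (q + (t * c) *. v0, eps0) > 0"
    by (rule U(3)) (use that c in \<open>auto simp: abs_mult field_simps\<close>)
   then show ?thesis using dom(1) by (simp add: v)
  qed
  then show "\<forall>\<^sub>F t in at 0. q + t *. v \<in> Rp eps0"
   unfolding eventually_at using U(2) c by (intro exI[of _ "dlt / \<bar>c\<bar>"]) (auto simp: dist_real_def)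
 qed
 have tr: "local_transition birth q eps0 (%eps U. n_regions (Rp eps) U = 2 \<and> n_regions (Rn eps) U = 1)
   (%eps U. n_regions (Rp eps) U = 1 \<and> n_regions (Rn eps) U = 2)" unfolding local_transition_def
 proof (intro allI impI, elim conjE)
  fix N :: "plane set" assume "open N" "q \<in> N"
  obtain U dlt where U: "open U" "convex U" "bounded U" "q \<in> U" "U \<subseteq> N" "dlt > 0"
   and UW: "!!p eps. p \<in> U ==> \<bar>eps - eps0\<bar> < dlt ==> (p, eps) \<in> W"
   and before: "!!eps. - dlt < birth * (eps - eps0) ==> birth * (eps - eps0) < 0 ==>
    card (components {p \<in> U. KK (p, eps) > 0}) = 2 \<and> card (components {p \<in> U. KK (p, eps) < 0}) = 1"
   and after: "!!eps. 0 < birth * (eps - eps0) ==> birth * (eps - eps0) < dlt ==>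
    card (components {p \<in> U. KK (p, eps) > 0}) = 1 \<and> card (components {p \<in> U. KK (p, eps) < 0}) = 2"
   by (rule indefinite_regions[OF neg \<open>open N\<close> \<open>q \<in> N\<close>]) (rule that, assumption+)
  have n: "n_regions (Rp eps) U = card (components {p \<in> U. KK (p, eps) > 0})"
   "n_regions (Rn eps) U = card (components {p \<in> U. KK (p, eps) < 0})" if "\<bar>eps - eps0\<bar> < dlt" for eps
  proof -
   have "Rp eps \<inter> U = {p \<in> U. KK (p, eps) > 0}" "Rn eps \<inter> U = {p \<in> U. KK (p, eps) < 0}"
    using dom[OF UW[OF _ that]] by auto
   then show "n_regions (Rp eps) U = card (components {p \<in> U. KK (p, eps) > 0})"
    "n_regions (Rn eps) U = card (components {p \<in> U. KK (p, eps) < 0})" by (simp_all add: n_regions_def)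
  qed
  have b: "n_regions (Rp eps) U = 2 \<and> n_regions (Rn eps) U = 1" if e: "- dlt < birth * (eps - eps0)" "birth * (eps - eps0) < 0" for eps
  proof -
   have "\<bar>eps - eps0\<bar> < dlt" using e ab[of "eps - eps0"] by auto
   from n[OF this] before[OF e] show ?thesis by simp
  qed
  have a: "n_regions (Rp eps) U = 1 \<and> n_regions (Rn eps) U = 2" if e: "0 < birth * (eps - eps0)" "birth * (eps - eps0) < dlt" for eps
  proof -
   have "\<bar>eps - eps0\<bar> < dlt" using e ab[of "eps - eps0"] by auto
   from n[OF this] after[OF e] show ?thesis by simp
  qed
  have "U homeomorphic (ball 0 1 :: plane set)" using U by (intro convex_open_homeomorphic_ball) auto
  then show "\<exists>U dlt. open U \<and> q \<in> U \<and> U \<subseteq> N \<and> U homeomorphic (ball 0 1 :: plane set) \<and> dlt > 0 \<and>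
    (\<forall>eps. 0 < birth * (eps - eps0) \<and> birth * (eps - eps0) < dlt --> n_regions (Rp eps) U = 1 \<and> n_regions (Rn eps) U = 2) \<and>
    (\<forall>eps. - dlt < birth * (eps - eps0) \<and> birth * (eps - eps0) < 0 --> n_regions (Rp eps) U = 2 \<and> n_regions (Rn eps) U = 1)"
   using U a b by (intro exI[of _ U] exI[of _ dlt]) simp
 qed
 show ?thesis
 proof (cases "hb v0 v0 > 0")
  case True
  then show ?thesis using indefinite_crossing[OF neg] pts tr unfolding case_c_def Rp_def Rn_def by simp
 next
  case False
  then show ?thesis using indefinite_crossing[OF neg] pts tr unfolding case_b_def Rp_def Rn_def by simp
 qed
qed

theorem four_cases:
 "case_a f q eps0 birth \<or> case_b f q eps0 birth \<or> case_c f q eps0 birth \<or> case_d f q eps0 birth"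
 using definite_cases indefinite_cases hb_det by (meson linorder_neqE_linordered_idom)

end

section \<open>The local statement at a versal point\<close>

text \<open>If both diagonal entries of a Hessian with zero determinant vanished, the whole matrix
  would, and every direction would be asymptotic.\<close>

lemma parabolic_frame:
 assumes W: "open W" "smooth_on W (%(p, eps). f eps p)" "(q, eps0) \<in> W"
  and p: "hess_det (f eps0) q = 0" "unique_asymptotic (f eps0) q"
 obtains e e' where "graph_family W f e e'" "graph_family.g02 f e' (q, eps0) ~= 0"
proof -
 interpret A: graph_family W f "(1,0)" "(0,1)" by unfold_locales (use W in auto)
 interpret B: graph_family W f "(0,1)" "(1,0)" by unfold_locales (use W in auto)
 have "A.g02 (q, eps0) ~= 0 \<or> B.g02 (q, eps0) ~= 0"
 proof (rule ccontr)
  assume "\<not> ?thesis"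
  moreover have "A.g20 = B.g02" by (simp add: A.g20_def B.g02_def)
  ultimately have z: "A.g02 (q, eps0) = 0" "A.g20 (q, eps0) = 0" by auto
  then have "A.g11 (q, eps0) = 0" using A.hess_det_eq[OF W(3)] p(1) by simp
  then have as: "asymptotic (f eps0) q v" if "v ~= 0" for v
   using A.line_contact_3[OF W(3) A.frame_expand] z that by (simp add: asymptotic_def)
  obtain v where v: "!!w. asymptotic (f eps0) q w ==> \<exists>c. w = c *. v" using p(2) unfolding unique_asymptotic_def by blast
  obtain c d where "(1, 0) = c *. v" "(0, 1) = d *. v" using v[OF as, of "(1,0)"] v[OF as, of "(0,1)"] by (auto simp: zero_prod_def)
  then show False by (cases v) auto
 qed
 then show ?thesis using that A.graph_family_axioms B.graph_family_axioms by blast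
qed

theorem local_theorem:
 assumes chart: "monge_chart M S W f" "(q, eps0) \<in> W"
  and p: "parabolic_morse (f eps0) q" "unique_asymptotic (f eps0) q" "general_position (f eps0) q"
  and versal: "pd (0, 1) (%(p, eps). hess_det (f eps) p) (q, eps0) ~= 0"
 shows "A3_transition (%eps. flecnodal_curve (f eps)) q eps0 \<and> (\<exists>sig\<in>{1, -1}.
    (case_a f q eps0 sig \<or> case_b f q eps0 sig \<or> case_c f q eps0 sig \<or> case_d f q eps0 sig) \<and>
    two_godrons_transition f q eps0 sig) \<and>
   (\<exists>V Th. umbrella_chart {(p, eps). p \<in> flecnodal_curve (f eps)} (q, eps0) V Th \<and> (\<forall>(p, eps) \<in> V.
      (p \<in> real_flecnodal_curve (f eps) \<longleftrightarrow> Th (p, eps) \<in> range umbrella_param) \<and>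
      (hyperbonode (f eps) p \<longleftrightarrow> Th (p, eps) \<in> self_intersection_line) \<and>
      (ellipnode (f eps) p \<longleftrightarrow> Th (p, eps) \<in> handle)) \<and>
    isochronal_section_tangent V Th) \<and>
   A3_singularity (flecnodal_curve (f eps0)) q"
proof -
 have W: "open W" "smooth_on W (%(p, eps). f eps p)" "(q, eps0) \<in> W" using chart by (auto simp: monge_chart_def)
 have h0: "hess_det (f eps0) q = 0" using p(1) by (simp add: parabolic_morse_def)
 obtain e e' where "graph_family W f e e'" "graph_family.g02 f e' (q, eps0) ~= 0" using parabolic_frame[OF W h0 p(2)] by blast
 then interpret morse_family W f e e' q eps0 unfolding morse_family_def morse_family_axioms_def using W(3) p versal by blast
 show ?thesis by (intro conjI A3_theorem umbrella_theorem bexI[OF _ birth(1)] four_cases godron_theorem)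
qed

subsection \<open>Determinants and surfaces in homogeneous coordinates\<close>

definition vol :: "real^4 => real^4 => real^4 => real^4 => real" where
 "vol a b c d = det (\<chi> i. if i = 1 then a else if i = 2 then b else if i = 3 then c else d)"

lemma vol_linear:
 "vol (a + a') b c d = vol a b c d + vol a' b c d" "vol a (b + b') c d = vol a b c d + vol a b' c d"
 "vol a b (c + c') d = vol a b c d + vol a b c' d" "vol a b c (d + d') = vol a b c d + vol a b c d'"
 "vol (r *. a) b c d = r * vol a b c d" "vol a (r *. b) c d = r * vol a b c d"
 "vol a b (r *. c) d = r * vol a b c d" "vol a b c (r *. d) = r * vol a b c d"
proof -
 have s: "r *. x = r *s x" for r and x :: "real^4" by (simp add: vec_eq_iff)
 have e: "(\<chi> i::4. if i = 1 then a else if i = 2 then b else if i = 3 then c else d)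
   = (\<chi> i. if i = 2 then b else if i = 1 then a else if i = 3 then c else d)"
  "(\<chi> i::4. if i = 1 then a else if i = 2 then b else if i = 3 then c else d)
   = (\<chi> i. if i = 3 then c else if i = 1 then a else if i = 2 then b else d)"
  "(\<chi> i::4. if i = 1 then a else if i = 2 then b else if i = 3 then c else d)
   = (\<chi> i. if i = 4 then d else if i = 1 then a else if i = 2 then b else c)" for a b c d :: "real^4"
  by (simp_all add: vec_eq_iff forall_4)
 show "vol (a + a') b c d = vol a b c d + vol a' b c d" "vol (r *. a) b c d = r * vol a b c d"
  unfolding vol_def s using det_row_add[of 1 "%_. a" "%_. a'" "%i. if i = 2 then b else if i = 3 then c else d"]
   det_row_mul[of 1 r "%_. a" "%i. if i = 2 then b else if i = 3 then c else d"] by simp_all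
 show "vol a (b + b') c d = vol a b c d + vol a b' c d" "vol a (r *. b) c d = r * vol a b c d"
  unfolding vol_def e(1) s using det_row_add[of 2 "%_. b" "%_. b'" "%i. if i = 1 then a else if i = 3 then c else d"]
   det_row_mul[of 2 r "%_. b" "%i. if i = 1 then a else if i = 3 then c else d"] by simp_all
 show "vol a b (c + c') d = vol a b c d + vol a b c' d" "vol a b (r *. c) d = r * vol a b c d"
  unfolding vol_def e(2) s using det_row_add[of 3 "%_. c" "%_. c'" "%i. if i = 1 then a else if i = 2 then b else d"]
   det_row_mul[of 3 r "%_. c" "%i. if i = 1 then a else if i = 2 then b else d"] by simp_all
 show "vol a b c (d + d') = vol a b c d + vol a b c d'" "vol a b c (r *. d) = r * vol a b c d"
  unfolding vol_def e(3) s using det_row_add[of 4 "%_. d" "%_. d'" "%i. if i = 1 then a else if i = 2 then b else c"]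
   det_row_mul[of 4 r "%_. d" "%i. if i = 1 then a else if i = 2 then b else c"] by simp_all
qed

lemma vol_repeat: "vol a a c d = 0" "vol a b a d = 0" "vol a b c a = 0" "vol a b b d = 0" "vol a b c b = 0" "vol a b c c = 0"
 unfolding vol_def by (rule det_identical_rows[of 1 2], simp_all add: row_def)
  (rule det_identical_rows[of 1 3] det_identical_rows[of 1 4] det_identical_rows[of 2 3]
   det_identical_rows[of 2 4] det_identical_rows[of 3 4]; simp add: row_def; fail)+

lemma vol_swap: "vol a c b d = - vol a b c d"
proof -
 have "vol a b c d + vol a c b d = 0" using vol_repeat(4)[of a "b + c" d] unfolding vol_linear by (simp add: vol_repeat)
 then show ?thesis by linarith
qed

text \<open>Shaped for the second fundamental form: multiples of the position vector and of tangent
  vectors may be added freely, and a change of tangent basis contributes its determinant.\<close>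

lemma vol_change:
 "vol (r *. z) (p1 *. z + (alp1 *. a + bet1 *. b)) (p2 *. z + (alp2 *. a + bet2 *. b)) (c + (r0 *. z + (r1 *. a + r2 *. b)))
  = r * (alp1 * bet2 - alp2 * bet1) * vol z a b c" by (simp add: vol_linear vol_repeat vol_swap[of z a b] algebra_simps)

lemma vol_matrix: "vol (T *v a) (T *v b) (T *v c) (T *v d) = det T * vol a b c d"
proof -
 let ?R = "%a b c d. (\<chi> i. if i = 1 then a else if i = 2 then b else if i = 3 then c else d) :: real^4^4"
 have "?R (T *v a) (T *v b) (T *v c) (T *v d) = ?R a b c d ** transpose T"
  by (simp add: vec_eq_iff forall_4 matrix_matrix_mult_def matrix_vector_mult_def transpose_def sum_4 mult.commute)
 then show ?thesis unfolding vol_def by (simp add: det_mul)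
qed

lemma vol_axis: "vol (axis 4 1) (axis 1 1) (axis 2 1) (axis 3 1) ~= 0"
proof -
 define A :: "real^4^4"
  where "A = (\<chi> i. if i = 1 then axis 4 1 else if i = 2 then axis 1 1 else if i = 3 then axis 2 1 else axis 3 1)"
 have "A ** transpose A = mat 1"
  by (simp add: A_def vec_eq_iff forall_4 matrix_matrix_mult_def transpose_def sum_4 mat_def axis_def)
 from arg_cong[OF this, of det] have "det A * det A = 1" by (simp only: det_mul det_transpose det_I)
 then show ?thesis unfolding vol_def A_def[symmetric] by auto
qed

lemma smooth_on_vol:
 assumes "open U" "smooth_on U a" "smooth_on U b" "smooth_on U c" "smooth_on U d"
 shows "smooth_on U (%w. vol (a w) (b w) (c w) (d w))"
proof -
 have "smooth_on U (%w. (if i = 1 then a w else if i = 2 then b w else if i = 3 then c w else d w) $ j)" for i j :: 4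
  using exhaust_4[of i] by (auto intro!: smooth_intros assms)
 then show ?thesis unfolding vol_def det_def vec_lambda_beta
  by (intro smooth_on_sum smooth_on_mult smooth_on_prod smooth_on_const assms(1)) auto
qed

text \<open>The second fundamental form of a surface given by homogeneous coordinates X: the part of
  the second derivative transverse to the projective tangent plane. Rescaling X or a projective
  transformation multiplies all its entries by one nonvanishing factor.\<close>

definition sff :: "(plane \<times> real => real^4) => plane \<times> real => plane \<times> real => plane \<times> real => real" where
 "sff X u v w = vol (X w) (pd eX X w) (pd eY X w) (pd u (pd v X) w)"

definition sff_det :: "(plane \<times> real => real^4) => plane \<times> real => real" where
 "sff_det X w = sff X eX eX w * sff X eY eY w - (sff X eX eY w)\<^sup>2"

lemma smooth_on_sff: "open U ==> smooth_on U X ==> smooth_on U (sff X u v)"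
 unfolding sff_def[abs_def] by (intro smooth_on_vol smooth_on_pd)

lemma smooth_on_sff_det: "open U ==> smooth_on U X ==> smooth_on U (sff_det X)"
 unfolding sff_det_def[abs_def] by (intro smooth_intros smooth_on_sff)

definition hess :: "(plane \<times> real => real) => plane \<times> real => real" where
 "hess F w = pd eX (pd eX F) w * pd eY (pd eY F) w - (pd eX (pd eY F) w)\<^sup>2"

lemma smooth_on_hess: "open U ==> smooth_on U F ==> smooth_on U (hess F)"
 unfolding hess_def[abs_def] by (intro smooth_intros smooth_on_pd)

text \<open>With g the Hessian determinant on surface-time, including the time derivative, this is
  failure of versality at a singular point of the parabolic curve.\<close>

definition critical_zero :: "('a::real_normed_vector => real) => 'a => bool" where
 "critical_zero g w \<longleftrightarrow> g w = 0 \<and> (\<forall>v. pd v g w = 0)"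

lemma pd_mult_scaleR:
 fixes g :: "'a::real_normed_vector => real" and Z :: "'a => 'b::real_normed_vector"
 assumes "g differentiable (at w)" "Z differentiable (at w)"
 shows "pd v (%w. g w *. Z w) w = pd v g w *. Z w + g w *. pd v Z w"
 by (rule pd_eqI[THEN trans]) (auto intro!: derivative_eq_intros has_derivative_pd assms)

lemma pd_vec_nth: "g differentiable (at w) ==> pd v (%w. g w $ i) w = pd v g w $ i"
 by (rule pd_eqI[OF bounded_linear.has_derivative[OF bounded_linear_vec_nth has_derivative_pd]])

lemma pd_commute_vec:
 fixes g :: "'a::euclidean_space => real^'n"
 assumes "open U" "smooth_on U g" "w \<in> U"
 shows "pd v (pd u g) w = pd u (pd v g) w"
proof -
 note d = smooth_on_differentiable[OF _ assms(1)]
 have e: "pd v (pd u g) w $ i = pd v (pd u (%w. g w $ i)) w" for u v i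
 proof -
  have "pd v (pd u (%w. g w $ i)) w = pd v (%w. pd u g w $ i) w"
   by (rule pd_cong_open[OF assms(1,3)]) (rule pd_vec_nth[OF d[OF assms(2)]])
  also have "\<dots> = pd v (pd u g) w $ i" by (rule pd_vec_nth[OF d[OF smooth_on_pd[OF assms(1,2)] assms(3)]])
  finally show ?thesis by simp
 qed
 show ?thesis unfolding vec_eq_iff e by (intro allI pd_commute[OF assms(1) _ assms(3)] smooth_on_vec_nth assms)
qed

text \<open>At a zero the product rule differentiates only the vanishing factor, so critical zeros
  pass through nonvanishing multipliers.\<close>

lemma critical_zero_factor:
 fixes a b :: "'a::euclidean_space => real"
 assumes "open U" "smooth_on U alp" "smooth_on U a" "smooth_on U bet" "smooth_on U b"
  and eq: "!!w. w \<in> U ==> alp w * a w = bet w * b w" and w: "w \<in> U" "alp w ~= 0" and b: "critical_zero b w"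
 shows "critical_zero a w"
proof -
 note d = smooth_on_differentiable[OF _ assms(1) w(1)]
 have "a w = 0" using eq[OF w(1)] w(2) b by (simp add: critical_zero_def)
 moreover have "pd v a w = 0" for v
 proof -
  have "pd v (%w. alp w *. a w) w = pd v (%w. bet w *. b w) w"
   by (rule pd_cong_open[OF assms(1) w(1)]) (simp add: eq)
  then show ?thesis using b w(2) \<open>a w = 0\<close>
   by (simp add: pd_mult_scaleR d assms(2-5) critical_zero_def del: real_scaleR_def)
 qed
 ultimately show ?thesis by (simp add: critical_zero_def)
qed

lemma binary_form_det:
 fixes l m n a1 a2 b1 b2 :: real
 shows "(a1 * a1 * l + (a1 * b1 + b1 * a1) * m + b1 * b1 * n) * (a2 * a2 * l + (a2 * b2 + b2 * a2) * m + b2 * b2 * n)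
  - (a1 * a2 * l + (a1 * b2 + b1 * a2) * m + b1 * b2 * n)\<^sup>2 = (a1 * b2 - a2 * b1)\<^sup>2 * (l * n - m\<^sup>2)"
 by algebra

text \<open>Compares two descriptions of one family: X gives homogeneous coordinates over an
  arbitrary chart of the source, while over Monge coordinates the same vectors are lam times (x t1 +
  y t2 + F t3 + t4). Psi passes from Monge coordinates to the chart.\<close>

locale monge_transfer =
 fixes Om On :: "(plane \<times> real) set" and X :: "plane \<times> real => real^4" and Psi :: "plane \<times> real => plane"
  and lam F :: "plane \<times> real => real" and t1 t2 t3 t4 :: "real^4"
 assumes op: "open Om" "open On" and sm: "smooth_on Om X" "smooth_on On Psi" "smooth_on On lam" "smooth_on On F"
  and img: "!!w. w \<in> On ==> (Psi w, snd w) \<in> Om" and X_eq: "!!w. w \<in> On ==> X (Psi w, snd w) =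
   lam w *. (fst (fst w) *. t1 + snd (fst w) *. t2 + F w *. t3 + t4)"
  and indep: "vol t4 t1 t2 t3 ~= 0" and lam0: "!!w. w \<in> On ==> lam w ~= 0"
begin

definition Xi where "Xi w = (Psi w, snd w)" for w :: "plane \<times> real"
definition a where "a v w = fst (pd v Psi w)" for v w :: "plane \<times> real"
definition b where "b v w = snd (pd v Psi w)" for v w :: "plane \<times> real"
definition J where "J w = a eX w * b eY w - a eY w * b eX w" for w

lemma smooth_ab: "smooth_on On (a v)" "smooth_on On (b v)" "smooth_on On Xi"
 unfolding a_def[abs_def] b_def[abs_def] Xi_def[abs_def] by (intro smooth_intros smooth_on_pd op sm)+

lemma diff: "smooth_on On g ==> w \<in> On ==> g differentiable (at w)" using smooth_on_differentiable op by blast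

lemma smooth_comp:
 fixes g :: "plane \<times> real => 'b::euclidean_space"
 assumes "smooth_on Om g" shows "smooth_on On (%w. g (Xi w))"
 by (rule smooth_on_compose[OF assms smooth_ab(3) op(2,1)]) (use img in \<open>auto simp: Xi_def\<close>)

lemma pd_Xi: "w \<in> On ==> pd v Xi w = ((a v w, b v w), snd v)" unfolding Xi_def[abs_def] a_def b_def
 by (rule pd_eqI[THEN trans]) (auto intro!: derivative_eq_intros has_derivative_pd diff sm)

lemma chain1:
 fixes g :: "plane \<times> real => 'b::euclidean_space"
 assumes "smooth_on Om g" "w \<in> On"
 shows "pd v (%w. g (Xi w)) w = pd ((a v w, b v w), snd v) g (Xi w)"
proof -
 have "Xi w \<in> Om" using img assms(2) by (simp add: Xi_def)
 have "((%w. g (Xi w)) has_derivative (%v. pd (pd v Xi w) g (Xi w))) (at w)"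
  using diff_chain_at[OF has_derivative_pd[OF diff[OF smooth_ab(3) assms(2)]] smooth_on_has_derivative[OF assms(1) op(1) \<open>Xi w \<in> Om\<close>]]
  by (simp add: o_def)
 from pd_eqI[OF this, of v] show ?thesis by (simp add: pd_Xi[OF assms(2)])
qed

lemma chain_space:
 fixes g :: "plane \<times> real => 'b::euclidean_space"
 assumes "smooth_on Om g" "w \<in> On" "snd v = 0"
 shows "pd v (%w. g (Xi w)) w = a v w *. pd eX g (Xi w) + b v w *. pd eY g (Xi w)"
proof -
 have m: "Xi w \<in> Om" using img assms(2) by (simp add: Xi_def)
 have e: "((a v w, b v w), snd v) = a v w *. eX + b v w *. eY" using assms(3) by simp
 show ?thesis unfolding chain1[OF assms(1,2)] e by (rule pd_linear(1)[OF smooth_on_differentiable[OF assms(1) op(1) m]])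
qed

lemma chain2:
 assumes w: "w \<in> On" and u: "snd u = 0" and v: "snd v = 0"
 shows "pd u (pd v (%w. X (Xi w))) w =
  (a u w * a v w) *. pd eX (pd eX X) (Xi w) + (a u w * b v w + b u w * a v w) *. pd eX (pd eY X) (Xi w)
   + (b u w * b v w) *. pd eY (pd eY X) (Xi w)
  + (0 *. X (Xi w) + (pd u (a v) w *. pd eX X (Xi w) + pd u (b v) w *. pd eY X (Xi w)))"
proof -
 have m: "Xi w \<in> Om" using img w by (simp add: Xi_def)
 note sX = smooth_on_pd[OF op(1) sm(1)]
 have "pd u (pd v (%w. X (Xi w))) w = pd u (%w. a v w *. pd eX X (Xi w) + b v w *. pd eY X (Xi w)) w"
  by (rule pd_cong_open[OF op(2) w]) (rule chain_space[OF sm(1) _ v])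
 also have "\<dots> = pd u (%w. a v w *. pd eX X (Xi w)) w + pd u (%w. b v w *. pd eY X (Xi w)) w"
  by (intro pd_add diff[OF _ w] smooth_on_scaleR smooth_comp smooth_ab sX op)
 also have "\<dots> = (pd u (a v) w *. pd eX X (Xi w) + a v w *. pd u (%w. pd eX X (Xi w)) w)
   + (pd u (b v) w *. pd eY X (Xi w) + b v w *. pd u (%w. pd eY X (Xi w)) w)"
  by (subst (1 2) pd_mult_scaleR) (auto intro!: diff smooth_ab smooth_comp sX w)
 finally show ?thesis unfolding chain_space[OF sX w u] pd_commute_vec[OF op(1) sm(1) m, of eY eX] by (simp add: algebra_simps)
qed

definition ZM where "ZM w = fst (fst w) *. t1 + snd (fst w) *. t2 + F w *. t3 + t4"

lemma smooth_ZM: "smooth_on On ZM" unfolding ZM_def[abs_def] by (intro smooth_intros op sm)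

lemma pd_ZM: "w \<in> On ==> pd v ZM w = fst (fst v) *. t1 + snd (fst v) *. t2 + pd v F w *. t3"
 unfolding ZM_def[abs_def] by (rule pd_eqI[THEN trans]) (auto intro!: derivative_eq_intros has_derivative_pd diff sm)

lemma pd2_ZM: assumes w: "w \<in> On" shows "pd u (pd v ZM) w = pd u (pd v F) w *. t3"
proof -
 have "pd u (pd v ZM) w = pd u (%w. fst (fst v) *. t1 + snd (fst v) *. t2 + pd v F w *. t3) w"
  by (rule pd_cong_open[OF op(2) w]) (rule pd_ZM)
 also have "\<dots> = pd u (pd v F) w *. t3"
  by (rule pd_eqI[THEN trans]) (auto intro!: derivative_eq_intros has_derivative_pd diff smooth_on_pd op sm w)
 finally show ?thesis .
qed

lemma graph2:
 assumes w: "w \<in> On"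
 shows "pd v (%w. lam w *. ZM w) w = pd v lam w *. ZM w + lam w *. pd v ZM w"
  "pd u (pd v (%w. lam w *. ZM w)) w =
   lam w *. pd u (pd v ZM) w + (pd u (pd v lam) w *. ZM w + (pd v lam w *. pd u ZM w + pd u lam w *. pd v ZM w))"
proof -
 have 1: "pd v (%w. lam w *. ZM w) w = pd v lam w *. ZM w + lam w *. pd v ZM w" if "w \<in> On" for w v
  by (rule pd_mult_scaleR) (auto intro!: diff sm smooth_ZM that)
 then show "pd v (%w. lam w *. ZM w) w = pd v lam w *. ZM w + lam w *. pd v ZM w" using w .
 have "pd u (pd v (%w. lam w *. ZM w)) w = pd u (%w. pd v lam w *. ZM w + lam w *. pd v ZM w) w"
  by (rule pd_cong_open[OF op(2) w]) (rule 1)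
 also have "\<dots> = pd u (%w. pd v lam w *. ZM w) w + pd u (%w. lam w *. pd v ZM w) w"
  by (intro pd_add diff[OF _ w] smooth_on_scaleR smooth_ZM smooth_on_pd sm op)
 also have "\<dots> = lam w *. pd u (pd v ZM) w + (pd u (pd v lam) w *. ZM w + (pd v lam w *. pd u ZM w + pd u lam w *. pd v ZM w))"
  by (subst (1 2) pd_mult_scaleR) (auto intro!: diff sm smooth_ZM smooth_on_pd op w simp: algebra_simps)
 finally show "pd u (pd v (%w. lam w *. ZM w)) w =
   lam w *. pd u (pd v ZM) w + (pd u (pd v lam) w *. ZM w + (pd v lam w *. pd u ZM w + pd u lam w *. pd v ZM w))" .
qed

definition kpa where "kpa w = lam w ^ 4 * vol t4 t1 t2 t3" for w

lemma kpa0: "w \<in> On ==> kpa w ~= 0" using indep lam0 by (simp add: kpa_def)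

text \<open>The same determinant is evaluated twice. In the chart, the change of tangent basis
  contributes J; in Monge form, rescaling the four vectors contributes lam^4, and only the t3-part
  of the second derivative remains.\<close>

lemma sff_transfer:
 assumes w: "w \<in> On" and u: "u = eX \<or> u = eY" and v: "v = eX \<or> v = eY"
 shows "J w * (a u w * a v w * sff X eX eX (Xi w) + (a u w * b v w + b u w * a v w) * sff X eX eY (Xi w)
  + b u w * b v w * sff X eY eY (Xi w)) = kpa w * pd u (pd v F) w"
proof -
 have s: "snd u = 0" "snd v = 0" using u v by auto
 have eq: "X (Xi w) = lam w *. ZM w" if "w \<in> On" for w using X_eq[OF that] by (simp add: Xi_def ZM_def)
 have eq1: "pd v (%w. X (Xi w)) w = pd v (%w. lam w *. ZM w) w" if "w \<in> On" for v w
  by (rule pd_cong_open[OF op(2) that]) (rule eq)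
 have eq2: "pd u (pd v (%w. X (Xi w))) w = pd u (pd v (%w. lam w *. ZM w)) w"
  by (rule pd_cong_open[OF op(2) w]) (rule eq1)
 let ?Y = "%w. X (Xi w)"
 let ?Q = "(a u w * a v w) *. pd eX (pd eX X) (Xi w) + (a u w * b v w + b u w * a v w) *. pd eX (pd eY X) (Xi w)
   + (b u w * b v w) *. pd eY (pd eY X) (Xi w)"
 have "vol (?Y w) (pd eX ?Y w) (pd eY ?Y w) (pd u (pd v ?Y) w) =
  vol (1 *. X (Xi w)) (0 *. X (Xi w) + (a eX w *. pd eX X (Xi w) + b eX w *. pd eY X (Xi w)))
   (0 *. X (Xi w) + (a eY w *. pd eX X (Xi w) + b eY w *. pd eY X (Xi w)))
   (?Q + (0 *. X (Xi w) + (pd u (a v) w *. pd eX X (Xi w) + pd u (b v) w *. pd eY X (Xi w))))"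
  unfolding chain2[OF w s] using chain_space[OF sm(1) w, of eX] chain_space[OF sm(1) w, of eY] by simp
 also have "\<dots> = J w * vol (X (Xi w)) (pd eX X (Xi w)) (pd eY X (Xi w)) ?Q" unfolding vol_change J_def by simp
 also have "\<dots> = J w * (a u w * a v w * sff X eX eX (Xi w) + (a u w * b v w + b u w * a v w) * sff X eX eY (Xi w)
  + b u w * b v w * sff X eY eY (Xi w))" unfolding vol_linear sff_def by simp
 finally have 1: "vol (?Y w) (pd eX ?Y w) (pd eY ?Y w) (pd u (pd v ?Y) w) = \<dots>" .
 \<comment> \<open>Since u and v are coordinate directions, the mixed terms of the product rule are
   tangential and drop out of the determinant.\<close>
 obtain r1 r2 where r: "pd v lam w *. pd u ZM w + pd u lam w *. pd v ZM w = r1 *. pd eX ZM w + r2 *. pd eY ZM w"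
 proof -
  have "pd v lam w *. pd u ZM w + pd u lam w *. pd v ZM w =
   ((if u = eX then pd v lam w else 0) + (if v = eX then pd u lam w else 0)) *. pd eX ZM w
   + ((if u = eX then 0 else pd v lam w) + (if v = eX then 0 else pd u lam w)) *. pd eY ZM w"
   using u v by (auto simp: algebra_simps)
  then show ?thesis using that by blast
 qed
 have "vol (?Y w) (pd eX ?Y w) (pd eY ?Y w) (pd u (pd v ?Y) w) =
  vol (lam w *. ZM w) (pd eX lam w *. ZM w + (lam w *. pd eX ZM w + 0 *. pd eY ZM w))
   (pd eY lam w *. ZM w + (0 *. pd eX ZM w + lam w *. pd eY ZM w))
   (lam w *. pd u (pd v ZM) w + (pd u (pd v lam) w *. ZM w + (r1 *. pd eX ZM w + r2 *. pd eY ZM w)))"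
  unfolding eq[OF w] eq1[OF w] eq2 graph2[OF w] r by simp
 also have "\<dots> = lam w ^ 4 * vol (ZM w) (pd eX ZM w) (pd eY ZM w) (pd u (pd v ZM) w)"
  by (simp only: vol_change) (simp add: vol_linear power4_eq_xxxx)
 also have "\<dots> = kpa w * pd u (pd v F) w"
  unfolding pd2_ZM[OF w] pd_ZM[OF w] ZM_def kpa_def by (simp add: vol_linear vol_repeat)
 finally show ?thesis using 1 by simp
qed

text \<open>Each of the two factors carries J, and the discriminant of a binary form changes by the
  square of the determinant of the substitution: J^4 in all.\<close>

lemma sff_det_transfer:
 assumes w: "w \<in> On"
 shows "J w ^ 4 * sff_det X (Xi w) = (kpa w)\<^sup>2 * hess F w"
proof -
 note t = sff_transfer[OF w, symmetric]
 have "(kpa w)\<^sup>2 * hess F w = (kpa w * pd eX (pd eX F) w) * (kpa w * pd eY (pd eY F) w) - (kpa w * pd eX (pd eY F) w)\<^sup>2"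
  unfolding hess_def by algebra
 also have "\<dots> = (J w)\<^sup>2 * ((a eX w * b eY w - a eY w * b eX w)\<^sup>2 * sff_det X (Xi w))"
  unfolding t[OF disjI1 disjI1, OF refl refl] t[OF disjI1 disjI2, OF refl refl] t[OF disjI2 disjI2, OF refl refl]
   sff_det_def binary_form_det[symmetric] by algebra
 also have "\<dots> = J w ^ 4 * sff_det X (Xi w)" unfolding J_def by algebra
 finally show ?thesis by simp
qed

lemma smooth_J: "smooth_on On J" unfolding J_def[abs_def] by (intro smooth_intros smooth_ab op)

lemma smooth_kpa: "smooth_on On kpa" unfolding kpa_def[abs_def] by (intro smooth_intros sm op)

lemma critical_transfer:
 assumes w: "w \<in> On" and J: "J w ~= 0"
 shows "critical_zero (hess F) w \<longleftrightarrow> critical_zero (sff_det X) (Xi w)"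
proof -
 have sD: "smooth_on On (%w. sff_det X (Xi w))" by (rule smooth_comp[OF smooth_on_sff_det[OF op(1) sm(1)]])
 have sH: "smooth_on On (hess F)" by (rule smooth_on_hess[OF op(2) sm(4)])
 have sJ: "smooth_on On (%w. J w ^ 4)" "smooth_on On (%w. (kpa w)\<^sup>2)" by (intro smooth_intros smooth_J smooth_kpa op)+
 have 1: "critical_zero (hess F) w \<longleftrightarrow> critical_zero (%w. sff_det X (Xi w)) w"
  using critical_zero_factor[OF op(2) sJ(1) sD sJ(2) sH sff_det_transfer w]
   critical_zero_factor[OF op(2) sJ(2) sH sJ(1) sD sff_det_transfer[symmetric] w] J kpa0[OF w] by auto
 have c: "pd v (%w. sff_det X (Xi w)) w = pd ((a v w, b v w), snd v) (sff_det X) (Xi w)" for v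
  by (rule chain1[OF smooth_on_sff_det[OF op(1) sm(1)] w])
 \<comment> \<open>The change of coordinates is a local diffeomorphism of surface-time, so vanishing
   of the differential in all its image directions is vanishing in every direction.\<close>
 have surj: "\<exists>v. ((a v w, b v w), snd v) = u" for u
 proof -
  let ?L = "%v. pd v Xi w"
  have l: "linear ?L" by (rule has_derivative_linear[OF has_derivative_pd[OF diff[OF smooth_ab(3) w]]])
  have "v = 0" if "?L v = 0" for v
  proof -
   obtain x y t where v: "v = ((x, y), t)" by (metis surj_pair)
   have z: "a v w = 0" "b v w = 0" "t = 0" using that by (auto simp: pd_Xi[OF w] v zero_prod_def)
   have e: "v = x *. eX + y *. eY" using z(3) by (simp add: v)
   have "pd v Psi w = x *. pd eX Psi w + y *. pd eY Psi w"
    unfolding e by (rule pd_linear(1)[OF diff[OF sm(2) w]])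
   then have "x * a eX w + y * a eY w = 0" "x * b eX w + y * b eY w = 0" using z by (simp_all add: a_def b_def)
   then have "x * J w = 0" "y * J w = 0" unfolding J_def by algebra+
   then show ?thesis using J z(3) by (simp add: v zero_prod_def)
  qed
  then have "inj ?L" by (simp add: linear_injective_0[OF l])
  then have "surj ?L" by (rule linear_injective_imp_surjective[OF l]) simp
  then obtain v where "u = pd v Xi w" by (rule surjE)
  then show ?thesis using pd_Xi[OF w, of v] by (intro exI[of _ v]) simp
 qed
 have "(\<forall>v. pd ((a v w, b v w), snd v) (sff_det X) (Xi w) = 0) \<longleftrightarrow> (\<forall>u. pd u (sff_det X) (Xi w) = 0)" (is "?l \<longleftrightarrow> ?r")
 proof
  assume l: ?l
  show ?r
  proof
   fix u
   obtain v where v: "((a v w, b v w), snd v) = u" using surj by blast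
   show "pd u (sff_det X) (Xi w) = 0" using l[rule_format, of v] unfolding v .
  qed
 qed simp
 then show ?thesis unfolding 1 unfolding critical_zero_def c by simp
qed

end

subsection \<open>A smooth step function\<close>

text \<open>The powers of 1/t make the family closed under differentiation, so that all functions in
  it are proved smooth by one induction.\<close>

definition flat :: "nat => real => real" where
 "flat n t = (if t > 0 then exp (- (1 / t)) / t ^ n else 0)"

lemma flat_derivative: "(flat n has_real_derivative flat (n + 2) t - real n * flat (n + 1) t) (at t)"
proof -
 consider "t > 0" | "t < 0" | "t = 0" by linarith
 then show ?thesis
 proof cases
  case 1
  have "((%t. exp (- (1 / t)) / t ^ n) has_real_derivative flat (n + 2) t - real n * flat (n + 1) t) (at t)"
   using 1 by (auto intro!: derivative_eq_intros simp: flat_def field_simps power2_eq_square) (cases n; simp add: field_simps)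
  then show ?thesis
   by (rule has_field_derivative_transform_within_open[of _ _ _ "{0<..}"]) (use 1 in \<open>auto simp: flat_def\<close>)
 next
  case 2
  have "((%t. 0) has_real_derivative flat (n + 2) t - real n * flat (n + 1) t) (at t)" using 2 by (simp add: flat_def)
  then show ?thesis
   by (rule has_field_derivative_transform_within_open[of _ _ _ "{..<0}"]) (use 2 in \<open>auto simp: flat_def\<close>)
 next
  case 3
  have r: "((%h. flat n h / h) \<longlongrightarrow> 0) (at_right 0)"
  proof -
   have "((%h::real. inverse h ^ (n + 1) / exp (inverse h)) \<longlongrightarrow> 0) (at_right 0)"
    by (rule filterlim_compose[OF tendsto_power_div_exp_0 filterlim_inverse_at_top_right])
   moreover have "\<forall>\<^sub>F h in at_right (0::real). inverse h ^ (n + 1) / exp (inverse h) = flat n h / h"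
    by (rule eventually_at_rightI[of 0 1]) (auto simp: flat_def exp_minus field_simps)
   ultimately show ?thesis using filterlim_cong[OF refl refl] by fastforce
  qed
  have l: "((%h. flat n h / h) \<longlongrightarrow> 0) (at_left 0)"
  proof (rule Lim_transform_eventually[OF tendsto_const])
   show "\<forall>\<^sub>F h in at_left 0. 0 = flat n h / h" by (rule eventually_at_leftI[of "-1"]) (auto simp: flat_def)
  qed
  show ?thesis unfolding 3 DERIV_def using filterlim_split_at[OF l r] by (simp add: flat_def)
 qed
qed

lemma smooth_flat: "smooth_on UNIV (flat n)"
proof (rule smooth_onI)
 fix k show "ndiff_on k UNIV (flat n)"
 proof (induction k arbitrary: n)
  case (Suc k)
  have "pd 1 (flat n) t = flat (n + 2) t + (- real n) * flat (n + 1) t" for t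
   using pd_eqI[OF flat_derivative[of n t, unfolded has_field_derivative_def], of 1] by simp
  then have "pd 1 (flat n) = (%t. flat (n + 2) t + (- real n) * flat (n + 1) t)" by (simp add: fun_eq_iff)
  moreover have "ndiff_on k UNIV (%t. flat (n + 2) t + (- real n) * flat (n + 1) t)"
   by (intro ndiff_on_add ndiff_on_mult ndiff_on_const Suc open_UNIV)
  moreover have "flat n differentiable_on UNIV"
   using flat_derivative real_differentiable_def by (blast intro: differentiable_on_openI)
  ultimately show ?case by simp
 qed simp
qed

lemma smooth_step:
 assumes "0 < (a::real)"
 obtains bet :: "real => real" where "smooth_on UNIV bet" "!!t. t \<le> a / 2 ==> bet t = 0" "!!t. t \<ge> a ==> bet t = 1"
proof -
 have pos: "flat 0 (t - a / 2) + flat 0 (a - t) > 0" for t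
  using assms by (cases "t > a / 2") (auto simp: flat_def intro!: add_pos_nonneg)
 have c: "smooth_on UNIV (%t. flat 0 (t - a / 2))" "smooth_on UNIV (%t. flat 0 (a - t))"
  by (rule smooth_on_compose[OF smooth_flat _ open_UNIV open_UNIV], intro smooth_intros open_UNIV, simp)+
 have "smooth_on UNIV (%t. flat 0 (t - a / 2) / (flat 0 (t - a / 2) + flat 0 (a - t)))"
  by (rule smooth_on_divide) (use pos in \<open>auto intro!: smooth_intros c open_UNIV simp: less_imp_neq[symmetric]\<close>)
 moreover have "flat 0 (t - a / 2) / (flat 0 (t - a / 2) + flat 0 (a - t)) = 1" if "t \<ge> a" for t
  using that assms by (simp add: flat_def)
 ultimately show ?thesis using that by (auto simp: flat_def)
qed

subsection \<open>Differential polynomials\<close>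

type_synonym jetfun = "(plane \<times> real => real^4^4) => plane \<times> real => real"

inductive diffpoly :: "jetfun => bool" where
 base: "set vs \<subseteq> Basis ==> diffpoly (%s w. partials vs s w $ i $ j)"
| const: "diffpoly (%s w. c)"
| add: "diffpoly G ==> diffpoly G' ==> diffpoly (%s w. G s w + G' s w)"
| mult: "diffpoly G ==> diffpoly G' ==> diffpoly (%s w. G s w * G' s w)"

text \<open>Agreement with a differential polynomial on smooth arguments only: the product rule
  turns derivatives into polynomials only where the argument is differentiable.\<close>

definition diff_op :: "jetfun => bool" where
 "diff_op G \<longleftrightarrow> (\<exists>Phi. diffpoly Phi \<and> (\<forall>U s. open U --> smooth_on U s --> (\<forall>w\<in>U. G s w = Phi s w)))"

lemma diff_opE:
 assumes "diff_op G"
 obtains Phi where "diffpoly Phi" "!!U s w. open U ==> smooth_on U s ==> w \<in> U ==> G s w = Phi s w"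
 using assms unfolding diff_op_def by metis

lemma diff_op_cong:
 assumes "!!U s w. open U ==> smooth_on U s ==> w \<in> U ==> G s w = G' s w" "diff_op G'"
 shows "diff_op G" using assms unfolding diff_op_def by metis

lemma diff_op_base: "diff_op (%s w. s w $ i $ j)" using diffpoly.base[of "[]" i j] unfolding diff_op_def by auto

lemma diff_op_const: "diff_op (%s w. c)" using diffpoly.const unfolding diff_op_def by blast

lemma diff_op_add: "diff_op G ==> diff_op G' ==> diff_op (%s w. G s w + G' s w)"
 and diff_op_mult: "diff_op G ==> diff_op G' ==> diff_op (%s w. G s w * G' s w)"
proof -
 assume "diff_op G" "diff_op G'"
 then obtain Phi Phi' where p: "diffpoly Phi" "!!U s w. open U ==> smooth_on U s ==> w \<in> U ==> G s w = Phi s w"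
  "diffpoly Phi'" "!!U s w. open U ==> smooth_on U s ==> w \<in> U ==> G' s w = Phi' s w" by (metis diff_opE)
 show "diff_op (%s w. G s w + G' s w)" unfolding diff_op_def
  by (rule exI[of _ "%s w. Phi s w + Phi' s w"]) (use p in \<open>auto intro!: diffpoly.add\<close>)
 show "diff_op (%s w. G s w * G' s w)" unfolding diff_op_def
  by (rule exI[of _ "%s w. Phi s w * Phi' s w"]) (use p in \<open>auto intro!: diffpoly.mult\<close>)
qed

lemma diff_op_diff: "diff_op G ==> diff_op G' ==> diff_op (%s w. G s w - G' s w)"
 using diff_op_add[of G "%s w. (-1) * G' s w"] diff_op_mult[OF diff_op_const[of "-1"], of G'] by simp

lemma diff_op_power: "diff_op G ==> diff_op (%s w. G s w ^ n)" by (induction n) (auto intro: diff_op_const diff_op_mult)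

lemma diff_op_sum: "finite I ==> (!!i. i \<in> I ==> diff_op (G i)) ==> diff_op (%s w. \<Sum>i\<in>I. G i s w)"
 by (induction rule: finite_induct) (auto intro: diff_op_const diff_op_add)

lemma diff_op_prod: "finite I ==> (!!i. i \<in> I ==> diff_op (G i)) ==> diff_op (%s w. \<Prod>i\<in>I. G i s w)"
 by (induction rule: finite_induct) (auto intro: diff_op_const diff_op_mult)

lemma diffpoly_smooth: "diffpoly G ==> open U ==> smooth_on U s ==> smooth_on U (G s)"
 by (induction rule: diffpoly.induct) (auto intro!: smooth_intros smooth_on_partials)

lemma diff_op_smooth: "diff_op G ==> open U ==> smooth_on U s ==> smooth_on U (G s)"
 by (erule diff_opE) (metis diffpoly_smooth smooth_on_cong)

lemma diffpoly_pd: "diffpoly G ==> b \<in> Basis ==> diff_op (%s. pd b (G s))"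
proof (induction rule: diffpoly.induct)
 case (base vs i j)
 have "diff_op (%s w. partials (b # vs) s w $ i $ j)"
  unfolding diff_op_def by (rule exI, rule conjI[OF diffpoly.base[of "b # vs" i j]]) (use base in auto)
 then show ?case
 proof (rule diff_op_cong[rotated])
  fix U s w assume a: "open U" "smooth_on U (s :: plane \<times> real => real^4^4)" "w \<in> U"
  have d: "partials vs s differentiable (at w)" by (rule smooth_on_differentiable[OF smooth_on_partials[OF a(1,2)] a(1,3)])
  have "(%w. partials vs s w $ i) differentiable (at w)"
   by (rule smooth_on_differentiable[OF smooth_on_vec_nth[OF a(1) smooth_on_partials[OF a(1,2)]] a(1,3)])
  then show "pd b (%w. partials vs s w $ i $ j) w = partials (b # vs) s w $ i $ j"
   by (simp add: pd_vec_nth d partials_Cons_pd del: partials.simps(2))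
 qed
next
 case (const c)
 show ?case by (rule diff_op_cong[OF _ diff_op_const[of 0]]) (simp add: pd_const)
next
 case (add G G')
 show ?case
 proof (rule diff_op_cong[OF _ diff_op_add[OF add.IH[OF add.prems]]])
  fix U s w assume a: "open U" "smooth_on U (s :: plane \<times> real => real^4^4)" "w \<in> U"
  show "pd b (%w. G s w + G' s w) w = pd b (G s) w + pd b (G' s) w"
   by (intro pd_add smooth_on_differentiable[OF diffpoly_smooth[OF _ a(1,2)] a(1,3)] add.hyps)
 qed
next
 case (mult G G')
 have m: "diff_op G" "diff_op G'" using mult.hyps unfolding diff_op_def by blast+
 show ?case
 proof (rule diff_op_cong[OF _ diff_op_add[OF diff_op_mult[OF m(1) mult.IH(2)[OF mult.prems]] diff_op_mult[OF mult.IH(1)[OF mult.prems] m(2)]]])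
  fix U s w assume a: "open U" "smooth_on U (s :: plane \<times> real => real^4^4)" "w \<in> U"
  show "pd b (%w. G s w * G' s w) w = G s w * pd b (G' s) w + pd b (G s) w * G' s w"
   by (intro pd_mult smooth_on_differentiable[OF diffpoly_smooth[OF _ a(1,2)] a(1,3)] mult.hyps)
 qed
qed

lemma diff_op_pd:
 assumes "diff_op G" "b \<in> Basis" shows "diff_op (%s. pd b (G s))"
proof -
 obtain Phi where P: "diffpoly Phi" "!!U s w. open U ==> smooth_on U s ==> w \<in> U ==> G s w = Phi s w"
  using assms(1) by (metis diff_opE)
 show ?thesis by (rule diff_op_cong[OF _ diffpoly_pd[OF P(1) assms(2)]]) (rule pd_cong_open, assumption+, rule P(2))
qed

definition close_jets :: "nat => real => (plane \<times> real) set => (plane \<times> real => real^4^4) => (plane \<times> real => real^4^4) => bool" where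
 "close_jets k dlt K s s' \<longleftrightarrow> (\<forall>vs. set vs \<subseteq> Basis \<and> length vs \<le> k -->
  (\<forall>x\<in>K. norm (partials vs s' x - partials vs s x) < dlt))"

lemma close_jets_mono: "close_jets k dlt K s s' ==> k' \<le> k ==> dlt \<le> dlt' ==> close_jets k' dlt' K s s'"
 unfolding close_jets_def by (meson le_trans less_le_trans)

definition jet_stable :: "(plane \<times> real) set => (plane \<times> real => real^4^4) => jetfun => bool" where
 "jet_stable K s G \<longleftrightarrow> (\<forall>e>0. \<exists>k. \<exists>dlt>0. \<forall>s'. close_jets k dlt K s s' --> (\<forall>x\<in>K. \<bar>G s' x - G s x\<bar> < e))"

lemma jet_stable_binary:
 assumes "jet_stable K s G" "jet_stable K s G'" "e > 0"
 obtains k dlt where "dlt > 0" "!!s' x. close_jets k dlt K s s' ==> x \<in> K ==> \<bar>G s' x - G s x\<bar> < e \<and> \<bar>G' s' x - G' s x\<bar> < e"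
proof -
 obtain k dlt where 1: "dlt > 0" "!!s'. close_jets k dlt K s s' --> (\<forall>x\<in>K. \<bar>G s' x - G s x\<bar> < e)"
  using assms(1,3) unfolding jet_stable_def by meson
 obtain k' dlt' where 2: "dlt' > 0" "!!s'. close_jets k' dlt' K s s' --> (\<forall>x\<in>K. \<bar>G' s' x - G' s x\<bar> < e)"
  using assms(2,3) unfolding jet_stable_def by meson
 show ?thesis
 proof (rule that[of "min dlt dlt'" "max k k'"])
  show "min dlt dlt' > 0" using 1 2 by simp
  fix s' x assume c: "close_jets (max k k') (min dlt dlt') K s s'" and "x \<in> K"
  have "close_jets k dlt K s s'" "close_jets k' dlt' K s s'" by (rule close_jets_mono[OF c]; simp)+
  then show "\<bar>G s' x - G s x\<bar> < e \<and> \<bar>G' s' x - G' s x\<bar> < e" using 1(2) 2(2) \<open>x \<in> K\<close> by blast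
 qed
qed

lemma diffpoly_stable:
 assumes "diffpoly G" and U: "open U" "smooth_on U s" "compact K" "K \<subseteq> U"
 shows "jet_stable K s G" using assms(1)
proof (induction rule: diffpoly.induct)
 case (base vs i j)
 show ?case unfolding jet_stable_def
 proof (intro allI impI)
  fix e :: real assume e: "e > 0"
  have "\<bar>partials vs s' x $ i $ j - partials vs s x $ i $ j\<bar> < e" if c: "close_jets (length vs) e K s s'" and x: "x \<in> K" for s' x
  proof -
  have "\<bar>partials vs s' x $ i $ j - partials vs s x $ i $ j\<bar> \<le> norm (partials vs s' x - partials vs s x)"
   using component_le_norm_cart[of "(partials vs s' x - partials vs s x) $ i" j] Finite_Cartesian_Product.norm_nth_le[of "partials vs s' x - partials vs s x" i]
   by simp
  also have "\<dots> < e" using c base x unfolding close_jets_def by simp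
  finally show ?thesis .
  qed
  then show "\<exists>k. \<exists>dlt>0. \<forall>s'. close_jets k dlt K s s' --> (\<forall>x\<in>K. \<bar>partials vs s' x $ i $ j - partials vs s x $ i $ j\<bar> < e)"
   using e by blast
 qed
next
 case (const c)
 show ?case unfolding jet_stable_def by (auto intro!: exI[of _ 1])
next
 case (add G G')
 show ?case unfolding jet_stable_def
 proof (intro allI impI)
  fix e :: real assume "e > 0"
  then have e: "e / 2 > 0" by simp
  obtain k dlt where k: "dlt > 0" "!!s' x. close_jets k dlt K s s' ==> x \<in> K ==> \<bar>G s' x - G s x\<bar> < e/2 \<and> \<bar>G' s' x - G' s x\<bar> < e/2"
   by (rule jet_stable_binary[OF add.IH e]) (rule that, assumption+)
  have "\<bar>G s' x + G' s' x - (G s x + G' s x)\<bar> < e" if "close_jets k dlt K s s'" "x \<in> K" for s' x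
   using k(2)[OF that] by linarith
  then show "\<exists>k. \<exists>dlt>0. \<forall>s'. close_jets k dlt K s s' --> (\<forall>x\<in>K. \<bar>G s' x + G' s' x - (G s x + G' s x)\<bar> < e)"
   using k(1) by blast
 qed
next
 case (mult G G')
 have "compact (G s ` K)" "compact (G' s ` K)"
  using continuous_on_subset[OF smooth_on_imp_continuous_on[OF diffpoly_smooth[OF mult.hyps(1) U(1,2)]] U(4)]
   continuous_on_subset[OF smooth_on_imp_continuous_on[OF diffpoly_smooth[OF mult.hyps(2) U(1,2)]] U(4)]
  by (auto intro: compact_continuous_image U(3))
 then obtain B1 B2 where B: "!!x. x \<in> K ==> \<bar>G s x\<bar> \<le> B1" "!!x. x \<in> K ==> \<bar>G' s x\<bar> \<le> B2"
  by (metis bounded_real compact_imp_bounded imageI)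
 define B where "B = max 0 (max B1 B2)"
 show ?case unfolding jet_stable_def
 proof (intro allI impI)
  fix e :: real assume "e > 0"
  \<comment> \<open>The product changes by at most (B + 1) e' + B e', which is below e.\<close>
  define e' where "e' = min 1 (e / (2 * B + 2))"
  have B0: "B \<ge> 0" by (simp add: B_def)
  have e': "e' > 0" "e' \<le> 1" using \<open>e > 0\<close> B0 by (auto simp: e'_def)
  have "(2 * B + 2) * e' \<le> (2 * B + 2) * (e / (2 * B + 2))" using B0 by (intro mult_left_mono) (auto simp: e'_def)
  then have e'3: "(2 * B + 2) * e' \<le> e" using B0 by simp
  obtain k dlt where k: "dlt > 0" "!!s' x. close_jets k dlt K s s' ==> x \<in> K ==> \<bar>G s' x - G s x\<bar> < e' \<and> \<bar>G' s' x - G' s x\<bar> < e'"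
   by (rule jet_stable_binary[OF mult.IH e'(1)]) (rule that, assumption+)
  have "\<bar>G s' x * G' s' x - G s x * G' s x\<bar> < e" if c: "close_jets k dlt K s s'" and x: "x \<in> K" for s' x
  proof -
   have 1: "\<bar>G s' x - G s x\<bar> < e'" "\<bar>G' s' x - G' s x\<bar> < e'" using k(2)[OF c x] by auto
   have 2: "\<bar>G s x\<bar> \<le> B" "\<bar>G' s x\<bar> \<le> B" using B[OF x] by (auto simp: B_def)
   have 3: "\<bar>G s' x\<bar> \<le> B + 1" using 1(1) 2(1) e'(2) by linarith
   have "G s' x * G' s' x - G s x * G' s x = G s' x * (G' s' x - G' s x) + G' s x * (G s' x - G s x)" by algebra
   then have "\<bar>G s' x * G' s' x - G s x * G' s x\<bar> \<le> \<bar>G s' x\<bar> * \<bar>G' s' x - G' s x\<bar> + \<bar>G' s x\<bar> * \<bar>G s' x - G s x\<bar>"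
    by (metis abs_mult abs_triangle_ineq)
   also have "\<dots> \<le> (B + 1) * e' + B * e'" using 1 2 3 B0 by (intro add_mono mult_mono) auto
   also have "\<dots> < e" using e' e'3 by (simp add: algebra_simps)
   finally show ?thesis .
  qed
  then show "\<exists>k. \<exists>dlt>0. \<forall>s'. close_jets k dlt K s s' --> (\<forall>x\<in>K. \<bar>G s' x * G' s' x - G s x * G' s x\<bar> < e)"
   using k(1) by blast
 qed
qed

lemma diff_ops_stable:
 assumes "finite \<G>" "!!G. G \<in> \<G> ==> diff_op G" and U: "open U" "smooth_on U s" "compact K" "K \<subseteq> U" and e: "e > 0"
 shows "\<exists>k. \<exists>dlt>0. \<forall>s'. smooth_on U s' --> close_jets k dlt K s s' --> (\<forall>G\<in>\<G>. \<forall>x\<in>K. \<bar>G s' x - G s x\<bar> < e)"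
 using assms(1,2)
proof (induction rule: finite_induct)
 case empty show ?case by (auto intro!: exI[of _ 1])
next
 case (insert G \<G>)
 obtain k dlt where 1: "dlt > 0" "!!s'. smooth_on U s' ==> close_jets k dlt K s s' ==> (\<forall>G\<in>\<G>. \<forall>x\<in>K. \<bar>G s' x - G s x\<bar> < e)"
  using insert.IH insert.prems by (metis insertCI)
 obtain Phi where P: "diffpoly Phi" "!!U s w. open U ==> smooth_on U s ==> w \<in> U ==> G s w = Phi s w"
  using insert.prems by (metis diff_opE insertI1)
 obtain k' dlt' where 2: "dlt' > 0" "!!s'. close_jets k' dlt' K s s' ==> (\<forall>x\<in>K. \<bar>Phi s' x - Phi s x\<bar> < e)"
  using diffpoly_stable[OF P(1) U] e unfolding jet_stable_def by metis
 show ?case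
 proof (intro exI[of _ "max k k'"] exI[of _ "min dlt dlt'"] conjI allI impI)
  show "min dlt dlt' > 0" using 1 2 by simp
  fix s' assume s': "smooth_on U s'" and c: "close_jets (max k k') (min dlt dlt') K s s'"
  have c': "close_jets k dlt K s s'" "close_jets k' dlt' K s s'" by (rule close_jets_mono[OF c]; simp)+
  have "\<forall>x\<in>K. \<bar>G s' x - G s x\<bar> < e"
   using 2(2)[OF c'(2)] P(2)[OF U(1) s'] P(2)[OF U(1,2)] U(4) by (metis subsetD)
  then show "\<forall>G\<in>insert G \<G>. \<forall>x\<in>K. \<bar>G s' x - G s x\<bar> < e" using 1(2)[OF s' c'(1)] by blast
 qed
qed

subsection \<open>The non-degeneracy condition in a chart\<close>

definition diff_op_vec :: "((plane \<times> real => real^4^4) => plane \<times> real => real^4) => bool" where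
 "diff_op_vec Y \<longleftrightarrow> (\<forall>a. diff_op (%s w. Y s w $ a)) \<and> (\<forall>U s. open U --> smooth_on U s --> smooth_on U (Y s))"

lemma diff_op_vec_pd:
 assumes "diff_op_vec Y" "b \<in> Basis" shows "diff_op_vec (%s. pd b (Y s))" unfolding diff_op_vec_def
proof (intro conjI allI impI)
 fix a
 show "diff_op (%s w. pd b (Y s) w $ a)"
 proof (rule diff_op_cong[OF _ diff_op_pd[OF _ assms(2)]])
  show "diff_op (%s w. Y s w $ a)" using assms(1) by (simp add: diff_op_vec_def)
  fix U s w assume "open U" "smooth_on U (s :: plane \<times> real => real^4^4)" "w \<in> U"
  then show "pd b (Y s) w $ a = pd b (%w. Y s w $ a) w"
   using assms(1) pd_vec_nth smooth_on_differentiable unfolding diff_op_vec_def by metis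
 qed
qed (use assms in \<open>auto simp: diff_op_vec_def intro!: smooth_on_pd\<close>)

text \<open>For the point spanned by v the k-th column of its matrix is v times v_k / |v|^2, hence a
  vector of homogeneous coordinates wherever v_k is nonzero. It is smooth and linear in the
  matrix.\<close>

definition col :: "4 => (plane \<times> real => real^4^4) => plane \<times> real => real^4" where
 "col k s w = (\<chi> a. s w $ a $ k)"

lemma smooth_on_col: "open U ==> smooth_on U s ==> smooth_on U (col k s)" unfolding col_def[abs_def] by (intro smooth_intros)

lemma diff_op_col: "diff_op_vec (col k)" unfolding diff_op_vec_def using smooth_on_col by (auto simp: col_def intro: diff_op_base)

lemma diff_op_vol:
 assumes "diff_op_vec A" "diff_op_vec B" "diff_op_vec C" "diff_op_vec D"
 shows "diff_op (%s w. vol (A s w) (B s w) (C s w) (D s w))"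
proof -
 have "diff_op (%s w. (if i = 1 then A s w else if i = 2 then B s w else if i = 3 then C s w else D s w) $ j)" for i j :: 4
  using exhaust_4[of i] assms by (auto simp: diff_op_vec_def)
 then show ?thesis unfolding vol_def det_def vec_lambda_beta
  by (intro diff_op_sum diff_op_mult diff_op_prod diff_op_const) (auto simp: finite_permutations)
qed

lemma basis_XYT: "eX \<in> Basis" "eY \<in> Basis" "eT \<in> Basis" by (auto simp: Basis_prod_def zero_prod_def)

lemma diff_op_sff: "u \<in> Basis ==> v \<in> Basis ==> diff_op (%s. sff (col k s) u v)"
 unfolding sff_def[abs_def] by (intro diff_op_vol diff_op_vec_pd diff_op_col basis_XYT)

lemma diff_op_sff_det: "diff_op (%s. sff_det (col k s))"
 unfolding sff_det_def[abs_def] by (intro diff_op_diff diff_op_mult diff_op_power diff_op_sff basis_XYT)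

text \<open>Up to the factor \<open>(X $ k)\<^sup>2\<close> this is the derivative of the affine coordinate \<open>X $ i / X $ k\<close>.\<close>

definition dcoord :: "4 => 4 => plane \<times> real => (plane \<times> real => real^4^4) => plane \<times> real => real" where
 "dcoord k i v s w = pd v (%w. s w $ i $ k) w * s w $ k $ k - s w $ i $ k * pd v (%w. s w $ k $ k) w"

text \<open>Up to a power of the diagonal entry, the Jacobian of the i-th and j-th affine
  coordinates; nonzero where these are coordinates on the surface.\<close>

definition jac :: "4 => 4 => 4 => (plane \<times> real => real^4^4) => plane \<times> real => real" where
 "jac k i j s w = dcoord k i eX s w * dcoord k j eY s w - dcoord k j eX s w * dcoord k i eY s w"

text \<open>The second fundamental form on the tangent vector along which the i-th affine coordinate is
 constant.\<close>

definition sff_level :: "4 => 4 => (plane \<times> real => real^4^4) => plane \<times> real => real" where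
 "sff_level k i s w = sff (col k s) eX eX w * (dcoord k i eY s w)\<^sup>2
  - 2 * sff (col k s) eX eY w * dcoord k i eX s w * dcoord k i eY s w
  + sff (col k s) eY eY w * (dcoord k i eX s w)\<^sup>2"

lemma diff_op_dcoord: "v \<in> Basis ==> diff_op (dcoord k i v)"
 unfolding dcoord_def[abs_def] by (intro diff_op_diff diff_op_mult diff_op_pd diff_op_base)

lemma diff_op_jac: "diff_op (jac k i j)" unfolding jac_def[abs_def] by (intro diff_op_diff diff_op_mult diff_op_dcoord basis_XYT)

lemma diff_op_sff_level: "diff_op (sff_level k i)" unfolding sff_level_def[abs_def]
 by (intro diff_op_diff diff_op_add diff_op_mult diff_op_power diff_op_const diff_op_sff diff_op_dcoord basis_XYT)

text \<open>What is excluded is a closed condition on a compact set, thanks to the threshold rho, so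
  regularity is stable. A nonzero product says that affine coordinates i and j parametrise the
  surface and that it has nonzero curvature in the direction of constant i-th coordinate.\<close>

definition regular :: "real => 4 => 4 => 4 => (plane \<times> real => real^4^4) => (plane \<times> real) set => bool" where
 "regular rho k i j s K \<longleftrightarrow> \<not> (\<exists>w\<in>K. critical_zero (sff_det (col k s)) w \<and> s w $ k $ k \<ge> rho \<and>
  \<bar>jac k i j s w * sff_level k i s w\<bar> \<ge> rho)"

lemma critical_zero_coords:
 fixes g :: "plane \<times> real => real"
 assumes "g differentiable (at w)"
 shows "critical_zero g w \<longleftrightarrow> g w = 0 \<and> pd eX g w = 0 \<and> pd eY g w = 0 \<and> pd eT g w = 0"
proof -
 have "pd v g w = 0" if "pd eX g w = 0" "pd eY g w = 0" "pd eT g w = 0" for v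
  using pd_coords[OF assms, of "fst (fst v)" "snd (fst v)" "snd v"] that by simp
 then show ?thesis unfolding critical_zero_def by blast
qed

lemma regular_stable:
 assumes U: "open U" "smooth_on U s" "compact K" "K \<subseteq> U" and reg: "regular rho k i j s K"
 shows "\<exists>n. \<exists>dlt>0. \<forall>s'. smooth_on U s' --> close_jets n dlt K s s' --> regular rho k i j s' K"
proof (cases "K = {}")
 case True
 then show ?thesis by (auto simp: regular_def intro!: exI[of _ 1])
next
 case False
 define D where "D v = (%s. pd v (sff_det (col k s)))" for v
 define Df where "Df = (%s. sff_det (col k s))"
 define P :: jetfun where "P = (%s w. s w $ k $ k)"
 define N where "N = (%s w. jac k i j s w * sff_level k i s w)"
 have ops: "diff_op Df" "diff_op (D eX)" "diff_op (D eY)" "diff_op (D eT)" "diff_op P" "diff_op N"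
  unfolding Df_def D_def P_def N_def
  by (intro diff_op_sff_det diff_op_pd basis_XYT diff_op_base diff_op_mult diff_op_jac diff_op_sff_level)+
 have cz: "critical_zero (sff_det (col k s)) w \<longleftrightarrow> Df s w = 0 \<and> D eX s w = 0 \<and> D eY s w = 0 \<and> D eT s w = 0"
  if "smooth_on U s" "w \<in> K" for s w unfolding Df_def D_def
  by (rule critical_zero_coords[OF smooth_on_differentiable[OF smooth_on_sff_det[OF U(1) smooth_on_col[OF U(1) that(1)]] U(1)]])
   (use that U(4) in auto)
 \<comment> \<open>A sum of six nonnegative terms that vanish together exactly at an excluded point.
   By compactness it has a positive minimum, and changing each term by less than a sixth of it
   cannot create a zero.\<close>
 define m where "m w = \<bar>Df s w\<bar> + \<bar>D eX s w\<bar> + \<bar>D eY s w\<bar> + \<bar>D eT s w\<bar> + max 0 (rho - P s w) + max 0 (rho - \<bar>N s w\<bar>)" for w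
 have c: "continuous_on K (G s)" if "diff_op G" for G
  by (rule continuous_on_subset[OF smooth_on_imp_continuous_on[OF diff_op_smooth[OF that U(1,2)]] U(4)])
 have "continuous_on K m" unfolding m_def by (intro continuous_intros c ops)
 then obtain w0 where w0: "w0 \<in> K" "!!w. w \<in> K ==> m w0 \<le> m w" using continuous_attains_inf[OF U(3) False] by metis
 have m0: "m w0 > 0"
 proof (rule ccontr)
  assume "\<not> m w0 > 0"
  then have "Df s w0 = 0 \<and> D eX s w0 = 0 \<and> D eY s w0 = 0 \<and> D eT s w0 = 0" "P s w0 \<ge> rho" "\<bar>N s w0\<bar> \<ge> rho"
   unfolding m_def by linarith+
  then have "critical_zero (sff_det (col k s)) w0 \<and> s w0 $ k $ k \<ge> rho \<and> \<bar>jac k i j s w0 * sff_level k i s w0\<bar> \<ge> rho"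
   using cz[OF U(2) w0(1)] by (simp add: P_def N_def)
  then show False using reg w0(1) unfolding regular_def by blast
 qed
 define \<G> where "\<G> = {Df, D eX, D eY, D eT, P, N}"
 have "finite \<G>" "!!G. G \<in> \<G> ==> diff_op G" using ops by (auto simp: \<G>_def)
 from diff_ops_stable[OF this U, of "m w0 / 6"] m0
 have "\<exists>n. \<exists>dlt>0. \<forall>s'. smooth_on U s' --> close_jets n dlt K s s' --> (\<forall>G\<in>\<G>. \<forall>x\<in>K. \<bar>G s' x - G s x\<bar> < m w0 / 6)"
  by simp
 then obtain n dlt where n: "dlt > 0" "!!s'. smooth_on U s' ==> close_jets n dlt K s s' ==>
   \<forall>G\<in>\<G>. \<forall>x\<in>K. \<bar>G s' x - G s x\<bar> < m w0 / 6" by blast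
 have "regular rho k i j s' K" if s': "smooth_on U s'" "close_jets n dlt K s s'" for s' unfolding regular_def
 proof
  assume "\<exists>w\<in>K. critical_zero (sff_det (col k s')) w \<and> s' w $ k $ k \<ge> rho \<and> \<bar>jac k i j s' w * sff_level k i s' w\<bar> \<ge> rho"
  then obtain w where w: "w \<in> K" "Df s' w = 0" "D eX s' w = 0" "D eY s' w = 0" "D eT s' w = 0" "P s' w \<ge> rho" "\<bar>N s' w\<bar> \<ge> rho"
   using cz[OF s'(1)] unfolding P_def N_def by blast
  have "\<bar>Df s' w - Df s w\<bar> < m w0 / 6" "\<bar>D eX s' w - D eX s w\<bar> < m w0 / 6" "\<bar>D eY s' w - D eY s w\<bar> < m w0 / 6"
   "\<bar>D eT s' w - D eT s w\<bar> < m w0 / 6" "\<bar>P s' w - P s w\<bar> < m w0 / 6" "\<bar>N s' w - N s w\<bar> < m w0 / 6"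
   using n(2)[OF s'] w(1) unfolding \<G>_def by blast+
  then have b: "\<bar>Df s w\<bar> < m w0 / 6" "\<bar>D eX s w\<bar> < m w0 / 6" "\<bar>D eY s w\<bar> < m w0 / 6" "\<bar>D eT s w\<bar> < m w0 / 6"
   and NP: "\<bar>P s' w - P s w\<bar> < m w0 / 6" "\<bar>N s' w - N s w\<bar> < m w0 / 6" using w(2-5) by simp_all
  have P: "max 0 (rho - P s w) < m w0 / 6" using NP(1) w(6) m0 by linarith
  have N: "max 0 (rho - \<bar>N s w\<bar>) < m w0 / 6" using NP(2) w(7) m0 by linarith
  have sum: "a1 + a2 + a3 + a4 + a5 + a6 < M" if "a1 < M / 6" "a2 < M / 6" "a3 < M / 6" "a4 < M / 6" "a5 < M / 6" "a6 < M / 6"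
   for a1 a2 a3 a4 a5 a6 M :: real using that by simp
  have "m w < m w0" using sum[OF b P N] by (simp only: m_def)
  then show False using w0(2)[OF w(1)] by simp
 qed
 then show ?thesis using n(1) by blast
qed

subsection \<open>Perturbations of the ambient space\<close>

type_synonym par = "(plane \<times> plane) \<times> real"

text \<open>No monomial contains y^2, so F_yy is left unchanged. The coefficient of x^2 moves F_xx,
  those of x^3, x^2 y and t x^2 move its three derivatives, and that of x y moves F_xy.\<close>

definition qpoly :: "par => real => real => real => real" where
 "qpoly c x y t = fst (fst (fst c)) * x\<^sup>2 + snd (fst (fst c)) * x ^ 3 + fst (snd (fst c)) * x\<^sup>2 * y
  + snd (snd (fst c)) * t * x\<^sup>2 + snd c * x * y"

lemma compact_projective_space: "compact projective_space"
proof -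
 have "projective_space = proj_point ` sphere 0 1"
 proof
  show "proj_point ` sphere 0 1 \<subseteq> projective_space" unfolding projective_space_def by (auto intro!: imageI)
  show "projective_space \<subseteq> proj_point ` sphere 0 1" unfolding projective_space_def
  proof safe
   fix v :: "real^4" assume v: "v ~= 0"
   have "proj_point v = proj_point (inverse (norm v) *. v)"
    using v by (simp add: proj_point_def vec_eq_iff dot_square_norm field_simps power2_eq_square)
   then show "proj_point v \<in> proj_point ` sphere 0 1" using v by (auto intro!: image_eqI)
  qed
 qed
 moreover have "continuous_on (sphere 0 1) proj_point" unfolding proj_point_def by (intro continuous_intros) auto
 ultimately show ?thesis using compact_continuous_image[OF _ compact_sphere] by metis
qed

text \<open>The affine chart with denominator index k exists only off a hyperplane. The cut-off bet
  in the diagonal entry of index k extends the perturbation by zero and leaves it unaltered where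
  that entry is at least a. Only coordinate l is moved.\<close>

locale perturbation =
 fixes i j l k :: 4 and bet :: "real => real" and a :: real
 assumes distinct: "i ~= j" "i ~= l" "j ~= l" "i ~= k" "j ~= k" "l ~= k"
  and a: "0 < a" and bet: "smooth_on UNIV bet" "!!t. t \<le> a / 2 ==> bet t = 0" "!!t. t \<ge> a ==> bet t = 1"
begin

definition phi :: "par => real => real^4^4 => real" where
 "phi c t P = bet (P $ k $ k) * qpoly c (P $ i $ k / P $ k $ k) (P $ j $ k / P $ k $ k) t"

text \<open>The ratio of the squared norms of the transformed and the original vector; dividing by
  it gives an orthogonal projection again.\<close>

definition nrm :: "par => real => real^4^4 => real" where
 "nrm c t P = 1 + 2 * phi c t P * P $ k $ l + (phi c t P)\<^sup>2 * P $ k $ k"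

text \<open>On the matrix of the line spanned by v this is the projective transformation
 \<open>v \<mapsto> v + phi v\<^sub>k e\<^sub>l\<close>, which adds \<open>phi\<close> to the affine coordinate \<open>v\<^sub>l / v\<^sub>k\<close>.\<close>

definition pert :: "par => real => real^4^4 => real^4^4" where
 "pert c t P = (\<chi> p q. (P $ p $ q + phi c t P * ((if p = l then P $ k $ q else 0) + (if q = l then P $ p $ k else 0))
  + (if p = l \<and> q = l then (phi c t P)\<^sup>2 * P $ k $ k else 0)) / nrm c t P)"

lemma pert_proj:
 fixes v :: "real^4" and c :: par and t :: real
 assumes v: "v ~= 0"
 defines "r \<equiv> phi c t (proj_point v)"
 shows "v + (r * v $ k) *. axis l 1 ~= 0" "nrm c t (proj_point v) > 0"
  "pert c t (proj_point v) = proj_point (v + (r * v $ k) *. axis l 1)"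
proof -
 define v' where "v' = v + (r * v $ k) *. axis l 1"
 have comp: "v' $ p = v $ p + (if p = l then r * v $ k else 0)" for p by (simp add: v'_def axis_def)
 show ne: "v + (r * v $ k) *. axis l 1 ~= 0"
 proof
  assume "v + (r * v $ k) *. axis l 1 = 0"
  then have "v' = 0" by (simp add: v'_def)
  then have "v $ k = 0" using comp[of k] distinct(6) by simp
  then show False using \<open>v' = 0\<close> v by (simp add: v'_def)
 qed
 have vv: "v \<bullet> v > 0" using v by simp
 have "v' \<bullet> v' = v \<bullet> v + 2 * (r * v $ k) * (v \<bullet> axis l 1) + (r * v $ k)\<^sup>2 * (axis l 1 \<bullet> (axis l 1 :: real^4))"
  unfolding v'_def by (simp add: inner_add_left inner_add_right inner_commute algebra_simps power2_eq_square)
 also have "\<dots> = v \<bullet> v + 2 * (r * v $ k) * v $ l + (r * v $ k)\<^sup>2" by (simp add: inner_axis inner_axis_axis)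
 finally have n: "v' \<bullet> v' = (v \<bullet> v) * nrm c t (proj_point v)"
  unfolding nrm_def r_def[symmetric] using vv by (simp add: proj_point_def field_simps power2_eq_square)
 have "v' \<bullet> v' > 0" using ne by (simp add: v'_def)
 then show np: "nrm c t (proj_point v) > 0" using n vv by (simp add: zero_less_mult_iff)
 have "pert c t (proj_point v) $ p $ q = v' $ p * v' $ q / (v' \<bullet> v')" for p q
  unfolding pert_def r_def[symmetric] n comp using vv np by (simp add: proj_point_def field_simps power2_eq_square)
 then show "pert c t (proj_point v) = proj_point (v + (r * v $ k) *. axis l 1)"
  by (simp add: v'_def[symmetric] proj_point_def vec_eq_iff)
qed

lemma pert_in_projective_space: "P \<in> projective_space ==> pert c t P \<in> projective_space \<and> nrm c t P > 0"
proof -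
 assume "P \<in> projective_space"
 then obtain v where v: "v ~= 0" "P = proj_point v" unfolding projective_space_def by blast
 show ?thesis unfolding v(2) pert_proj(3)[OF v(1)] using pert_proj(1,2)[OF v(1), of c t] unfolding projective_space_def by blast
qed

lemma pert_in_affine_space: "P \<in> affine_space ==> l ~= 4 ==> pert c t P \<in> affine_space"
proof -
 assume "P \<in> affine_space" and l: "l ~= 4"
 then obtain v where v: "v $ 4 ~= 0" "P = proj_point v" by (auto simp: affine_space_def)
 then have "v ~= 0" by auto
 from pert_proj(3)[OF this] show ?thesis unfolding affine_space_def v(2) using v(1) l by (auto intro!: imageI simp: axis_def)
qed

abbreviation "PP z \<equiv> fst (fst z)" for z :: "((real^4^4) \<times> real) \<times> par"
abbreviation "TT z \<equiv> snd (fst z)" for z :: "((real^4^4) \<times> real) \<times> par"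

lemma smooth_qpoly:
 assumes "open U" "smooth_on U c" "smooth_on U x" "smooth_on U y" "smooth_on U t"
 shows "smooth_on U (%z. qpoly (c z) (x z) (y z) (t z))" unfolding qpoly_def by (intro smooth_intros assms)

text \<open>The two open sets cover everything: on one the quotients are smooth, on the other the
  cut-off vanishes identically.\<close>

lemma smooth_phi: "smooth_on UNIV (%z. phi (snd z) (TT z) (PP z))"
proof (rule smooth_on_local[OF open_UNIV])
 fix z :: "((real^4^4) \<times> real) \<times> par"
 have o: "open {z. PP z $ k $ k > 0}" "open {z. PP z $ k $ k < a / 2}" by (intro open_Collect_less continuous_intros)+
 consider "PP z $ k $ k > 0" | "PP z $ k $ k < a / 2" using a by linarith
 then show "\<exists>V. open V \<and> z \<in> V \<and> smooth_on V (%z. phi (snd z) (TT z) (PP z))"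
 proof cases
  case 1
  have b: "smooth_on {z :: ((real^4^4) \<times> real) \<times> par. PP z $ k $ k > 0} (%z. bet (PP z $ k $ k))"
   by (rule smooth_on_compose[OF bet(1) _ o(1) open_UNIV], intro smooth_intros o(1)) simp
  have "smooth_on {z :: ((real^4^4) \<times> real) \<times> par. PP z $ k $ k > 0} (%z. phi (snd z) (TT z) (PP z))"
   unfolding phi_def by (intro smooth_on_mult b smooth_qpoly smooth_on_divide smooth_intros o(1)) auto
  then show ?thesis using 1 o(1) by blast
 next
  case 2
  have "smooth_on {z :: ((real^4^4) \<times> real) \<times> par. PP z $ k $ k < a / 2} (%z. 0 :: real)" by (rule smooth_on_const)
  then have "smooth_on {z. PP z $ k $ k < a / 2} (%z. phi (snd z) (TT z) (PP z))"
   by (subst smooth_on_cong[OF o(2), where g="%z. 0"]) (auto simp: phi_def bet(2))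
  then show ?thesis using 2 o(2) by blast
 qed
qed

definition Z where "Z = {z. nrm (snd z) (TT z) (PP z) ~= 0}"

lemma smooth_nrm: "smooth_on UNIV (%z. nrm (snd z) (TT z) (PP z))" unfolding nrm_def by (intro smooth_intros smooth_phi open_UNIV)

lemma open_Z: "open Z"
proof -
 have "Z = (%z. nrm (snd z) (TT z) (PP z)) -` (- {0})" by (auto simp: Z_def)
 then show ?thesis using continuous_open_preimage[OF smooth_on_imp_continuous_on[OF smooth_nrm] open_UNIV, of "- {0}"] by auto
qed

lemma smooth_pert: "smooth_on Z (%z. pert (snd z) (TT z) (PP z))"
proof -
 have s: "smooth_on Z (%z. phi (snd z) (TT z) (PP z))" "smooth_on Z (%z. nrm (snd z) (TT z) (PP z))"
  using smooth_on_subset[OF smooth_phi] smooth_on_subset[OF smooth_nrm] by auto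
 have c: "smooth_on Z (%z. if b then g z else 0)" if "smooth_on Z g" for b and g :: "((real^4^4) \<times> real) \<times> par => real"
  using that by (cases b) (auto intro: smooth_on_const)
 show ?thesis unfolding pert_def
  by (intro smooth_on_vec_lambda smooth_on_divide smooth_on_add smooth_on_mult c smooth_on_power s smooth_on_vec_nth smooth_on_fst smooth_on_snd smooth_on_id open_Z)
   (auto simp: Z_def)
qed

lemma pert_0: "phi 0 t P = 0" "nrm 0 t P = 1" "pert 0 t P = P" by (simp_all add: phi_def qpoly_def nrm_def pert_def vec_eq_iff)

lemma pert_column:
 fixes P :: "real^4^4" and c :: par and t :: real
 assumes "P $ k $ k > a"
 defines "r \<equiv> qpoly c (P $ i $ k / P $ k $ k) (P $ j $ k / P $ k $ k) t"
 shows "pert c t P $ p $ k = (P $ p $ k + (if p = l then r * P $ k $ k else 0)) / nrm c t P"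
 using assms(1) distinct(6) bet(3)[of "P $ k $ k"] by (simp add: pert_def phi_def r_def)

lemma pert_kk: "pert c t P $ k $ k = P $ k $ k / nrm c t P" using distinct(6) by (simp add: pert_def)

text \<open>At c = 0 the map \<open>pert\<close> is the identity, so both conditions hold there with
  room to spare. Compactness of projective space, of the range of the bounded time and of the unit
  sphere of directions gives one eta for all; it keeps immersions immersed.\<close>

lemma small_parameters:
 obtains eta where "eta > 0" "!!c t P. norm c < eta ==> \<bar>t\<bar> \<le> 2 ==> P \<in> projective_space ==> nrm c t P > 1 / 2"
  "!!c t P h. norm c < eta ==> \<bar>t\<bar> \<le> 2 ==> P \<in> projective_space ==> h ~= 0 ==>
   pd ((h, 0), 0) (%z. pert (snd z) (TT z) (PP z)) ((P, t), c) ~= 0"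
proof -
 let ?G = "%z. pert (snd z) (TT z) (PP z)"
 define Q where "Q = {y :: (((real^4^4) \<times> real) \<times> par) \<times> (real^4^4).
  fst y \<in> Z \<and> nrm (snd (fst y)) (TT (fst y)) (PP (fst y)) > 1 / 2 \<and> pd ((snd y, 0), 0) ?G (fst y) ~= 0}"
 have "open Q"
 proof -
  have oZ: "open (Z \<times> (UNIV :: (real^4^4) set))" by (intro open_Times open_Z open_UNIV)
  have 1: "continuous_on (Z \<times> UNIV) (%y :: (((real^4^4) \<times> real) \<times> par) \<times> (real^4^4). nrm (snd (fst y)) (TT (fst y)) (PP (fst y)))"
   by (rule continuous_on_compose2[OF smooth_on_imp_continuous_on[OF smooth_nrm]]) (auto intro!: continuous_intros)
  have e: "pd ((snd y, 0), 0) ?G (fst y) = (\<Sum>b\<in>Basis. (((snd y, 0), 0) \<bullet> b) *. pd b ?G (fst y))"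
   if "y \<in> Z \<times> UNIV" for y :: "(((real^4^4) \<times> real) \<times> par) \<times> (real^4^4)"
   by (rule pd_sum_Basis[OF smooth_on_differentiable[OF smooth_pert open_Z]]) (use that in auto)
  have "continuous_on (Z \<times> UNIV) (%y :: (((real^4^4) \<times> real) \<times> par) \<times> (real^4^4).
    \<Sum>b\<in>Basis. (((snd y, 0), 0) \<bullet> b) *. pd b ?G (fst y))"
   by (intro continuous_intros continuous_on_compose2[OF smooth_on_imp_continuous_on[OF smooth_on_pd[OF open_Z smooth_pert]]]) auto
  then have 2: "continuous_on (Z \<times> UNIV) (%y :: (((real^4^4) \<times> real) \<times> par) \<times> (real^4^4). pd ((snd y, 0), 0) ?G (fst y))"
   by (subst continuous_on_cong[OF refl e])
  have "Q = ((Z \<times> UNIV) \<inter> (%y. nrm (snd (fst y)) (TT (fst y)) (PP (fst y))) -` {1/2<..})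
   \<inter> ((Z \<times> UNIV) \<inter> (%y. pd ((snd y, 0), 0) ?G (fst y)) -` (- {0}))" unfolding Q_def by auto
  moreover have "open ((Z \<times> UNIV) \<inter> (%y :: (((real^4^4) \<times> real) \<times> par) \<times> (real^4^4). nrm (snd (fst y)) (TT (fst y)) (PP (fst y))) -` {1/2<..})"
   by (rule continuous_open_preimage[OF 1 oZ open_greaterThan])
  moreover have "open ((Z \<times> UNIV) \<inter> (%y :: (((real^4^4) \<times> real) \<times> par) \<times> (real^4^4). pd ((snd y, 0), 0) ?G (fst y)) -` (- {0}))"
   by (rule continuous_open_preimage[OF 2 oZ]) auto
  ultimately show ?thesis by (simp only: open_Int)
 qed
 have cK: "compact (((projective_space \<times> {-2..2}) \<times> {0}) \<times> sphere 0 1 :: ((((real^4^4) \<times> real) \<times> par) \<times> (real^4^4)) set)"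
  by (intro compact_Times compact_projective_space) auto
 have sub: "((projective_space \<times> {-2..2}) \<times> {0}) \<times> sphere 0 1 \<subseteq> Q"
 proof
  fix y :: "(((real^4^4) \<times> real) \<times> par) \<times> (real^4^4)"
  assume "y \<in> ((projective_space \<times> {-2..2}) \<times> {0}) \<times> sphere 0 1"
  then obtain P t h where y: "y = (((P, t), 0), h)" "norm h = 1" by (cases y) auto
  have z: "((P, t), 0) \<in> Z" by (simp add: Z_def pert_0)
  have "pd (h, 0) (%y. ?G (y, 0)) (P, t) = pd ((h, 0), 0) ?G ((P, t), 0)"
   by (rule pd_slice[OF smooth_on_differentiable[OF smooth_pert open_Z z]])
  moreover have "(%y. ?G (y, 0)) = fst" by (simp add: fun_eq_iff pert_0)
  ultimately have "pd ((h, 0), 0) ?G ((P, t), 0) = h" by (simp add: pd_fst_snd)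
  then show "y \<in> Q" using y z by (auto simp: Q_def pert_0)
 qed
 obtain eta where eta: "eta > 0"
  "(\<Union>x\<in>((projective_space \<times> {-2..2}) \<times> {0}) \<times> sphere 0 1. ball x eta) \<subseteq> Q"
  by (rule compact_subset_open_imp_ball_epsilon_subset[OF cK \<open>open Q\<close> sub])
 have inQ: "(((P, t), c), h) \<in> Q" if "norm c < eta" "\<bar>t\<bar> \<le> 2" "P \<in> projective_space" "norm h = 1" for c t P h
 proof -
  have "(((P, t), c), h) \<in> ball (((P, t), 0), h) eta" using that(1) by (simp add: dist_Pair_Pair dist_norm)
  moreover have "(((P, t), 0), h) \<in> ((projective_space \<times> {-2..2}) \<times> {0}) \<times> sphere 0 1" using that by auto
  ultimately show ?thesis using eta(2) by blast
 qed
 show ?thesis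
 proof (rule that[OF eta(1)])
  fix c :: par and t :: real and P :: "real^4^4" assume c: "norm c < eta" "\<bar>t\<bar> \<le> 2" "P \<in> projective_space"
  obtain h :: "real^4^4" where "norm h = 1" using vector_choose_size[of 1] by auto
  from inQ[OF c this] show "nrm c t P > 1 / 2" by (simp add: Q_def)
  fix h :: "real^4^4" assume h: "h ~= 0"
  have "norm (inverse (norm h) *. h) = 1" using h by simp
  from inQ[OF c this] have z: "((P, t), c) \<in> Z" and nz: "pd ((inverse (norm h) *. h, 0), 0) ?G ((P, t), c) ~= 0"
   by (simp_all add: Q_def)
  have "pd (inverse (norm h) *. ((h, 0), 0)) ?G ((P, t), c) = inverse (norm h) *. pd ((h, 0), 0) ?G ((P, t), c)"
   by (rule pd_linear(3)[OF smooth_on_differentiable[OF smooth_pert open_Z z]])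
  then show "pd ((h, 0), 0) ?G ((P, t), c) ~= 0" using nz by auto
 qed
qed

lemma smooth_pert_joint:
 fixes s :: "plane \<times> real => real^4^4"
 assumes "open U" "smooth_on U s" "!!w. w \<in> U ==> s w \<in> projective_space"
 shows "smooth_on (U \<times> UNIV) (%z. pert (snd z) (arctan (snd (fst z))) (s (fst z)))"
proof -
 have o: "open (U \<times> (UNIV :: par set))" by (intro open_Times assms open_UNIV)
 have 1: "smooth_on (U \<times> (UNIV :: par set)) (%z. s (fst z))"
  by (rule smooth_on_compose[OF assms(2) _ o assms(1)], intro smooth_intros o) auto
 have 2: "smooth_on (U \<times> (UNIV :: par set)) (%z. arctan (snd (fst z)))"
  by (rule smooth_on_compose[OF smooth_on_arctan _ o open_UNIV], intro smooth_intros o) auto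
 have "smooth_on (U \<times> (UNIV :: par set)) (%z. ((s (fst z), arctan (snd (fst z))), snd z))"
  by (intro smooth_on_Pair 1 2 smooth_on_snd smooth_on_id o)
 from smooth_on_compose[OF smooth_pert this o open_Z]
 have "(%z. ((s (fst z), arctan (snd (fst z))), snd z)) ` (U \<times> UNIV) \<subseteq> Z ==> ?thesis" by simp
 moreover have "((s (fst z), arctan (snd (fst z))), snd z) \<in> Z" if "z \<in> U \<times> UNIV" for z :: "(plane \<times> real) \<times> par"
 proof -
  have "fst z \<in> U" using that by (rule mem_Times_iff[THEN iffD1, THEN conjunct1])
  from pert_in_projective_space[OF assms(3)[OF this], of "snd z" "arctan (snd (fst z))"] show ?thesis unfolding Z_def by simp
 qed
 ultimately show ?thesis by blast
qed

lemma smooth_pert_slice: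
 fixes s :: "plane \<times> real => real^4^4"
 assumes "open U" "smooth_on U s" "!!w. w \<in> U ==> s w \<in> projective_space"
 shows "smooth_on U (%w. pert c (arctan (snd w)) (s w))"
 using smooth_on_slice[OF _ smooth_pert_joint[OF assms], of c] assms(1) by (simp add: open_Times)

text \<open>The perturbed family is jointly smooth in the point and c, so the strict inequalities on
  the compact set at c = 0 extend to a uniform neighbourhood. The centre s1 may differ from s
  because neighbourhoods in the topology need not be centred at the given family.\<close>

lemma close_jets_pert:
 fixes s :: "plane \<times> real => real^4^4"
 assumes U: "open U" "smooth_on U s" "!!w. w \<in> U ==> s w \<in> projective_space" and K: "compact K" "K \<subseteq> U"
  and s0: "!!vs x. set vs \<subseteq> Basis ==> length vs \<le> n ==> x \<in> K ==> norm (partials vs s x - partials vs s1 x) < dlt"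
  and s1: "smooth_on U s1"
 shows "\<exists>eta>0. \<forall>c. norm c < eta --> close_jets n dlt K s1 (%w. pert c (arctan (snd w)) (s w))"
proof -
 let ?F = "%z. pert (snd z) (arctan (snd (fst z))) (s (fst z))"
 have sF: "smooth_on (U \<times> (UNIV :: par set)) ?F" by (rule smooth_pert_joint[OF U])
 have o: "open (U \<times> (UNIV :: par set))" by (intro open_Times U open_UNIV)
 have one: "\<exists>eta>0. \<forall>c. norm c < eta --> (\<forall>x\<in>K. norm (partials vs (%w. pert c (arctan (snd w)) (s w)) x - partials vs s1 x) < dlt)"
  if vs: "set vs \<subseteq> Basis" "length vs \<le> n" for vs
 proof -
  have eq: "partials vs (%w. pert c (arctan (snd w)) (s w)) x = partials (map (%v. (v, 0)) vs) ?F (x, c)" if "x \<in> U" for x c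
   using partials_slice[OF o sF, of x c vs] that by simp
  define g where "g z = partials (map (%v. (v, 0)) vs) ?F z - partials vs s1 (fst z)" for z
  have "continuous_on (U \<times> UNIV) g" unfolding g_def
   by (intro continuous_intros smooth_on_imp_continuous_on[OF smooth_on_partials[OF o sF]]
     continuous_on_compose2[OF smooth_on_imp_continuous_on[OF smooth_on_partials[OF U(1) s1]]]) auto
  from continuous_open_preimage[OF this o open_ball[of 0 dlt]]
  have oG: "open (U \<times> UNIV \<inter> g -` ball 0 dlt)" .
  have cK: "compact (K \<times> {0 :: par})" by (intro compact_Times K) auto
  have sub: "K \<times> {0} \<subseteq> U \<times> UNIV \<inter> g -` ball 0 dlt"
  proof
   fix z :: "(plane \<times> real) \<times> par" assume "z \<in> K \<times> {0}"
   then obtain x where x: "z = (x, 0)" "x \<in> K" by (cases z) auto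
   then have "x \<in> U" using K by auto
   have "g z = partials vs s x - partials vs s1 x" using eq[OF \<open>x \<in> U\<close>, of 0] by (simp add: g_def x pert_0)
   then show "z \<in> U \<times> UNIV \<inter> g -` ball 0 dlt" using s0[OF vs x(2)] x(1) \<open>x \<in> U\<close> by simp
  qed
  obtain eta where e: "eta > 0" "(\<Union>x\<in>K \<times> {0}. ball x eta) \<subseteq> U \<times> UNIV \<inter> g -` ball 0 dlt"
   by (rule compact_subset_open_imp_ball_epsilon_subset[OF cK oG sub])
  have "norm (partials vs (%w. pert c (arctan (snd w)) (s w)) x - partials vs s1 x) < dlt" if "norm c < eta" "x \<in> K" for c x
  proof -
   have "(x, c) \<in> ball (x, 0) eta" using that by (simp add: dist_Pair_Pair dist_norm)
   then have "(x, c) \<in> U \<times> UNIV \<inter> g -` ball 0 dlt" using e(2) that(2) by blast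
   then show ?thesis using eq[of x c] by (simp add: g_def)
  qed
  then show ?thesis using e(1) by blast
 qed
 define L where "L = {vs :: (plane \<times> real) list. set vs \<subseteq> Basis \<and> length vs \<le> n}"
 have "finite L" unfolding L_def by (rule finite_lists_length_le) simp
 then have "\<exists>eta>0. \<forall>c. norm c < eta --> (\<forall>vs\<in>L. \<forall>x\<in>K. norm (partials vs (%w. pert c (arctan (snd w)) (s w)) x - partials vs s1 x) < dlt)"
  using one
 proof -
  assume f: "finite L"
  have *: "\<forall>vs\<in>L. \<exists>eta>0. \<forall>c. norm c < eta --> (\<forall>x\<in>K. norm (partials vs (%w. pert c (arctan (snd w)) (s w)) x - partials vs s1 x) < dlt)"
   using one by (simp add: L_def)
  from f * show ?thesis
  proof (induction rule: finite_induct)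
   case empty show ?case by (auto intro: exI[of _ 1])
  next
   case (insert v L)
   obtain eta1 where 1: "eta1 > 0" "\<forall>c. norm c < eta1 --> (\<forall>x\<in>K. norm (partials v (%w. pert c (arctan (snd w)) (s w)) x - partials v s1 x) < dlt)"
    using insert.prems by blast
   obtain eta2 where 2: "eta2 > 0" "\<forall>c. norm c < eta2 --> (\<forall>vs\<in>L. \<forall>x\<in>K. norm (partials vs (%w. pert c (arctan (snd w)) (s w)) x - partials vs s1 x) < dlt)"
    using insert by blast
   show ?case by (rule exI[of _ "min eta1 eta2"]) (use 1 2 in auto)
  qed
 qed
 then show ?thesis unfolding close_jets_def L_def by auto
qed

end

subsection \<open>Almost every perturbation is non-degenerate\<close>

text \<open>If \<open>F\<^sub>y\<^sub>y ~= 0\<close>, the four equations \<open>hess F = 0\<close>, \<open>d (hess F) = 0\<close> at a point y determine all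
 five coefficients of the quadratic-cubic perturbation as functions of y and of \<open>s = F\<^sub>x\<^sub>y\<close>.\<close>

lemma degenerate_parameters_negligible:
 fixes f :: "plane \<times> real => real"
 assumes On: "open On" "smooth_on On f"
 defines "F \<equiv> (%c y. f y + qpoly c (fst (fst y)) (snd (fst y)) (arctan (snd y)))"
 shows "negligible {c. \<exists>y\<in>On. critical_zero (hess (F c)) y \<and> pd eY (pd eY (F c)) y ~= 0}"
proof -
 define A B C where "A = pd eX (pd eX f)" and "B = pd eX (pd eY f)" and "C = pd eY (pd eY f)"
 have sm: "smooth_on On A" "smooth_on On B" "smooth_on On C" unfolding A_def B_def C_def by (intro smooth_on_pd On)+
 note d = smooth_on_differentiable[OF _ On(1)]
 \<comment> \<open>The coefficients in order of solvability, with s = F_xy: H = 0 gives F_xx = s^2 /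
   F_yy, the derivatives of H in y, x and time give c3, c2 and c4, the value of s gives c5, and F_xx
   gives c1. The source has dimension 4, the target 5.\<close>
 define K where "K z = (let y = fst z; s = snd z; x = fst (fst y); u = snd (fst y); th = arctan (snd y); t = s\<^sup>2 / C y;
   c3 = ((2 * s * pd eY B y - t * pd eY C y) / C y - pd eY A y) / 2;
   c2 = ((2 * s * (pd eX B y + 2 * c3) - t * pd eX C y) / C y - pd eX A y) / 6;
   c4 = ((2 * s * pd eT B y - t * pd eT C y) / C y - pd eT A y) * (1 + (snd y)\<^sup>2) / 2;
   c5 = s - B y - 2 * c3 * x;
   c1 = (t - A y - 6 * c2 * x - 2 * c3 * u - 2 * c4 * th) / 2
  in (((c1, c2), (c3, c4)), c5))" for z :: "(plane \<times> real) \<times> real"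
 define S where "S = {z :: (plane \<times> real) \<times> real. fst z \<in> On \<and> C (fst z) ~= 0}"
 have oS: "open S"
 proof -
  have "S = (On \<inter> C -` (- {0})) \<times> UNIV" by (auto simp: S_def)
  moreover have "open (On \<inter> C -` (- {0}))"
   by (rule continuous_open_preimage[OF smooth_on_imp_continuous_on[OF sm(3)] On(1)]) auto
  ultimately show ?thesis by (simp add: open_Times)
 qed
 have sc: "smooth_on S (%z. g (fst z))" if "smooth_on On g" for g :: "plane \<times> real => real"
  by (rule smooth_on_compose[OF that _ oS On(1)], intro smooth_intros oS) (auto simp: S_def)
 have sth: "smooth_on S (%z. arctan (snd (fst z)))"
  by (rule smooth_on_compose[OF smooth_on_arctan _ oS open_UNIV], intro smooth_intros oS) auto
 have Cn: "C (fst z) ~= 0" if "z \<in> S" for z using that by (simp add: S_def)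
 have "smooth_on S K" unfolding K_def Let_def
  by (intro smooth_on_Pair smooth_on_divide smooth_on_mult smooth_on_add smooth_on_diff smooth_on_power
    smooth_on_const smooth_on_snd smooth_on_fst smooth_on_id sth sc smooth_on_pd sm On oS) (auto dest: Cn)
 then have neg: "negligible (K ` S)" by (intro negligible_differentiable_image_lowdim smooth_on_imp_differentiable_on) simp_all
 have "c \<in> K ` S" if y: "y \<in> On" and cz: "critical_zero (hess (F c)) y" and nz: "pd eY (pd eY (F c)) y ~= 0" for c y
 proof -
  obtain c1 c2 c3 c4 c5 where c: "c = (((c1, c2), (c3, c4)), c5)" by (metis surj_pair)
  let ?x = "%y :: plane \<times> real. fst (fst y)" let ?u = "%y :: plane \<times> real. snd (fst y)"
  let ?th = "%y :: plane \<times> real. arctan (snd y)"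
  have F: "F c = (%y. f y + (c1 * (?x y)\<^sup>2 + c2 * (?x y) ^ 3 + c3 * (?x y)\<^sup>2 * ?u y + c4 * ?th y * (?x y)\<^sup>2 + c5 * ?x y * ?u y))"
   by (simp add: F_def c qpoly_def fun_eq_iff algebra_simps)
  have D0: "(F c has_derivative (%v. pd v f y + ((2 * c1 * ?x y + 3 * c2 * (?x y)\<^sup>2 + 2 * c3 * ?x y * ?u y + 2 * c4 * ?th y * ?x y + c5 * ?u y) * fst (fst v)
    + (c3 * (?x y)\<^sup>2 + c5 * ?x y) * snd (fst v) + c4 * (?x y)\<^sup>2 / (1 + (snd y)\<^sup>2) * snd v))) (at y)" if "y \<in> On" for y
   unfolding F by (auto intro!: derivative_eq_intros has_derivative_pd d On that
     simp: fun_eq_iff algebra_simps power2_eq_square power3_eq_cube divide_inverse)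
  have FX: "pd eX (F c) y = pd eX f y + (2 * c1 * ?x y + 3 * c2 * (?x y)\<^sup>2 + 2 * c3 * ?x y * ?u y + 2 * c4 * ?th y * ?x y + c5 * ?u y)"
   and FY: "pd eY (F c) y = pd eY f y + (c3 * (?x y)\<^sup>2 + c5 * ?x y)" if "y \<in> On" for y
   using pd_eqI[OF D0[OF that], of eX] pd_eqI[OF D0[OF that], of eY] by simp_all
  have D1: "((%y. pd eX f y + (2 * c1 * ?x y + 3 * c2 * (?x y)\<^sup>2 + 2 * c3 * ?x y * ?u y + 2 * c4 * ?th y * ?x y + c5 * ?u y)) has_derivative
    (%v. pd v (pd eX f) y + ((2 * c1 + 6 * c2 * ?x y + 2 * c3 * ?u y + 2 * c4 * ?th y) * fst (fst v)
     + (2 * c3 * ?x y + c5) * snd (fst v) + 2 * c4 * ?x y / (1 + (snd y)\<^sup>2) * snd v))) (at y)" if "y \<in> On" for y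
   by (auto intro!: derivative_eq_intros has_derivative_pd d smooth_on_pd On that
     simp: fun_eq_iff algebra_simps power2_eq_square power3_eq_cube divide_inverse)
  have D2: "((%y. pd eY f y + (c3 * (?x y)\<^sup>2 + c5 * ?x y)) has_derivative
    (%v. pd v (pd eY f) y + (2 * c3 * ?x y + c5) * fst (fst v))) (at y)" if "y \<in> On" for y
   by (auto intro!: derivative_eq_intros has_derivative_pd d smooth_on_pd On that
     simp: fun_eq_iff algebra_simps power2_eq_square power3_eq_cube divide_inverse)
  have FXX: "pd eX (pd eX (F c)) y = A y + (2 * c1 + 6 * c2 * ?x y + 2 * c3 * ?u y + 2 * c4 * ?th y)"
   and FXY: "pd eX (pd eY (F c)) y = B y + (2 * c3 * ?x y + c5)" and FYY: "pd eY (pd eY (F c)) y = C y" if "y \<in> On" for y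
   using trans[OF pd_cong_open[OF On(1) that FX] pd_eqI[OF D1[OF that]], of eX]
    trans[OF pd_cong_open[OF On(1) that FY] pd_eqI[OF D2[OF that]], of eX]
    trans[OF pd_cong_open[OF On(1) that FY] pd_eqI[OF D2[OF that]], of eY] by (simp_all add: A_def B_def C_def)
  have H: "hess (F c) y = (A y + (2 * c1 + 6 * c2 * ?x y + 2 * c3 * ?u y + 2 * c4 * ?th y)) * C y - (B y + (2 * c3 * ?x y + c5))\<^sup>2" if "y \<in> On" for y
   unfolding hess_def FXX[OF that] FXY[OF that] FYY[OF that] ..
  define s t where "s = B y + (2 * c3 * ?x y + c5)" and "t = A y + (2 * c1 + 6 * c2 * ?x y + 2 * c3 * ?u y + 2 * c4 * ?th y)"
  have th': "1 + (snd y)\<^sup>2 ~= 0" by (simp add: add_nonneg_eq_0_iff)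
  have D3: "((%y. (A y + (2 * c1 + 6 * c2 * ?x y + 2 * c3 * ?u y + 2 * c4 * ?th y)) * C y - (B y + (2 * c3 * ?x y + c5))\<^sup>2) has_derivative
    (%v. (pd v A y + (6 * c2 * fst (fst v) + 2 * c3 * snd (fst v) + 2 * c4 * (snd v / (1 + (snd y)\<^sup>2)))) * C y
    + t * pd v C y - 2 * s * (pd v B y + 2 * c3 * fst (fst v)))) (at y)"
   unfolding s_def t_def by (auto intro!: derivative_eq_intros has_derivative_pd d sm y
     simp: fun_eq_iff algebra_simps power2_eq_square divide_inverse)
  have dH: "pd v (hess (F c)) y = (pd v A y + (6 * c2 * fst (fst v) + 2 * c3 * snd (fst v) + 2 * c4 * (snd v / (1 + (snd y)\<^sup>2)))) * C y
    + t * pd v C y - 2 * s * (pd v B y + 2 * c3 * fst (fst v))" for v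
   by (rule trans[OF pd_cong_open[OF On(1) y H] pd_eqI[OF D3]])
  have C0: "C y ~= 0" using nz FYY[OF y] by simp
  have z: "t * C y = s\<^sup>2" using cz H[OF y] by (simp add: critical_zero_def s_def t_def)
  have dz: "pd v (hess (F c)) y = 0" for v using cz unfolding critical_zero_def by blast
  have eY: "(pd eY A y + 2 * c3) * C y + t * pd eY C y - 2 * s * pd eY B y = 0" using dz[of eY] unfolding dH by simp
  have eX: "(pd eX A y + 6 * c2) * C y + t * pd eX C y - 2 * s * (pd eX B y + 2 * c3) = 0" using dz[of eX] unfolding dH by simp
  have eT: "(pd eT A y + 2 * c4 * (1 / (1 + (snd y)\<^sup>2))) * C y + t * pd eT C y - 2 * s * pd eT B y = 0"
   using dz[of eT] unfolding dH by simp
  have k0: "s\<^sup>2 / C y = t" using z C0 by (simp add: field_simps)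
  have k3: "((2 * s * pd eY B y - t * pd eY C y) / C y - pd eY A y) / 2 = c3"
  proof -
   have "2 * s * pd eY B y - t * pd eY C y = (pd eY A y + 2 * c3) * C y" using eY by linarith
   then show ?thesis using C0 by simp
  qed
  have k2: "((2 * s * (pd eX B y + 2 * c3) - t * pd eX C y) / C y - pd eX A y) / 6 = c2"
  proof -
   have "2 * s * (pd eX B y + 2 * c3) - t * pd eX C y = (pd eX A y + 6 * c2) * C y" using eX by linarith
   then show ?thesis using C0 by simp
  qed
  have k4: "((2 * s * pd eT B y - t * pd eT C y) / C y - pd eT A y) * (1 + (snd y)\<^sup>2) / 2 = c4"
  proof -
   have "2 * s * pd eT B y - t * pd eT C y = (pd eT A y + 2 * c4 * (1 / (1 + (snd y)\<^sup>2))) * C y" using eT by linarith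
   then show ?thesis using C0 th' by simp
  qed
  have "K (y, s) = c" unfolding K_def Let_def fst_conv snd_conv k0 k3 k2 k4 c by (simp add: s_def t_def)
  moreover have "(y, s) \<in> S" using y C0 by (simp add: S_def)
  ultimately show ?thesis by (metis imageI)
 qed
 then show ?thesis by (intro negligible_subset[OF neg]) blast
qed

lemma vol_axis_distinct:
 fixes i j k l :: 4
 assumes "i ~= j" "i ~= l" "j ~= l" "i ~= k" "j ~= k" "l ~= k"
 shows "vol (axis k 1) (axis i 1) (axis j 1) (axis l 1) ~= 0"
proof -
 define A :: "real^4^4"
  where "A = (\<chi> p. if p = 1 then axis k 1 else if p = 2 then axis i 1 else if p = 3 then axis j 1 else axis l 1)"
 have "(A ** transpose A) $ p $ q = A $ p \<bullet> A $ q" for p q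
  by (simp add: matrix_matrix_mult_def transpose_def inner_vec_def)
 then have "A ** transpose A = mat 1" using assms by (simp add: A_def vec_eq_iff forall_4 mat_def inner_axis_axis)
 from arg_cong[OF this, of det] have "det A * det A = 1" by (simp only: det_mul det_transpose det_I)
 then show ?thesis unfolding vol_def A_def[symmetric] by auto
qed

lemma dcoord_ratio:
 assumes "open U" "smooth_on U s" "w \<in> U" "s w $ k $ k ~= 0"
 shows "dcoord k i v s w = (s w $ k $ k)\<^sup>2 * pd v (%w. s w $ i $ k / s w $ k $ k) w"
proof -
 have d: "(%w. s w $ p $ k) differentiable (at w)" for p
  by (rule smooth_on_differentiable[OF _ assms(1,3)]) (intro smooth_intros assms)
 have "pd v (%w. s w $ i $ k / s w $ k $ k) w
   = (pd v (%w. s w $ i $ k) w * s w $ k $ k - s w $ i $ k * pd v (%w. s w $ k $ k) w) / (s w $ k $ k * s w $ k $ k)"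
  by (rule pd_eqI[OF has_derivative_divide'[OF has_derivative_pd[OF d] has_derivative_pd[OF d] assms(4)]])
 then show ?thesis using assms(4) by (simp add: dcoord_def power2_eq_square)
qed

text \<open>Countably many of the neighbourhoods already cover, by the Lindelof property.\<close>

lemma negligible_locally:
 fixes P :: "'b::euclidean_space => 'a::euclidean_space => bool"
 assumes "!!w. w \<in> Om ==> \<exists>V. open V \<and> w \<in> V \<and> negligible {c. \<exists>w\<in>V. P c w}"
  and "!!c w. P c w ==> w \<in> Om"
 shows "negligible {c. \<exists>w. P c w}"
proof -
 define \<F> where "\<F> = {V. open V \<and> negligible {c. \<exists>w\<in>V. P c w}}"
 obtain \<F>' where F: "\<F>' \<subseteq> \<F>" "countable \<F>'" "\<Union>\<F>' = \<Union>\<F>"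
  using Lindelof[of \<F>] unfolding \<F>_def by blast
 have "negligible (\<Union>V\<in>\<F>'. {c. \<exists>w\<in>V. P c w})"
  by (rule negligible_countable_Union) (use F \<F>_def in auto)
 moreover have "{c. \<exists>w. P c w} \<subseteq> (\<Union>V\<in>\<F>'. {c. \<exists>w\<in>V. P c w})"
 proof
  fix c assume "c \<in> {c. \<exists>w. P c w}"
  then obtain w where w: "P c w" by blast
  then have "w \<in> \<Union>\<F>" using assms unfolding \<F>_def by blast
  then have "w \<in> \<Union>\<F>'" using F(3) by simp
  then show "c \<in> (\<Union>V\<in>\<F>'. {c. \<exists>w\<in>V. P c w})" using w by blast
 qed
 ultimately show ?thesis by (rule negligible_subset)
qed

locale perturbed_chart = perturbation +
 fixes Om :: "(plane \<times> real) set" and s :: "plane \<times> real => real^4^4"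
 assumes openOm: "open Om" and smooth_s: "smooth_on Om s" and proj_s: "!!w. w \<in> Om ==> s w \<in> projective_space"
begin

definition sc where "sc c w = pert c (arctan (snd w)) (s w)" for c w
definition ratio where "ratio p w = s w $ p $ k / s w $ k $ k" for p w
text \<open>Where the cut-off equals 1 the perturbation adds exactly the polynomial
  \<open>qpoly\<close> to the l-th affine coordinate.\<close>

definition Om1 where "Om1 = {w \<in> Om. s w $ k $ k > a}"

lemma smooth_sc: "smooth_on Om (sc c)" unfolding sc_def[abs_def] by (rule smooth_pert_slice[OF openOm smooth_s proj_s])

lemma nrm_s: "w \<in> Om ==> nrm c t (s w) > 0" using pert_in_projective_space[OF proj_s] by blast

lemma Om1: "open Om1" "Om1 \<subseteq> Om" "w \<in> Om1 ==> s w $ k $ k > 0"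
proof -
 have "smooth_on Om (%w. s w $ k $ k)" by (intro smooth_intros openOm smooth_s)
 from continuous_open_preimage[OF smooth_on_imp_continuous_on[OF this] openOm open_greaterThan[of a]]
 have "open (Om \<inter> (%w. s w $ k $ k) -` {a<..})" .
 moreover have "Om1 = Om \<inter> (%w. s w $ k $ k) -` {a<..}" by (auto simp: Om1_def)
 ultimately show "open Om1" by simp
qed (use a in \<open>auto simp: Om1_def\<close>)

lemma smooth_ratio: "smooth_on Om1 (ratio p)" unfolding ratio_def[abs_def]
 by (intro smooth_on_divide smooth_on_vec_nth Om1 smooth_on_subset[OF smooth_s]) (use Om1(3) in \<open>auto simp: less_imp_neq[symmetric]\<close>)

lemma all_indices: "p = i \<or> p = j \<or> p = l \<or> p = k"
proof -
 have "card {i, j, l, k} = 4" using distinct by simp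
 then have "{i, j, l, k} = UNIV" by (intro card_subset_eq) auto
 then show ?thesis by blast
qed

lemma col_sc:
 assumes w: "w \<in> Om1"
 shows "col k (sc c) w = (s w $ k $ k / nrm c (arctan (snd w)) (s w)) *.
  (ratio i w *. axis i 1 + ratio j w *. axis j 1
   + (ratio l w + qpoly c (ratio i w) (ratio j w) (arctan (snd w))) *. axis l 1 + axis k 1)"
proof -
 have k: "s w $ k $ k > a" "s w $ k $ k > 0" using w Om1(3) by (auto simp: Om1_def)
 have n: "nrm c (arctan (snd w)) (s w) > 0" using nrm_s w Om1(2) by blast
 have "col k (sc c) w $ p = ((s w $ k $ k / nrm c (arctan (snd w)) (s w)) *.
  (ratio i w *. axis i 1 + ratio j w *. axis j 1
   + (ratio l w + qpoly c (ratio i w) (ratio j w) (arctan (snd w))) *. axis l 1 + axis k 1)) $ p" for p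
  using all_indices[of p] distinct k(2) n
  by (elim disjE) (simp_all add: col_def sc_def pert_column[OF k(1)] ratio_def axis_def field_simps)
 then show ?thesis by (simp add: vec_eq_iff)
qed

lemma ratio_sc:
 assumes w: "w \<in> Om1" and p: "p ~= l"
 shows "sc c w $ p $ k / sc c w $ k $ k = ratio p w"
proof -
 have k: "s w $ k $ k > a" "s w $ k $ k > 0" using w Om1(3) by (auto simp: Om1_def)
 have "nrm c (arctan (snd w)) (s w) > 0" using nrm_s w Om1(2) by blast
 then show ?thesis using p k(2) distinct(6) by (simp add: sc_def pert_column[OF k(1)] ratio_def)
qed

lemma dcoord_sc:
 assumes w: "w \<in> Om1" and p: "p ~= l"
 shows "dcoord k p v (sc c) w = (sc c w $ k $ k)\<^sup>2 * pd v (ratio p) w" "sc c w $ k $ k ~= 0"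
proof -
 have "nrm c (arctan (snd w)) (s w) > 0" using nrm_s w Om1(2) by blast
 then show nz: "sc c w $ k $ k ~= 0" using Om1(3)[OF w] by (simp add: sc_def pert_kk)
 show "dcoord k p v (sc c) w = (sc c w $ k $ k)\<^sup>2 * pd v (ratio p) w"
  unfolding dcoord_ratio[OF Om1(1) smooth_on_subset[OF smooth_sc Om1(2)] w nz]
  by (subst pd_cong_open[OF Om1(1) w ratio_sc[OF _ p]]) auto
qed

definition bad where "bad c w \<longleftrightarrow> w \<in> Om1 \<and> critical_zero (sff_det (col k (sc c))) w \<and>
 jac k i j (sc c) w * sff_level k i (sc c) w ~= 0" for c w

text \<open>Affine coordinates i and j are unaffected by the perturbation, so this Jacobian is
  independent of c and localises the problem once for all parameters.\<close>

definition rjac where "rjac w = pd eX (ratio i) w * pd eY (ratio j) w - pd eX (ratio j) w * pd eY (ratio i) w" for w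

lemma bad_rjac: assumes "bad c w" shows "rjac w ~= 0"
proof -
 have w: "w \<in> Om1" and j0: "jac k i j (sc c) w ~= 0" using assms by (auto simp: bad_def)
 have "jac k i j (sc c) w = (sc c w $ k $ k) ^ 4 * rjac w"
  unfolding jac_def rjac_def dcoord_sc(1)[OF w distinct(2)] dcoord_sc(1)[OF w distinct(3)] by algebra
 then show ?thesis using j0 by auto
qed

text \<open>Use affine coordinates i and j on the surface. It becomes the graph of the l-th one, the
  perturbation adds \<open>qpoly\<close> to this graph, and
  \<open>degenerate_parameters_negligible\<close> applies.\<close>

lemma bad_locally_negligible:
 assumes w0: "w0 \<in> Om1" and r0: "rjac w0 ~= 0"
 shows "\<exists>V. open V \<and> w0 \<in> V \<and> negligible {c. \<exists>w\<in>V. bad c w}"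
proof -
 define xi where "xi w = ((ratio i w, ratio j w), snd w)" for w
 have sxi: "smooth_on Om1 xi" unfolding xi_def[abs_def] by (intro smooth_on_Pair smooth_ratio smooth_on_snd smooth_on_id Om1(1))
 have dr: "ratio p differentiable (at w0)" for p by (rule smooth_on_differentiable[OF smooth_ratio Om1(1) w0])
 have pxi: "pd v xi w0 = ((pd v (ratio i) w0, pd v (ratio j) w0), snd v)" for v
  unfolding xi_def[abs_def] by (rule pd_eqI[THEN trans]) (auto intro!: derivative_eq_intros has_derivative_pd dr)
 have inj: "v = 0" if z: "pd v xi w0 = 0" for v
 proof -
  obtain x y t where v: "v = ((x, y), t)" by (metis surj_pair)
  have z: "pd v (ratio i) w0 = 0" "pd v (ratio j) w0 = 0" "t = 0" using z by (auto simp: pxi v zero_prod_def)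
  then have "x * pd eX (ratio i) w0 + y * pd eY (ratio i) w0 = 0" "x * pd eX (ratio j) w0 + y * pd eY (ratio j) w0 = 0"
   using pd_coords[OF dr, of x y t] by (simp_all add: v)
  then have "x * rjac w0 = 0" "y * rjac w0 = 0" unfolding rjac_def by algebra+
  then show ?thesis using r0 z(3) by (simp add: v zero_prod_def)
 qed
 obtain V where V: "open V" "V \<subseteq> Om1" "w0 \<in> V" "diffeo_on V xi"
  using smooth_inverse_function[OF Om1(1) sxi w0 inj] by metis
 note D = diffeo_onD[OF V(4)]
 define On where "On = xi ` V"
 define Xi' where "Xi' = inv_into V xi"
 have inv: "Xi' (xi w) = w" if "w \<in> V" for w using that D(3) by (simp add: Xi'_def inv_into_f_f)
 have OnV: "Xi' y \<in> V" "xi (Xi' y) = y" if "y \<in> On" for y using that by (auto simp: On_def inv)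
 have On: "open On" "smooth_on On Xi'" using D by (auto simp: On_def Xi'_def)
 define Psi where "Psi y = fst (Xi' y)" for y
 have sPsi: "smooth_on On Psi" unfolding Psi_def[abs_def] by (intro smooth_intros On)
 have Psi: "(Psi y, snd y) = Xi' y" "ratio i (Xi' y) = fst (fst y)" "ratio j (Xi' y) = snd (fst y)" "snd (Xi' y) = snd y"
  if "y \<in> On" for y using OnV(2)[OF that] by (auto simp: xi_def Psi_def prod_eq_iff)
 have scomp: "smooth_on On (%y. g (Xi' y))" if "smooth_on Om1 g" for g :: "plane \<times> real => real"
  by (rule smooth_on_compose[OF that On(2,1) Om1(1)]) (use OnV(1) V(2) in blast)
 define f where "f y = ratio l (Xi' y)" for y
 have sf: "smooth_on On f" unfolding f_def[abs_def] by (rule scomp[OF smooth_ratio])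
 define F where "F c y = f y + qpoly c (fst (fst y)) (snd (fst y)) (arctan (snd y))" for c y
 have neg: "negligible {c. \<exists>y\<in>On. critical_zero (hess (F c)) y \<and> pd eY (pd eY (F c)) y ~= 0}"
  unfolding F_def[abs_def] by (rule degenerate_parameters_negligible[OF On(1) sf])
 have sub: "\<exists>y\<in>On. critical_zero (hess (F c)) y \<and> pd eY (pd eY (F c)) y ~= 0" if w: "w \<in> V" and bad: "bad c w" for c w
 proof -
  define lam where "lam y = s (Xi' y) $ k $ k / nrm c (arctan (snd (Xi' y))) (s (Xi' y))" for y
  have s1: "smooth_on Om1 s" by (rule smooth_on_subset[OF smooth_s Om1(2)])
  have sn: "smooth_on Om1 (%w. nrm c (arctan (snd w)) (s w))"
  proof -
   have a: "smooth_on Om1 (%w. arctan (snd w))"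
    by (rule smooth_on_compose[OF smooth_on_arctan _ Om1(1) open_UNIV], intro smooth_intros Om1(1)) auto
   have "smooth_on Om1 (%w. ((s w, arctan (snd w)), c))" by (intro smooth_on_Pair smooth_on_const s1 a Om1(1))
   from smooth_on_compose[OF smooth_nrm this Om1(1) open_UNIV] show ?thesis by simp
  qed
  have n0: "nrm c (arctan (snd w)) (s w) ~= 0" if "w \<in> Om1" for w
   using nrm_s[of w c "arctan (snd w)"] subsetD[OF Om1(2) that] by simp
  have "smooth_on Om1 (%w. s w $ k $ k / nrm c (arctan (snd w)) (s w))"
   by (intro smooth_on_divide smooth_on_vec_nth s1 sn Om1(1) n0)
  then have slam: "smooth_on On lam" unfolding lam_def[abs_def] by (rule scomp)
  have sF: "smooth_on On (F c)"
  proof -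
   have "smooth_on On (%y. arctan (snd y))"
    by (rule smooth_on_compose[OF smooth_on_arctan _ On(1) open_UNIV], intro smooth_intros On(1)) auto
   then show ?thesis
    unfolding F_def[abs_def] by (intro smooth_on_add sf smooth_qpoly smooth_on_const smooth_on_fst smooth_on_snd smooth_on_id On(1))
  qed
  have V1: "Xi' y \<in> Om1" if "y \<in> On" for y using OnV(1)[OF that] V(2) by blast
  interpret M: monge_transfer V On "col k (sc c)" Psi lam "F c" "axis i 1" "axis j 1" "axis l 1" "axis k 1"
  proof
   show "smooth_on V (col k (sc c))" by (intro smooth_on_col V(1) smooth_on_subset[OF smooth_sc]) (use V(2) Om1(2) in blast)
   show "(Psi y, snd y) \<in> V" if "y \<in> On" for y using Psi(1)[OF that] OnV(1)[OF that] by simp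
   show "col k (sc c) (Psi y, snd y) = lam y *. (fst (fst y) *. axis i 1 + snd (fst y) *. axis j 1 + F c y *. axis l 1 + axis k 1)"
    if "y \<in> On" for y unfolding Psi(1)[OF that] col_sc[OF V1[OF that]] lam_def F_def f_def Psi(2-4)[OF that] ..
   show "vol (axis k 1) (axis i 1) (axis j 1) (axis l 1) ~= 0" by (rule vol_axis_distinct[OF distinct])
   show "lam y ~= 0" if "y \<in> On" for y
    using Om1(3)[OF V1[OF that]] nrm_s[of "Xi' y" c "arctan (snd (Xi' y))"] V1[OF that] Om1(2) by (auto simp: lam_def)
  qed (use V On sPsi slam sF in auto)
  define y where "y = xi w"
  have y: "y \<in> On" "Xi' y = w" using w inv by (auto simp: y_def On_def)
  have My: "M.Xi y = w" using Psi(1)[OF y(1)] y(2) by (simp add: M.Xi_def)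
  have w1: "w \<in> Om1" using w V(2) by blast
  have sV: "smooth_on V (ratio p)" for p by (rule smooth_on_subset[OF smooth_ratio V(2)])
  have MXi: "M.Xi y = Xi' y" if "y \<in> On" for y using Psi(1)[OF that] by (simp add: M.Xi_def)
  have ch: "M.a v y * pd eX (ratio i) w + M.b v y * pd eY (ratio i) w = fst (fst v)"
   "M.a v y * pd eX (ratio j) w + M.b v y * pd eY (ratio j) w = snd (fst v)" if v: "snd v = 0" for v
  proof -
   have "pd v (%y. ratio i (M.Xi y)) y = pd v (%y. fst (fst y)) y" "pd v (%y. ratio j (M.Xi y)) y = pd v (%y. snd (fst y)) y"
    by (rule pd_cong_open[OF On(1) y(1)], simp add: MXi Psi)+
   moreover have "pd v (%y. fst (fst y)) y = fst (fst v)" "pd v (%y. snd (fst y)) y = snd (fst v)"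
    by (rule pd_eqI[THEN trans], auto intro!: derivative_eq_intros)+
   ultimately show "M.a v y * pd eX (ratio i) w + M.b v y * pd eY (ratio i) w = fst (fst v)"
    "M.a v y * pd eX (ratio j) w + M.b v y * pd eY (ratio j) w = snd (fst v)"
    using M.chain_space[OF sV[of i] y(1) v] M.chain_space[OF sV[of j] y(1) v] by (simp_all add: My)
  qed
  have "M.J y * rjac w = 1" unfolding M.J_def rjac_def using ch[of eX] ch[of eY] by (simp, algebra)
  then have J: "M.J y ~= 0" by auto
  have crit: "critical_zero (hess (F c)) y" using M.critical_transfer[OF y(1) J] bad by (simp add: My bad_def)
  have "pd eY (pd eY (F c)) y ~= 0"
  proof
   assume 0: "pd eY (pd eY (F c)) y = 0"
   define L11 L12 L22 where "L11 = sff (col k (sc c)) eX eX w" and "L12 = sff (col k (sc c)) eX eY w"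
    and "L22 = sff (col k (sc c)) eY eY w"
   define p q where "p = M.a eY y" and "q = M.b eY y"
   have "M.J y * (p * p * L11 + (p * q + q * p) * L12 + q * q * L22) = 0"
    using M.sff_transfer[OF y(1), of eY eY] 0 by (simp add: My L11_def L12_def L22_def p_def q_def)
   then have Q: "p * p * L11 + (p * q + q * p) * L12 + q * q * L22 = 0" using J by simp
   define alp gam where "alp = dcoord k i eX (sc c) w" and "gam = dcoord k i eY (sc c) w"
   have "p * pd eX (ratio i) w + q * pd eY (ratio i) w = 0" using ch(1)[of eY] by (simp add: p_def q_def)
   \<comment> \<open>The second coordinate direction keeps the i-th affine coordinate constant, so
     (p, q) is proportional to (gam, -alp), and the form on it is \<open>sff_level\<close> up to a
     factor.\<close>
   then have rel: "p * alp + q * gam = 0" unfolding alp_def gam_def dcoord_sc(1)[OF w1 distinct(2)] by algebra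
   have lev: "sff_level k i (sc c) w = L11 * gam\<^sup>2 - 2 * L12 * alp * gam + L22 * alp\<^sup>2"
    by (simp add: sff_level_def L11_def L12_def L22_def alp_def gam_def)
   have "p\<^sup>2 * sff_level k i (sc c) w = 0" "q\<^sup>2 * sff_level k i (sc c) w = 0" unfolding lev using Q rel by algebra+
   then have "p = 0" "q = 0" using bad by (auto simp: bad_def)
   then show False using J by (simp add: M.J_def p_def q_def)
  qed
  then show ?thesis using crit y(1) by blast
 qed
 have "negligible {c. \<exists>w\<in>V. bad c w}" by (rule negligible_subset[OF neg]) (use sub in blast)
 then show ?thesis using V(1,3) by blast
qed

theorem bad_negligible: "negligible {c. \<exists>w. bad c w}"
proof (rule negligible_locally[where Om="{w \<in> Om1. rjac w ~= 0}"])
 show "\<exists>V. open V \<and> w \<in> V \<and> negligible {c. \<exists>w\<in>V. bad c w}" if "w \<in> {w \<in> Om1. rjac w ~= 0}" for w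
  using bad_locally_negligible that by blast
 show "w \<in> {w \<in> Om1. rjac w ~= 0}" if "bad c w" for c w using bad_rjac[OF that] that by (simp add: bad_def)
qed

end

subsection \<open>Charts of the source surface\<close>

lemma local_param_image: "local_param M U psi ==> psi ` U \<subseteq> M"
 using openin_subset[of "top_of_set M" "psi ` U"] unfolding local_param_def by simp

text \<open>The inverse of a local parametrisation is given only as a homeomorphism onto its image.
  Projecting the ambient space to the tangent plane at one point makes the chart a local
  diffeomorphism of the plane, whose smooth inverse expresses Psi through mu.\<close>

lemma smooth_on_chart_inverse:
 fixes psi :: "plane => 'a::euclidean_space" and mu :: "plane \<times> real => 'a"
 assumes psi: "local_param M U psi" and W: "open W" "smooth_on W mu" "mu ` W \<subseteq> M" "w0 \<in> W" and u0: "u0 \<in> U" "mu w0 = psi u0"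
 obtains On Psi where "open On" "w0 \<in> On" "On \<subseteq> W" "smooth_on On Psi" "Psi w0 = u0" "!!w. w \<in> On ==> Psi w \<in> U \<and> psi (Psi w) = mu w"
proof -
 have U: "open U" "smooth_on U psi" "inj (frechet_derivative psi (at u0))" "openin (top_of_set M) (psi ` U)"
  using psi u0(1) unfolding local_param_def by auto
 obtain psi' where h: "homeomorphism U (psi ` U) psi psi'" using psi unfolding local_param_def by blast
 obtain T where T: "open T" "psi ` U = M \<inter> T" using U(4) unfolding openin_open by blast
 define W1 where "W1 = W \<inter> mu -` T"
 have W1: "open W1" "w0 \<in> W1"
  unfolding W1_def using continuous_open_preimage[OF smooth_on_imp_continuous_on[OF W(2)] W(1) T(1)] W(4) u0 T(2) by auto
 have inpsi: "mu w \<in> psi ` U" if "w \<in> W1" for w using that W(3) T(2) by (auto simp: W1_def)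
 define Psi where "Psi w = psi' (mu w)" for w
 have Psi: "Psi w \<in> U" "psi (Psi w) = mu w" if "w \<in> W1" for w
  using inpsi[OF that] h unfolding Psi_def homeomorphism_def by auto
 have Psi0: "Psi w0 = u0" using h u0 unfolding Psi_def homeomorphism_def by auto
 have cont: "continuous_on W1 Psi"
 proof -
  have "continuous_on (psi ` U) psi'" using h by (simp add: homeomorphism_def)
  moreover have "continuous_on W1 mu" using smooth_on_imp_continuous_on[OF W(2)] by (rule continuous_on_subset) (auto simp: W1_def)
  ultimately show ?thesis unfolding Psi_def by (rule continuous_on_compose2) (use inpsi in blast)
 qed
 define e1 e2 where "e1 = pd (1, 0) psi u0" and "e2 = pd (0, 1) psi u0"
 define prj where "prj y = (y \<bullet> e1, y \<bullet> e2)" for y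
 have sprj: "smooth_on UNIV prj" unfolding prj_def[abs_def] by (intro smooth_intros open_UNIV)
 have sprjpsi: "smooth_on U (%u. prj (psi u))" by (rule smooth_on_compose[OF sprj U(2,1) open_UNIV]) simp
 have d: "psi differentiable (at u0)" by (rule smooth_on_differentiable[OF U(2,1) u0(1)])
 have p: "pd v (%u. prj (psi u)) u0 = prj (pd v psi u0)" for v
  unfolding prj_def by (rule pd_eqI[THEN trans]) (auto intro!: derivative_eq_intros has_derivative_pd d)
 have inj: "v = 0" if z: "pd v (%u. prj (psi u)) u0 = 0" for v
 proof -
  obtain x y where v: "v = (x, y)" by (metis surj_pair)
  have "pd (x *. (1, 0) + y *. (0, 1)) psi u0 = x *. e1 + y *. e2" unfolding e1_def e2_def by (rule pd_linear(1)[OF d])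
  then have pv: "pd v psi u0 = x *. e1 + y *. e2" by (simp add: v)
  have "prj (pd v psi u0) = 0" using z by (simp only: p)
  then have "pd v psi u0 \<bullet> e1 = 0" "pd v psi u0 \<bullet> e2 = 0" unfolding prj_def by (auto simp: zero_prod_def)
  \<comment> \<open>The vector is tangent, a combination of e1 and e2, and orthogonal to
    both.\<close>
  then have "pd v psi u0 \<bullet> pd v psi u0 = 0" by (subst (2) pv) (simp add: inner_add_right)
  then have "frechet_derivative psi (at u0) v = 0" by (simp add: pd_def)
  then show "v = 0" using U(3) linear_injective_0[OF linear_frechet_derivative[OF d]] by blast
 qed
 obtain V where V: "open V" "V \<subseteq> U" "u0 \<in> V" "diffeo_on V (%u. prj (psi u))"
  using smooth_inverse_function[OF U(1) sprjpsi u0(1) inj] by metis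
 note D = diffeo_onD[OF V(4)]
 define On where "On = W1 \<inter> Psi -` V"
 have On: "open On" "w0 \<in> On" unfolding On_def using continuous_open_preimage[OF cont W1(1) V(1)] W1(2) Psi0 V(3) by auto
 have "smooth_on On (%w. inv_into V (%u. prj (psi u)) (prj (mu w)))"
 proof (rule smooth_on_compose[OF D(5) _ On(1) D(2)])
  have "smooth_on On mu" by (rule smooth_on_subset[OF W(2)]) (auto simp: On_def W1_def)
  then show "smooth_on On (%w. prj (mu w))" by (rule smooth_on_compose[OF sprj _ On(1) open_UNIV]) simp
  show "(%w. prj (mu w)) ` On \<subseteq> (%u. prj (psi u)) ` V"
  proof
   fix z assume "z \<in> (%w. prj (mu w)) ` On"
   then obtain w where w: "w \<in> W1" "Psi w \<in> V" "z = prj (mu w)" by (auto simp: On_def)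
   then show "z \<in> (%u. prj (psi u)) ` V" using Psi(2)[OF w(1)] by (metis imageI)
  qed
 qed
 moreover have "inv_into V (%u. prj (psi u)) (prj (mu w)) = Psi w" if w: "w \<in> On" for w
 proof -
  have "w \<in> W1" "Psi w \<in> V" using w by (auto simp: On_def)
  then show ?thesis using inv_into_f_f[OF D(3), of "Psi w"] Psi(2) by simp
 qed
 ultimately have "smooth_on On Psi" by (subst smooth_on_cong[OF On(1), where g="%w. inv_into V (%u. prj (psi u)) (prj (mu w))"]) auto
 then show ?thesis using that[of On Psi] On Psi0 Psi by (auto simp: On_def W1_def)
qed

text \<open>Genericity allows countably many conditions, each over a compact set. Images of balls
  form an open cover of M, from which the Lindelof property selects countably many.\<close>

lemma countable_chart_cover:
 fixes M :: "'a::euclidean_space set"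
 assumes "smooth_surface M"
 obtains \<C> :: "(plane set \<times> (plane => 'a) \<times> plane set) set" where "countable \<C>"
  "!!U psi K. (U, psi, K) \<in> \<C> ==> local_param M U psi \<and> compact K \<and> K \<subseteq> U"
  "!!m. m \<in> M ==> \<exists>U psi K u. (U, psi, K) \<in> \<C> \<and> u \<in> K \<and> psi u = m"
proof -
 define good where "good N t \<longleftrightarrow> (case t of (U, psi, K) => local_param M U psi \<and> compact K \<and> K \<subseteq> U \<and> N \<subseteq> psi ` K)"
  for N and t :: "plane set \<times> (plane => 'a) \<times> plane set"
 define \<F> where "\<F> = {N. openin (top_of_set M) N \<and> (\<exists>t. good N t)}"
 obtain \<F>' where F: "\<F>' \<subseteq> \<F>" "countable \<F>'" "\<Union>\<F>' = \<Union>\<F>"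
  using Lindelof_openin[of \<F> M] unfolding \<F>_def by blast
 define pick where "pick N = (SOME t. good N t)" for N
 have pick: "good N (pick N)" if "N \<in> \<F>" for N using that unfolding \<F>_def pick_def by (blast intro: someI_ex)
 have cov: "m \<in> \<Union>\<F>" if m: "m \<in> M" for m
 proof -
  obtain U psi where c: "local_param M U psi" "m \<in> psi ` U" using assms m unfolding smooth_surface_def by blast
  then obtain u where u: "u \<in> U" "psi u = m" by blast
  obtain psi' where h: "homeomorphism U (psi ` U) psi psi'" and oU: "open U" and oM: "openin (top_of_set M) (psi ` U)"
   using c(1) unfolding local_param_def by blast
  obtain e where e: "e > 0" "cball u e \<subseteq> U" using oU u(1) open_contains_cball by blast
  have "openin (top_of_set U) (ball u e)" by (rule open_subset) (use e(2) ball_subset_cball[of u e] in auto)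
  then have "openin (top_of_set M) (psi ` ball u e)" using homeomorphism_imp_open_map[OF h] openin_trans oM by blast
  moreover have "good (psi ` ball u e) (U, psi, cball u e)" using c(1) e(2) ball_subset_cball[of u e] by (auto simp: good_def)
  moreover have "m \<in> psi ` ball u e" using u e by auto
  ultimately show ?thesis unfolding \<F>_def by blast
 qed
 show ?thesis
 proof (rule that[of "pick ` \<F>'"])
  show "countable (pick ` \<F>')" using F(2) by simp
  show "local_param M U psi \<and> compact K \<and> K \<subseteq> U" if t: "(U, psi, K) \<in> pick ` \<F>'" for U psi K
  proof -
   obtain N where N: "N \<in> \<F>'" "(U, psi, K) = pick N" using t by blast
   have "good N (U, psi, K)" unfolding N(2) using pick N(1) F(1) by blast
   then show ?thesis by (simp add: good_def)
  qed
  show "\<exists>U psi K u. (U, psi, K) \<in> pick ` \<F>' \<and> u \<in> K \<and> psi u = m" if m: "m \<in> M" for m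
  proof -
   obtain N where N: "N \<in> \<F>'" "m \<in> N" using cov[OF m] F(3) by blast
   obtain U psi K where t: "pick N = (U, psi, K)" by (metis prod_cases3)
   have "good N (U, psi, K)" using pick[of N] N(1) F(1) t by auto
   then obtain u where "u \<in> K" "psi u = m" using N(2) unfolding good_def by auto
   moreover have "(U, psi, K) \<in> pick ` \<F>'" using t N(1) by (metis imageI)
   ultimately show ?thesis by blast
  qed
 qed
qed

subsection \<open>Openness and density\<close>

text \<open>A chart with empty domain imposes no condition on jets, so the set of all families is
  itself one of the generating sets.\<close>

lemma topspace_C_infinity: "topspace (C_infinity_topology M A) = surface_families M A"
proof -
 have e: "local_param M {} psi" for psi :: "plane => 'a"
  unfolding local_param_def smooth_on_def by (auto simp: homeomorphism_def differentiable_on_def)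
 show ?thesis unfolding C_infinity_topology_def topology_generated_by_topspace
 proof
  show "surface_families M A \<subseteq> \<Union> {N. \<exists>S\<in>surface_families M A. \<exists>U psi K. \<exists>k::nat. \<exists>dlt>0.
    local_param M U psi \<and> compact K \<and> K \<subseteq> U \<times> UNIV \<and>
    N = {S' \<in> surface_families M A. \<forall>vs. set vs \<subseteq> Basis \<and> length vs \<le> k -->
       (\<forall>x\<in>K. norm (partials vs (in_chart S' psi) x - partials vs (in_chart S psi) x) < dlt)}}"
  proof
   fix S assume S: "S \<in> surface_families M A"
   show "S \<in> \<Union> {N. \<exists>S\<in>surface_families M A. \<exists>U psi K. \<exists>k::nat. \<exists>dlt>0.
    local_param M U psi \<and> compact K \<and> K \<subseteq> U \<times> UNIV \<and>
    N = {S' \<in> surface_families M A. \<forall>vs. set vs \<subseteq> Basis \<and> length vs \<le> k -->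
       (\<forall>x\<in>K. norm (partials vs (in_chart S' psi) x - partials vs (in_chart S psi) x) < dlt)}}"
    by (rule UnionI[of "surface_families M A"], unfold mem_Collect_eq, rule bexI[OF _ S],
      rule exI[of _ "{}"], rule exI[of _ "%_. undefined"], rule exI[of _ "{}"], rule exI[of _ 0], rule exI[of _ 1])
     (use e S in auto)
  qed
 qed auto
qed

lemma surface_familiesD:
 assumes "S \<in> surface_families M A" "local_param M U psi"
 shows "open (U \<times> (UNIV :: real set))" "smooth_on (U \<times> UNIV) (in_chart S psi)" "u \<in> U ==> inj (frechet_derivative (%x. S (psi x) eps) (at u))"
 using assms unfolding surface_families_def local_param_def by (auto intro: open_Times)

lemma open_regular:
 assumes psi: "local_param M U psi" and K: "compact K" "K \<subseteq> U \<times> UNIV"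
 shows "openin (C_infinity_topology M A) {S \<in> surface_families M A. regular rho k i j (in_chart S psi) K}"
proof (subst openin_subopen, intro ballI)
 fix S assume "S \<in> {S \<in> surface_families M A. regular rho k i j (in_chart S psi) K}"
 then have S: "S \<in> surface_families M A" "regular rho k i j (in_chart S psi) K" by auto
 note D = surface_familiesD[OF _ psi]
 obtain n dlt where n: "dlt > 0" "!!s'. smooth_on (U \<times> UNIV) s' ==> close_jets n dlt K (in_chart S psi) s' ==> regular rho k i j s' K"
  using regular_stable[OF D(1,2)[OF S(1)] K S(2)] by blast
 define N where "N = {S' \<in> surface_families M A. \<forall>vs. set vs \<subseteq> Basis \<and> length vs \<le> n -->
       (\<forall>x\<in>K. norm (partials vs (in_chart S' psi) x - partials vs (in_chart S psi) x) < dlt)}"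
 have "openin (C_infinity_topology M A) N" unfolding C_infinity_topology_def
  by (rule topology_generated_by_Basis, unfold mem_Collect_eq, rule bexI[OF _ S(1)], rule exI[of _ U], rule exI[of _ psi],
    rule exI[of _ K], rule exI[of _ n], rule exI[of _ dlt]) (use n psi K N_def in blast)
 moreover have "S \<in> N" using S(1) n(1) by (simp add: N_def)
 moreover have "N \<subseteq> {S \<in> surface_families M A. regular rho k i j (in_chart S psi) K}"
  using n(2) D(2) unfolding N_def close_jets_def by blast
 ultimately show "\<exists>T. openin (C_infinity_topology M A) T \<and> S \<in> T \<and> T \<subseteq> {S \<in> surface_families M A. regular rho k i j (in_chart S psi) K}"
  by blast
qed

lemma affine_subset_projective: "affine_space \<subseteq> projective_space"
 unfolding affine_space_def projective_space_def by (intro image_mono) auto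

context perturbation
begin

text \<open>Time enters through arctan, so the perturbation is uniformly small for all
  times.\<close>

definition pfam :: "('m => real => real^4^4) => par => 'm => real => real^4^4" where
 "pfam S c = (%m eps. pert c (arctan eps) (S m eps))"

lemma in_chart_pfam: "in_chart (pfam S c) psi = (%w. pert c (arctan (snd w)) (in_chart S psi w))"
 by (auto simp: in_chart_def pfam_def)

lemma arctan_le_2: "\<bar>arctan x\<bar> \<le> 2" using arctan_bounded[of x] pi_less_4 by auto

lemma pfam_in_families:
 fixes M :: "'m::euclidean_space set"
 assumes S: "S \<in> surface_families M A" and A: "A = projective_space \<or> A = affine_space \<and> l ~= 4"
  and imm: "!!t P h. \<bar>t\<bar> \<le> 2 ==> P \<in> projective_space ==> h ~= 0 ==>
   pd ((h, 0), 0) (%z. pert (snd z) (TT z) (PP z)) ((P, t), c) ~= 0"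
 shows "pfam S c \<in> surface_families M A"
proof -
 have AP: "A \<subseteq> projective_space" using A affine_subset_projective by auto
 have SA: "S m eps \<in> A" if "m \<in> M" for m eps using S that by (simp add: surface_families_def)
 have chart: "smooth_on (U \<times> UNIV) (in_chart (pfam S c) psi) \<and>
   (\<forall>u\<in>U. \<forall>eps. inj (frechet_derivative (%x. pfam S c (psi x) eps) (at u)))" if psi: "local_param M U psi" for U psi
 proof -
  note D = surface_familiesD[OF S psi]
  have oU: "open U" and im: "psi ` U \<subseteq> M" using psi local_param_image unfolding local_param_def by blast+
  have pr: "in_chart S psi w \<in> projective_space" if "w \<in> U \<times> UNIV" for w
   using that SA im AP by (auto simp: in_chart_def)
  have "inj (frechet_derivative (%x. pfam S c (psi x) eps) (at u))" if u: "u \<in> U" for u eps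
  proof -
   let ?g = "%x. S (psi x) eps" and ?t = "arctan eps"
   let ?G = "%z. pert (snd z) (TT z) (PP z)"
   have dg: "?g differentiable (at u)"
   proof -
    have "smooth_on {x. (x, eps) \<in> U \<times> UNIV} (%x. in_chart S psi (x, eps))" by (rule smooth_on_slice[OF D(1,2)])
    then have "smooth_on U ?g" by (simp add: in_chart_def)
    then show ?thesis using smooth_on_differentiable oU u by blast
   qed
   have P: "?g u \<in> projective_space" using pr[of "(u, eps)"] u by (simp add: in_chart_def)
   have z: "((?g u, ?t), c) \<in> Z" using pert_in_projective_space[OF P, of c ?t] unfolding Z_def by simp
   have dG: "?G differentiable (at ((?g u, ?t), c))" by (rule smooth_on_differentiable[OF smooth_pert open_Z z])
   have sl1: "pd (h, 0) (%y. ?G (y, c)) (?g u, ?t) = pd ((h, 0), 0) ?G ((?g u, ?t), c)" for h :: "real^4^4"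
    by (rule pd_slice[OF dG])
   have dG1: "(%y. ?G (y, c)) differentiable (at (?g u, ?t))"
    using differentiable_compose[of ?G "%y. (y, c)" "(?g u, ?t)" UNIV] dG by simp
   have sl2: "pd h (%P. pert c ?t P) (?g u) = pd (h, 0) (%y. ?G (y, c)) (?g u, ?t)" for h using pd_slice[OF dG1, of h] by simp
   have dp: "(%P. pert c ?t P) differentiable (at (?g u))"
    using differentiable_compose[of "%y. ?G (y, c)" "%P. (P, ?t)" "?g u" UNIV] dG1 by simp
   have ch: "pd v (%x. pfam S c (psi x) eps) u = pd ((pd v ?g u, 0), 0) ?G ((?g u, ?t), c)" for v
    unfolding pfam_def by (subst pd_compose[OF dg dp]) (simp only: sl1 sl2)
   have dS: "(%x. pfam S c (psi x) eps) differentiable (at u)"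
    unfolding pfam_def by (rule differentiable_compose[OF _ dg]) (use dp in simp)
   have "v = 0" if v0: "frechet_derivative (%x. pfam S c (psi x) eps) (at u) v = 0" for v
   proof -
    have "pd ((pd v ?g u, 0), 0) ?G ((?g u, ?t), c) = 0" using v0 ch[of v] by (simp add: pd_def)
    then have "pd v ?g u = 0" using imm[OF arctan_le_2 P] by blast
    then have "frechet_derivative ?g (at u) v = 0" by (simp add: pd_def)
    then show "v = 0" using D(3)[OF u] linear_injective_0[OF linear_frechet_derivative[OF dg]] by blast
   qed
   then show ?thesis using linear_injective_0[OF linear_frechet_derivative[OF dS]] by blast
  qed
  then show ?thesis unfolding in_chart_pfam using smooth_pert_slice[OF D(1,2) pr] by blast
 qed
 have "pfam S c m eps \<in> A" if "m \<in> M" for m eps using A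
 proof
  assume "A = projective_space"
  then show ?thesis using SA[OF that, of eps] pert_in_projective_space[of "S m eps" c "arctan eps"] unfolding pfam_def by simp
 next
  assume "A = affine_space \<and> l ~= 4"
  then show ?thesis using SA[OF that, of eps] pert_in_affine_space[of "S m eps" c "arctan eps"] unfolding pfam_def by simp
 qed
 then show ?thesis using chart unfolding surface_families_def by blast
qed

text \<open>Induction over the generation of the topology; finite intersections take the smaller
  radius, and a generating set is treated by \<open>close_jets_pert\<close> relative to its own
  centre.\<close>

lemma pfam_tendsto:
 fixes M :: "'m::euclidean_space set"
 assumes S: "S \<in> surface_families M A" and A: "A \<subseteq> projective_space"
  and O: "openin (C_infinity_topology M A) N" "S \<in> N"
 shows "\<exists>eta>0. \<forall>c. norm c < eta --> pfam S c \<in> surface_families M A --> pfam S c \<in> N"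
proof -
 have "S \<in> N --> ?thesis" using O(1) unfolding C_infinity_topology_def openin_topology_generated_by_iff
 proof (induction rule: generate_topology_on.induct)
  case Empty
  then show ?case by simp
 next
  case (Int a b)
  show ?case
  proof
   assume ab: "S \<in> a \<inter> b"
   obtain eta1 where 1: "eta1 > 0" "\<forall>c. norm c < eta1 --> pfam S c \<in> surface_families M A --> pfam S c \<in> a" using Int ab by blast
   obtain eta2 where 2: "eta2 > 0" "\<forall>c. norm c < eta2 --> pfam S c \<in> surface_families M A --> pfam S c \<in> b" using Int ab by blast
   show "\<exists>eta>0. \<forall>c. norm c < eta --> pfam S c \<in> surface_families M A --> pfam S c \<in> a \<inter> b"
    by (rule exI[of _ "min eta1 eta2"]) (use 1 2 in auto)
  qed
 next
  case (UN K)
  show ?case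
  proof
   assume "S \<in> \<Union>K"
   then obtain a where "a \<in> K" "S \<in> a" by blast
   then show "\<exists>eta>0. \<forall>c. norm c < eta --> pfam S c \<in> surface_families M A --> pfam S c \<in> \<Union>K" using UN by blast
  qed
 next
  case (Basis N)
  then obtain S1 U psi K n dlt where b: "S1 \<in> surface_families M A" "local_param M U psi" "compact K" "K \<subseteq> U \<times> UNIV"
   and N: "N = {S' \<in> surface_families M A. \<forall>vs. set vs \<subseteq> Basis \<and> length vs \<le> n -->
       (\<forall>x\<in>K. norm (partials vs (in_chart S' psi) x - partials vs (in_chart S1 psi) x) < dlt)}" by blast
  show ?case
  proof
   assume SN: "S \<in> N"
   have im: "psi ` U \<subseteq> M" by (rule local_param_image[OF b(2)])
   have pr: "in_chart S psi w \<in> projective_space" if "w \<in> U \<times> UNIV" for w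
    using that S im A unfolding surface_families_def by (auto simp: in_chart_def)
   have "\<exists>eta>0. \<forall>c. norm c < eta --> close_jets n dlt K (in_chart S1 psi) (%w. pert c (arctan (snd w)) (in_chart S psi w))"
    by (rule close_jets_pert[OF surface_familiesD(1,2)[OF S b(2)] pr b(3,4) _ surface_familiesD(2)[OF b(1,2)]])
     (use SN N in blast)+
   then show "\<exists>eta>0. \<forall>c. norm c < eta --> pfam S c \<in> surface_families M A --> pfam S c \<in> N"
    unfolding N close_jets_def in_chart_pfam[symmetric] by blast
  qed
 qed
 then show ?thesis using O(2) by blast
qed

end

text \<open>Almost every small parameter is free of bad points. In the affine case k = 4 forces the
  perturbed coordinate l to be another one, which keeps affine space invariant.\<close>

lemma dense_regular:
 fixes M :: "'m::euclidean_space set"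
 assumes psi: "local_param M U psi" and K: "K \<subseteq> U \<times> UNIV" and ijk: "i ~= j" "i ~= k" "j ~= k" and rho: "rho > 0"
  and A: "A = projective_space \<or> A = affine_space \<and> k = 4"
  and S: "S \<in> surface_families M A" and N: "openin (C_infinity_topology M A) N" "S \<in> N"
 shows "\<exists>S'\<in>N. regular rho k i j (in_chart S' psi) K"
proof -
 obtain l where l: "i ~= l" "j ~= l" "l ~= k"
 proof -
  have "card {i, j, k} < card (UNIV :: 4 set)" using card_insert_le_m1[of 3] by (simp add: card_insert_if)
  then obtain l where "l \<notin> {i, j, k}" by (metis UNIV_eq_I less_irrefl)
  then have "i ~= l" "j ~= l" "l ~= k" by auto
  then show ?thesis by (rule that)
 qed
 \<comment> \<open>Perturbation divides the diagonal entry by \<open>nrm\<close>, which exceeds 1/2.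
   An entry of at least rho afterwards was above rho/2 before, hence in the region where the cut-off
   is 1.\<close>
 obtain bet :: "real => real" where b: "smooth_on UNIV bet" "!!t. t \<le> rho / 2 / 2 ==> bet t = 0" "!!t. t \<ge> rho / 2 ==> bet t = 1"
  using smooth_step[of "rho / 2"] rho by (metis half_gt_zero)
 interpret perturbation i j l k bet "rho / 2" by unfold_locales (use ijk l rho b in auto)
 have A': "A = projective_space \<or> A = affine_space \<and> l ~= 4" using A l(3) by auto
 have AP: "A \<subseteq> projective_space" using A affine_subset_projective by auto
 have im: "psi ` U \<subseteq> M" by (rule local_param_image[OF psi])
 interpret C: perturbed_chart i j l k bet "rho / 2" "U \<times> UNIV" "in_chart S psi"
 proof
  show "in_chart S psi w \<in> projective_space" if "w \<in> U \<times> UNIV" for w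
   using that S im AP unfolding surface_families_def by (auto simp: in_chart_def)
 qed (rule surface_familiesD[OF S psi])+
 obtain eta1 where 1: "eta1 > 0" "!!c t P. norm c < eta1 ==> \<bar>t\<bar> \<le> 2 ==> P \<in> projective_space ==> nrm c t P > 1 / 2"
  "!!c t P h. norm c < eta1 ==> \<bar>t\<bar> \<le> 2 ==> P \<in> projective_space ==> h ~= 0 ==>
   pd ((h, 0), 0) (%z. pert (snd z) (TT z) (PP z)) ((P, t), c) ~= 0" by (rule small_parameters) (rule that, assumption+)
 obtain eta2 where 2: "eta2 > 0" "\<forall>c. norm c < eta2 --> pfam S c \<in> surface_families M A --> pfam S c \<in> N"
  using pfam_tendsto[OF S AP N] by blast
 have "\<not> ball 0 (min eta1 eta2) \<subseteq> {c. \<exists>w. C.bad c w}"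
 proof
  assume "ball 0 (min eta1 eta2) \<subseteq> {c. \<exists>w. C.bad c w}"
  then have "negligible (ball (0 :: par) (min eta1 eta2))" using C.bad_negligible negligible_subset by blast
  then have "ball (0 :: par) (min eta1 eta2) = {}" using open_not_negligible open_ball by blast
  then show False using 1(1) 2(1) by auto
 qed
 then obtain c where c: "norm c < eta1" "norm c < eta2" "!!w. \<not> C.bad c w" by (auto simp: subset_iff)
 have "pfam S c \<in> surface_families M A" by (rule pfam_in_families[OF S A' 1(3)[OF c(1)]])
 then have "pfam S c \<in> N" using 2(2) c(2) by blast
 moreover have "regular rho k i j (in_chart (pfam S c) psi) K" unfolding regular_def
 proof
  have e: "in_chart (pfam S c) psi = C.sc c" unfolding in_chart_pfam C.sc_def[abs_def] ..
  assume "\<exists>w\<in>K. critical_zero (sff_det (col k (in_chart (pfam S c) psi))) w \<and> in_chart (pfam S c) psi w $ k $ k \<ge> rho \<and>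
  \<bar>jac k i j (in_chart (pfam S c) psi) w * sff_level k i (in_chart (pfam S c) psi) w\<bar> \<ge> rho"
  then obtain w where w: "w \<in> K" "critical_zero (sff_det (col k (C.sc c))) w" "C.sc c w $ k $ k \<ge> rho"
   "\<bar>jac k i j (C.sc c) w * sff_level k i (C.sc c) w\<bar> \<ge> rho" unfolding e by blast
  have wU: "w \<in> U \<times> UNIV" using w(1) K by blast
  define n where "n = nrm c (arctan (snd w)) (in_chart S psi w)"
  have n: "n > 1 / 2" unfolding n_def by (rule 1(2)[OF c(1) arctan_le_2 C.proj_s[OF wU]])
  have "in_chart S psi w $ k $ k / n \<ge> rho" using w(3) by (simp add: C.sc_def pert_kk n_def)
  then have "in_chart S psi w $ k $ k \<ge> rho * n" using n by (simp add: field_simps)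
  moreover have "rho * n > rho / 2" using n rho by simp
  ultimately have "w \<in> C.Om1" using wU by (simp add: C.Om1_def)
  moreover have "jac k i j (C.sc c) w * sff_level k i (C.sc c) w ~= 0" using w(4) rho by auto
  ultimately have "C.bad c w" using w(2) by (simp add: C.bad_def)
  then show False using c(3) by blast
 qed
 ultimately show ?thesis by blast
qed

subsection \<open>Versality of the generic family\<close>

lemma smooth_on_proj_point: "smooth_on {v. v ~= 0} proj_point"
proof -
 have o: "open {v :: real^4. v ~= 0}" by (simp add: open_Collect_neq)
 show ?thesis unfolding proj_point_def
  by (intro smooth_on_vec_lambda smooth_on_divide smooth_on_mult smooth_on_vec_nth smooth_on_inner smooth_on_id o) auto
qed

text \<open>If all these minors vanished, the affine coordinates with denominator k would have a
  common kernel vector. The projection matrix is a function of these coordinates, so the family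
  would not be immersed.\<close>

lemma jac_nonzero:
 fixes s :: "plane \<times> real => real^4^4"
 assumes Om: "open Om" "smooth_on Om s" "!!w. w \<in> Om ==> s w \<in> projective_space" and w: "w \<in> Om"
  and k: "s w $ k $ k ~= 0" and imm: "!!v. pd (v, 0) s w = 0 ==> v = 0"
 obtains i j where "i ~= j" "i ~= k" "j ~= k" "jac k i j s w ~= 0"
proof (rule ccontr)
 assume no: "\<not> thesis"
 define Om' where "Om' = Om \<inter> (%w. s w $ k $ k) -` (- {0})"
 have O': "open Om'" "w \<in> Om'"
 proof -
  have "smooth_on Om (%w. s w $ k $ k)" by (intro smooth_intros Om)
  from continuous_open_preimage[OF smooth_on_imp_continuous_on[OF this] Om(1)] show "open Om'" unfolding Om'_def by auto
  show "w \<in> Om'" using w k by (simp add: Om'_def)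
 qed
 define R where "R w = (\<chi> p. s w $ p $ k / s w $ k $ k)" for w
 have sr: "smooth_on Om' (%w. s w $ p $ k / s w $ k $ k)" for p
  by (intro smooth_on_divide smooth_on_vec_nth O'(1) smooth_on_subset[OF Om(2)]) (auto simp: Om'_def)
 have sR: "smooth_on Om' R" unfolding R_def[abs_def] by (intro smooth_on_vec_lambda sr O'(1))
 have dr: "dcoord k p v s w = (s w $ k $ k)\<^sup>2 * pd v R w $ p" for p v
 proof -
  have "R differentiable (at w)" by (rule smooth_on_differentiable[OF sR O'])
  then have "pd v R w $ p = pd v (%w. R w $ p) w" by (simp add: pd_vec_nth)
  then show ?thesis using dcoord_ratio[OF Om(1,2) w k, of p v] by (simp add: R_def)
 qed
 define al be where "al p = pd eX R w $ p" and "be p = pd eY R w $ p" for p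
 have Rk: "al k = 0" "be k = 0" using dr[of k eX] dr[of k eY] k by (auto simp: dcoord_def al_def be_def)
 have det0: "al i * be j - al j * be i = 0" for i j
 proof (cases "i = j \<or> i = k \<or> j = k")
  case True
  then show ?thesis using Rk by auto
 next
  case False
  then have "jac k i j s w = 0" using no that by blast
  then have "(s w $ k $ k) ^ 4 * (al i * be j - al j * be i) = 0" unfolding jac_def dr al_def be_def by algebra
  then show ?thesis using k by simp
 qed
 \<comment> \<open>All pairs (al p, be p) are proportional; any nonzero one turned by a right angle
   is orthogonal to all of them.\<close>
 obtain v1 v2 where v: "(v1, v2) ~= (0, 0)" "!!p. v1 * al p + v2 * be p = 0"
 proof (cases "\<exists>p. al p ~= 0 \<or> be p ~= 0")
  case True
  then obtain p where "al p ~= 0 \<or> be p ~= 0" by blast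
  moreover have "- be p * al q + al p * be q = 0" for q using det0[of p q] by (simp add: algebra_simps)
  ultimately show ?thesis using that[of "- be p" "al p"] by auto
 next
  case False
  then show ?thesis using that[of 1 0] by auto
 qed
 have dR: "pd ((v1, v2), 0) R w = 0"
 proof -
  have "pd (v1 *. eX + v2 *. eY) R w = v1 *. pd eX R w + v2 *. pd eY R w"
   by (rule pd_linear(1)[OF smooth_on_differentiable[OF sR O']])
  also have "\<dots> = 0" using v(2) by (simp add: vec_eq_iff al_def be_def)
  finally show ?thesis by simp
 qed
 have sp: "s w = proj_point (R w)" "R w ~= 0" if w: "w \<in> Om'" for w
 proof -
  have wk: "w \<in> Om" "s w $ k $ k ~= 0" using w by (auto simp: Om'_def)
  obtain x where x: "x ~= 0" "s w = proj_point x" using Om(3)[OF wk(1)] unfolding projective_space_def by blast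
  have xk: "x $ k ~= 0" using wk(2) unfolding x(2) by (auto simp: proj_point_def)
  have R: "R w = inverse (x $ k) *. x" using xk x(1) by (simp add: R_def x(2) proj_point_def vec_eq_iff field_simps)
  show "s w = proj_point (R w)" unfolding R x(2) using xk x(1)
   by (simp add: proj_point_def vec_eq_iff field_simps power2_eq_square)
  show "R w ~= 0" using R xk x(1) by auto
 qed
 have o: "open {v :: real^4. v ~= 0}" by (simp add: open_Collect_neq)
 have "pd ((v1, v2), 0) s w = pd ((v1, v2), 0) (%w. proj_point (R w)) w" by (rule pd_cong_open[OF O' sp(1)])
 also have "\<dots> = pd (pd ((v1, v2), 0) R w) proj_point (R w)"
  by (rule pd_compose[OF smooth_on_differentiable[OF sR O'] smooth_on_differentiable[OF smooth_on_proj_point o]]) (use sp(2)[OF O'(2)] in simp)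
 also have "\<dots> = 0"
  unfolding dR by (rule pd_linear(4)[OF smooth_on_differentiable[OF smooth_on_proj_point o]]) (use sp(2)[OF O'(2)] in simp)
 finally have "(v1, v2) = 0" by (rule imm)
 then show False using v(1) by (simp add: zero_prod_def)
qed

text \<open>The two expressions are the values of the form at (b, -a) and (b', -a'). A form of rank
  one vanishes on a single line only, and these vectors are independent.\<close>

lemma rank_one_levels:
 fixes l m n a b a' b' :: real
 assumes "l * n - m\<^sup>2 = 0" "l ~= 0 \<or> m ~= 0 \<or> n ~= 0" "a * b' - a' * b ~= 0"
 shows "l * b\<^sup>2 - 2 * m * a * b + n * a\<^sup>2 ~= 0 \<or> l * b'\<^sup>2 - 2 * m * a' * b' + n * a'\<^sup>2 ~= 0"
proof (rule ccontr)
 assume "\<not> ?thesis"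
 then have z: "l * b\<^sup>2 - 2 * m * a * b + n * a\<^sup>2 = 0" "l * b'\<^sup>2 - 2 * m * a' * b' + n * a'\<^sup>2 = 0" by auto
 have "(l * b - m * a)\<^sup>2 = 0" "(m * b - n * a)\<^sup>2 = 0" "(l * b' - m * a')\<^sup>2 = 0" "(m * b' - n * a')\<^sup>2 = 0"
  using z assms(1) by algebra+
 then have k: "l * b = m * a" "m * b = n * a" "l * b' = m * a'" "m * b' = n * a'" by simp_all
 have "l * (a * b' - a' * b) = 0" "m * (a * b' - a' * b) = 0" "n * (a * b' - a' * b) = 0" using k by algebra+
 then show False using assms(2,3) by auto
qed

text \<open>Translates failure of versality in a Monge chart into a violation visible in every chart
  of the source around the point. KS lists the admissible denominators: in affine space only the
  fourth coordinate.\<close>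

lemma degenerate_in_chart:
 fixes M :: "'a::euclidean_space set" and psi :: "plane => 'a"
 assumes S: "S \<in> surface_families M A" and A: "A = projective_space \<and> KS = UNIV \<or> A = affine_space \<and> KS = {4}"
  and mc: "monge_chart M S W f" and q: "(q, eps0) \<in> W" and p: "parabolic_morse (f eps0) q" "unique_asymptotic (f eps0) q"
  and nv: "pd (0, 1) (%(p, eps). hess_det (f eps) p) (q, eps0) = 0"
 obtains m where "m \<in> M" "!!(psi :: plane => 'a) U u. local_param M U psi ==> u \<in> U ==> psi u = m ==>
  \<exists>k\<in>KS. \<exists>i j. i ~= j \<and> i ~= k \<and> j ~= k \<and> critical_zero (sff_det (col k (in_chart S psi))) (u, eps0) \<and>
   in_chart S psi (u, eps0) $ k $ k > 0 \<and> jac k i j (in_chart S psi) (u, eps0) * sff_level k i (in_chart S psi) (u, eps0) ~= 0"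
proof -
 obtain T :: "real^4^4" and mu where W: "open W" "smooth_on W (%(p, eps). f eps p)" and T: "invertible T"
  and mu: "smooth_on W mu" "mu ` W \<subseteq> M"
  and eq: "!!p eps. (p, eps) \<in> W ==> S (mu (p, eps)) eps = proj_point (T *v vector [fst p, snd p, f eps p, 1])"
  using mc unfolding monge_chart_def by blast
 define F where "F = (%(p, eps). f eps p)"
 have sF: "smooth_on W F" using W(2) by (simp add: F_def)
 have h0: "hess_det (f eps0) q = 0" using p(1) by (simp add: parabolic_morse_def)
 interpret G: graph_family W f "(1,0)" "(0,1)" by unfold_locales (use W in auto)
 have GF: "G.F = F" by (simp add: G.F_def F_def)
 have hd: "hess_det (f eps) p = hess F (p, eps)" if "(p, eps) \<in> W" for p eps
  using G.hess_det_eq[OF that] by (simp add: hess_def G.g20_def G.g11_def G.g02_def GF)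
 have sh: "smooth_on W (hess F)" by (rule smooth_on_hess[OF W(1) sF])
 have dh: "hess F differentiable (at (q, eps0))" by (rule smooth_on_differentiable[OF sh W(1) q])
 have crit: "critical_zero (hess F) (q, eps0)" unfolding critical_zero_def
 proof (intro conjI allI)
  show "hess F (q, eps0) = 0" using hd[OF q] h0 by simp
  fix v :: "plane \<times> real"
  have "pd (fst v) (hess_det (f eps0)) q = pd (fst v) (%p. hess F (p, eps0)) q"
   by (rule pd_cong_open[OF open_slice[OF W(1), of eps0]]) (use q hd in auto)
  also have "\<dots> = pd (fst v, 0) (hess F) (q, eps0)" by (rule pd_slice[OF dh])
  finally have "pd (fst v, 0) (hess F) (q, eps0) = frechet_derivative (hess_det (f eps0)) (at q) (fst v)" by (simp add: pd_def)
  also have "\<dots> = 0" using p(1) unfolding parabolic_morse_def by blast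
  finally have 1: "pd (fst v, 0) (hess F) (q, eps0) = 0" .
  have "pd (0, 1) (%(p, eps). hess_det (f eps) p) (q, eps0) = pd (0, 1) (hess F) (q, eps0)"
   by (rule pd_cong_open[OF W(1) q]) (use hd in auto)
  then have 2: "pd (0, 1) (hess F) (q, eps0) = 0" using nv by simp
  have "pd (1 *. (fst v, 0) + snd v *. (0, 1)) (hess F) (q, eps0) = 0"
   by (subst pd_linear(1)[OF dh]) (simp add: 1 2)
  then show "pd v (hess F) (q, eps0) = 0" by simp
 qed
 obtain e where e: "e = eX \<or> e = eY" "pd e (pd e F) (q, eps0) ~= 0"
 proof -
  obtain e e' where g: "graph_family W f e e'" "graph_family.g02 f e' (q, eps0) ~= 0"
   using parabolic_frame[OF W q h0 p(2)] by blast
  interpret g: graph_family W f e e' by (rule g(1))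
  have "pd (e', 0) (pd (e', 0) F) (q, eps0) ~= 0" using g(2) by (simp add: g.g02_def g.F_def F_def)
  moreover have "(e', 0) = eX \<or> (e', 0) = eY" using g.frame by auto
  ultimately show ?thesis using that by blast
 qed
 define t where "t p = T *v axis p 1" for p :: 4
 define ZZ where "ZZ w = fst (fst w) *. t 1 + snd (fst w) *. t 2 + F w *. t 3 + t 4" for w
 have ZZ: "T *v vector [fst (fst w), snd (fst w), F w, 1] = ZZ w" for w
 proof -
  have "(vector [x, y, z, 1] :: real^4) = x *. axis 1 1 + y *. axis 2 1 + z *. axis 3 1 + axis 4 1" for x y z
   by (simp add: vec_eq_iff forall_4 vector_def axis_def)
  then show ?thesis by (simp add: ZZ_def t_def matrix_vector_right_distrib matrix_vector_mult_scaleR)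
 qed
 have Smu: "S (mu w) (snd w) = proj_point (ZZ w)" if "w \<in> W" for w
  using eq[of "fst w" "snd w"] that ZZ[of w] by (simp add: F_def case_prod_beta)
 have detT: "det T ~= 0" using T by (simp add: invertible_det_nz)
 have ZZ0: "ZZ w ~= 0" for w
 proof
  assume "ZZ w = 0"
  then have "T *v vector [fst (fst w), snd (fst w), F w, 1] = 0" using ZZ by simp
  moreover obtain T' where "T' ** T = mat 1" using T unfolding invertible_def by blast
  ultimately have "(vector [fst (fst w), snd (fst w), F w, 1] :: real^4) = 0" by (metis matrix_left_invertible_ker)
  then have "(vector [fst (fst w), snd (fst w), F w, 1] :: real^4) $ 4 = 0" by simp
  then show False by (simp add: vector_def)
 qed
 have indep: "vol (t 4) (t 1) (t 2) (t 3) ~= 0" unfolding t_def vol_matrix using detT vol_axis by simp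
 have m: "mu (q, eps0) \<in> M" using mu(2) q by blast
 have SA: "S (mu (q, eps0)) eps0 \<in> A" using S m by (simp add: surface_families_def)
 \<comment> \<open>Some homogeneous coordinate of the point is nonzero, in affine space the fourth
   one.\<close>
 obtain k where k: "k \<in> KS" "ZZ (q, eps0) $ k ~= 0"
 proof -
  from A show ?thesis
  proof
   assume "A = projective_space \<and> KS = UNIV"
   then show ?thesis using that ZZ0[of "(q, eps0)"] by (auto simp: vec_eq_iff)
  next
   assume a: "A = affine_space \<and> KS = {4}"
   then obtain v where v: "v $ 4 ~= 0" "proj_point (ZZ (q, eps0)) = proj_point v"
    using SA Smu[OF q] unfolding affine_space_def by auto
   from v(2) have "proj_point (ZZ (q, eps0)) $ 4 $ 4 = proj_point v $ 4 $ 4" by simp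
   then have "ZZ (q, eps0) $ 4 ~= 0" using v(1) by (auto simp: proj_point_def)
   then show ?thesis using that a by blast
  qed
 qed
 show ?thesis
 proof (rule that[OF m])
  fix psi :: "plane => 'a" and U u assume psi: "local_param M U psi" and u: "u \<in> U" "psi u = mu (q, eps0)"
  define s where "s = in_chart S psi"
  note D = surface_familiesD[OF S psi, folded s_def]
  have pr: "s w \<in> projective_space" if "w \<in> U \<times> UNIV" for w
   using that S local_param_image[OF psi] A affine_subset_projective unfolding surface_families_def s_def
   by (auto simp: in_chart_def)
  obtain O1 Psi where O1: "open O1" "(q, eps0) \<in> O1" "O1 \<subseteq> W" "smooth_on O1 Psi" "Psi (q, eps0) = u"
   "!!w. w \<in> O1 ==> Psi w \<in> U \<and> psi (Psi w) = mu w"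
   using smooth_on_chart_inverse[OF psi W(1) mu q u(1) u(2)[symmetric]] by metis
  have sZ: "smooth_on O1 ZZ" unfolding ZZ_def[abs_def] by (intro smooth_intros O1(1) smooth_on_subset[OF sF O1(3)])
  define On where "On = O1 \<inter> (%w. ZZ w $ k) -` (- {0})"
  have On: "open On" "(q, eps0) \<in> On" "On \<subseteq> O1"
  proof -
   have "smooth_on O1 (%w. ZZ w $ k)" by (intro smooth_on_vec_nth sZ O1(1))
   from continuous_open_preimage[OF smooth_on_imp_continuous_on[OF this] O1(1)] show "open On" unfolding On_def by auto
  qed (use O1(2) k(2) in \<open>auto simp: On_def\<close>)
  define lam where "lam w = ZZ w $ k / (ZZ w \<bullet> ZZ w)" for w
  have sZn: "smooth_on On ZZ" by (rule smooth_on_subset[OF sZ On(3)])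
  interpret M: monge_transfer "U \<times> UNIV" On "col k s" Psi lam F "t 1" "t 2" "t 3" "t 4"
  proof
   show "smooth_on (U \<times> UNIV) (col k s)" by (rule smooth_on_col[OF D(1,2)])
   show "smooth_on On lam" unfolding lam_def[abs_def]
    by (intro smooth_on_divide smooth_on_vec_nth smooth_on_inner sZn On(1)) (simp add: ZZ0)
   show "(Psi w, snd w) \<in> U \<times> UNIV" if "w \<in> On" for w
   proof -
    have "w \<in> O1" using that On(3) by blast
    then have "Psi w \<in> U" using O1(6) by blast
    then show ?thesis by simp
   qed
   show "lam w ~= 0" if "w \<in> On" for w using that ZZ0[of w] by (simp add: lam_def On_def)
   show "col k s (Psi w, snd w) = lam w *. (fst (fst w) *. t 1 + snd (fst w) *. t 2 + F w *. t 3 + t 4)" if w: "w \<in> On" for w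
   proof -
    have "w \<in> O1" "w \<in> W" using w On(3) O1(3) by auto
    then have "s (Psi w, snd w) = proj_point (ZZ w)" using O1(6) Smu by (simp add: s_def in_chart_def)
    then show ?thesis unfolding ZZ_def[symmetric] by (simp add: col_def lam_def proj_point_def vec_eq_iff)
   qed
   show "smooth_on On F" by (rule smooth_on_subset[OF sF]) (use On(3) O1(3) in blast)
   show "smooth_on On Psi" by (rule smooth_on_subset[OF O1(4) On(3)])
  qed (rule D(1) On(1) indep)+
  have X0: "M.Xi (q, eps0) = (u, eps0)" using O1(5) by (simp add: M.Xi_def)
  define w0 where "w0 = (u, eps0)"
  have w0: "w0 \<in> U \<times> UNIV" using u(1) by (simp add: w0_def)
  have kap: "M.kpa (q, eps0) * pd e (pd e F) (q, eps0) ~= 0" using M.kpa0[OF On(2)] e(2) by simp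
  note tr = M.sff_transfer[OF On(2) e(1) e(1), unfolded X0, folded w0_def]
  have J: "M.J (q, eps0) ~= 0" using tr kap by (metis mult_zero_left)
  have cz: "critical_zero (sff_det (col k s)) w0" using M.critical_transfer[OF On(2) J] crit by (simp add: X0 w0_def)
  have L: "sff (col k s) eX eX w0 ~= 0 \<or> sff (col k s) eX eY w0 ~= 0 \<or> sff (col k s) eY eY w0 ~= 0"
   using tr kap by (metis mult_zero_right add_0)
  have L0: "sff (col k s) eX eX w0 * sff (col k s) eY eY w0 - (sff (col k s) eX eY w0)\<^sup>2 = 0"
   using cz by (simp add: critical_zero_def sff_det_def)
  have sk: "s w0 = proj_point (ZZ (q, eps0))" using u(2) Smu[OF q] by (simp add: s_def in_chart_def w0_def)
  have kk: "s w0 $ k $ k > 0"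
  proof -
   have "ZZ (q, eps0) \<bullet> ZZ (q, eps0) > 0" using ZZ0 by simp
   moreover have "ZZ (q, eps0) $ k * ZZ (q, eps0) $ k > 0" using k(2) by (simp add: zero_less_mult_iff linorder_neq_iff) blast
   ultimately show ?thesis unfolding sk by (simp add: proj_point_def)
  qed
  have imm: "v = 0" if "pd (v, 0) s w0 = 0" for v
  proof -
   have ds: "s differentiable (at (u, eps0))" by (rule smooth_on_differentiable[OF D(2,1)]) (use u in auto)
   have "pd v (%x. s (x, eps0)) u = 0" using pd_slice[OF ds, of v] that by (simp add: w0_def)
   then have z: "frechet_derivative (%x. S (psi x) eps0) (at u) v = 0" by (simp add: pd_def s_def in_chart_def)
   have "(%x. s (x, eps0)) differentiable (at u)" using differentiable_compose[of s "%x. (x, eps0)" u UNIV] ds by simp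
   then have "(%x. S (psi x) eps0) differentiable (at u)" by (simp add: s_def in_chart_def)
   then show ?thesis using z D(3)[OF u(1)] linear_injective_0[OF linear_frechet_derivative] by blast
  qed
  obtain i j where ij: "i ~= j" "i ~= k" "j ~= k" "jac k i j s w0 ~= 0"
  proof -
   have "s w0 $ k $ k ~= 0" using kk by simp
   from jac_nonzero[OF D(1,2) pr w0 this imm, of "\<exists>i j. i ~= j \<and> i ~= k \<and> j ~= k \<and> jac k i j s w0 ~= 0"]
   have "\<exists>i j. i ~= j \<and> i ~= k \<and> j ~= k \<and> jac k i j s w0 ~= 0" by blast
   then show ?thesis using that by blast
  qed
  have "sff_level k i s w0 ~= 0 \<or> sff_level k j s w0 ~= 0"
   unfolding sff_level_def by (rule rank_one_levels[OF L0 L]) (use ij(4) in \<open>simp add: jac_def\<close>)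
  then have "\<exists>i j. i ~= j \<and> i ~= k \<and> j ~= k \<and> jac k i j s w0 * sff_level k i s w0 ~= 0"
  proof
   assume "sff_level k i s w0 ~= 0"
   then show ?thesis using ij by (intro exI[of _ i] exI[of _ j]) simp
  next
   assume "sff_level k j s w0 ~= 0"
   moreover have "jac k j i s w0 ~= 0" using ij(4) by (simp add: jac_def)
   ultimately show ?thesis using ij by (intro exI[of _ j] exI[of _ i]) simp
  qed
  then show "\<exists>k\<in>KS. \<exists>i j. i ~= j \<and> i ~= k \<and> j ~= k \<and> critical_zero (sff_det (col k (in_chart S psi))) (u, eps0) \<and>
   in_chart S psi (u, eps0) $ k $ k > 0 \<and> jac k i j (in_chart S psi) (u, eps0) * sff_level k i (in_chart S psi) (u, eps0) ~= 0"
   using cz kk k(1) unfolding s_def w0_def by blast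
 qed
qed

text \<open>The whole space is added to make the countable family nonempty, hence enumerable by the
  natural numbers.\<close>

lemma generically_countable:
 assumes "countable \<G>" "!!N. N \<in> \<G> ==> openin X N \<and> X closure_of N = topspace X"
  and "!!x. x \<in> topspace X ==> x \<in> \<Inter>\<G> ==> Q x"
 shows "generically X Q"
proof -
 define \<H> where "\<H> = insert (topspace X) \<G>"
 have H: "countable \<H>" "\<H> ~= {}" using assms(1) by (auto simp: \<H>_def)
 have r: "range (from_nat_into \<H>) = \<H>" by (rule range_from_nat_into[OF H(2,1)])
 show ?thesis unfolding generically_def
 proof (intro exI[of _ "from_nat_into \<H>"] conjI allI ballI)
  fix n
  have "from_nat_into \<H> n \<in> \<H>" by (rule from_nat_into[OF H(2)])
  then show "openin X (from_nat_into \<H> n)" "X closure_of (from_nat_into \<H> n) = topspace X"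
   using assms(2) by (auto simp: \<H>_def)
 next
  fix x assume "x \<in> (\<Inter>n. from_nat_into \<H> n)"
  then have "x \<in> \<Inter>\<H>" using r by auto
  then show "Q x" using assms(3) by (auto simp: \<H>_def)
 qed
qed

text \<open>A non-versal point lies in one of the compact charts, at a time in some [-n, n], and its
  nonzero quantities exceed some 1/(r+1); so it violates one of countably many open dense
  conditions.\<close>

theorem generically_versal:
 fixes M :: "'a::euclidean_space set"
 assumes M: "smooth_surface M" and A: "A = projective_space \<or> A = affine_space"
 shows "generically (C_infinity_topology M A) (%S. \<forall>W f q eps0. monge_chart M S W f \<and> (q, eps0) \<in> W \<and>
  parabolic_morse (f eps0) q \<and> unique_asymptotic (f eps0) q -->
  pd (0, 1) (%(p, eps). hess_det (f eps) p) (q, eps0) ~= 0)"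
proof -
 let ?X = "C_infinity_topology M A"
 define KS where "KS = (if A = projective_space then UNIV else {4 :: 4})"
 have A': "A = projective_space \<and> KS = UNIV \<or> A = affine_space \<and> KS = {4}" using A by (auto simp: KS_def)
 obtain \<C> :: "(plane set \<times> (plane => 'a) \<times> plane set) set" where C: "countable \<C>"
  "!!U psi K. (U, psi, K) \<in> \<C> ==> local_param M U psi \<and> compact K \<and> K \<subseteq> U"
  "!!m. m \<in> M ==> \<exists>U psi K u. (U, psi, K) \<in> \<C> \<and> u \<in> K \<and> psi u = m"
  by (rule countable_chart_cover[OF M]) (rule that, assumption+)
 define GS where "GS = (%((U :: plane set, psi, K), n :: nat, r :: nat, k, i, j).
  {S \<in> surface_families M A. regular (1 / Suc r) k i j (in_chart S psi) (K \<times> {- real n..real n})})"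
 define IX where "IX = {(c, n :: nat, r :: nat, k, i, j). c \<in> \<C> \<and> k \<in> KS \<and> i ~= j \<and> i ~= k \<and> j ~= (k :: 4)}"
 have "countable IX"
  by (rule countable_subset[of _ "\<C> \<times> (UNIV :: (nat \<times> nat \<times> 4 \<times> 4 \<times> 4) set)"]) (use C(1) in \<open>auto simp: IX_def\<close>)
 show ?thesis
 proof (rule generically_countable[where \<G>="GS ` IX"])
  show "countable (GS ` IX)" using \<open>countable IX\<close> by simp
  fix N assume "N \<in> GS ` IX"
  then obtain U psi K n r k i j where c: "(U, psi, K) \<in> \<C>" and ix: "k \<in> KS" "i ~= j" "i ~= k" "j ~= k"
   and N: "N = {S \<in> surface_families M A. regular (1 / Suc r) k i j (in_chart S psi) (K \<times> {- real n..real n})}"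
   unfolding IX_def GS_def by auto
  have psi: "local_param M U psi" and K: "compact (K \<times> {- real n..real n})" "K \<times> {- real n..real n} \<subseteq> U \<times> UNIV"
   using C(2)[OF c] by (auto intro: compact_Times)
  have A2: "A = projective_space \<or> A = affine_space \<and> k = 4" using A' ix(1) by auto
  show "openin ?X N \<and> ?X closure_of N = topspace ?X"
  proof
   show "openin ?X N" unfolding N by (rule open_regular[OF psi K])
   show "?X closure_of N = topspace ?X"
   proof
    show "?X closure_of N \<subseteq> topspace ?X" by (rule closure_of_subset_topspace)
    show "topspace ?X \<subseteq> ?X closure_of N"
    proof
     fix S assume S: "S \<in> topspace ?X"
     have "\<exists>y\<in>N. y \<in> T" if T: "S \<in> T" "openin ?X T" for T
     proof -
      obtain S' where "S' \<in> T" "regular (1 / Suc r) k i j (in_chart S' psi) (K \<times> {- real n..real n})"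
       using dense_regular[OF psi K(2) ix(2-4) _ A2 _ T(2,1), of "1 / Suc r"] S topspace_C_infinity[of M A] by auto
      moreover have "S' \<in> surface_families M A"
       using openin_subset[OF T(2)] \<open>S' \<in> T\<close> topspace_C_infinity[of M A] by auto
      ultimately show ?thesis unfolding N by blast
     qed
     then show "S \<in> ?X closure_of N" unfolding in_closure_of using S by blast
    qed
   qed
  qed
 next
  fix S assume "S \<in> topspace ?X" and SG: "S \<in> \<Inter> (GS ` IX)"
  then have S: "S \<in> surface_families M A" by (simp add: topspace_C_infinity)
  show "\<forall>W f q eps0. monge_chart M S W f \<and> (q, eps0) \<in> W \<and>
   parabolic_morse (f eps0) q \<and> unique_asymptotic (f eps0) q -->
   pd (0, 1) (%(p, eps). hess_det (f eps) p) (q, eps0) ~= 0"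
  proof (intro allI impI notI, elim conjE)
   fix W f q eps0 assume mc: "monge_chart M S W f" "(q, eps0) \<in> W" "parabolic_morse (f eps0) q" "unique_asymptotic (f eps0) q"
    and nv: "pd (0, 1) (%(p, eps). hess_det (f eps) p) (q, eps0) = 0"
   obtain m where m: "m \<in> M" and bad: "!!(psi :: plane => 'a) U u. local_param M U psi ==> u \<in> U ==> psi u = m ==>
     \<exists>k\<in>KS. \<exists>i j. i ~= j \<and> i ~= k \<and> j ~= k \<and> critical_zero (sff_det (col k (in_chart S psi))) (u, eps0) \<and>
     in_chart S psi (u, eps0) $ k $ k > 0 \<and> jac k i j (in_chart S psi) (u, eps0) * sff_level k i (in_chart S psi) (u, eps0) ~= 0"
    by (rule degenerate_in_chart[OF S A' mc nv]) (rule that, assumption+)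
   obtain U psi K u where c: "(U, psi, K) \<in> \<C>" "u \<in> K" "psi u = m" using C(3)[OF m] by blast
   have "local_param M U psi" "u \<in> U" using C(2)[OF c(1)] c(2) by auto
   from bad[OF this c(3)] obtain k i j where k: "k \<in> KS" "i ~= j" "i ~= k" "j ~= k"
    and cz: "critical_zero (sff_det (col k (in_chart S psi))) (u, eps0)" "in_chart S psi (u, eps0) $ k $ k > 0"
     "jac k i j (in_chart S psi) (u, eps0) * sff_level k i (in_chart S psi) (u, eps0) ~= 0" by blast
   \<comment> \<open>Both quantities bounded below in \<open>regular\<close> are positive here, so
     one threshold 1/(r+1) lies beneath them.\<close>
   define b where "b = min (in_chart S psi (u, eps0) $ k $ k) \<bar>jac k i j (in_chart S psi) (u, eps0) * sff_level k i (in_chart S psi) (u, eps0)\<bar>"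
   have "b > 0" using cz(2,3) by (simp add: b_def)
   then obtain r where r: "1 / Suc r < b" using nat_approx_posE by blast
   obtain n where n: "\<bar>eps0\<bar> \<le> real n" using real_arch_simple by blast
   have "((U, psi, K), n, r, k, i, j) \<in> IX" using c(1) k by (simp add: IX_def)
   then have "S \<in> GS ((U, psi, K), n, r, k, i, j)" using SG by blast
   then have "regular (1 / Suc r) k i j (in_chart S psi) (K \<times> {- real n..real n})" by (simp add: GS_def)
   moreover have "(u, eps0) \<in> K \<times> {- real n..real n}" using c(2) n by auto
   moreover have "in_chart S psi (u, eps0) $ k $ k \<ge> 1 / Suc r"
    "\<bar>jac k i j (in_chart S psi) (u, eps0) * sff_level k i (in_chart S psi) (u, eps0)\<bar> \<ge> 1 / Suc r"
    using r by (simp_all add: b_def)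
   ultimately show False using cz(1) unfolding regular_def by blast
  qed
 qed
qed

lemma generically_mono: "generically X P ==> (!!x. P x ==> Q x) ==> generically X Q" unfolding generically_def by blast

theorem theorem5p2:
  fixes M :: "'a::euclidean_space set" and A :: "(real^4^4) set"
  assumes "smooth_surface M"
    and "A = projective_space \<or> A = affine_space"
  shows "generically (C_infinity_topology M A) (\<lambda>S.
    \<forall>W f q \<epsilon>0.
      monge_chart M S W f \<and> (q, \<epsilon>0) \<in> W \<and>
      parabolic_morse (f \<epsilon>0) q \<and> unique_asymptotic (f \<epsilon>0) q \<and> general_position (f \<epsilon>0) q
    \<longrightarrow>
      A3_transition (\<lambda>\<epsilon>. flecnodal_curve (f \<epsilon>)) q \<epsilon>0 \<and>
      (\<exists>\<sigma>\<in>{1, -1}.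
         (case_a f q \<epsilon>0 \<sigma> \<or> case_b f q \<epsilon>0 \<sigma> \<or> case_c f q \<epsilon>0 \<sigma> \<or> case_d f q \<epsilon>0 \<sigma>) \<and>
         two_godrons_transition f q \<epsilon>0 \<sigma>) \<and>
      (\<exists>V \<Theta>. umbrella_chart {(p, \<epsilon>). p \<in> flecnodal_curve (f \<epsilon>)} (q, \<epsilon>0) V \<Theta> \<and>
         (\<forall>(p, \<epsilon>) \<in> V.
            (p \<in> real_flecnodal_curve (f \<epsilon>) \<longleftrightarrow> \<Theta> (p, \<epsilon>) \<in> range umbrella_param) \<and>
            (hyperbonode (f \<epsilon>) p \<longleftrightarrow> \<Theta> (p, \<epsilon>) \<in> self_intersection_line) \<and>
            (ellipnode (f \<epsilon>) p \<longleftrightarrow> \<Theta> (p, \<epsilon>) \<in> handle)) \<and>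
         isochronal_section_tangent V \<Theta>) \<and>
      A3_singularity (flecnodal_curve (f \<epsilon>0)) q)"
  by (rule generically_mono[OF generically_versal[OF assms]], intro allI impI, elim conjE, rule local_theorem)
    (assumption | blast)+

end
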